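(* Fix $T>0$ and $e_1,r_1,r_2,y_0\in\mathbb{R}$ with $e_1\neq0$, $r_1<r_2$ and $y_0\neq r_1$. Let $h:C([0,T],\mathbb{R})\to[0,\infty]$ be a nonnegative measurable function of continuous paths. Let $Y$ be a QNV process with polynomial $P(z)=e_1(z-r_1)(z-r_2)$ and $Y_0=y_0$, i.e. $\mathrm{d}Y_t=P(Y_t)\,\mathrm{d}\widetilde B_t$ for a Brownian motion $\widetilde B$. Let $Z=\{Z_t\}_{t\ge0}$ be a (possibly negative) geometric Brownian motion with $Z_0=(y_0-r_2)/(y_0-r_1)$ and $\mathrm{d}Z_t/Z_t=e_1(r_2-r_1)\,\mathrm{d}B_t$ for all $t\ge0$, where $B$ is a Brownian motion, and let $\tau$ be the first hitting time of $1$ by $Z$. Then $$\mathbb{E}\big[h(\{Y_t\}_{t\in[0,T]})\big]=\frac{y_0-r_1}{r_2-r_1}\,\mathbb{E}\Big[h\Big(\Big\{\tfrac{r_2-r_1Z_t}{1-Z_t}\Big\}_{t\in[0,T]}\Big)\mathbf{1}_{\{\tau>T\}}(1-Z_T)\Big],$$ where each expectation is taken under the probability measure on which the respective process is defined.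
   Context: Convention: $\infty\cdot\mathbf{1}_A(\omega)=0$ for $\omega\notin A$ (so the integrand on the right is $0$ off $\{\tau>T\}$). *)

theory Defs
  imports "HOL-Probability.Probability"
begin

definition cpaths :: "real \<Rightarrow> (real \<Rightarrow> real) set" where
  "cpaths T = {f. continuous_on {0..T} f \<and> (\<forall>t. t \<notin> {0..T} \<longrightarrow> f t = 0)}"

(* C([0,T],R) with the sigma-algebra generated by the coordinate maps
   (= Borel sigma-algebra of the sup-norm topology). *)
definition path_space :: "real \<Rightarrow> (real \<Rightarrow> real) measure" where
  "path_space T = sigma (cpaths T)
     {{f \<in> cpaths T. f t \<in> A} | t A. t \<in> {0..T} \<and> A \<in> sets borel}"

definition restrict_path :: "real \<Rightarrow> (real \<Rightarrow> real) \<Rightarrow> (real \<Rightarrow> real)" where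
  "restrict_path T f = (\<lambda>t. if t \<in> {0..T} then f t else 0)"

definition filtration :: "'a measure \<Rightarrow> (real \<Rightarrow> 'a measure) \<Rightarrow> bool" where
  "filtration M F \<longleftrightarrow>
     (\<forall>t\<ge>0. subalgebra M (F t)) \<and>
     (\<forall>s t. 0 \<le> s \<longrightarrow> s \<le> t \<longrightarrow> sets (F s) \<subseteq> sets (F t))"

definition brownian_motion :: "'a measure \<Rightarrow> (real \<Rightarrow> 'a measure) \<Rightarrow> (real \<Rightarrow> 'a \<Rightarrow> real) \<Rightarrow> bool" where
  "brownian_motion M F B \<longleftrightarrow>
     prob_space M \<and> filtration M F \<and>
     (\<forall>\<omega>\<in>space M. B 0 \<omega> = 0 \<and> continuous_on {0..} (\<lambda>t. B t \<omega>)) \<and>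
     (\<forall>t\<ge>0. B t \<in> borel_measurable (F t)) \<and>
     (\<forall>s t. 0 \<le> s \<longrightarrow> s < t \<longrightarrow>
        distributed M lborel (\<lambda>\<omega>. B t \<omega> - B s \<omega>) (normal_density 0 (sqrt (t - s)))) \<and>
     (\<forall>s t. 0 \<le> s \<longrightarrow> s < t \<longrightarrow>
        (\<forall>A\<in>sets (F s). \<forall>C\<in>sets borel.
           measure M (A \<inter> {\<omega>\<in>space M. B t \<omega> - B s \<omega> \<in> C})
             = measure M A * measure M {\<omega>\<in>space M. B t \<omega> - B s \<omega> \<in> C}))"

definition conv_in_prob :: "'a measure \<Rightarrow> (nat \<Rightarrow> 'a \<Rightarrow> real) \<Rightarrow> ('a \<Rightarrow> real) \<Rightarrow> bool" where
  "conv_in_prob M X L \<longleftrightarrow>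
     (\<forall>\<epsilon>>0. (\<lambda>n. measure M {\<omega>\<in>space M. \<bar>X n \<omega> - L \<omega>\<bar> > \<epsilon>}) \<longlonglongrightarrow> 0)"

(* Ito integral int_0^t G_s dB_s of a continuous adapted integrand, defined as the
   limit in probability of left-point Riemann sums along uniform partitions. *)
definition ito_integral_is ::
  "'a measure \<Rightarrow> (real \<Rightarrow> 'a \<Rightarrow> real) \<Rightarrow> (real \<Rightarrow> 'a \<Rightarrow> real) \<Rightarrow> real \<Rightarrow> ('a \<Rightarrow> real) \<Rightarrow> bool" where
  "ito_integral_is M G B t I \<longleftrightarrow>
     conv_in_prob M
       (\<lambda>n \<omega>. \<Sum>k<n. G (t * real k / real n) \<omega> *
                 (B (t * real (Suc k) / real n) \<omega> - B (t * real k / real n) \<omega>)) I"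

definition sde_solution ::
  "'a measure \<Rightarrow> (real \<Rightarrow> 'a measure) \<Rightarrow> (real \<Rightarrow> 'a \<Rightarrow> real) \<Rightarrow> (real \<Rightarrow> real) \<Rightarrow> real
     \<Rightarrow> (real \<Rightarrow> 'a \<Rightarrow> real) \<Rightarrow> bool" where
  "sde_solution M F B P y0 Y \<longleftrightarrow>
     brownian_motion M F B \<and>
     (\<forall>t\<ge>0. Y t \<in> borel_measurable (F t)) \<and>
     (\<forall>\<omega>\<in>space M. Y 0 \<omega> = y0 \<and> continuous_on {0..} (\<lambda>t. Y t \<omega>)) \<and>
     (\<forall>t\<ge>0. ito_integral_is M (\<lambda>s \<omega>. P (Y s \<omega>)) B t (\<lambda>\<omega>. Y t \<omega> - y0))"

definition qnv_poly :: "real \<Rightarrow> real \<Rightarrow> real \<Rightarrow> real \<Rightarrow> real" where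
  "qnv_poly e1 r1 r2 z = e1 * (z - r1) * (z - r2)"

(* (possibly negative) geometric Brownian motion: dZ_t / Z_t = sigma dB_t, Z_0 = z0 *)
definition gbm :: "real \<Rightarrow> real \<Rightarrow> (real \<Rightarrow> 'a \<Rightarrow> real) \<Rightarrow> real \<Rightarrow> 'a \<Rightarrow> real" where
  "gbm z0 \<sigma> B t \<omega> = z0 * exp (\<sigma> * B t \<omega> - \<sigma>\<^sup>2 * t / 2)"

end

theory Submission
  imports Defs "HOL-Real_Asymp.Real_Asymp"
begin

text \<open>
  Put \<open>x(y) = (y - r2) / (y - r1)\<close>. For real \<open>\<theta>\<close> and \<open>\<kappa>\<close> the function
  \<open>\<bar>y - r1\<bar> * sqrt \<bar>x\<bar> * cos (\<theta> * ln \<bar>x\<bar> + \<kappa>)\<close> is an eigenfunction of the generator of \<open>Y\<close>. Under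
  \<open>y = (r2 - r1 z) / (1 - z)\<close>, and up to the weight \<open>(1 - z) / (1 - z0)\<close>, it becomes
  \<open>sqrt \<bar>z\<bar> * cos (\<theta> * ln \<bar>z\<bar> + \<kappa>)\<close>, an eigenfunction for geometric Brownian motion with the same eigenvalue.
  Kill \<open>Y\<close> on leaving the component of the complement of \<open>{r1, r2}\<close> containing \<open>y0\<close>, and \<open>Z\<close> on hitting 1.
  Discretised Dynkin formulas show that the law of the killed \<open>Y\<close> and the weighted law of the killed
  \<open>(r2 - r1 Z) / (1 - Z)\<close> integrate these eigenfunctions to the same values after each time step. By Fourier
  uniqueness the eigenfunctions separate measures, so the finite-dimensional distributions on dyadic grids agree
  by induction over the grid, and hence so do the laws on path space. Since \<open>1 - Z\<close> stopped at 0 is a martingale,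
  the weighted law has mass one, so \<open>Y\<close> almost surely stays in its component. If \<open>y0 = r2\<close>, both processes are
  constant, as the Lyapunov function \<open>(y - r2)\<^sup>2 / (y - r1)\<close> shows for \<open>Y\<close>.
\<close>

text \<open>The stochastic integral is given only at fixed times, as a limit in probability of
  Riemann sums along uniform partitions. Hence martingale arguments run on finite grids, where the
  increments are independent Gaussians, and limits are taken in expectations only. Matching
  expectations over a separating class avoids any uniqueness theorem for the equation. The class
  comes from solving \<open>P^2 / 2 * \<phi>'' = c * \<phi>\<close>: a product of powers of
  \<open>\<bar>y - r1\<bar>\<close> and \<open>\<bar>y - r2\<bar>\<close> is a solution whenever the
  exponents add up to 1, and the exponents \<open>1/2 - i * \<theta>\<close> and
  \<open>1/2 + i * \<theta>\<close> turn the logarithm of the ratio into a Fourier variable. The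
  exit terms of Dynkin's formula have to disappear. At a root the amplitude
  \<open>sqrt (\<bar>y - r1\<bar> * \<bar>y - r2\<bar>)\<close> vanishes; at infinity the
  probability of getting there vanishes, which suffices once the function is bounded. Nothing has to
  be known beforehand about whether \<open>Y\<close> can reach a root.\<close>

section \<open>Continuous paths observed on uniform grids\<close>

lemma grid_point_bounds:
  fixes s u :: real
  assumes "u > 0" "N > 0" "k \<le> N"
  shows "s + real k * (u / real N) \<in> {s..s + u}"
proof -
  have "real k * (u / real N) \<le> real N * (u / real N)"
    using assms by (intro mult_right_mono) auto
  then show ?thesis using assms by auto
qed

lemma grid_point_near:
  fixes s u :: real
  assumes "u > 0" "N > 0" "r \<in> {s..s + u}"
  obtains k where "k \<le> N" "\<bar>r - (s + real k * (u / real N))\<bar> \<le> u / real N"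
proof -
  define x where "x = (r - s) * real N / u"
  have x0: "0 \<le> x" using assms by (auto simp: x_def)
  have "(r - s) * real N \<le> u * real N" using assms by (intro mult_right_mono) auto
  then have xN: "x \<le> real N" using assms(1) by (simp add: x_def field_simps)
  define k where "k = nat \<lfloor>x\<rfloor>"
  have k1: "real k \<le> x" "x \<le> real k + 1" using x0 unfolding k_def by linarith+
  have "k \<le> N" using k1 xN by linarith
  moreover have "r - (s + real k * (u / real N)) = (x - real k) * (u / real N)"
    using assms by (simp add: x_def field_simps)
  moreover have "\<bar>(x - real k) * (u / real N)\<bar> \<le> 1 * (u / real N)"
    unfolding abs_mult using k1 assms by (intro mult_mono) auto
  ultimately show ?thesis using that by simp
qed

text \<open>Leaving a closed set is an open condition along the path, so it persists on a whole
  neighbourhood of times, which a fine enough grid must meet. A grid can only err by missing an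
  exit, and this error disappears pathwise.\<close>

lemma grid_stay_tendsto:
  fixes p :: "real \<Rightarrow> real" and N :: "nat \<Rightarrow> nat"
  assumes cont: "continuous_on {s..s + u} p" and u: "u > 0" and K: "closed K"
    and N: "filterlim N at_top sequentially" and Npos: "\<And>L. N L > 0"
  shows "(\<lambda>L. if \<forall>k\<le>N L. p (s + real k * (u / real (N L))) \<in> K then 1 else 0 :: real)
     \<longlonglongrightarrow> (if \<forall>r\<in>{s..s+u}. p r \<in> K then 1 else 0)"
proof (cases "\<forall>r\<in>{s..s+u}. p r \<in> K")
  case True
  then have "\<forall>k\<le>N L. p (s + real k * (u / real (N L))) \<in> K" for L
    using grid_point_bounds[OF u Npos] by blast
  then show ?thesis using True by simp
next
  case False
  then obtain r where r: "r \<in> {s..s+u}" "p r \<in> - K" by auto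
  have "open (- K)" using K by auto
  then obtain e where e: "e > 0" "\<And>y. dist y (p r) < e \<Longrightarrow> y \<in> - K"
    using r(2) unfolding open_dist by blast
  obtain d where d: "d > 0" "\<And>x. x \<in> {s..s+u} \<Longrightarrow> dist x r < d \<Longrightarrow> dist (p x) (p r) < e"
    using cont r(1) e(1) unfolding continuous_on_iff by metis
  have "filterlim (\<lambda>L. real (N L)) at_top sequentially"
    using N filterlim_compose filterlim_real_sequentially by blast
  then have "(\<lambda>L. u / real (N L)) \<longlonglongrightarrow> 0"
    by (rule tendsto_divide_0[OF tendsto_const filterlim_at_top_imp_at_infinity])
  then have "eventually (\<lambda>L. u / real (N L) < d) sequentially"
    using d(1) by (rule order_tendstoD(2))
  then have "eventually (\<lambda>L. (if \<forall>k\<le>N L. p (s + real k * (u / real (N L))) \<in> K then 1 else 0 :: real) = 0) sequentially"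
  proof eventually_elim
    case (elim L)
    obtain k where k: "k \<le> N L" "\<bar>r - (s + real k * (u / real (N L)))\<bar> \<le> u / real (N L)"
      using grid_point_near[OF u Npos r(1)] by blast
    have "dist (s + real k * (u / real (N L))) r < d" using k(2) elim by (auto simp: dist_real_def)
    then have "p (s + real k * (u / real (N L))) \<in> - K"
      using d(2) e(2) grid_point_bounds[OF u Npos k(1)] by blast
    then show ?case using k(1) by auto
  qed
  moreover have "(if \<forall>r\<in>{s..s+u}. p r \<in> K then 1 else 0 :: real) = 0" using False by auto
  ultimately show ?thesis by (simp only: tendsto_eventually)
qed

text \<open>A condition on uncountably many times becomes measurable as the pointwise limit of its
  grid versions. The one-point interval is treated apart because the grids need positive
  length.\<close>

lemma stay_sets:
  fixes X :: "real \<Rightarrow> 'a \<Rightarrow> real"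
  assumes X: "\<And>r. r \<in> {s..t} \<Longrightarrow> X r \<in> borel_measurable M"
    and cont: "\<And>\<omega>. \<omega> \<in> space M \<Longrightarrow> continuous_on {s..t} (\<lambda>r. X r \<omega>)"
    and K: "closed K"
  shows "{\<omega>\<in>space M. \<forall>r\<in>{s..t}. X r \<omega> \<in> K} \<in> sets M"
proof -
  consider "t < s" | "t = s" | "s < t" by linarith
  then show ?thesis
  proof cases
    case 2
    have [measurable]: "X s \<in> borel_measurable M" "K \<in> sets borel" using X K 2 by auto
    show ?thesis using 2 by simp
  next
    case 3
    define u where "u = t - s"
    have u: "u > 0" "s + u = t" using 3 by (auto simp: u_def)
    have Kb[measurable]: "K \<in> sets borel" using K by auto
    let ?S = "\<lambda>n. {\<omega>\<in>space M. \<forall>k\<in>{..n}. X (s + real k * (u / real n)) \<omega> \<in> K}"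
    let ?f = "\<lambda>L \<omega>. if \<forall>k\<le>Suc L. X (s + real k * (u / real (Suc L))) \<omega> \<in> K then 1 else 0 :: real"
    let ?g = "\<lambda>\<omega>. if \<forall>r\<in>{s..s+u}. X r \<omega> \<in> K then 1 else 0 :: real"
    have S: "?S n \<in> sets M" if "n > 0" for n
    proof (rule sets.sets_Collect_finite_All)
      fix k assume "k \<in> {..n}"
      then have "X (s + real k * (u / real n)) \<in> borel_measurable M"
        using X grid_point_bounds[OF u(1) that, of k s] u by auto
      from measurable_sets[OF this Kb]
      show "{\<omega> \<in> space M. X (s + real k * (u / real n)) \<omega> \<in> K} \<in> sets M"
        by (simp add: vimage_def Int_def conj_commute)
    qed simp
    have "?f L \<in> borel_measurable M" for L
    proof -
      have "(\<lambda>\<omega>. indicator (?S (Suc L)) \<omega> :: real) \<in> borel_measurable M"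
        using S[of "Suc L"] by (rule borel_measurable_indicator) simp
      moreover have "indicator (?S (Suc L)) \<omega> = ?f L \<omega>" if "\<omega> \<in> space M" for \<omega>
        using that unfolding indicator_def of_bool_def by (simp only: mem_Collect_eq simp_thms Ball_def atMost_iff)
      ultimately show ?thesis by (subst measurable_cong[symmetric])
    qed
    moreover have "(\<lambda>L. ?f L \<omega>) \<longlonglongrightarrow> ?g \<omega>" if "\<omega> \<in> space M" for \<omega>
      using cont[OF that] u K by (intro grid_stay_tendsto filterlim_Suc) auto
    ultimately have g: "?g \<in> borel_measurable M" by (rule borel_measurable_LIMSEQ_real[rotated])
    have "{\<omega>\<in>space M. \<forall>r\<in>{s..t}. X r \<omega> \<in> K} = ?g -` {1} \<inter> space M"
      using u by (auto split: if_split_asm)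
    also have "\<dots> \<in> sets M" using g by measurable
    finally show ?thesis .
  qed simp
qed

section \<open>Brownian increments and discrete stochastic sums\<close>

locale brownian =
  fixes M :: "'a measure" and F :: "real \<Rightarrow> 'a measure" and B :: "real \<Rightarrow> 'a \<Rightarrow> real"
  assumes bm: "brownian_motion M F B"

sublocale brownian \<subseteq> prob_space M
  using bm by (simp add: brownian_motion_def)

context brownian begin

lemma sub: "0 \<le> t \<Longrightarrow> subalgebra M (F t)"
  using bm by (auto simp: brownian_motion_def filtration_def)

lemma space_F: "0 \<le> t \<Longrightarrow> space (F t) = space M"
  using sub by (auto simp: subalgebra_def)

lemma sub_mono: "0 \<le> s \<Longrightarrow> s \<le> t \<Longrightarrow> subalgebra (F t) (F s)"
  using bm space_F by (auto simp: brownian_motion_def filtration_def subalgebra_def)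

lemma F_mono: "f \<in> measurable (F s) N \<Longrightarrow> 0 \<le> s \<Longrightarrow> s \<le> t \<Longrightarrow> f \<in> measurable (F t) N"
  using measurable_from_subalg[OF sub_mono] by blast

lemma F_M: "f \<in> measurable (F s) N \<Longrightarrow> 0 \<le> s \<Longrightarrow> f \<in> measurable M N"
  using measurable_from_subalg[OF sub] by blast

lemma F_sets_mono: "A \<in> sets (F s) \<Longrightarrow> 0 \<le> s \<Longrightarrow> s \<le> t \<Longrightarrow> A \<in> sets (F t)"
  using sub_mono by (auto simp: subalgebra_def)

lemma F_sets_M: "A \<in> sets (F s) \<Longrightarrow> 0 \<le> s \<Longrightarrow> A \<in> sets M"
  using sub by (auto simp: subalgebra_def)

lemma B_meas: "0 \<le> t \<Longrightarrow> B t \<in> borel_measurable (F t)"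
  using bm by (auto simp: brownian_motion_def)

lemma B_cont: "\<omega> \<in> space M \<Longrightarrow> continuous_on {0..} (\<lambda>t. B t \<omega>)"
  using bm by (auto simp: brownian_motion_def)

lemma B_0: "\<omega> \<in> space M \<Longrightarrow> B 0 \<omega> = 0"
  using bm by (auto simp: brownian_motion_def)

lemma B_meas_M[measurable]: "0 \<le> t \<Longrightarrow> B t \<in> borel_measurable M"
  using F_M[OF B_meas] .

lemma inc_dist: "0 \<le> s \<Longrightarrow> s < t \<Longrightarrow>
    distributed M lborel (\<lambda>\<omega>. B t \<omega> - B s \<omega>) (normal_density 0 (sqrt (t - s)))"
  using bm by (auto simp: brownian_motion_def)

text \<open>Independence is assumed for events of \<open>F s\<close> against increment events.
  Preimages of Borel sets already form a sigma-algebra, so this product formula amounts to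
  independence of the two variables, and expectations of products split.\<close>

lemma inc_indep_var:
  assumes "0 \<le> s" "s < t" and g: "g \<in> borel_measurable (F s)" and f: "f \<in> borel_measurable borel"
  shows "indep_var borel g borel (\<lambda>\<omega>. f (B t \<omega> - B s \<omega>) :: real)"
proof -
  have st: "0 \<le> t" using assms by simp
  have [measurable]: "B s \<in> borel_measurable M" "B t \<in> borel_measurable M"
    using assms by auto
  note f[measurable]
  have gM: "g \<in> borel_measurable M" using F_M[OF g] assms by auto
  have sgen: "sigma_sets (space M) {X -` A \<inter> space M |A. A \<in> sets borel} = {X -` A \<inter> space M |A. A \<in> sets borel}"
    for X :: "'a \<Rightarrow> real"
    using sigma_sets_vimage_commute[of X "space M" UNIV "sets borel"] sets.sigma_sets_eq[of "borel :: real measure"]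
    by simp
  show ?thesis
    unfolding indep_var_eq sgen indep_sets2_eq
  proof (intro conjI ballI subsetI)
    show "random_variable borel g" by (rule gM)
    show "random_variable borel (\<lambda>\<omega>. f (B t \<omega> - B s \<omega>))" by measurable
    show "x \<in> events" if "x \<in> {g -` A \<inter> space M |A. A \<in> sets borel}" for x
      using that gM by (auto intro: measurable_sets)
    show "x \<in> events" if "x \<in> {(\<lambda>\<omega>. f (B t \<omega> - B s \<omega>)) -` A \<inter> space M |A. A \<in> sets borel}" for x
      using that by (auto intro!: measurable_sets[where A=borel])
    fix a b assume "a \<in> {g -` A \<inter> space M |A. A \<in> sets borel}"
      and "b \<in> {(\<lambda>\<omega>. f (B t \<omega> - B s \<omega>)) -` A \<inter> space M |A. A \<in> sets borel}"
    then obtain A C where A: "A \<in> sets borel" "a = g -` A \<inter> space M"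
      and C: "C \<in> sets borel" "b = (\<lambda>\<omega>. f (B t \<omega> - B s \<omega>)) -` C \<inter> space M" by blast
    have a: "a \<in> sets (F s)"
      using measurable_sets[OF g A(1)] A(2) space_F[OF assms(1)] by simp
    have C': "f -` C \<in> sets borel" using measurable_sets[OF f C(1)] by simp
    have b: "b = {\<omega>\<in>space M. B t \<omega> - B s \<omega> \<in> f -` C}" using C by auto
    have eq: "\<And>A C. A \<in> sets (F s) \<Longrightarrow> C \<in> sets borel \<Longrightarrow>
           measure M (A \<inter> {\<omega>\<in>space M. B t \<omega> - B s \<omega> \<in> C})
             = measure M A * measure M {\<omega>\<in>space M. B t \<omega> - B s \<omega> \<in> C}"
      using bm assms(1,2) unfolding brownian_motion_def by blast
    show "prob (a \<inter> b) = prob a * prob b" unfolding b by (rule eq[OF a C'])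
  qed
qed

lemma inc_mult:
  assumes "0 \<le> s" "s < t" "g \<in> borel_measurable (F s)" "f \<in> borel_measurable borel"
    "integrable M g" "integrable M (\<lambda>\<omega>. f (B t \<omega> - B s \<omega>))"
  shows inc_mult_integrable: "integrable M (\<lambda>\<omega>. g \<omega> * f (B t \<omega> - B s \<omega>) :: real)"
    and inc_mult_integral: "(\<integral>\<omega>. g \<omega> * f (B t \<omega> - B s \<omega>) \<partial>M) = (\<integral>\<omega>. g \<omega> \<partial>M) * (\<integral>\<omega>. f (B t \<omega> - B s \<omega>) \<partial>M)"
  using indep_var_integrable[OF inc_indep_var[OF assms(1-4)] assms(5,6)]
    indep_var_lebesgue_integral[OF inc_indep_var[OF assms(1-4)] assms(5,6)] by auto

lemma inc_moments:
  assumes "0 \<le> s" "s < t"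
  shows inc_int: "integrable M (\<lambda>\<omega>. (B t \<omega> - B s \<omega>) ^ k)"
    and inc_abs_int: "integrable M (\<lambda>\<omega>. \<bar>B t \<omega> - B s \<omega>\<bar> ^ k)"
    and inc_1: "(\<integral>\<omega>. (B t \<omega> - B s \<omega>) \<partial>M) = 0"
    and inc_2: "(\<integral>\<omega>. (B t \<omega> - B s \<omega>)^2 \<partial>M) = t - s"
    and inc_3: "(\<integral>\<omega>. (B t \<omega> - B s \<omega>)^3 \<partial>M) = 0"
    and inc_4: "(\<integral>\<omega>. (B t \<omega> - B s \<omega>)^4 \<partial>M) = 3 * (t - s)^2"
    and inc_abs3: "(\<integral>\<omega>. \<bar>B t \<omega> - B s \<omega>\<bar>^3 \<partial>M) \<le> 2 * (sqrt (t - s))^3"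
proof -
  let ?d = "normal_density 0 (sqrt (t - s))"
  have D: "distributed M lborel (\<lambda>\<omega>. B t \<omega> - B s \<omega>) ?d" by (rule inc_dist[OF assms])
  have pos: "t - s > 0" using assms by simp
  have I: "(\<integral>\<omega>. g (B t \<omega> - B s \<omega>) \<partial>M) = (\<integral>x. ?d x * g x \<partial>lborel)" if "g \<in> borel_measurable borel" for g :: "real \<Rightarrow> real"
    using distributed_integral[OF D, of g] that by auto
  have J: "integrable M (\<lambda>\<omega>. g (B t \<omega> - B s \<omega>)) = integrable lborel (\<lambda>x. ?d x * g x)" if "g \<in> borel_measurable borel" for g :: "real \<Rightarrow> real"
    using distributed_integrable[OF D, of g] that by auto
  show "integrable M (\<lambda>\<omega>. (B t \<omega> - B s \<omega>) ^ k)"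
    using integrable_normal_moment[of "sqrt (t - s)" 0 k] pos by (subst J) auto
  show "integrable M (\<lambda>\<omega>. \<bar>B t \<omega> - B s \<omega>\<bar> ^ k)"
    using integrable_normal_moment_abs[of "sqrt (t - s)" 0 k] pos by (subst J) auto
  show "(\<integral>\<omega>. (B t \<omega> - B s \<omega>) \<partial>M) = 0"
    using integral_normal_moment_odd[of "sqrt (t - s)" 0 0] pos by (subst I) auto
  show "(\<integral>\<omega>. (B t \<omega> - B s \<omega>)^2 \<partial>M) = t - s"
    using integral_normal_moment_even[of "sqrt (t - s)" 0 1] pos by (subst I) auto
  show "(\<integral>\<omega>. (B t \<omega> - B s \<omega>)^3 \<partial>M) = 0"
    using integral_normal_moment_odd[of "sqrt (t - s)" 0 1] pos by (subst I) auto
  show "(\<integral>\<omega>. (B t \<omega> - B s \<omega>)^4 \<partial>M) = 3 * (t - s)^2"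
    using integral_normal_moment_even[of "sqrt (t - s)" 0 2] pos
    by (subst I) (auto simp: field_simps power2_eq_square fact_numeral)
  have "(\<integral>\<omega>. \<bar>B t \<omega> - B s \<omega>\<bar>^3 \<partial>M) = 2 * (sqrt (t - s))^3 * sqrt (2 / pi)"
    using integral_normal_moment_abs_odd[of "sqrt (t - s)" 0 1] pos by (subst I) auto
  also have "\<dots> \<le> 2 * (sqrt (t - s))^3 * 1"
    using pos pi_gt3 by (intro mult_left_mono) auto
  finally show "(\<integral>\<omega>. \<bar>B t \<omega> - B s \<omega>\<bar>^3 \<partial>M) \<le> 2 * (sqrt (t - s))^3" by simp
qed

end

section \<open>Martingale transforms along a grid and their maximal inequality\<close>

lemma abs_pow_le_1_pow4:
  fixes x :: real assumes "m \<le> 4" shows "\<bar>x\<bar> ^ m \<le> 1 + x ^ 4"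
proof -
  have e: "x ^ 4 = \<bar>x\<bar> ^ 4" by (simp add: power_abs power_even_abs_numeral)
  show ?thesis
  proof (cases "\<bar>x\<bar> \<le> 1")
    case True
    then have "\<bar>x\<bar> ^ m \<le> 1" by (simp add: power_le_one)
    moreover have "x ^ 4 \<ge> 0" by simp
    ultimately show ?thesis by linarith
  next
    case False
    then have "\<bar>x\<bar> ^ m \<le> \<bar>x\<bar> ^ 4" using assms by (intro power_increasing) auto
    then show ?thesis using e by linarith
  qed
qed

lemma integrable_mult_bounded:
  fixes f g :: "'a \<Rightarrow> real"
  assumes "integrable M f" "g \<in> borel_measurable M" "\<And>\<omega>. \<bar>g \<omega>\<bar> \<le> C"
  shows "integrable M (\<lambda>\<omega>. f \<omega> * g \<omega>)"
proof (rule Bochner_Integration.integrable_bound[OF integrable_mult_left[OF integrable_abs[OF assms(1)], of C]])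
  show "(\<lambda>\<omega>. f \<omega> * g \<omega>) \<in> borel_measurable M" using assms by measurable
  show "AE x in M. norm (f x * g x) \<le> norm (\<bar>f x\<bar> * C)"
  proof (rule AE_I2)
    fix x
    have "0 \<le> C" using assms(3)[of x] by linarith
    then show "norm (f x * g x) \<le> norm (\<bar>f x\<bar> * C)"
      using assms(3)[of x] by (auto simp: abs_mult intro!: mult_left_mono)
  qed
qed

lemma (in prob_space) prob_tendsto_0:
  assumes "\<And>n. A n \<in> events" "\<And>\<omega>. \<omega> \<in> space M \<Longrightarrow> eventually (\<lambda>n. \<omega> \<notin> A n) sequentially"
  shows "(\<lambda>n. prob (A n)) \<longlonglongrightarrow> 0"
proof -
  have "(\<lambda>n. \<integral>\<omega>. indicator (A n) \<omega> \<partial>M) \<longlonglongrightarrow> (\<integral>\<omega>. (0::real) \<partial>M)"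
  proof (rule integral_dominated_convergence[where w="\<lambda>_. 1"])
    show "AE x in M. (\<lambda>i. indicator (A i) x :: real) \<longlonglongrightarrow> 0"
    proof (rule AE_I2)
      fix x assume "x \<in> space M"
      then have "eventually (\<lambda>n. (indicator (A n) x :: real) = 0) sequentially"
        using assms(2) by (auto elim!: eventually_mono simp: indicator_def)
      then show "(\<lambda>i. indicator (A i) x :: real) \<longlonglongrightarrow> 0" by (rule tendsto_eventually)
    qed
  qed (use assms in \<open>auto simp: indicator_def\<close>)
  moreover have "(\<integral>\<omega>. indicator (A n) \<omega> \<partial>M) = prob (A n)" for n
    using assms(1)[of n] sets.sets_into_space[OF assms(1)[of n]] by (simp add: Int_absorb2)
  ultimately show ?thesis by simp
qed

context brownian begin

definition binc :: "real \<Rightarrow> real \<Rightarrow> nat \<Rightarrow> 'a \<Rightarrow> real" where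
  "binc s \<delta> j \<omega> = B (s + real (Suc j) * \<delta>) \<omega> - B (s + real j * \<delta>) \<omega>"

text \<open>A martingale transform: when each \<open>g j\<close> is known at time
  \<open>s + j * \<delta>\<close>, this is a discrete martingale in \<open>k\<close>.\<close>

definition msum :: "real \<Rightarrow> real \<Rightarrow> (nat \<Rightarrow> 'a \<Rightarrow> real) \<Rightarrow> nat \<Rightarrow> 'a \<Rightarrow> real" where
  "msum s \<delta> g k \<omega> = (\<Sum>j<k. g j \<omega> * binc s \<delta> j \<omega>)"

lemma msum_0[simp]: "msum s \<delta> g 0 \<omega> = 0"
  and msum_Suc: "msum s \<delta> g (Suc k) \<omega> = msum s \<delta> g k \<omega> + g k \<omega> * binc s \<delta> k \<omega>"
  by (auto simp: msum_def)

lemma binc_meas: "0 \<le> s \<Longrightarrow> 0 < \<delta> \<Longrightarrow> binc s \<delta> j \<in> borel_measurable (F (s + real (Suc j) * \<delta>))"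
proof -
  assume "0 \<le> s" "0 < \<delta>"
  then have le: "0 \<le> s + real j * \<delta>" "s + real j * \<delta> \<le> s + real (Suc j) * \<delta>"
    by (auto simp: algebra_simps)
  have "B (s + real j * \<delta>) \<in> borel_measurable (F (s + real (Suc j) * \<delta>))"
    by (rule F_mono[OF B_meas]) (use le in auto)
  moreover have "B (s + real (Suc j) * \<delta>) \<in> borel_measurable (F (s + real (Suc j) * \<delta>))"
    by (rule B_meas) (use le in auto)
  ultimately show ?thesis unfolding binc_def by (intro borel_measurable_diff)
qed

lemma binc_step:
  assumes "0 \<le> s" "0 < \<delta>"
  shows "0 \<le> s + real j * \<delta>" "s + real j * \<delta> < s + real (Suc j) * \<delta>" "s + real j * \<delta> \<le> s + real (Suc j) * \<delta>"
     "s + real (Suc j) * \<delta> - (s + real j * \<delta>) = \<delta>"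
  using assms by (auto simp: algebra_simps)

lemma binc_mult:
  assumes "0 \<le> s" "0 < \<delta>" and g: "g \<in> borel_measurable (F (s + real j * \<delta>))" "integrable M g"
  shows "integrable M (\<lambda>\<omega>. g \<omega> * binc s \<delta> j \<omega> ^ m)"
    and "(\<integral>\<omega>. g \<omega> * binc s \<delta> j \<omega> \<partial>M) = 0"
    and "(\<integral>\<omega>. g \<omega> * binc s \<delta> j \<omega> ^ 2 \<partial>M) = (\<integral>\<omega>. g \<omega> \<partial>M) * \<delta>"
    and "(\<integral>\<omega>. g \<omega> * binc s \<delta> j \<omega> ^ 3 \<partial>M) = 0"
    and "(\<integral>\<omega>. g \<omega> * binc s \<delta> j \<omega> ^ 4 \<partial>M) = (\<integral>\<omega>. g \<omega> \<partial>M) * (3 * \<delta>\<^sup>2)"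
proof -
  note st = binc_step[OF assms(1,2), of j]
  note m = inc_moments[OF st(1,2)]
  have pm: "(\<lambda>x::real. x ^ k) \<in> borel_measurable borel" for k by measurable
  note e = inc_mult_integral[OF st(1,2) g(1) pm g(2) m(1)]
  show "integrable M (\<lambda>\<omega>. g \<omega> * binc s \<delta> j \<omega> ^ m)"
    unfolding binc_def by (rule inc_mult_integrable[OF st(1,2) g(1) pm g(2) m(1)])
  show "(\<integral>\<omega>. g \<omega> * binc s \<delta> j \<omega> \<partial>M) = 0" using e[of 1] m(3) by (simp add: binc_def)
  show "(\<integral>\<omega>. g \<omega> * binc s \<delta> j \<omega> ^ 2 \<partial>M) = (\<integral>\<omega>. g \<omega> \<partial>M) * \<delta>"
    using e[of 2] m(4) unfolding st(4) by (simp add: binc_def)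
  show "(\<integral>\<omega>. g \<omega> * binc s \<delta> j \<omega> ^ 3 \<partial>M) = 0" using e[of 3] m(5) by (simp add: binc_def)
  show "(\<integral>\<omega>. g \<omega> * binc s \<delta> j \<omega> ^ 4 \<partial>M) = (\<integral>\<omega>. g \<omega> \<partial>M) * (3 * \<delta>\<^sup>2)"
    using e[of 4] m(6) unfolding st(4) by (simp add: binc_def)
qed

lemma msum_meas:
  assumes "0 \<le> s" "0 < \<delta>" and g: "\<And>j. g j \<in> borel_measurable (F (s + real j * \<delta>))"
  shows "msum s \<delta> g k \<in> borel_measurable (F (s + real k * \<delta>))"
proof (induction k)
  case 0 show ?case by (simp add: msum_def)
next
  case (Suc k)
  note st = binc_step[OF assms(1,2), of k]
  have "msum s \<delta> g k \<in> borel_measurable (F (s + real (Suc k) * \<delta>))"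
    by (rule F_mono[OF Suc st(1,3)])
  moreover have "g k \<in> borel_measurable (F (s + real (Suc k) * \<delta>))"
    by (rule F_mono[OF g st(1,3)])
  ultimately show ?case unfolding msum_Suc
    using binc_meas[OF assms(1,2), of k] by (intro borel_measurable_add borel_measurable_times)
qed

text \<open>The bounds are the moments of a centred Gaussian of variance
  \<open>C\<^sup>2 * (k * \<delta>)\<close>. In the expansion of a power of the next sum, all odd
  powers of the new increment have mean 0. The mixed term of the fourth power needs the second
  moment, hence the joint induction; it closes because
  \<open>3 * k^2 + 6 * k + 3 = 3 * (k + 1)^2\<close>.\<close>

lemma msum_moments:
  assumes s: "0 \<le> s" "0 < \<delta>" and g: "\<And>j. g j \<in> borel_measurable (F (s + real j * \<delta>))"
    and C: "\<And>j \<omega>. \<bar>g j \<omega>\<bar> \<le> C"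
  shows "integrable M (\<lambda>\<omega>. msum s \<delta> g k \<omega> ^ 4) \<and> (\<integral>\<omega>. msum s \<delta> g k \<omega> ^ 2 \<partial>M) \<le> C\<^sup>2 * (real k * \<delta>)
    \<and> (\<integral>\<omega>. msum s \<delta> g k \<omega> ^ 4 \<partial>M) \<le> 3 * C^4 * (real k * \<delta>)\<^sup>2"
proof (induction k)
  case 0 show ?case by simp
next
  case (Suc k)
  note st = binc_step[OF s, of k]
  let ?x = "msum s \<delta> g k" let ?g = "g k" let ?d = "binc s \<delta> k"
  have C0: "0 \<le> C" using C[of 0 undefined] by linarith
  have xF[measurable]: "?x \<in> borel_measurable (F (s + real k * \<delta>))" by (rule msum_meas[OF s g])
  have gF[measurable]: "?g \<in> borel_measurable (F (s + real k * \<delta>))" by (rule g)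
  have xM[measurable]: "?x \<in> borel_measurable M" by (rule F_M[OF xF st(1)])
  have gM[measurable]: "?g \<in> borel_measurable M" by (rule F_M[OF gF st(1)])
  have xi: "integrable M (\<lambda>\<omega>. ?x \<omega> ^ m)" if "m \<le> 4" for m
  proof (rule Bochner_Integration.integrable_bound)
    show "integrable M (\<lambda>\<omega>. 1 + ?x \<omega> ^ 4)" using Suc by simp
    show "AE \<omega> in M. norm (?x \<omega> ^ m) \<le> norm (1 + ?x \<omega> ^ 4)"
    proof (rule AE_I2)
      fix \<omega>
      have "0 \<le> ?x \<omega> ^ 4" by simp
      then show "norm (?x \<omega> ^ m) \<le> norm (1 + ?x \<omega> ^ 4)"
        using abs_pow_le_1_pow4[OF that, of "?x \<omega>"] by (simp add: power_abs)
    qed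
  qed measurable
  have gb: "\<bar>?g \<omega> ^ m\<bar> \<le> C ^ m" for m \<omega>
    unfolding power_abs by (intro power_mono C) auto
  have xg: "integrable M (\<lambda>\<omega>. ?x \<omega> ^ m * ?g \<omega> ^ n)" if "m \<le> 4" for m n
    by (rule integrable_mult_bounded[OF xi[OF that] _ gb]) measurable
  have xgF: "(\<lambda>\<omega>. ?x \<omega> ^ m * ?g \<omega> ^ n) \<in> borel_measurable (F (s + real k * \<delta>))" for m n
    by measurable
  have xgd: "integrable M (\<lambda>\<omega>. ?x \<omega> ^ m * ?g \<omega> ^ n * ?d \<omega> ^ l)" if "m \<le> 4" for m n l
    by (rule binc_mult(1)[OF s xgF xg[OF that]])
  note E = binc_mult(2-5)[OF s xgF xg]
  have E1: "(\<integral>\<omega>. ?x \<omega> ^ m * ?g \<omega> ^ n * ?d \<omega> \<partial>M) = 0" if "m \<le> 4" for m n using E(1)[OF that] .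
  have E': "(\<integral>\<omega>. ?x \<omega> ^ 1 * ?g \<omega> ^ 1 * ?d \<omega> \<partial>M) = 0"
    "(\<integral>\<omega>. ?x \<omega> ^ 3 * ?g \<omega> ^ 1 * ?d \<omega> \<partial>M) = 0"
    "(\<integral>\<omega>. ?x \<omega> ^ 0 * ?g \<omega> ^ 2 * ?d \<omega> ^ 2 \<partial>M) = (\<integral>\<omega>. ?x \<omega> ^ 0 * ?g \<omega> ^ 2 \<partial>M) * \<delta>"
    "(\<integral>\<omega>. ?x \<omega> ^ 2 * ?g \<omega> ^ 2 * ?d \<omega> ^ 2 \<partial>M) = (\<integral>\<omega>. ?x \<omega> ^ 2 * ?g \<omega> ^ 2 \<partial>M) * \<delta>"
    "(\<integral>\<omega>. ?x \<omega> ^ 1 * ?g \<omega> ^ 3 * ?d \<omega> ^ 3 \<partial>M) = 0"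
    "(\<integral>\<omega>. ?x \<omega> ^ 0 * ?g \<omega> ^ 4 * ?d \<omega> ^ 4 \<partial>M) = (\<integral>\<omega>. ?x \<omega> ^ 0 * ?g \<omega> ^ 4 \<partial>M) * (3 * \<delta>\<^sup>2)"
    by (rule E; simp)+
  have e2: "(?x \<omega> + ?g \<omega> * ?d \<omega>)^2 = ?x \<omega>^2 + 2 * (?x \<omega>^1 * ?g \<omega>^1 * ?d \<omega>) + ?x \<omega>^0 * ?g \<omega>^2 * ?d \<omega>^2" for \<omega>
    by (simp add: power2_eq_square algebra_simps)
  have e4: "(?x \<omega> + ?g \<omega> * ?d \<omega>)^4 = ?x \<omega>^4 + 4 * (?x \<omega>^3 * ?g \<omega>^1 * ?d \<omega>) + 6 * (?x \<omega>^2 * ?g \<omega>^2 * ?d \<omega>^2)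
      + 4 * (?x \<omega>^1 * ?g \<omega>^3 * ?d \<omega>^3) + ?x \<omega>^0 * ?g \<omega>^4 * ?d \<omega>^4" for \<omega>
    by (simp add: eval_nat_numeral algebra_simps)
  have i1: "integrable M (\<lambda>\<omega>. ?x \<omega> ^ m * ?g \<omega> ^ n * ?d \<omega>)" if "m \<le> 4" for m n
    using xgd[OF that, of n 1] by simp
  have int4: "integrable M (\<lambda>\<omega>. (?x \<omega> + ?g \<omega> * ?d \<omega>)^4)"
    unfolding e4 by (intro Bochner_Integration.integrable_add integrable_mult_right xgd xi i1) auto
  have g2: "(\<integral>\<omega>. ?x \<omega>^0 * ?g \<omega>^2 \<partial>M) \<le> C\<^sup>2"
  proof -
    have "(\<integral>\<omega>. ?x \<omega>^0 * ?g \<omega>^2 \<partial>M) \<le> (\<integral>\<omega>. C\<^sup>2 \<partial>M)"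
      using xg[of 0 2] gb[of _ 2] by (intro integral_mono) (auto simp: abs_le_iff)
    then show ?thesis by (simp add: prob_space)
  qed
  have g4: "(\<integral>\<omega>. ?x \<omega>^0 * ?g \<omega>^4 \<partial>M) \<le> C^4"
  proof -
    have "(\<integral>\<omega>. ?x \<omega>^0 * ?g \<omega>^4 \<partial>M) \<le> (\<integral>\<omega>. C^4 \<partial>M)"
      using xg[of 0 4] gb[of _ 4] by (intro integral_mono) (auto simp: abs_le_iff)
    then show ?thesis by (simp add: prob_space)
  qed
  have xg22: "(\<integral>\<omega>. ?x \<omega>^2 * ?g \<omega>^2 \<partial>M) \<le> C\<^sup>2 * (C\<^sup>2 * (real k * \<delta>))"
  proof -
    have "(\<integral>\<omega>. ?x \<omega>^2 * ?g \<omega>^2 \<partial>M) \<le> (\<integral>\<omega>. ?x \<omega>^2 * C\<^sup>2 \<partial>M)"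
      using gb[of _ 2] by (intro integral_mono xg integrable_mult_left xi mult_left_mono) (auto simp: abs_le_iff)
    also have "\<dots> = (\<integral>\<omega>. ?x \<omega>^2 \<partial>M) * C\<^sup>2" by simp
    also have "\<dots> \<le> C\<^sup>2 * (real k * \<delta>) * C\<^sup>2" using Suc by (intro mult_right_mono) auto
    finally show ?thesis by (simp add: mult_ac)
  qed
  have "(\<integral>\<omega>. (?x \<omega> + ?g \<omega> * ?d \<omega>)^2 \<partial>M) = (\<integral>\<omega>. ?x \<omega>^2 \<partial>M) + (\<integral>\<omega>. ?x \<omega>^0 * ?g \<omega>^2 \<partial>M) * \<delta>"
    unfolding e2 by (subst Bochner_Integration.integral_add,
      (intro Bochner_Integration.integrable_add integrable_mult_right xgd xi i1; simp)+)+ (simp only: integral_mult_right_zero E' mult_zero_right add_0_right)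
  also have "\<dots> \<le> C\<^sup>2 * (real k * \<delta>) + C\<^sup>2 * \<delta>"
    using Suc g2 s by (intro add_mono mult_right_mono) auto
  finally have r2: "(\<integral>\<omega>. (?x \<omega> + ?g \<omega> * ?d \<omega>)^2 \<partial>M) \<le> C\<^sup>2 * (real (Suc k) * \<delta>)"
    by (simp add: algebra_simps)
  have "(\<integral>\<omega>. (?x \<omega> + ?g \<omega> * ?d \<omega>)^4 \<partial>M) = (\<integral>\<omega>. ?x \<omega>^4 \<partial>M) + 6 * ((\<integral>\<omega>. ?x \<omega>^2 * ?g \<omega>^2 \<partial>M) * \<delta>)
      + (\<integral>\<omega>. ?x \<omega>^0 * ?g \<omega>^4 \<partial>M) * (3 * \<delta>\<^sup>2)"
    unfolding e4 by (subst Bochner_Integration.integral_add,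
      (intro Bochner_Integration.integrable_add integrable_mult_right xgd xi i1; simp)+)+ (simp only: integral_mult_right_zero E' mult_zero_right add_0_right)
  also have "\<dots> \<le> 3 * C^4 * (real k * \<delta>)\<^sup>2 + 6 * (C\<^sup>2 * (C\<^sup>2 * (real k * \<delta>)) * \<delta>) + C^4 * (3 * \<delta>\<^sup>2)"
    using Suc g4 xg22 s by (intro add_mono mult_right_mono mult_left_mono) auto
  also have "\<dots> = 3 * C^4 * (real (Suc k) * \<delta>)\<^sup>2"
    by (simp add: eval_nat_numeral algebra_simps)
  finally show ?case using int4 r2 unfolding msum_Suc by blast
qed

text \<open>Stopping replaces a maximum by a terminal value: once the sum has exceeded
  \<open>\<eta>\<close>, the integrand is set to 0 and the sum stays where it is, so Markov's
  inequality at the last index controls all indices. Fourth moments are used because the bound is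
  later added up over about \<open>L\<close> intervals of length \<open>u / L\<close>, and only a
  quadratic power of the length makes that sum vanish.\<close>

lemma msum_maximal:
  assumes s: "0 \<le> s" "0 < \<delta>" and g: "\<And>j. g j \<in> borel_measurable (F (s + real j * \<delta>))"
    and C: "\<And>j \<omega>. \<bar>g j \<omega>\<bar> \<le> C" and \<eta>: "\<eta> > 0"
  shows "{\<omega>\<in>space M. \<exists>k\<in>{..n}. \<bar>msum s \<delta> g k \<omega>\<bar> > \<eta>} \<in> sets M"
    and "prob {\<omega>\<in>space M. \<exists>k\<in>{..n}. \<bar>msum s \<delta> g k \<omega>\<bar> > \<eta>} \<le> 3 * C^4 * (real n * \<delta>)\<^sup>2 / \<eta>^4"
proof -
  have t0: "0 \<le> s + real j * \<delta>" for j using s by simp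
  have C0: "0 \<le> C" using C[of 0 undefined] by linarith
  let ?S = "msum s \<delta> g"
  have SF: "?S k \<in> borel_measurable (F (s + real k * \<delta>))" for k by (rule msum_meas[OF s g])
  have [measurable]: "?S k \<in> borel_measurable M" for k by (rule F_M[OF SF t0])
  show E: "{\<omega>\<in>space M. \<exists>k\<in>{..n}. \<bar>?S k \<omega>\<bar> > \<eta>} \<in> sets M" by measurable
  \<comment> \<open>\<open>H j\<close> looks at the sums up to index \<open>j\<close> only and is
    therefore known before increment \<open>j\<close>. The increment that crosses
    \<open>\<eta>\<close> is kept; all later ones are dropped.\<close>
  define H where "H = (\<lambda>j. {\<omega>\<in>space M. \<forall>i\<in>{..j}. \<bar>?S i \<omega>\<bar> \<le> \<eta>})"
  define g' where "g' = (\<lambda>j \<omega>. indicator (H j) \<omega> * g j \<omega>)"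
  have HF: "H j \<in> sets (F (s + real j * \<delta>))" for j
    unfolding H_def space_F[OF t0, of j, symmetric]
  proof (rule sets.sets_Collect_finite_All)
    fix i assume "i \<in> {..j}"
    then have "real i * \<delta> \<le> real j * \<delta>" using s by (intro mult_right_mono) auto
    then have "?S i \<in> borel_measurable (F (s + real j * \<delta>))"
      by (intro F_mono[OF SF t0]) auto
    then show "{\<omega> \<in> space (F (s + real j * \<delta>)). \<bar>?S i \<omega>\<bar> \<le> \<eta>} \<in> sets (F (s + real j * \<delta>))" by measurable
  qed simp
  have g'F: "g' j \<in> borel_measurable (F (s + real j * \<delta>))" for j
    unfolding g'_def using HF g by (intro borel_measurable_times borel_measurable_indicator)
  have g'C: "\<bar>g' j \<omega>\<bar> \<le> C" for j \<omega>
    using C[of j \<omega>] C0 by (auto simp: g'_def indicator_def)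
  have stop: "\<bar>msum s \<delta> g' n \<omega>\<bar> > \<eta>" if w: "\<omega> \<in> space M" and ex: "\<exists>k\<in>{..n}. \<bar>?S k \<omega>\<bar> > \<eta>" for \<omega>
  proof -
    define k where "k = (LEAST k. \<bar>?S k \<omega>\<bar> > \<eta>)"
    have k1: "\<bar>?S k \<omega>\<bar> > \<eta>" using ex unfolding k_def by (auto intro: LeastI)
    have k2: "\<not> \<bar>?S i \<omega>\<bar> > \<eta>" if "i < k" for i using that unfolding k_def by (rule not_less_Least)
    have k3: "k \<le> n" using ex unfolding k_def by (meson Least_le atMost_iff le_trans)
    have a: "g' j \<omega> = g j \<omega>" if "j < k" for j
      using that k2 w by (auto simp: g'_def H_def indicator_def not_less)
    have b: "g' j \<omega> = 0" if "k \<le> j" for j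
      using that k1 w by (force simp: g'_def H_def indicator_def not_le)
    have "msum s \<delta> g' n \<omega> = (\<Sum>j<n. if j < k then g j \<omega> * binc s \<delta> j \<omega> else 0)"
      unfolding msum_def by (rule sum.cong) (auto simp: a b not_less)
    also have "\<dots> = (\<Sum>j<k. g j \<omega> * binc s \<delta> j \<omega>)"
      by (rule sum.mono_neutral_cong_right) (use k3 in auto)
    finally show ?thesis using k1 by (simp add: msum_def)
  qed
  note mm = msum_moments[OF s g'F g'C, of n]
  have [measurable]: "msum s \<delta> g' n \<in> borel_measurable M" by (rule F_M[OF msum_meas[OF s g'F] t0])
  have "prob {\<omega>\<in>space M. \<exists>k\<in>{..n}. \<bar>?S k \<omega>\<bar> > \<eta>} \<le> prob {\<omega>\<in>space M. msum s \<delta> g' n \<omega> ^ 4 \<ge> \<eta>^4}"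
  proof (rule finite_measure_mono)
    show "{\<omega>\<in>space M. \<exists>k\<in>{..n}. \<bar>?S k \<omega>\<bar> > \<eta>} \<subseteq> {\<omega>\<in>space M. msum s \<delta> g' n \<omega> ^ 4 \<ge> \<eta>^4}"
    proof (intro subsetI CollectI conjI; elim CollectE conjE bexE)
      fix \<omega> k assume "\<omega> \<in> space M" "k \<in> {..n}" "\<bar>?S k \<omega>\<bar> > \<eta>"
      then have "\<eta> ^ 4 \<le> \<bar>msum s \<delta> g' n \<omega>\<bar> ^ 4" using stop[of \<omega>] \<eta> by (intro power_mono) force+
      then show "msum s \<delta> g' n \<omega> ^ 4 \<ge> \<eta> ^ 4" by (simp add: power_even_abs_numeral)
    qed
  qed measurable
  also have "\<dots> \<le> (\<integral>\<omega>. msum s \<delta> g' n \<omega> ^ 4 \<partial>M) / \<eta>^4"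
    using mm \<eta> by (intro integral_Markov_inequality_measure[where A="{}"]) auto
  also have "\<dots> \<le> 3 * C^4 * (real n * \<delta>)\<^sup>2 / \<eta>^4"
    using mm \<eta> by (intro divide_right_mono) auto
  finally show "prob {\<omega>\<in>space M. \<exists>k\<in>{..n}. \<bar>?S k \<omega>\<bar> > \<eta>} \<le> 3 * C^4 * (real n * \<delta>)\<^sup>2 / \<eta>^4" .
qed

end

section \<open>Riemann sums of the stochastic differential equation\<close>

lemma sum_lessThan_shift:
  fixes h :: "nat \<Rightarrow> real"
  shows "(\<Sum>j<b. h (a + j)) = (\<Sum>k<a + b. h k) - (\<Sum>k<a. h k)"
  by (induction b) auto

lemma uniform_cont_interval:
  fixes p :: "real \<Rightarrow> real"
  assumes "continuous_on {0..} p" "0 \<le> s" "\<epsilon> > 0"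
  obtains d where "d > 0" "\<And>x y. x \<in> {s..s+u} \<Longrightarrow> y \<in> {s..s+u} \<Longrightarrow> \<bar>x - y\<bar> < d \<Longrightarrow> \<bar>p x - p y\<bar> < \<epsilon>"
proof -
  have "continuous_on {s..s+u} p" using assms(1) by (rule continuous_on_subset) (use assms in auto)
  then have "uniformly_continuous_on {s..s+u} p" by (rule compact_uniformly_continuous) simp
  then show ?thesis using that \<open>\<epsilon> > 0\<close> unfolding uniformly_continuous_on_def dist_real_def by metis
qed

locale sde = brownian M F B for M :: "'a measure" and F B +
  fixes P :: "real \<Rightarrow> real" and y0 :: real and Y :: "real \<Rightarrow> 'a \<Rightarrow> real"
  assumes sol: "sde_solution M F B P y0 Y" and Pc: "continuous_on UNIV P"
begin

lemma Y_meas: "0 \<le> t \<Longrightarrow> Y t \<in> borel_measurable (F t)"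
  and Y_0: "\<omega> \<in> space M \<Longrightarrow> Y 0 \<omega> = y0"
  and Y_cont: "\<omega> \<in> space M \<Longrightarrow> continuous_on {0..} (\<lambda>t. Y t \<omega>)"
  and ito: "0 \<le> t \<Longrightarrow> ito_integral_is M (\<lambda>s \<omega>. P (Y s \<omega>)) B t (\<lambda>\<omega>. Y t \<omega> - y0)"
  using sol by (auto simp: sde_solution_def)

lemma Y_meas_M[measurable]: "0 \<le> t \<Longrightarrow> Y t \<in> borel_measurable M"
  using F_M[OF Y_meas] .

lemma P_meas[measurable]: "P \<in> borel_measurable borel"
  using Pc by (rule borel_measurable_continuous_onI)

text \<open>With \<open>t = u * m / L\<close>, cutting \<open>[0, t]\<close> into
  \<open>n * m\<close> equal pieces gives the mesh \<open>u / (n * L)\<close> whatever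
  \<open>m\<close> is. Uniform partitions of different intervals thus share one grid, and their
  Riemann sums can be subtracted from each other.\<close>

definition jsum :: "real \<Rightarrow> nat \<Rightarrow> nat \<Rightarrow> nat \<Rightarrow> 'a \<Rightarrow> real" where
  "jsum u L m n \<omega> = (\<Sum>k<n * m. P (Y (u * real k / real (n * L)) \<omega>) *
     (B (u * real (Suc k) / real (n * L)) \<omega> - B (u * real k / real (n * L)) \<omega>))"

lemma jsum_meas[measurable]: "0 < u \<Longrightarrow> jsum u L m n \<in> borel_measurable M"
  unfolding jsum_def by measurable

lemma jsum_conv:
  assumes u: "0 < u" and L: "0 < L"
  shows "conv_in_prob M (jsum u L m) (\<lambda>\<omega>. Y (u * real m / real L) \<omega> - y0)"
\<comment> \<open>For \<open>m = 0\<close> the indices \<open>n * m\<close> do not tend to infinity,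
  but then the sum is empty and \<open>Y 0 = y0\<close>.\<close>
proof (cases "m = 0")
  case True
  have "{\<omega> \<in> space M. \<epsilon> < \<bar>jsum u L m n \<omega> - (Y (u * real m / real L) \<omega> - y0)\<bar>} = {}" if "\<epsilon> > 0" for \<epsilon> n
    using True that by (auto simp: jsum_def Y_0)
  then show ?thesis unfolding conv_in_prob_def by (intro allI impI) (simp only: measure_empty tendsto_const)
next
  case False
  define t where "t = u * real m / real L"
  have t: "t \<ge> 0" using u by (simp add: t_def)
  let ?X = "\<lambda>n \<omega>. \<Sum>k<n. P (Y (t * real k / real n) \<omega>) *
                 (B (t * real (Suc k) / real n) \<omega> - B (t * real k / real n) \<omega>)"
  have e: "t * x / real (n * m) = u * x / real (n * L)" for x n
    using False L by (cases "n = 0") (auto simp: t_def field_simps)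
  have eq: "jsum u L m n \<omega> = ?X (n * m) \<omega>" for n \<omega>
    unfolding jsum_def e by (rule refl)
  have sm: "filterlim (\<lambda>n. n * m) at_top sequentially"
    using False by (intro filterlim_subseq) (auto simp: strict_mono_def)
  have "conv_in_prob M ?X (\<lambda>\<omega>. Y t \<omega> - y0)" using ito[OF t] by (simp add: ito_integral_is_def)
  then have "(\<lambda>n. prob {\<omega> \<in> space M. \<epsilon> < \<bar>?X n \<omega> - (Y t \<omega> - y0)\<bar>}) \<longlonglongrightarrow> 0" if "\<epsilon> > 0" for \<epsilon>
    using that unfolding conv_in_prob_def by blast
  note lim = filterlim_compose[OF this sm]
  show ?thesis unfolding conv_in_prob_def t_def[symmetric] eq by (intro allI impI lim)
qed

definition usum :: "real \<Rightarrow> real \<Rightarrow> nat \<Rightarrow> 'a \<Rightarrow> real" where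
  "usum s \<delta> k \<omega> = Y s \<omega> + msum s \<delta> (\<lambda>j \<omega>. P (Y (s + real j * \<delta>) \<omega>)) k \<omega>"

lemma grid_nonneg: "0 \<le> s \<Longrightarrow> 0 < \<delta> \<Longrightarrow> 0 \<le> s + real j * \<delta>" by simp

lemma PY_F: "0 \<le> s \<Longrightarrow> 0 < \<delta> \<Longrightarrow> (\<lambda>\<omega>. P (Y (s + real j * \<delta>) \<omega>)) \<in> borel_measurable (F (s + real j * \<delta>))"
  by (rule measurable_compose[OF Y_meas P_meas]) simp

lemma usum_F: "0 \<le> s \<Longrightarrow> 0 < \<delta> \<Longrightarrow> usum s \<delta> k \<in> borel_measurable (F (s + real k * \<delta>))"
  unfolding usum_def
  by (intro borel_measurable_add msum_meas PY_F F_mono[OF Y_meas]) auto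

lemma usum_M[measurable]: "0 \<le> s \<Longrightarrow> 0 < \<delta> \<Longrightarrow> usum s \<delta> k \<in> borel_measurable M"
  by (rule F_M[OF usum_F]) auto

lemma usum_jsum:
  assumes "0 < u" "0 < L" "0 < n"
  shows "usum (u * real i) (u / real (n * L)) (n * q) \<omega> - Y (u * real i) \<omega>
     = jsum u L (i * L + q) n \<omega> - jsum u L (i * L) n \<omega>"
proof -
  let ?h = "\<lambda>k. P (Y (u * real k / real (n * L)) \<omega>) *
     (B (u * real (Suc k) / real (n * L)) \<omega> - B (u * real k / real (n * L)) \<omega>)"
  have p: "u * real i + real j * (u / real (n * L)) = u * real (n * (i * L) + j) / real (n * L)" for j
    using assms by (simp add: field_simps)
  have p': "u * real i + real (Suc j) * (u / real (n * L)) = u * real (Suc (n * (i * L) + j)) / real (n * L)" for j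
    using p[of "Suc j"] by simp
  have "usum (u * real i) (u / real (n * L)) (n * q) \<omega> - Y (u * real i) \<omega> = (\<Sum>j<n*q. ?h (n * (i * L) + j))"
    unfolding usum_def msum_def binc_def p p' by simp
  also have "\<dots> = (\<Sum>k<n * (i * L) + n * q. ?h k) - (\<Sum>k<n * (i * L). ?h k)"
    by (rule sum_lessThan_shift)
  finally show ?thesis by (simp add: jsum_def distrib_left)
qed

text \<open>The integral is given only over intervals that start at 0, so a Riemann sum started at
  \<open>u * i\<close> is obtained as a difference of two. Both end points must lie on one uniform
  grid, the reason why start times are multiples of \<open>u\<close> from here on.\<close>

lemma usum_conv:
  assumes u: "0 < u" and L: "0 < L" and \<epsilon>: "\<epsilon> > 0"
  shows "(\<lambda>n. prob {\<omega>\<in>space M. \<bar>usum (u * real i) (u / real (n * L)) (n * q) \<omega> - Y (u * real i + real q * (u / real L)) \<omega>\<bar> > \<epsilon>}) \<longlonglongrightarrow> 0"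
proof -
  let ?m = "i * L + q"
  let ?A = "\<lambda>m n. {\<omega>\<in>space M. \<bar>jsum u L m n \<omega> - (Y (u * real m / real L) \<omega> - y0)\<bar> > \<epsilon> / 2}"
  let ?E = "\<lambda>n. {\<omega>\<in>space M. \<bar>usum (u * real i) (u / real (n * L)) (n * q) \<omega> - Y (u * real i + real q * (u / real L)) \<omega>\<bar> > \<epsilon>}"
  have c: "(\<lambda>n. prob (?A m n)) \<longlonglongrightarrow> 0" for m
    by (rule jsum_conv[OF u L, unfolded conv_in_prob_def, rule_format, OF half_gt_zero[OF \<epsilon>]])
  have lim: "(\<lambda>n. prob (?A ?m n) + prob (?A (i * L) n)) \<longlonglongrightarrow> 0"
    using tendsto_add[OF c[of ?m] c[of "i * L"]] by (simp only: add_0_right)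
  have t: "u * real ?m / real L = u * real i + real q * (u / real L)" "u * real (i * L) / real L = u * real i"
    using L by (auto simp: field_simps)
  have Am: "?A m n \<in> events" for m n
  proof -
    have [measurable]: "Y (u * real m / real L) \<in> borel_measurable M" using u by (intro Y_meas_M) auto
    have [measurable]: "jsum u L m n \<in> borel_measurable M" using u by (rule jsum_meas)
    show ?thesis by measurable
  qed
  have "prob (?E n) \<le> prob (?A ?m n) + prob (?A (i * L) n)" if "n > 0" for n
  proof -
    have "?E n \<subseteq> ?A ?m n \<union> ?A (i * L) n"
    proof
      fix \<omega> assume w: "\<omega> \<in> ?E n"
      show "\<omega> \<in> ?A ?m n \<union> ?A (i * L) n"
      proof -
        let ?a = "jsum u L ?m n \<omega> - (Y (u * real i + real q * (u / real L)) \<omega> - y0)"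
        let ?b = "jsum u L (i * L) n \<omega> - (Y (u * real i) \<omega> - y0)"
        have "usum (u * real i) (u / real (n * L)) (n * q) \<omega> - Y (u * real i + real q * (u / real L)) \<omega> = ?a - ?b"
          using usum_jsum[OF u L that, of i q \<omega>] by linarith
        moreover have "\<epsilon> < \<bar>usum (u * real i) (u / real (n * L)) (n * q) \<omega> - Y (u * real i + real q * (u / real L)) \<omega>\<bar>" "\<omega> \<in> space M"
          using w by blast+
        ultimately have "\<epsilon> / 2 < \<bar>?a\<bar> \<or> \<epsilon> / 2 < \<bar>?b\<bar>" "\<omega> \<in> space M" by linarith+
        then show ?thesis unfolding t by blast
      qed
    qed
    then have "prob (?E n) \<le> prob (?A ?m n \<union> ?A (i * L) n)"
      using Am by (intro finite_measure_mono sets.Un)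
    also have "\<dots> \<le> prob (?A ?m n) + prob (?A (i * L) n)"
      using Am by (intro measure_Un_le)
    finally show ?thesis .
  qed
  then have ev: "eventually (\<lambda>n. prob (?E n) \<le> prob (?A ?m n) + prob (?A (i * L) n)) sequentially"
    by (intro eventually_mono[OF eventually_gt_at_top[of 0]])
  show ?thesis
    by (rule tendsto_sandwich[OF always_eventually[OF allI[OF measure_nonneg]] ev tendsto_const lim])
qed

text \<open>Each path is uniformly continuous on the compact interval, so it leaves these events
  from some index on; dominated convergence turns this into convergence of probabilities.\<close>

lemma osc_tendsto:
  fixes N :: "nat \<Rightarrow> nat" and a b :: "nat \<Rightarrow> nat \<Rightarrow> real"
  assumes s: "0 \<le> s" and ab: "\<And>L k. k \<le> N L \<Longrightarrow> a L k \<in> {s..s+u} \<and> b L k \<in> {s..s+u}"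
    and h: "h \<longlonglongrightarrow> 0" and abh: "\<And>L k. k \<le> N L \<Longrightarrow> \<bar>a L k - b L k\<bar> \<le> h L" and \<eta>: "\<eta> > 0"
  shows "(\<lambda>L. prob {\<omega>\<in>space M. \<exists>k\<in>{..N L}. \<bar>Y (a L k) \<omega> - Y (b L k) \<omega>\<bar> > \<eta>}) \<longlonglongrightarrow> 0"
    and "{\<omega>\<in>space M. \<exists>k\<in>{..N L}. \<bar>Y (a L k) \<omega> - Y (b L k) \<omega>\<bar> > \<eta>} \<in> events"
proof -
  have m: "{\<omega>\<in>space M. \<exists>k\<in>{..N L}. \<bar>Y (a L k) \<omega> - Y (b L k) \<omega>\<bar> > \<eta>} \<in> events" for L
  proof (rule sets.sets_Collect_finite_Ex)
    fix k assume "k \<in> {..N L}"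
    then have "0 \<le> a L k" "0 \<le> b L k" using ab[of k L] s by auto
    then show "{\<omega>\<in>space M. \<bar>Y (a L k) \<omega> - Y (b L k) \<omega>\<bar> > \<eta>} \<in> events" by measurable
  qed simp
  then show "{\<omega>\<in>space M. \<exists>k\<in>{..N L}. \<bar>Y (a L k) \<omega> - Y (b L k) \<omega>\<bar> > \<eta>} \<in> events" .
  show "(\<lambda>L. prob {\<omega>\<in>space M. \<exists>k\<in>{..N L}. \<bar>Y (a L k) \<omega> - Y (b L k) \<omega>\<bar> > \<eta>}) \<longlonglongrightarrow> 0"
  proof (rule prob_tendsto_0[OF m])
    fix \<omega> assume w: "\<omega> \<in> space M"
    obtain d where d: "d > 0" "\<And>x y. x \<in> {s..s+u} \<Longrightarrow> y \<in> {s..s+u} \<Longrightarrow> \<bar>x - y\<bar> < d \<Longrightarrow> \<bar>Y x \<omega> - Y y \<omega>\<bar> < \<eta>"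
      using uniform_cont_interval[OF Y_cont[OF w] s \<eta>] by blast
    have "eventually (\<lambda>L. h L < d) sequentially" using h d(1) by (rule order_tendstoD)
    then show "eventually (\<lambda>L. \<omega> \<notin> {\<omega>\<in>space M. \<exists>k\<in>{..N L}. \<bar>Y (a L k) \<omega> - Y (b L k) \<omega>\<bar> > \<eta>}) sequentially"
    proof eventually_elim
      case (elim L)
      have "\<bar>Y (a L k) \<omega> - Y (b L k) \<omega>\<bar> < \<eta>" if "k \<le> N L" for k
        using d(2)[of "a L k" "b L k"] ab[OF that] abh[OF that] elim by force
      then show ?case by force
    qed
  qed
qed

lemma range_sets:
  assumes "0 \<le> s"
  shows "{\<omega>\<in>space M. \<exists>r\<in>{s..s+u}. Y r \<omega> < x} \<in> events" "{\<omega>\<in>space M. \<exists>r\<in>{s..s+u}. Y r \<omega> > x} \<in> events"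
proof -
  have Ym: "Y r \<in> borel_measurable M" if "r \<in> {s..s+u}" for r using that assms by (intro Y_meas_M) auto
  have Yc: "continuous_on {s..s+u} (\<lambda>r. Y r \<omega>)" if "\<omega> \<in> space M" for \<omega>
    by (rule continuous_on_subset[OF Y_cont[OF that]]) (use assms in auto)
  have "{\<omega>\<in>space M. \<exists>r\<in>{s..s+u}. Y r \<omega> < x} = space M - {\<omega>\<in>space M. \<forall>r\<in>{s..s+u}. Y r \<omega> \<in> {x..}}"
    unfolding atLeast_iff not_less[symmetric] by blast
  then show "{\<omega>\<in>space M. \<exists>r\<in>{s..s+u}. Y r \<omega> < x} \<in> events"
    using stay_sets[OF Ym Yc closed_atLeast] by auto
  have "{\<omega>\<in>space M. \<exists>r\<in>{s..s+u}. Y r \<omega> > x} = space M - {\<omega>\<in>space M. \<forall>r\<in>{s..s+u}. Y r \<omega> \<in> {..x}}"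
    unfolding atMost_iff not_less[symmetric] by blast
  then show "{\<omega>\<in>space M. \<exists>r\<in>{s..s+u}. Y r \<omega> > x} \<in> events"
    using stay_sets[OF Ym Yc closed_atMost] by auto
qed

text \<open>The deviation is tested only while the earlier grid values lie in \<open>K\<close>,
  where \<open>P\<close> is bounded. The condition runs over \<open>j < k\<close>, so the first grid
  point outside \<open>K\<close> is still controlled: the sum up to \<open>k\<close> uses only left
  end points.\<close>

definition bad :: "real \<Rightarrow> real \<Rightarrow> real set \<Rightarrow> real \<Rightarrow> nat \<Rightarrow> 'a set" where
  "bad s u K \<eta> N = {\<omega>\<in>space M. \<exists>k\<in>{..N}. (\<forall>j<k. Y (s + real j * (u / real N)) \<omega> \<in> K) \<and>
     \<bar>usum s (u / real N) k \<omega> - Y (s + real k * (u / real N)) \<omega>\<bar> > \<eta>}"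

lemma bad_sets:
  assumes "0 \<le> s" "u > 0" "N > 0" "closed K"
  shows "bad s u K \<eta> N \<in> events"
proof -
  have [measurable]: "K \<in> sets borel" using assms by auto
  have [measurable]: "Y (s + real j * (u / real N)) \<in> borel_measurable M" for j
    using assms by (intro Y_meas_M) auto
  have [measurable]: "usum s (u / real N) k \<in> borel_measurable M" for k
    using assms by (intro usum_M) auto
  have Ym: "{\<omega>\<in>space M. Y (s + real j * (u / real N)) \<omega> \<in> K} \<in> events" for j by measurable
  have "{\<omega>\<in>space M. (\<forall>j\<in>{..<k}. Y (s + real j * (u / real N)) \<omega> \<in> K)} \<in> events" for k
    by (rule sets.sets_Collect_finite_All[OF Ym]) simp
  moreover have "{\<omega>\<in>space M. \<bar>usum s (u / real N) k \<omega> - Y (s + real k * (u / real N)) \<omega>\<bar> > \<eta>} \<in> events" for k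
    by measurable
  ultimately have "{\<omega>\<in>space M. (\<forall>j<k. Y (s + real j * (u / real N)) \<omega> \<in> K) \<and>
     \<bar>usum s (u / real N) k \<omega> - Y (s + real k * (u / real N)) \<omega>\<bar> > \<eta>} \<in> events" for k
    unfolding Ball_def lessThan_iff by (intro sets.sets_Collect_conj)
  then show ?thesis unfolding bad_def by (intro sets.sets_Collect_finite_Ex finite_atMost)
qed

text \<open>The Riemann sums converge to \<open>Y\<close> only at each fixed time. Comparing at the points of a coarse grid
  and controlling the fine grid in between by a maximal inequality gives closeness at all fine grid points
  up to the first exit from \<open>K\<close>.\<close>

lemma good_grids:
  fixes u :: real and i :: nat
  assumes u: "0 < u" and K: "compact K"
  defines "s \<equiv> u * real i"
  obtains N :: "nat \<Rightarrow> nat" where "\<And>L. N L > 0" "filterlim N at_top sequentially"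
    "\<And>\<eta>. \<eta> > 0 \<Longrightarrow> (\<lambda>L. prob (bad s u K \<eta> (N L))) \<longlonglongrightarrow> 0"
proof -
  have s0: "0 \<le> s" using u by (simp add: s_def)
  define E where "E = (\<lambda>L q n. {\<omega>\<in>space M. \<bar>usum s (u / real (n * L)) (n * q) \<omega> - Y (s + real q * (u / real L)) \<omega>\<bar> > 1 / real L})"
  have Elim: "(\<lambda>n. \<Sum>q\<le>L. prob (E L q n)) \<longlonglongrightarrow> 0" if "L > 0" for L
    unfolding E_def s_def using usum_conv[OF u that] that by (intro tendsto_null_sum) auto
  \<comment> \<open>Convergence in probability comes without a rate. For each number
    \<open>L\<close> of coarse cells a refinement \<open>n L\<close> is picked that makes the
    deviations at all coarse points rare simultaneously.\<close>
  have "\<exists>n>0. (\<Sum>q\<le>L. prob (E L q n)) < 1 / real L" if "L > 0" for L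
  proof -
    have "eventually (\<lambda>n. (\<Sum>q\<le>L. prob (E L q n)) < 1 / real L) sequentially"
      using Elim[OF that] that by (intro order_tendstoD(2)) auto
    then have ev: "eventually (\<lambda>n. 0 < n \<and> (\<Sum>q\<le>L. prob (E L q n)) < 1 / real L) sequentially"
      using eventually_gt_at_top[of 0] by eventually_elim auto
    show ?thesis using eventually_happens'[OF sequentially_bot ev] .
  qed
  then obtain n where n: "\<And>L. L > 0 \<Longrightarrow> n L > 0 \<and> (\<Sum>q\<le>L. prob (E L q (n L))) < 1 / real L" by metis
  have npos: "0 < n (Suc L)" for L using n[of "Suc L"] by blast
  define N where "N = (\<lambda>L. n (Suc L) * Suc L)"
  have N0: "N L > 0" for L using n[of "Suc L"] by (auto simp: N_def)
  have Nge: "N L \<ge> L" for L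
  proof -
    have "1 * Suc L \<le> n (Suc L) * Suc L" using n[of "Suc L"] by (intro mult_right_mono) auto
    then show ?thesis by (simp add: N_def)
  qed
  have Nlim: "filterlim N at_top sequentially"
    unfolding filterlim_at_top by (meson Nge eventually_sequentially le_trans)
  obtain C where C: "C > 0" "\<And>y. y \<in> K \<Longrightarrow> \<bar>P y\<bar> \<le> C"
  proof -
    have "compact (P ` K)" using K Pc continuous_on_subset by (intro compact_continuous_image) auto
    then have "bounded (P ` K)" by (rule compact_imp_bounded)
    then obtain C where "C > 0" "\<And>y. y \<in> K \<Longrightarrow> norm (P y) \<le> C" unfolding bounded_pos by auto
    then show ?thesis using that by auto
  qed
  have Kc: "closed K" using K by (rule compact_imp_closed)
  have [measurable]: "K \<in> sets borel" using Kc by auto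
  have bd: "(\<lambda>L. prob (bad s u K \<eta> (N L))) \<longlonglongrightarrow> 0" if \<eta>: "\<eta> > 0" for \<eta>
  proof -
    \<comment> \<open>Cut off outside \<open>K\<close>, the coefficient is bounded by
      \<open>C\<close> and the maximal inequality applies. Up to the first grid exit from
      \<open>K\<close> it agrees with \<open>P\<close> along \<open>Y\<close>.\<close>
    define g where "g = (\<lambda>L q j \<omega>. let y = Y (s + real q * (u / real (Suc L)) + real j * (u / real (N L))) \<omega> in indicator K y * P y)"
    \<comment> \<open>The deviation at a fine grid point has three sources: the error at the coarse
      point to its left (\<open>B1\<close>, with a threshold that is eventually below
      \<open>\<eta> / 3\<close>), the movement of the sum since then (\<open>B2\<close>), and the
      movement of \<open>Y\<close> since then (\<open>B3\<close>).\<close>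
    define B1 where "B1 = (\<lambda>L. \<Union>q\<le>Suc L. E (Suc L) q (n (Suc L)))"
    define B2' where "B2' = (\<lambda>L q. {\<omega>\<in>space M. \<exists>k\<in>{..n (Suc L)}. \<bar>msum (s + real q * (u / real (Suc L))) (u / real (N L)) (g L q) k \<omega>\<bar> > \<eta> / 3})"
    define B2 where "B2 = (\<lambda>L. \<Union>q\<le>Suc L. B2' L q)"
    define bb where "bb = (\<lambda>L k. s + real (k div n (Suc L)) * (u / real (Suc L)))"
    define B3 where "B3 = (\<lambda>L. {\<omega>\<in>space M. \<exists>k\<in>{..N L}. \<bar>Y (s + real k * (u / real (N L))) \<omega> - Y (bb L k) \<omega>\<bar> > \<eta> / 3})"
    have nd: "real (n (Suc L)) * (u / real (N L)) = u / real (Suc L)" for L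
      unfolding N_def of_nat_mult using npos[of L] by (simp del: of_nat_Suc)
    have split: "s + real k * (u / real (N L)) = bb L k + real (k mod n (Suc L)) * (u / real (N L))" for k L
    proof -
      have "real k = real (k div n (Suc L)) * real (n (Suc L)) + real (k mod n (Suc L))"
        by (simp only: div_mult_mod_eq flip: of_nat_mult of_nat_add)
      then have "real k * (u / real (N L)) = real (k div n (Suc L)) * (real (n (Suc L)) * (u / real (N L))) + real (k mod n (Suc L)) * (u / real (N L))"
        by (simp add: algebra_simps)
      then show ?thesis unfolding nd bb_def by simp
    qed
    have E_ev: "E L q k \<in> events" if "L > 0" "k > 0" for L q k
    proof -
      have [measurable]: "Y (s + real q * (u / real L)) \<in> borel_measurable M"
        using s0 u that by (intro Y_meas_M) auto
      have [measurable]: "usum s (u / real (k * L)) (k * q) \<in> borel_measurable M"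
        using s0 u that by (intro usum_M) auto
      show ?thesis unfolding E_def by measurable
    qed
    have B1_ev: "B1 L \<in> events" for L unfolding B1_def using E_ev n[of "Suc L"] by auto
    have B1_p: "prob (B1 L) \<le> 1 / real (Suc L)" for L
    proof -
      have "prob (B1 L) \<le> (\<Sum>q\<le>Suc L. prob (E (Suc L) q (n (Suc L))))"
        unfolding B1_def using E_ev n[of "Suc L"] by (intro measure_UNION_le) auto
      then show ?thesis using n[of "Suc L"] by simp
    qed
    have B2: "B2' L q \<in> events \<and> prob (B2' L q) \<le> 3 * C^4 * (u / real (Suc L))\<^sup>2 / (\<eta>/3)^4" for L q
    proof -
      have s': "0 \<le> s + real q * (u / real (Suc L))" using s0 u by simp
      have d': "0 < u / real (N L)" using u N0 by simp
      have gF: "g L q j \<in> borel_measurable (F (s + real q * (u / real (Suc L)) + real j * (u / real (N L))))" for j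
      proof -
        have "Y (s + real q * (u / real (Suc L)) + real j * (u / real (N L))) \<in> borel_measurable (F (s + real q * (u / real (Suc L)) + real j * (u / real (N L))))"
          by (rule Y_meas[OF grid_nonneg[OF s' d']])
        moreover have "(\<lambda>y. indicator K y * P y) \<in> borel_measurable borel" by measurable
        ultimately show ?thesis unfolding g_def Let_def by (rule measurable_compose)
      qed
      have gC: "\<bar>g L q j \<omega>\<bar> \<le> C" for j \<omega>
        using C by (auto simp: g_def Let_def indicator_def less_imp_le)
      show ?thesis
        unfolding B2'_def using msum_maximal[OF s' d' gF gC, of "\<eta>/3" "n (Suc L)"] \<eta> nd[of L] by simp
    qed
    have B2_ev: "B2 L \<in> events" for L unfolding B2_def using B2 by auto
    have B2_p: "prob (B2 L) \<le> real (L + 2) * (3 * C^4 * (u / real (Suc L))\<^sup>2 / (\<eta>/3)^4)" for L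
    proof -
      have "prob (B2 L) \<le> (\<Sum>q\<le>Suc L. prob (B2' L q))"
        unfolding B2_def using B2 by (intro measure_UNION_le) auto
      also have "\<dots> \<le> (\<Sum>q\<le>Suc L. 3 * C^4 * (u / real (Suc L))\<^sup>2 / (\<eta>/3)^4)"
        using B2 by (intro sum_mono) auto
      finally show ?thesis by simp
    qed
    have kdiv: "k div n (Suc L) \<le> Suc L" if "k \<le> N L" for k L
      using that n[of "Suc L"] div_le_mono[of k "n (Suc L) * Suc L" "n (Suc L)"] by (simp add: N_def)
    have B3: "(\<lambda>L. prob (B3 L)) \<longlonglongrightarrow> 0" "B3 L \<in> events" for L
    proof -
      have 1: "s + real k * (u / real (N L)) \<in> {s..s+u} \<and> bb L k \<in> {s..s+u}" if "k \<le> N L" for L k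
        using grid_point_bounds[OF u N0 that] grid_point_bounds[OF u _ kdiv[OF that]] by (auto simp: bb_def)
      have 2: "(\<lambda>L. u / real (Suc L)) \<longlonglongrightarrow> 0" by real_asymp
      have 3: "\<bar>s + real k * (u / real (N L)) - bb L k\<bar> \<le> u / real (Suc L)" for L k
      proof -
        have "real (k mod n (Suc L)) * (u / real (N L)) \<le> real (n (Suc L)) * (u / real (N L))"
          using n[of "Suc L"] u by (intro mult_right_mono) (auto simp: less_imp_le)
        then show ?thesis unfolding split nd using u by simp
      qed
      show "(\<lambda>L. prob (B3 L)) \<longlonglongrightarrow> 0" "B3 L \<in> events"
        unfolding B3_def using osc_tendsto[OF s0 1 2 3, where \<eta>="\<eta>/3"] \<eta> by auto
    qed
    have sub: "bad s u K \<eta> (N L) \<subseteq> B1 L \<union> B2 L \<union> B3 L" if L: "1 / real (Suc L) \<le> \<eta> / 3" for L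
    proof
      fix \<omega> assume w: "\<omega> \<in> bad s u K \<eta> (N L)"
      let ?d = "u / real (N L)" let ?n = "n (Suc L)"
      from w obtain k where k: "k \<le> N L" "\<forall>j<k. Y (s + real j * ?d) \<omega> \<in> K"
         "\<bar>usum s ?d k \<omega> - Y (s + real k * ?d) \<omega>\<bar> > \<eta>" and ws: "\<omega> \<in> space M"
        unfolding bad_def by auto
      let ?q = "k div ?n" let ?j = "k mod ?n"
      have kq: "k = ?n * ?q + ?j" by simp
      have sq: "s + real ?q * (u / real (Suc L)) + real j * ?d = s + real (?n * ?q + j) * ?d" for j
        by (subst nd[symmetric]) (simp add: algebra_simps)
      have sq': "s + real ?q * (u / real (Suc L)) + real (Suc j) * ?d = s + real (Suc (?n * ?q + j)) * ?d" for j
        using sq[of "Suc j"] by simp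
      have gq: "g L ?q j \<omega> = P (Y (s + real (?n * ?q + j) * ?d) \<omega>)" if "j < ?j" for j
      proof -
        have "?n * ?q + j < k" using that kq by linarith
        then show ?thesis using k(2) unfolding g_def Let_def sq by auto
      qed
      have "msum (s + real ?q * (u / real (Suc L))) ?d (g L ?q) ?j \<omega>
        = (\<Sum>j<?j. P (Y (s + real (?n * ?q + j) * ?d) \<omega>) * binc s ?d (?n * ?q + j) \<omega>)"
        unfolding msum_def binc_def sq sq' using gq by (intro sum.cong) auto
      also have "\<dots> = usum s ?d (?n * ?q + ?j) \<omega> - usum s ?d (?n * ?q) \<omega>"
        unfolding usum_def msum_def by (subst sum_lessThan_shift[where h="\<lambda>j. P (Y (s + real j * ?d) \<omega>) * binc s ?d j \<omega>"]) simp
      finally have ms: "usum s ?d k \<omega> - usum s ?d (?n * ?q) \<omega> = msum (s + real ?q * (u / real (Suc L))) ?d (g L ?q) ?j \<omega>"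
        using kq by simp
      show "\<omega> \<in> B1 L \<union> B2 L \<union> B3 L"
      proof (rule ccontr)
        assume "\<omega> \<notin> B1 L \<union> B2 L \<union> B3 L"
        then have c: "\<omega> \<notin> B1 L" "\<omega> \<notin> B2 L" "\<omega> \<notin> B3 L" by auto
        have NL: "N L = ?n * Suc L" by (simp add: N_def)
        have "\<omega> \<notin> E (Suc L) ?q ?n" using c(1) kdiv[OF k(1)] unfolding B1_def by blast
        then have "\<not> \<bar>usum s ?d (?n * ?q) \<omega> - Y (bb L k) \<omega>\<bar> > 1 / real (Suc L)"
          unfolding E_def bb_def NL using ws by blast
        then have 1: "\<bar>usum s ?d (?n * ?q) \<omega> - Y (bb L k) \<omega>\<bar> \<le> \<eta> / 3" using L by linarith
        have jn: "?j \<in> {..?n}" using npos[of L] by (simp add: less_imp_le)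
        have "\<omega> \<notin> B2' L ?q" using c(2) kdiv[OF k(1)] unfolding B2_def by blast
        then have "\<not> \<bar>usum s ?d k \<omega> - usum s ?d (?n * ?q) \<omega>\<bar> > \<eta> / 3"
          unfolding ms B2'_def using ws jn by blast
        then have 2: "\<bar>usum s ?d k \<omega> - usum s ?d (?n * ?q) \<omega>\<bar> \<le> \<eta> / 3" by linarith
        have "\<not> \<bar>Y (s + real k * ?d) \<omega> - Y (bb L k) \<omega>\<bar> > \<eta> / 3"
          using c(3) ws k(1) unfolding B3_def by blast
        then have 3: "\<bar>Y (s + real k * ?d) \<omega> - Y (bb L k) \<omega>\<bar> \<le> \<eta> / 3" by linarith
        show False using 1 2 3 k(3) by linarith
      qed
    qed
    have le: "prob (bad s u K \<eta> (N L)) \<le> 1 / real (Suc L) + real (L + 2) * (3 * C^4 * (u / real (Suc L))\<^sup>2 / (\<eta>/3)^4) + prob (B3 L)"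
      if L: "1 / real (Suc L) \<le> \<eta> / 3" for L
    proof -
      have "prob (bad s u K \<eta> (N L)) \<le> prob (B1 L \<union> B2 L \<union> B3 L)"
        using B1_ev B2_ev B3(2) sub[OF L] by (intro finite_measure_mono) auto
      also have "\<dots> \<le> prob (B1 L \<union> B2 L) + prob (B3 L)"
        using B1_ev B2_ev B3(2) by (intro measure_Un_le) auto
      also have "prob (B1 L \<union> B2 L) \<le> prob (B1 L) + prob (B2 L)"
        using B1_ev B2_ev by (intro measure_Un_le) auto
      finally show ?thesis using B1_p[of L] B2_p[of L] by linarith
    qed
    have lim: "(\<lambda>L. 1 / real (Suc L) + real (L + 2) * (3 * C^4 * (u / real (Suc L))\<^sup>2 / (\<eta>/3)^4)) \<longlonglongrightarrow> 0"
    proof -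
      define c where "c = 3 * C^4 * u\<^sup>2 / (\<eta>/3)^4"
      have e: "real (L + 2) * (3 * C^4 * (u / real (Suc L))\<^sup>2 / (\<eta>/3)^4) = c * (real (L + 2) / (real (Suc L))\<^sup>2)" for L
        by (simp add: c_def power_divide mult_ac del: of_nat_Suc of_nat_add)
      have "(\<lambda>L. real (L + 2) / (real (Suc L))\<^sup>2) \<longlonglongrightarrow> 0" by real_asymp
      then have "(\<lambda>L. c * (real (L + 2) / (real (Suc L))\<^sup>2)) \<longlonglongrightarrow> 0" by (rule tendsto_mult_right_zero)
      moreover have "(\<lambda>L. 1 / real (Suc L)) \<longlonglongrightarrow> 0" by real_asymp
      ultimately show ?thesis unfolding e by (rule tendsto_add_zero[rotated])
    qed
    have lim': "(\<lambda>L. 1 / real (Suc L) + real (L + 2) * (3 * C^4 * (u / real (Suc L))\<^sup>2 / (\<eta>/3)^4) + prob (B3 L)) \<longlonglongrightarrow> 0"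
      using tendsto_add[OF lim B3(1)] by simp
    have "(\<lambda>L. 1 / real (Suc L)) \<longlonglongrightarrow> 0" by real_asymp
    then have "eventually (\<lambda>L. 1 / real (Suc L) < \<eta> / 3) sequentially" using \<eta> by (intro order_tendstoD(2)) auto
    then have ev: "eventually (\<lambda>L. prob (bad s u K \<eta> (N L)) \<le> 1 / real (Suc L) + real (L + 2) * (3 * C^4 * (u / real (Suc L))\<^sup>2 / (\<eta>/3)^4) + prob (B3 L)) sequentially"
      by eventually_elim (rule le, simp)
    show ?thesis
      by (rule tendsto_sandwich[OF always_eventually[OF allI[OF measure_nonneg]] ev tendsto_const lim'])
  qed
  show ?thesis by (rule that[OF N0 Nlim bd])
qed

end

section \<open>Dynkin's formula for eigenfunctions of the generator\<close>

lemma compact_bound_real: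
  fixes f :: "real \<Rightarrow> real"
  assumes "continuous_on S f" "compact S"
  obtains C where "C > 0" "\<And>x. x \<in> S \<Longrightarrow> \<bar>f x\<bar> \<le> C"
proof -
  have "bounded (f ` S)" using assms by (intro compact_imp_bounded compact_continuous_image)
  then obtain C where "C > 0" "\<And>y. y \<in> f ` S \<Longrightarrow> norm y \<le> C" unfolding bounded_pos by blast
  then show ?thesis using that by auto
qed

lemma lipschitz_from_deriv:
  fixes f f' :: "real \<Rightarrow> real"
  assumes "\<And>x. x \<in> {a..b} \<Longrightarrow> (f has_real_derivative f' x) (at x)" "\<And>x. x \<in> {a..b} \<Longrightarrow> \<bar>f' x\<bar> \<le> C"
    and "x \<in> {a..b}" "y \<in> {a..b}"
  shows "\<bar>f x - f y\<bar> \<le> C * \<bar>x - y\<bar>"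
proof -
  have "norm (f x - f y) \<le> C * norm (x - y)"
    by (rule field_differentiable_bound[of "{a..b}" f f'])
       (use assms in \<open>auto intro: has_field_derivative_at_within\<close>)
  then show ?thesis by simp
qed

text \<open>Brownian increments are unbounded, so the remainder must be controlled for every
  \<open>h\<close>, also when \<open>x + h\<close> leaves the interval and the function is cut off
  to 0. In that case \<open>\<bar>h\<bar> \<ge> e\<close>, and each of the remaining terms is
  dominated by \<open>\<bar>h\<bar>^3\<close> after multiplication with powers of
  \<open>\<bar>h\<bar> / e\<close>.\<close>

lemma taylor_cubic_bound:
  fixes f f1 f2 f3 :: "real \<Rightarrow> real"
  assumes d: "\<And>x. x \<in> {al..be} \<Longrightarrow> (f has_real_derivative f1 x) (at x)"
      "\<And>x. x \<in> {al..be} \<Longrightarrow> (f1 has_real_derivative f2 x) (at x)"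
      "\<And>x. x \<in> {al..be} \<Longrightarrow> (f2 has_real_derivative f3 x) (at x)"
    and C: "\<And>x. x \<in> {al..be} \<Longrightarrow> \<bar>f x\<bar> \<le> C" "\<And>x. x \<in> {al..be} \<Longrightarrow> \<bar>f1 x\<bar> \<le> C"
      "\<And>x. x \<in> {al..be} \<Longrightarrow> \<bar>f2 x\<bar> \<le> C" "\<And>x. x \<in> {al..be} \<Longrightarrow> \<bar>f3 x\<bar> \<le> C"
    and e: "e > 0" and x: "x \<in> {al + e..be - e}"
  shows "\<bar>indicator {al..be} (x + h) * f (x + h) - f x - f1 x * h - f2 x / 2 * h\<^sup>2\<bar> \<le> C * (1 + 1 / e^3 + 1 / e^2 + 1 / e) * \<bar>h\<bar>^3"
proof -
  have xI: "x \<in> {al..be}" using x e by auto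
  have C0: "0 \<le> C" using C(1)[OF xI] by linarith
  show ?thesis
  proof (cases "x + h \<in> {al..be}")
    case True
    show ?thesis
    proof (cases "h = 0")
      case True then show ?thesis using xI by simp
    next
      case False
      define diff where "diff = (\<lambda>m::nat. if m = 0 then f else if m = 1 then f1 else if m = 2 then f2 else f3)"
      have "\<exists>t. (if x + h < x then x + h < t \<and> t < x else x < t \<and> t < x + h) \<and>
        f (x + h) = (\<Sum>m<3. (diff m x / fact m) * (x + h - x)^m) + (diff 3 t / fact 3) * (x + h - x)^3"
      proof (rule Taylor[where a=al and b=be])
        show "\<forall>m t. m < 3 \<and> al \<le> t \<and> t \<le> be \<longrightarrow> DERIV (diff m) t :> diff (Suc m) t"
          using d by (auto simp: diff_def less_Suc_eq numeral_3_eq_3 numeral_2_eq_2)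
      qed (use True False xI in \<open>auto simp: diff_def\<close>)
      then obtain t where t: "(if x + h < x then x + h < t \<and> t < x else x < t \<and> t < x + h)"
        "f (x + h) = (\<Sum>m<3. (diff m x / fact m) * (x + h - x)^m) + (diff 3 t / fact 3) * (x + h - x)^3" by blast
      have tI: "t \<in> {al..be}" using t(1) True xI by (auto split: if_splits)
      have "indicator {al..be} (x + h) * f (x + h) - f x - f1 x * h - f2 x / 2 * h\<^sup>2 = f3 t / 6 * h^3"
        using True unfolding t(2) by (simp add: diff_def eval_nat_numeral)
      moreover have "\<bar>f3 t / 6 * h^3\<bar> \<le> C * \<bar>h\<bar>^3"
        unfolding abs_mult power_abs[symmetric] using C(4)[OF tI] by (intro mult_right_mono) auto
      moreover have "C * \<bar>h\<bar>^3 \<le> C * (1 + 1 / e^3 + 1 / e^2 + 1 / e) * \<bar>h\<bar>^3"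
      proof (intro mult_right_mono)
        have "0 \<le> 1 / e^3" "0 \<le> 1 / e^2" "0 \<le> 1 / e" using e by auto
        then have "C * 1 \<le> C * (1 + 1 / e^3 + 1 / e^2 + 1 / e)" using C0 by (intro mult_left_mono) linarith+
        then show "C \<le> C * (1 + 1 / e^3 + 1 / e^2 + 1 / e)" by simp
      qed simp
      ultimately show ?thesis by linarith
    qed
  next
    case False
    define r where "r = \<bar>h\<bar>"
    have r: "r \<ge> e" using False x by (auto simp: r_def)
    have re: "1 \<le> r / e" using r e by simp
    have r1: "1 \<le> (r / e)^3" using re by simp
    have r2: "r \<le> r^3 / e^2"
    proof -
      have "r * 1 \<le> r * (r / e)^2" using re r e by (intro mult_left_mono) auto
      then show ?thesis by (simp add: power_divide power2_eq_square power3_eq_cube)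
    qed
    have r3: "r^2 \<le> r^3 / e"
    proof -
      have "r^2 * 1 \<le> r^2 * (r / e)" using re by (intro mult_left_mono) auto
      then show ?thesis by (simp add: power2_eq_square power3_eq_cube)
    qed
    have 1: "\<bar>f1 x * h\<bar> \<le> C * r" unfolding abs_mult r_def using C(2)[OF xI] by (intro mult_right_mono) auto
    have 2: "\<bar>f2 x / 2 * h\<^sup>2\<bar> \<le> C * r^2"
      unfolding abs_mult r_def using C(3)[OF xI] C0 by (intro mult_mono) auto
    have i0: "indicator {al..be} (x + h) = (0::real)" using False by simp
    have "\<bar>indicator {al..be} (x + h) * f (x + h) - f x - f1 x * h - f2 x / 2 * h\<^sup>2\<bar> \<le> C * 1 + C * r + C * r^2"
      unfolding i0 using C(1)[OF xI] 1 2 by linarith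
    also have "\<dots> \<le> C * (r / e)^3 + C * (r^3 / e^2) + C * (r^3 / e)"
      using r1 r2 r3 C0 by (intro add_mono mult_left_mono)
    also have "\<dots> \<le> C * r^3 + (C * (r / e)^3 + C * (r^3 / e^2) + C * (r^3 / e))"
    proof -
      have "0 \<le> C * r^3" using C0 r e by auto
      then show ?thesis by linarith
    qed
    also have "\<dots> = C * (1 + 1 / e^3 + 1 / e^2 + 1 / e) * r^3"
      by (simp add: algebra_simps power_divide)
    finally show ?thesis by (simp add: r_def)
  qed
qed

context brownian begin

text \<open>Second-order expansion of one Euler step: the first-order term has mean 0, the
  second-order term yields the generator times \<open>\<delta>\<close>, and the third absolute
  moment of the increment bounds the remainder by order \<open>\<delta> * sqrt \<delta>\<close>,
  which still vanishes after summation over order \<open>1 / \<delta>\<close> steps. The factor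
  \<open>1 - c * \<delta>\<close> discounts the growth rate \<open>c\<close>; its product with the
  second-order term is the error of order \<open>\<delta>\<^sup>2\<close>. The weight
  \<open>w\<close> carries the past, including the indicator that the step is not frozen.\<close>

lemma one_step:
  assumes s: "0 \<le> s" "0 < \<delta>"
    and w: "w \<in> borel_measurable (F (s + real j * \<delta>))" and x: "x \<in> borel_measurable (F (s + real j * \<delta>))"
    and p: "p \<in> borel_measurable (F (s + real j * \<delta>))"
    and W: "\<And>\<omega>. \<bar>w \<omega>\<bar> \<le> W" and C: "\<And>\<omega>. \<bar>p \<omega>\<bar> \<le> C"
    and \<psi>[measurable]: "\<psi>0 \<in> borel_measurable borel" "\<psi>1 \<in> borel_measurable borel" "\<psi>2 \<in> borel_measurable borel"
    and \<psi>C: "\<And>x. \<bar>\<psi>0 x\<bar> \<le> C" "\<And>x. \<bar>\<psi>1 x\<bar> \<le> C" "\<And>x. \<bar>\<psi>2 x\<bar> \<le> C"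
    and taylor: "\<And>\<omega> h. w \<omega> \<noteq> 0 \<Longrightarrow> \<bar>\<psi>0 (x \<omega> + h) - \<psi>0 (x \<omega>) - \<psi>1 (x \<omega>) * h - \<psi>2 (x \<omega>) / 2 * h\<^sup>2\<bar> \<le> C * \<bar>h\<bar>^3"
    and q: "\<bar>c * \<delta>\<bar> \<le> 1"
  shows "\<bar>(\<integral>\<omega>. w \<omega> * ((1 - c * \<delta>) * \<psi>0 (x \<omega> + p \<omega> * binc s \<delta> j \<omega>) - \<psi>0 (x \<omega>)) \<partial>M)
     - \<delta> * (\<integral>\<omega>. w \<omega> * (\<psi>2 (x \<omega>) / 2 * (p \<omega>)\<^sup>2 - c * \<psi>0 (x \<omega>)) \<partial>M)\<bar>
     \<le> 4 * W * C^4 * (\<delta> * sqrt \<delta>) + W * \<bar>c\<bar> * C^3 * \<delta>\<^sup>2"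
proof -
  note t0 = binc_step(1)[OF s, of j]
  let ?d = "binc s \<delta> j"
  have W0: "0 \<le> W" using W[of undefined] by linarith
  have C0: "0 \<le> C" using C[of undefined] by linarith
  note w[measurable] x[measurable] p[measurable]
  have [measurable]: "w \<in> borel_measurable M" "x \<in> borel_measurable M" "p \<in> borel_measurable M"
    using F_M[OF w t0] F_M[OF x t0] F_M[OF p t0] by auto
  have [measurable]: "?d \<in> borel_measurable M"
    by (rule F_M[OF binc_meas[OF s]]) (use binc_step[OF s, of "Suc j"] in auto)
  have bi: "integrable M f" if "f \<in> borel_measurable M" "\<And>\<omega>. \<bar>f \<omega>\<bar> \<le> K" for f :: "'a \<Rightarrow> real" and K
    using that by (intro integrable_const_bound[where B=K]) auto
  define g1 where "g1 = (\<lambda>\<omega>. w \<omega> * (\<psi>1 (x \<omega>) * p \<omega>))"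
  define g2 where "g2 = (\<lambda>\<omega>. w \<omega> * (\<psi>2 (x \<omega>) / 2 * (p \<omega>)\<^sup>2))"
  define g0 where "g0 = (\<lambda>\<omega>. w \<omega> * \<psi>0 (x \<omega>))"
  define g3 where "g3 = (\<lambda>\<omega>. w \<omega> * ((1 - c * \<delta>) * \<psi>0 (x \<omega> + p \<omega> * ?d \<omega>) - \<psi>0 (x \<omega>)))"
  have g1F: "g1 \<in> borel_measurable (F (s + real j * \<delta>))" unfolding g1_def by measurable
  have g2F: "g2 \<in> borel_measurable (F (s + real j * \<delta>))" unfolding g2_def by measurable
  have [measurable]: "g0 \<in> borel_measurable M" "g1 \<in> borel_measurable M" "g2 \<in> borel_measurable M" "g3 \<in> borel_measurable M"
    unfolding g0_def g1_def g2_def g3_def by measurable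
  have b1: "\<bar>g1 \<omega>\<bar> \<le> W * (C * C)" for \<omega>
    unfolding g1_def abs_mult using W C \<psi>C W0 C0 by (intro mult_mono) auto
  have b2: "\<bar>g2 \<omega>\<bar> \<le> W * (C * C\<^sup>2)" for \<omega>
  proof -
    have "\<bar>\<psi>2 (x \<omega>) / 2\<bar> \<le> C" using \<psi>C(3)[of "x \<omega>"] C0 by simp
    moreover have "\<bar>(p \<omega>)\<^sup>2\<bar> \<le> C\<^sup>2" unfolding power_abs using C by (intro power_mono) auto
    ultimately show ?thesis unfolding g2_def abs_mult[of "w \<omega>"] abs_mult[of "_ / 2"]
      using W W0 C0 by (intro mult_mono) auto
  qed
  have b0: "\<bar>g0 \<omega>\<bar> \<le> W * C" for \<omega>
    unfolding g0_def abs_mult using W \<psi>C W0 by (intro mult_mono) auto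
  have b3: "\<bar>g3 \<omega>\<bar> \<le> W * (2 * C + C)" for \<omega>
  proof -
    have "\<bar>(1 - c * \<delta>) * \<psi>0 (x \<omega> + p \<omega> * ?d \<omega>)\<bar> \<le> 2 * C"
      unfolding abs_mult using q \<psi>C(1) by (intro mult_mono) auto
    then have "\<bar>(1 - c * \<delta>) * \<psi>0 (x \<omega> + p \<omega> * ?d \<omega>) - \<psi>0 (x \<omega>)\<bar> \<le> 2 * C + C"
      using \<psi>C(1)[of "x \<omega>"] by linarith
    then show ?thesis unfolding g3_def abs_mult[of "w \<omega>"] using W W0 by (intro mult_mono) auto
  qed
  have i0: "integrable M g0" and i1: "integrable M g1" and i2: "integrable M g2" and i3: "integrable M g3"
    using bi[of g0, OF _ b0] bi[of g1, OF _ b1] bi[of g2, OF _ b2] bi[of g3, OF _ b3] by auto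
  have m1: "integrable M (\<lambda>\<omega>. g1 \<omega> * ?d \<omega>)" using binc_mult(1)[OF s g1F i1, of 1] by simp
  have m2: "integrable M (\<lambda>\<omega>. g2 \<omega> * ?d \<omega> ^ 2)" by (rule binc_mult(1)[OF s g2F i2])
  have e1: "(\<integral>\<omega>. g1 \<omega> * ?d \<omega> \<partial>M) = 0" by (rule binc_mult(2)[OF s g1F i1])
  have e2: "(\<integral>\<omega>. g2 \<omega> * ?d \<omega> ^ 2 \<partial>M) = (\<integral>\<omega>. g2 \<omega> \<partial>M) * \<delta>" by (rule binc_mult(3)[OF s g2F i2])
  \<comment> \<open>Regrouping gives \<open>w * (1 - c * \<delta>)\<close> times the Taylor
    remainder of \<open>\<psi>0\<close>; written this way, the mean of every term but
    \<open>R\<close> itself is known.\<close>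
  define R where "R = (\<lambda>\<omega>. g3 \<omega> + c * \<delta> * g0 \<omega> - (1 - c * \<delta>) * (g1 \<omega> * ?d \<omega> + g2 \<omega> * ?d \<omega> ^ 2))"
  have iR: "integrable M R"
    unfolding R_def by (intro Bochner_Integration.integrable_diff Bochner_Integration.integrable_add integrable_mult_right i3 i0 m1 m2)
  have "(\<integral>\<omega>. R \<omega> \<partial>M) = (\<integral>\<omega>. g3 \<omega> \<partial>M) + c * \<delta> * (\<integral>\<omega>. g0 \<omega> \<partial>M) - (1 - c * \<delta>) * ((\<integral>\<omega>. g1 \<omega> * ?d \<omega> \<partial>M) + (\<integral>\<omega>. g2 \<omega> * ?d \<omega> ^ 2 \<partial>M))"
    unfolding R_def using i3 i0 m1 m2 by simp
  then have ER: "(\<integral>\<omega>. g3 \<omega> \<partial>M) = (\<integral>\<omega>. R \<omega> \<partial>M) - c * \<delta> * (\<integral>\<omega>. g0 \<omega> \<partial>M) + (1 - c * \<delta>) * ((\<integral>\<omega>. g2 \<omega> \<partial>M) * \<delta>)"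
    unfolding e1 e2 add_0_left by linarith
  have E2: "(\<integral>\<omega>. w \<omega> * (\<psi>2 (x \<omega>) / 2 * (p \<omega>)\<^sup>2 - c * \<psi>0 (x \<omega>)) \<partial>M) = (\<integral>\<omega>. g2 \<omega> \<partial>M) - c * (\<integral>\<omega>. g0 \<omega> \<partial>M)"
  proof -
    have "(\<lambda>\<omega>. w \<omega> * (\<psi>2 (x \<omega>) / 2 * (p \<omega>)\<^sup>2 - c * \<psi>0 (x \<omega>))) = (\<lambda>\<omega>. g2 \<omega> - c * g0 \<omega>)"
      unfolding g2_def g0_def by (rule ext) (simp only: right_diff_distrib mult.left_commute)
    then show ?thesis using i2 i0 by simp
  qed
  have Rb: "\<bar>R \<omega>\<bar> \<le> 2 * W * C^4 * \<bar>?d \<omega>\<bar>^3" for \<omega>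
  proof (cases "w \<omega> = 0")
    case True
    then show ?thesis using W0 C0 by (simp add: R_def g0_def g1_def g2_def g3_def)
  next
    case False
    let ?h = "p \<omega> * ?d \<omega>"
    let ?T = "\<psi>0 (x \<omega> + ?h) - \<psi>0 (x \<omega>) - \<psi>1 (x \<omega>) * ?h - \<psi>2 (x \<omega>) / 2 * ?h\<^sup>2"
    have r1: "R \<omega> = (w \<omega> * (1 - c * \<delta>)) * ?T"
      unfolding R_def g0_def g1_def g2_def g3_def by (simp add: algebra_simps power_mult_distrib)
    have r2: "\<bar>?T\<bar> \<le> C * (C^3 * \<bar>?d \<omega>\<bar>^3)"
    proof -
      have "\<bar>?h\<bar>^3 \<le> C^3 * \<bar>?d \<omega>\<bar>^3"
        unfolding abs_mult power_mult_distrib using C by (intro mult_right_mono power_mono) auto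
      then show ?thesis using taylor[OF False, of ?h] C0 by (meson mult_left_mono order_trans)
    qed
    have r3: "\<bar>w \<omega> * (1 - c * \<delta>)\<bar> \<le> W * 2" unfolding abs_mult using W q W0 by (intro mult_mono) auto
    have "\<bar>R \<omega>\<bar> \<le> (W * 2) * (C * (C^3 * \<bar>?d \<omega>\<bar>^3))"
      unfolding r1 abs_mult[of "w \<omega> * (1 - c * \<delta>)" ?T] by (rule mult_mono[OF r3 r2]) (use W0 in auto)
    then show ?thesis by (simp add: mult_ac eval_nat_numeral)
  qed
  have ab3: "integrable M (\<lambda>\<omega>. \<bar>?d \<omega>\<bar>^3)" "(\<integral>\<omega>. \<bar>?d \<omega>\<bar>^3 \<partial>M) \<le> 2 * (sqrt \<delta>)^3"
    using inc_abs_int[OF binc_step(1,2)[OF s], of j 3] inc_abs3[OF binc_step(1,2)[OF s], of j]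
    unfolding binc_step(4)[OF s] by (auto simp: binc_def)
  have "\<bar>\<integral>\<omega>. R \<omega> \<partial>M\<bar> \<le> (\<integral>\<omega>. \<bar>R \<omega>\<bar> \<partial>M)" by (rule integral_abs_bound)
  also have "\<dots> \<le> (\<integral>\<omega>. 2 * W * C^4 * \<bar>?d \<omega>\<bar>^3 \<partial>M)"
    using iR ab3 Rb by (intro integral_mono) auto
  also have "\<dots> = 2 * W * C^4 * (\<integral>\<omega>. \<bar>?d \<omega>\<bar>^3 \<partial>M)" by simp
  also have "\<dots> \<le> 2 * W * C^4 * (2 * (sqrt \<delta>)^3)"
    using ab3 W0 C0 by (intro mult_left_mono) auto
  also have "\<dots> = 4 * W * C^4 * (\<delta> * sqrt \<delta>)" using s by (simp add: power3_eq_cube)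
  finally have R1: "\<bar>\<integral>\<omega>. R \<omega> \<partial>M\<bar> \<le> 4 * W * C^4 * (\<delta> * sqrt \<delta>)" .
  have "\<bar>\<integral>\<omega>. g2 \<omega> \<partial>M\<bar> \<le> (\<integral>\<omega>. \<bar>g2 \<omega>\<bar> \<partial>M)" by (rule integral_abs_bound)
  also have "\<dots> \<le> (\<integral>\<omega>. W * (C * C\<^sup>2) \<partial>M)" using i2 b2 by (intro integral_mono) auto
  also have "\<dots> = W * C^3" by (simp add: prob_space power2_eq_square power3_eq_cube)
  finally have "\<bar>c * \<delta>\<^sup>2 * (\<integral>\<omega>. g2 \<omega> \<partial>M)\<bar> \<le> (\<bar>c\<bar> * \<delta>\<^sup>2) * (W * C^3)"
    unfolding abs_mult by (intro mult_mono) auto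
  then have R2: "\<bar>c * \<delta>\<^sup>2 * (\<integral>\<omega>. g2 \<omega> \<partial>M)\<bar> \<le> W * \<bar>c\<bar> * C^3 * \<delta>\<^sup>2" by (simp add: mult_ac)
  have "(\<integral>\<omega>. g3 \<omega> \<partial>M) - \<delta> * ((\<integral>\<omega>. g2 \<omega> \<partial>M) - c * (\<integral>\<omega>. g0 \<omega> \<partial>M)) = (\<integral>\<omega>. R \<omega> \<partial>M) - c * \<delta>\<^sup>2 * (\<integral>\<omega>. g2 \<omega> \<partial>M)"
    unfolding ER by (simp add: algebra_simps power2_eq_square)
  then show ?thesis unfolding E2 using R1 R2 unfolding g3_def by linarith
qed

end

lemma abs_le_add_diff:
  fixes x y :: real
  assumes "\<bar>x\<bar> \<le> p" "\<bar>y - x\<bar> \<le> q" shows "\<bar>y\<bar> \<le> p + q"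
  using assms by linarith

context brownian begin

lemma integrable_ind[simp]: "H \<in> events \<Longrightarrow> integrable M (indicator H :: 'a \<Rightarrow> real)"
  by (rule integrable_const_bound[where B=1]) auto

lemma msum_stopped:
  assumes "k \<le> n" "\<And>j. j < k \<Longrightarrow> g' j \<omega> = g j \<omega>" "\<And>j. k \<le> j \<Longrightarrow> j < n \<Longrightarrow> g' j \<omega> = 0"
  shows "msum s \<delta> g' n \<omega> = msum s \<delta> g k \<omega>"
  unfolding msum_def
  by (rule sum.mono_neutral_cong_right) (use assms in auto)

end

text \<open>The last assumption says that \<open>\<phi>\<close> is an eigenfunction of the generator
  \<open>P^2 / 2 * d^2/dy^2\<close>, so that \<open>exp (- c * t) * \<phi> (Y t)\<close> should be a
  local martingale up to the exit from \<open>I\<close>. The third derivative serves the Taylor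
  remainder and the Lipschitz bound of \<open>\<phi>2\<close>.\<close>

locale sde_test = sde M F B P y0 Y for M :: "'a measure" and F B P y0 Y +
  fixes \<phi> \<phi>1 \<phi>2 \<phi>3 :: "real \<Rightarrow> real" and I :: "real set" and c :: real
  assumes I: "open I"
    and d1: "\<And>x. x \<in> I \<Longrightarrow> (\<phi> has_real_derivative \<phi>1 x) (at x)"
    and d2: "\<And>x. x \<in> I \<Longrightarrow> (\<phi>1 has_real_derivative \<phi>2 x) (at x)"
    and d3: "\<And>x. x \<in> I \<Longrightarrow> (\<phi>2 has_real_derivative \<phi>3 x) (at x)"
    and c3: "continuous_on I \<phi>3"
    and eigen: "\<And>x. x \<in> I \<Longrightarrow> \<phi>2 x / 2 * (P x)\<^sup>2 = c * \<phi> x"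
begin

lemma cont_phi: "continuous_on I \<phi>" "continuous_on I \<phi>1" "continuous_on I \<phi>2"
  using d1 d2 d3 by (auto intro!: continuous_at_imp_continuous_on DERIV_isCont)

text \<open>The margin is \<open>2 * h\<close> because the Riemann sum may sit up to
  \<open>h\<close> outside \<open>{a..b}\<close> and the Taylor estimate needs another
  \<open>h\<close> around such a point. One constant \<open>C\<close> dominates all bounds, which
  keeps the later error terms short.\<close>

lemma constants:
  assumes ab: "a \<le> b" "{a..b} \<subseteq> I"
  obtains h C :: real where "h > 0" "C > 0" "{a - 2 * h..b + 2 * h} \<subseteq> I"
    "\<And>x. x \<in> {a - 2 * h..b + 2 * h} \<Longrightarrow> \<bar>\<phi> x\<bar> \<le> C"
    "\<And>x. x \<in> {a - 2 * h..b + 2 * h} \<Longrightarrow> \<bar>\<phi>1 x\<bar> \<le> C"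
    "\<And>x. x \<in> {a - 2 * h..b + 2 * h} \<Longrightarrow> \<bar>\<phi>2 x\<bar> \<le> C"
    "\<And>x y. x \<in> {a - 2 * h..b + 2 * h} \<Longrightarrow> y \<in> {a - 2 * h..b + 2 * h} \<Longrightarrow> \<bar>\<phi> x - \<phi> y\<bar> \<le> C * \<bar>x - y\<bar>"
    "\<And>x y. x \<in> {a - 2 * h..b + 2 * h} \<Longrightarrow> y \<in> {a - 2 * h..b + 2 * h} \<Longrightarrow> \<bar>\<phi>2 x - \<phi>2 y\<bar> \<le> C * \<bar>x - y\<bar>"
    "\<And>x. x \<in> {a..b} \<Longrightarrow> \<bar>P x\<bar> \<le> C"
    "\<And>x t. x \<in> {a - h..b + h} \<Longrightarrow> \<bar>indicator {a - 2 * h..b + 2 * h} (x + t) * \<phi> (x + t) - \<phi> x - \<phi>1 x * t - \<phi>2 x / 2 * t\<^sup>2\<bar> \<le> C * \<bar>t\<bar>^3"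
proof -
  have "a \<in> I" "b \<in> I" using ab by auto
  obtain ea where ea: "ea > 0" "cball a ea \<subseteq> I" using I \<open>a \<in> I\<close> open_contains_cball by blast
  obtain eb where eb: "eb > 0" "cball b eb \<subseteq> I" using I \<open>b \<in> I\<close> open_contains_cball by blast
  define h where "h = min ea eb / 2"
  have h: "h > 0" using ea eb by (auto simp: h_def)
  let ?S = "{a - 2 * h..b + 2 * h}"
  have S: "?S \<subseteq> I"
  proof
    fix x assume x: "x \<in> ?S"
    consider "x \<in> {a..b}" | "x \<in> cball a ea" | "x \<in> cball b eb"
      using x by (auto simp: h_def dist_real_def) linarith
    then show "x \<in> I" using ab ea eb by cases auto
  qed
  have cp: "compact ?S" by simp
  obtain C0 where C0: "C0 > 0" "\<And>x. x \<in> ?S \<Longrightarrow> \<bar>\<phi> x\<bar> \<le> C0"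
    using compact_bound_real[OF continuous_on_subset[OF cont_phi(1) S] cp] by blast
  obtain C1 where C1: "C1 > 0" "\<And>x. x \<in> ?S \<Longrightarrow> \<bar>\<phi>1 x\<bar> \<le> C1"
    using compact_bound_real[OF continuous_on_subset[OF cont_phi(2) S] cp] by blast
  obtain C2 where C2: "C2 > 0" "\<And>x. x \<in> ?S \<Longrightarrow> \<bar>\<phi>2 x\<bar> \<le> C2"
    using compact_bound_real[OF continuous_on_subset[OF cont_phi(3) S] cp] by blast
  obtain C3 where C3: "C3 > 0" "\<And>x. x \<in> ?S \<Longrightarrow> \<bar>\<phi>3 x\<bar> \<le> C3"
    using compact_bound_real[OF continuous_on_subset[OF c3 S] cp] by blast
  obtain C4 where C4: "C4 > 0" "\<And>x. x \<in> {a..b} \<Longrightarrow> \<bar>P x\<bar> \<le> C4"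
    using compact_bound_real[OF continuous_on_subset[OF Pc subset_UNIV] compact_Icc] by blast
  define C' where "C' = C0 + C1 + C2 + C3 + C4"
  have C': "C0 \<le> C'" "C1 \<le> C'" "C2 \<le> C'" "C3 \<le> C'" "C4 \<le> C'" "C' > 0"
    using C0 C1 C2 C3 C4 by (auto simp: C'_def)
  define k where "k = 1 + 1 / h^3 + 1 / h^2 + 1 / h"
  have k: "1 \<le> k"
  proof -
    have "0 \<le> 1 / h^3" "0 \<le> 1 / h^2" "0 \<le> 1 / h" using h by auto
    then show ?thesis unfolding k_def by linarith
  qed
  define C where "C = C' * k"
  have "C' * 1 \<le> C" unfolding C_def using C' k by (intro mult_left_mono) auto
  then have CC: "C' \<le> C" by simp
  have Cpos: "0 < C" using CC C'(6) by linarith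
  have up: "0 \<le> t \<Longrightarrow> C' * t \<le> C * t" for t using CC by (rule mult_right_mono)
  have b0: "\<And>x. x \<in> ?S \<Longrightarrow> \<bar>\<phi> x\<bar> \<le> C'" using C0(2) C' order_trans by blast
  have b1: "\<And>x. x \<in> ?S \<Longrightarrow> \<bar>\<phi>1 x\<bar> \<le> C'" using C1(2) C' order_trans by blast
  have b2: "\<And>x. x \<in> ?S \<Longrightarrow> \<bar>\<phi>2 x\<bar> \<le> C'" using C2(2) C' order_trans by blast
  have b3: "\<And>x. x \<in> ?S \<Longrightarrow> \<bar>\<phi>3 x\<bar> \<le> C'" using C3(2) C' order_trans by blast
  have b4: "\<And>x. x \<in> {a..b} \<Longrightarrow> \<bar>P x\<bar> \<le> C'" using C4(2) C' order_trans by blast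
  have D1: "x \<in> ?S \<Longrightarrow> (\<phi> has_real_derivative \<phi>1 x) (at x)" for x using d1 S by blast
  have D2: "x \<in> ?S \<Longrightarrow> (\<phi>1 has_real_derivative \<phi>2 x) (at x)" for x using d2 S by blast
  have D3: "x \<in> ?S \<Longrightarrow> (\<phi>2 has_real_derivative \<phi>3 x) (at x)" for x using d3 S by blast
  show ?thesis
  proof (rule that[of h C])
    show "\<bar>\<phi> x - \<phi> y\<bar> \<le> C * \<bar>x - y\<bar>" if "x \<in> ?S" "y \<in> ?S" for x y
      using order_trans[OF lipschitz_from_deriv[OF D1 b1 that] up[of "\<bar>x - y\<bar>"]] by simp
    show "\<bar>\<phi>2 x - \<phi>2 y\<bar> \<le> C * \<bar>x - y\<bar>" if "x \<in> ?S" "y \<in> ?S" for x y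
      using order_trans[OF lipschitz_from_deriv[OF D3 b3 that] up[of "\<bar>x - y\<bar>"]] by simp
    show "\<bar>indicator ?S (x + t) * \<phi> (x + t) - \<phi> x - \<phi>1 x * t - \<phi>2 x / 2 * t\<^sup>2\<bar> \<le> C * \<bar>t\<bar>^3"
      if "x \<in> {a - h..b + h}" for x t
    proof -
      have "x \<in> {a - 2 * h + h..b + 2 * h - h}" using that by auto
      from taylor_cubic_bound[OF D1 D2 D3 b0 b1 b2 b3 h this]
      show ?thesis unfolding C_def k_def .
    qed
  qed (use h S Cpos b0 b1 b2 b4 order_trans[OF _ CC] in auto)
qed

end

section \<open>The discretised Dynkin formula on one grid and one compact interval\<close>

locale dynkin_grid = sde_test M F B P y0 Y \<phi> \<phi>1 \<phi>2 \<phi>3 I c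
  for M :: "'a measure" and F B P y0 Y \<phi> \<phi>1 \<phi>2 \<phi>3 I c +
  fixes a b h C s u :: real and A :: "'a set"
  assumes ab: "a \<le> b" and h: "h > 0" and C: "C > 0" and SI: "{a - 2 * h..b + 2 * h} \<subseteq> I"
   and p0: "\<And>x. x \<in> {a - 2 * h..b + 2 * h} \<Longrightarrow> \<bar>\<phi> x\<bar> \<le> C"
   and p1: "\<And>x. x \<in> {a - 2 * h..b + 2 * h} \<Longrightarrow> \<bar>\<phi>1 x\<bar> \<le> C"
   and p2: "\<And>x. x \<in> {a - 2 * h..b + 2 * h} \<Longrightarrow> \<bar>\<phi>2 x\<bar> \<le> C"
   and l0: "\<And>x y. x \<in> {a - 2 * h..b + 2 * h} \<Longrightarrow> y \<in> {a - 2 * h..b + 2 * h} \<Longrightarrow> \<bar>\<phi> x - \<phi> y\<bar> \<le> C * \<bar>x - y\<bar>"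
   and l2: "\<And>x y. x \<in> {a - 2 * h..b + 2 * h} \<Longrightarrow> y \<in> {a - 2 * h..b + 2 * h} \<Longrightarrow> \<bar>\<phi>2 x - \<phi>2 y\<bar> \<le> C * \<bar>x - y\<bar>"
   and PC: "\<And>x. x \<in> {a..b} \<Longrightarrow> \<bar>P x\<bar> \<le> C"
   and taylor: "\<And>x t. x \<in> {a - h..b + h} \<Longrightarrow> \<bar>indicator {a - 2 * h..b + 2 * h} (x + t) * \<phi> (x + t) - \<phi> x - \<phi>1 x * t - \<phi>2 x / 2 * t\<^sup>2\<bar> \<le> C * \<bar>t\<bar>^3"
   and s: "0 \<le> s" and u: "0 < u" and A: "A \<in> sets (F s)" and AY: "\<And>\<omega>. \<omega> \<in> A \<Longrightarrow> Y s \<omega> \<in> {a..b}"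
begin

abbreviation "S \<equiv> {a - 2 * h..b + 2 * h}"
text \<open>The cut-off makes the test functions globally bounded, as the Riemann sum may jump
  anywhere in a single step.\<close>

definition "\<psi>0 x = indicator S x * \<phi> x"
definition "\<psi>1 x = indicator S x * \<phi>1 x"
definition "\<psi>2 x = indicator S x * \<phi>2 x"

lemma psi_meas[measurable]: "\<psi>0 \<in> borel_measurable borel" "\<psi>1 \<in> borel_measurable borel" "\<psi>2 \<in> borel_measurable borel"
proof -
  have "(\<lambda>x. indicator S x *\<^sub>R f x) \<in> borel_measurable borel" if "continuous_on I f" for f :: "real \<Rightarrow> real"
    by (rule borel_measurable_continuous_on_indicator[OF _ continuous_on_subset[OF that SI]]) simp
  from this[OF cont_phi(1)] this[OF cont_phi(2)] this[OF cont_phi(3)]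
  show "\<psi>0 \<in> borel_measurable borel" "\<psi>1 \<in> borel_measurable borel" "\<psi>2 \<in> borel_measurable borel"
    unfolding \<psi>0_def \<psi>1_def \<psi>2_def by simp_all
qed

lemma psi_bound: "\<bar>\<psi>0 x\<bar> \<le> C" "\<bar>\<psi>1 x\<bar> \<le> C" "\<bar>\<psi>2 x\<bar> \<le> C"
  using p0[of x] p1[of x] p2[of x] C by (cases "x \<in> S"; simp add: \<psi>0_def \<psi>1_def \<psi>2_def)+

lemma psi_eq: "x \<in> S \<Longrightarrow> \<psi>0 x = \<phi> x" "x \<in> S \<Longrightarrow> \<psi>1 x = \<phi>1 x" "x \<in> S \<Longrightarrow> \<psi>2 x = \<phi>2 x"
  by (auto simp: \<psi>0_def \<psi>1_def \<psi>2_def)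

text \<open>\<open>VV\<close> is the Riemann sum of the equation, frozen once \<open>Y\<close> has left \<open>{a..b}\<close> or the sum has drifted from
  \<open>Y\<close> by more than \<open>\<eta>\<close>; \<open>DD\<close> is the discrete counterpart of \<open>exp (- c t)\<close>, frozen at the same time.\<close>

definition "gp N j = s + real j * (u / real N)"
definition "GG \<eta> N k = {\<omega>\<in>space M. \<forall>j\<in>{..k}. Y (gp N j) \<omega> \<in> {a..b} \<and> \<bar>usum s (u / real N) j \<omega> - Y (gp N j) \<omega>\<bar> \<le> \<eta>}"
definition "gg \<eta> N j \<omega> = indicator (GG \<eta> N j) \<omega> * P (Y (gp N j) \<omega>)"
definition "VV \<eta> N k \<omega> = Y s \<omega> + msum s (u / real N) (gg \<eta> N) k \<omega>"
definition "DD \<eta> N k \<omega> = (\<Prod>j<k. 1 - c * (u / real N) * indicator (GG \<eta> N j) \<omega>)"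
definition "XX \<eta> N k \<omega> = indicator A \<omega> * DD \<eta> N k \<omega> * \<psi>0 (VV \<eta> N k \<omega>)"

text \<open>The three outcomes on the grid: no exit, or a first exit through the lower or through
  the upper end. \<open>JJ\<close> collects the paths with a large grid increment, for which the
  exit value need not be close to the end that was crossed. At \<open>k = 0\<close> truncated
  subtraction makes the increment 0.\<close>

definition "GS N = {\<omega>\<in>space M. \<forall>k\<in>{..N}. Y (gp N k) \<omega> \<in> {a..b}}"
definition "EA N = {\<omega>\<in>space M. \<exists>k\<in>{..N}. Y (gp N k) \<omega> < a \<and> (\<forall>j\<in>{..<k}. Y (gp N j) \<omega> \<in> {a..b})}"
definition "EB N = {\<omega>\<in>space M. \<exists>k\<in>{..N}. Y (gp N k) \<omega> > b \<and> (\<forall>j\<in>{..<k}. Y (gp N j) \<omega> \<in> {a..b})}"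
definition "JJ \<eta> N = {\<omega>\<in>space M. \<exists>k\<in>{..N}. \<bar>Y (gp N k) \<omega> - Y (gp N (k - 1)) \<omega>\<bar> > \<eta>}"

definition "Dm = exp (\<bar>c\<bar> * u)"

lemma Dm1: "1 \<le> Dm" using u by (simp add: Dm_def)

context
  fixes N :: nat and \<eta> :: real
  assumes N: "N > 0" and \<eta>: "0 < \<eta>" "\<eta> \<le> h" and cN: "\<bar>c\<bar> * (u / real N) \<le> 1"
begin

abbreviation "\<delta> \<equiv> u / real N"

lemma \<delta>: "0 < \<delta>" using u N by simp

lemma gp0: "0 \<le> gp N j" using s u by (simp add: gp_def)

lemma gp_mono: "i \<le> j \<Longrightarrow> gp N i \<le> gp N j"
  using mult_right_mono[of "real i" "real j" \<delta>] \<delta> by (simp add: gp_def)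

lemma usum_gp: "usum s \<delta> j \<in> borel_measurable (F (gp N j))"
  using usum_F[OF s \<delta>] by (simp add: gp_def)

lemma GG_F: "GG \<eta> N k \<in> sets (F (gp N k))"
  unfolding GG_def space_F[OF gp0, of k, symmetric]
proof (rule sets.sets_Collect_finite_All)
  fix j assume "j \<in> {..k}"
  then have le: "gp N j \<le> gp N k" by (intro gp_mono) auto
  have [measurable]: "usum s \<delta> j \<in> borel_measurable (F (gp N k))"
    by (rule F_mono[OF usum_gp gp0 le])
  have [measurable]: "Y (gp N j) \<in> borel_measurable (F (gp N k))"
    by (rule F_mono[OF Y_meas[OF gp0] gp0 le])
  show "{\<omega> \<in> space (F (gp N k)). Y (gp N j) \<omega> \<in> {a..b} \<and> \<bar>usum s \<delta> j \<omega> - Y (gp N j) \<omega>\<bar> \<le> \<eta>} \<in> sets (F (gp N k))"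
    by measurable
qed simp

lemma GG_M[measurable]: "GG \<eta> N k \<in> events" by (rule F_sets_M[OF GG_F gp0])

lemma A_F: "A \<in> sets (F (gp N k))"
  by (rule F_sets_mono[OF A s]) (use u in \<open>simp add: gp_def\<close>)

lemma A_M[measurable]: "A \<in> events" by (rule F_sets_M[OF A s])

lemma GG_anti: "i \<le> j \<Longrightarrow> GG \<eta> N j \<subseteq> GG \<eta> N i"
  unfolding GG_def by auto

lemma gg_F: "gg \<eta> N j \<in> borel_measurable (F (gp N j))"
proof -
  have "(\<lambda>\<omega>. P (Y (gp N j) \<omega>)) \<in> borel_measurable (F (gp N j))"
    by (rule measurable_compose[OF Y_meas[OF gp0] P_meas])
  then show ?thesis unfolding gg_def using GG_F by (intro borel_measurable_times borel_measurable_indicator)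
qed

lemma gg_C: "\<bar>gg \<eta> N j \<omega>\<bar> \<le> C"
  using PC[of "Y (gp N j) \<omega>"] C by (auto simp: gg_def indicator_def GG_def)

lemma VV_F: "VV \<eta> N k \<in> borel_measurable (F (gp N k))"
proof -
  have "msum s \<delta> (gg \<eta> N) k \<in> borel_measurable (F (s + real k * \<delta>))"
    by (rule msum_meas[OF s \<delta>]) (use gg_F in \<open>simp add: gp_def\<close>)
  moreover have "Y s \<in> borel_measurable (F (gp N k))"
    by (rule F_mono[OF Y_meas[OF s] s]) (use u in \<open>simp add: gp_def\<close>)
  ultimately show ?thesis unfolding VV_def gp_def by (intro borel_measurable_add)
qed

lemma DD_F: "DD \<eta> N k \<in> borel_measurable (F (gp N k))"
  unfolding DD_def
proof (intro borel_measurable_prod borel_measurable_diff borel_measurable_times borel_measurable_const borel_measurable_indicator)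
  fix j assume "j \<in> {..<k}"
  then show "GG \<eta> N j \<in> sets (F (gp N k))"
    by (intro F_sets_mono[OF GG_F gp0] gp_mono) auto
qed

lemma cd: "\<bar>c * \<delta>\<bar> \<le> 1" using cN u by (simp add: abs_mult)

lemma fac: "0 \<le> 1 - c * \<delta> * indicator H \<omega>" "1 - c * \<delta> * indicator H \<omega> \<le> 1 + \<bar>c\<bar> * \<delta>"
proof -
  have "\<bar>c * \<delta> * indicator H \<omega>\<bar> \<le> \<bar>c\<bar> * \<delta>" using \<delta> u by (auto simp: indicator_def abs_mult)
  then show "0 \<le> 1 - c * \<delta> * indicator H \<omega>" "1 - c * \<delta> * indicator H \<omega> \<le> 1 + \<bar>c\<bar> * \<delta>"
    using cN by linarith+
qed

lemma DD_bound: assumes "k \<le> N" shows "0 \<le> DD \<eta> N k \<omega>" "DD \<eta> N k \<omega> \<le> Dm"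
proof -
  show "0 \<le> DD \<eta> N k \<omega>" unfolding DD_def using fac by (intro prod_nonneg) auto
  have "DD \<eta> N k \<omega> \<le> (\<Prod>j<k. 1 + \<bar>c\<bar> * \<delta>)" unfolding DD_def using fac by (intro prod_mono) auto
  also have "\<dots> = (1 + \<bar>c\<bar> * \<delta>)^k" by simp
  also have "\<dots> \<le> exp (\<bar>c\<bar> * \<delta>)^k" using u by (intro power_mono exp_ge_add_one_self) auto
  also have "\<dots> = exp (real k * (\<bar>c\<bar> * \<delta>))" by (simp only: exp_of_nat_mult)
  also have "\<dots> \<le> exp (real N * (\<bar>c\<bar> * \<delta>))" using assms u by (simp only: exp_le_cancel_iff) (intro mult_right_mono, auto)
  also have "real N * (\<bar>c\<bar> * \<delta>) = \<bar>c\<bar> * u" using N by simp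
  finally show "DD \<eta> N k \<omega> \<le> Dm" by (simp add: Dm_def)
qed

lemma GG_lt: "\<omega> \<in> GG \<eta> N k \<Longrightarrow> VV \<eta> N k \<omega> = usum s \<delta> k \<omega>"
proof -
  assume w: "\<omega> \<in> GG \<eta> N k"
  have "gg \<eta> N j \<omega> = P (Y (s + real j * \<delta>) \<omega>)" if "j < k" for j
  proof -
    have "\<omega> \<in> GG \<eta> N j" using w GG_anti[of j k] that by auto
    then show ?thesis by (simp add: gg_def gp_def)
  qed
  then have "msum s \<delta> (gg \<eta> N) k \<omega> = msum s \<delta> (\<lambda>j \<omega>. P (Y (s + real j * \<delta>) \<omega>)) k \<omega>"
    unfolding msum_def by (intro sum.cong) auto
  then show ?thesis by (simp add: VV_def usum_def)
qed

lemma GG_near: "\<omega> \<in> GG \<eta> N k \<Longrightarrow> Y (gp N k) \<omega> \<in> {a..b} \<and> \<bar>VV \<eta> N k \<omega> - Y (gp N k) \<omega>\<bar> \<le> \<eta>"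
  using GG_lt by (auto simp: GG_def)

text \<open>The error of one grid step. The term of order \<open>\<eta> * \<delta>\<close> arises
  because the eigenvalue equation is applied at \<open>Y\<close> while the test function is
  evaluated at \<open>VV\<close>; the other two come from \<open>one_step\<close>. After
  \<open>N\<close> steps the first one adds up to order \<open>\<eta>\<close>, the others vanish
  with the mesh.\<close>

definition "rate = Dm * ((C^3 + \<bar>c\<bar> * C) * \<eta> * \<delta> + 4 * C^4 * (\<delta> * sqrt \<delta>) + \<bar>c\<bar> * C^3 * \<delta>\<^sup>2)"

lemma XX_int: "k \<le> N \<Longrightarrow> integrable M (XX \<eta> N k)"
proof (rule integrable_const_bound[where B="1 * Dm * C"])
  assume k: "k \<le> N"
  have [measurable]: "DD \<eta> N k \<in> borel_measurable M" by (rule F_M[OF DD_F gp0])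
  have [measurable]: "VV \<eta> N k \<in> borel_measurable M" by (rule F_M[OF VV_F gp0])
  show "XX \<eta> N k \<in> borel_measurable M" unfolding XX_def by measurable
  show "AE \<omega> in M. norm (XX \<eta> N k \<omega>) \<le> 1 * Dm * C"
    unfolding XX_def real_norm_def abs_mult using DD_bound[OF k] psi_bound C Dm1
    by (intro AE_I2 mult_mono) (auto simp: indicator_def)
qed

lemma XX_step:
  assumes k: "k < N"
  shows "\<bar>(\<integral>\<omega>. XX \<eta> N (Suc k) \<omega> \<partial>M) - (\<integral>\<omega>. XX \<eta> N k \<omega> \<partial>M)\<bar> \<le> rate"
proof -
  define w where "w = (\<lambda>\<omega>. indicator A \<omega> * DD \<eta> N k \<omega> * indicator (GG \<eta> N k) \<omega> :: real)"
  let ?x = "VV \<eta> N k" let ?p = "gg \<eta> N k"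
  have DDm[measurable]: "DD \<eta> N k \<in> borel_measurable (F (gp N k))" by (rule DD_F)
  have wF: "w \<in> borel_measurable (F (gp N k))"
    unfolding w_def using A_F GG_F DD_F by (intro borel_measurable_times borel_measurable_indicator)
  have wB: "\<bar>w \<omega>\<bar> \<le> Dm" for \<omega>
    using DD_bound[of k \<omega>] k Dm1 by (auto simp: w_def indicator_def)
  have step: "XX \<eta> N (Suc k) \<omega> - XX \<eta> N k \<omega> = w \<omega> * ((1 - c * \<delta>) * \<psi>0 (?x \<omega> + ?p \<omega> * binc s \<delta> k \<omega>) - \<psi>0 (?x \<omega>))" for \<omega>
  proof (cases "\<omega> \<in> GG \<eta> N k")
    case True
    then show ?thesis by (simp add: XX_def w_def VV_def msum_Suc DD_def algebra_simps)
  next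
    case False
    then show ?thesis by (simp add: XX_def w_def VV_def msum_Suc DD_def gg_def)
  qed
  have ty: "\<bar>\<psi>0 (?x \<omega> + t) - \<psi>0 (?x \<omega>) - \<psi>1 (?x \<omega>) * t - \<psi>2 (?x \<omega>) / 2 * t\<^sup>2\<bar> \<le> C * \<bar>t\<bar>^3" if "w \<omega> \<noteq> 0" for \<omega> t
  proof -
    have "\<omega> \<in> GG \<eta> N k" using that by (auto simp: w_def indicator_def split: if_splits)
    from GG_near[OF this] have x: "?x \<omega> \<in> {a - h..b + h}" "?x \<omega> \<in> S" using \<eta> h by auto
    show ?thesis using taylor[OF x(1), of t] unfolding psi_eq[OF x(2)] unfolding \<psi>0_def .
  qed
  have main: "\<bar>(\<integral>\<omega>. w \<omega> * ((1 - c * \<delta>) * \<psi>0 (?x \<omega> + ?p \<omega> * binc s \<delta> k \<omega>) - \<psi>0 (?x \<omega>)) \<partial>M)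
     - \<delta> * (\<integral>\<omega>. w \<omega> * (\<psi>2 (?x \<omega>) / 2 * (?p \<omega>)\<^sup>2 - c * \<psi>0 (?x \<omega>)) \<partial>M)\<bar>
     \<le> 4 * Dm * C^4 * (\<delta> * sqrt \<delta>) + Dm * \<bar>c\<bar> * C^3 * \<delta>\<^sup>2"
    by (rule one_step[OF s \<delta> wF[unfolded gp_def] VV_F[unfolded gp_def] gg_F[unfolded gp_def] wB gg_C psi_meas psi_bound ty cd])
  have gen: "\<bar>w \<omega> * (\<psi>2 (?x \<omega>) / 2 * (?p \<omega>)\<^sup>2 - c * \<psi>0 (?x \<omega>))\<bar> \<le> Dm * ((C^3 + \<bar>c\<bar> * C) * \<eta>)" for \<omega>
  proof (cases "w \<omega> = 0")
    case True
    then show ?thesis using C Dm1 \<eta> by simp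
  next
    case False
    then have G: "\<omega> \<in> GG \<eta> N k" by (auto simp: w_def indicator_def split: if_splits)
    let ?y = "Y (gp N k) \<omega>"
    from GG_near[OF G] have y: "?y \<in> {a..b}" "\<bar>?x \<omega> - ?y\<bar> \<le> \<eta>" by auto
    have xS: "?x \<omega> \<in> S" and yS: "?y \<in> S" using y \<eta> h by auto
    have yI: "?y \<in> I" using yS SI by blast
    have p: "?p \<omega> = P ?y" using G by (simp add: gg_def)
    have p2: "(P ?y)\<^sup>2 \<le> C\<^sup>2" using PC[OF y(1)] by (metis abs_ge_zero power2_abs power_mono)
    have e: "\<psi>2 (?x \<omega>) / 2 * (?p \<omega>)\<^sup>2 - c * \<psi>0 (?x \<omega>) = (\<phi>2 (?x \<omega>) - \<phi>2 ?y) / 2 * (P ?y)\<^sup>2 - c * (\<phi> (?x \<omega>) - \<phi> ?y)"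
      unfolding psi_eq[OF xS] p using eigen[OF yI] by (simp add: field_simps)
    have "\<bar>(\<phi>2 (?x \<omega>) - \<phi>2 ?y) / 2 * (P ?y)\<^sup>2\<bar> \<le> (C * \<eta>) * C\<^sup>2"
    proof -
      have "\<bar>\<phi>2 (?x \<omega>) - \<phi>2 ?y\<bar> \<le> C * \<eta>"
        using order_trans[OF l2[OF xS yS] mult_left_mono[OF y(2)]] C by simp
      then have "\<bar>(\<phi>2 (?x \<omega>) - \<phi>2 ?y) / 2\<bar> \<le> C * \<eta>" by simp
      then show ?thesis unfolding abs_mult[of "_ / 2"] using p2 C \<eta> by (intro mult_mono) auto
    qed
    moreover have "\<bar>c * (\<phi> (?x \<omega>) - \<phi> ?y)\<bar> \<le> \<bar>c\<bar> * (C * \<eta>)"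
      unfolding abs_mult using order_trans[OF l0[OF xS yS] mult_left_mono[OF y(2)]] C by (intro mult_left_mono) auto
    ultimately have "\<bar>\<psi>2 (?x \<omega>) / 2 * (?p \<omega>)\<^sup>2 - c * \<psi>0 (?x \<omega>)\<bar> \<le> (C * \<eta>) * C\<^sup>2 + \<bar>c\<bar> * (C * \<eta>)"
      unfolding e by linarith
    also have "\<dots> = (C^3 + \<bar>c\<bar> * C) * \<eta>" by (simp add: algebra_simps power2_eq_square power3_eq_cube)
    finally show ?thesis unfolding abs_mult[of "w \<omega>"] using wB[of \<omega>] Dm1 by (intro mult_mono) auto
  qed
  have gen0: "0 \<le> Dm * ((C^3 + \<bar>c\<bar> * C) * \<eta>)" using gen[of undefined] abs_ge_zero order_trans by blast
  have [measurable]: "w \<in> borel_measurable M" "?x \<in> borel_measurable M" "?p \<in> borel_measurable M"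
    using F_M[OF wF gp0] F_M[OF VV_F gp0] F_M[OF gg_F gp0] by auto
  have "\<bar>\<integral>\<omega>. w \<omega> * (\<psi>2 (?x \<omega>) / 2 * (?p \<omega>)\<^sup>2 - c * \<psi>0 (?x \<omega>)) \<partial>M\<bar> \<le> (\<integral>\<omega>. \<bar>w \<omega> * (\<psi>2 (?x \<omega>) / 2 * (?p \<omega>)\<^sup>2 - c * \<psi>0 (?x \<omega>))\<bar> \<partial>M)"
    by (rule integral_abs_bound)
  also have "\<dots> \<le> (\<integral>\<omega>. Dm * ((C^3 + \<bar>c\<bar> * C) * \<eta>) \<partial>M)"
    by (intro integral_mono integrable_abs integrable_const_bound[where B="Dm * ((C^3 + \<bar>c\<bar> * C) * \<eta>)"] AE_I2)
      (use gen gen0 in auto)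
  also have "\<dots> = Dm * ((C^3 + \<bar>c\<bar> * C) * \<eta>)" by (simp add: prob_space)
  finally have d1: "\<bar>\<delta> * (\<integral>\<omega>. w \<omega> * (\<psi>2 (?x \<omega>) / 2 * (?p \<omega>)\<^sup>2 - c * \<psi>0 (?x \<omega>)) \<partial>M)\<bar> \<le> \<delta> * (Dm * ((C^3 + \<bar>c\<bar> * C) * \<eta>))"
    unfolding abs_mult[of \<delta>] using \<delta> by (intro mult_mono) auto
  have d2: "(\<integral>\<omega>. XX \<eta> N (Suc k) \<omega> \<partial>M) - (\<integral>\<omega>. XX \<eta> N k \<omega> \<partial>M) = (\<integral>\<omega>. w \<omega> * ((1 - c * \<delta>) * \<psi>0 (?x \<omega> + ?p \<omega> * binc s \<delta> k \<omega>) - \<psi>0 (?x \<omega>)) \<partial>M)"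
    using XX_int[of k] XX_int[of "Suc k"] k unfolding step[symmetric] by (intro Bochner_Integration.integral_diff[symmetric]) auto
  have "\<bar>(\<integral>\<omega>. XX \<eta> N (Suc k) \<omega> \<partial>M) - (\<integral>\<omega>. XX \<eta> N k \<omega> \<partial>M)\<bar> \<le>
     \<delta> * (Dm * ((C^3 + \<bar>c\<bar> * C) * \<eta>)) + (4 * Dm * C^4 * (\<delta> * sqrt \<delta>) + Dm * \<bar>c\<bar> * C^3 * \<delta>\<^sup>2)"
    unfolding d2 by (rule abs_le_add_diff[OF d1 main])
  also have "\<dots> = rate" unfolding rate_def by (simp only: distrib_left mult_ac)
  finally show ?thesis .
qed

lemma XX_total: "\<bar>(\<integral>\<omega>. XX \<eta> N N \<omega> \<partial>M) - (\<integral>\<omega>. indicator A \<omega> * \<phi> (Y s \<omega>) \<partial>M)\<bar> \<le> real N * rate"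
proof -
  have "\<bar>(\<integral>\<omega>. XX \<eta> N k \<omega> \<partial>M) - (\<integral>\<omega>. XX \<eta> N 0 \<omega> \<partial>M)\<bar> \<le> real k * rate" if "k \<le> N" for k
    using that
  proof (induction k)
    case (Suc k)
    have "\<bar>(\<integral>\<omega>. XX \<eta> N k \<omega> \<partial>M) - (\<integral>\<omega>. XX \<eta> N 0 \<omega> \<partial>M)\<bar> \<le> real k * rate" using Suc by simp
    moreover have "real (Suc k) * rate = real k * rate + rate" by (simp add: algebra_simps)
    ultimately show ?case using XX_step[of k] Suc.prems by linarith
  qed simp
  moreover have "XX \<eta> N 0 \<omega> = indicator A \<omega> * \<phi> (Y s \<omega>)" for \<omega>
    using AY[of \<omega>] h psi_eq(1)[of "Y s \<omega>"] by (cases "\<omega> \<in> A") (auto simp: XX_def DD_def VV_def)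
  ultimately show ?thesis by simp
qed

lemma gp_N: "gp N N = s + u" using N by (simp add: gp_def)

lemma gp_in: "k \<le> N \<Longrightarrow> gp N k \<in> {s..s+u}"
  unfolding gp_def by (rule grid_point_bounds[OF u N])

lemma Yg[measurable]: "Y (gp N k) \<in> borel_measurable M" by (rule Y_meas_M[OF gp0])

lemma GS_M[measurable]: "GS N \<in> events" unfolding GS_def by measurable
lemma EA_M[measurable]: "EA N \<in> events" unfolding EA_def by measurable
lemma EB_M[measurable]: "EB N \<in> events" unfolding EB_def by measurable
lemma JJ_M[measurable]: "JJ \<eta> N \<in> events" unfolding JJ_def by measurable
lemma bad_M[measurable]: "bad s u {a..b} \<eta> N \<in> events" using bad_sets[OF s u N] by simp
lemma DD_M[measurable]: "DD \<eta> N k \<in> borel_measurable M" by (rule F_M[OF DD_F gp0])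
lemma VV_M[measurable]: "VV \<eta> N k \<in> borel_measurable M" by (rule F_M[OF VV_F gp0])

lemma not_badD:
  assumes "\<omega> \<in> space M" "\<omega> \<notin> bad s u {a..b} \<eta> N" "k \<le> N" "\<And>j. j < k \<Longrightarrow> Y (gp N j) \<omega> \<in> {a..b}"
  shows "\<bar>usum s \<delta> k \<omega> - Y (gp N k) \<omega>\<bar> \<le> \<eta>"
proof (rule ccontr)
  assume "\<not> \<bar>usum s \<delta> k \<omega> - Y (gp N k) \<omega>\<bar> \<le> \<eta>"
  then have "\<eta> < \<bar>usum s \<delta> k \<omega> - Y (gp N k) \<omega>\<bar>" by linarith
  then show False using assms unfolding bad_def gp_def by blast
qed

text \<open>Off the bad event the drift of the sum away from \<open>Y\<close> cannot be what freezes
  \<open>VV\<close>, so freezing takes place exactly at the first grid exit.\<close>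

lemma exit_structure:
  assumes w: "\<omega> \<in> space M" "\<omega> \<notin> bad s u {a..b} \<eta> N" and k: "k \<le> N" and j: "\<And>j. j < k \<Longrightarrow> Y (gp N j) \<omega> \<in> {a..b}"
   and e: "k = N \<or> Y (gp N k) \<omega> \<notin> {a..b}"
  shows "VV \<eta> N N \<omega> = usum s \<delta> k \<omega>"
proof -
  have G: "\<omega> \<in> GG \<eta> N i" if "i < k" for i
    using w(1) not_badD[OF w] that k j unfolding GG_def by auto
  have nG: "\<omega> \<notin> GG \<eta> N i" if "k \<le> i" "i < N" for i
    using that e unfolding GG_def by auto
  have "msum s \<delta> (gg \<eta> N) N \<omega> = msum s \<delta> (\<lambda>j \<omega>. P (Y (s + real j * \<delta>) \<omega>)) k \<omega>"
    by (rule msum_stopped[OF k]) (use G nG in \<open>simp_all add: gg_def gp_def\<close>)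
  then show ?thesis by (simp add: VV_def usum_def)
qed

text \<open>What \<open>XX\<close> amounts to at the final time up to small errors: after an exit
  the test function is replaced by its value at the end that was crossed, so that the unknown exit
  weights multiply the constants \<open>\<phi> a\<close> and \<open>\<phi> b\<close>.\<close>

definition "lin \<omega> = indicator A \<omega> * indicator (GS N) \<omega> * (1 - c * \<delta>)^N * \<psi>0 (Y (s + u) \<omega>)
   + indicator A \<omega> * indicator (EA N) \<omega> * DD \<eta> N N \<omega> * \<phi> a + indicator A \<omega> * indicator (EB N) \<omega> * DD \<eta> N N \<omega> * \<phi> b"

text \<open>At a first exit the previous grid value is still in \<open>{a..b}\<close> and the
  increment is at most \<open>\<eta>\<close>, so \<open>Y\<close> is within \<open>\<eta>\<close> of
  the end it crossed and the sum within \<open>2 * \<eta>\<close>. The Lipschitz bound of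
  \<open>\<phi>\<close> does the rest. The exit index is positive because \<open>Y\<close> starts in
  \<open>{a..b}\<close> on \<open>A\<close>.\<close>

lemma XX_lin:
  assumes w: "\<omega> \<in> space M" "\<omega> \<notin> bad s u {a..b} \<eta> N" and J: "\<omega> \<notin> JJ \<eta> N"
  shows "\<bar>XX \<eta> N N \<omega> - lin \<omega>\<bar> \<le> Dm * (2 * C * \<eta>)"
proof (cases "\<omega> \<in> A")
  case False
  then show ?thesis using Dm1 C \<eta> by (simp add: XX_def lin_def)
next
  case A: True
  show ?thesis
  proof (cases "\<omega> \<in> GS N")
    case True
    have g: "Y (gp N k) \<omega> \<in> {a..b}" if "k \<le> N" for k using True that by (auto simp: GS_def)
    have "\<omega> \<notin> EA N" "\<omega> \<notin> EB N" using g by (force simp: EA_def EB_def)+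
    moreover have GG: "\<omega> \<in> GG \<eta> N k" if "k \<le> N" for k
      using w(1) not_badD[OF w] g that unfolding GG_def by auto
    then have "DD \<eta> N N \<omega> = (1 - c * \<delta>)^N" unfolding DD_def by simp
    ultimately have e: "XX \<eta> N N \<omega> - lin \<omega> = DD \<eta> N N \<omega> * (\<psi>0 (VV \<eta> N N \<omega>) - \<psi>0 (Y (s + u) \<omega>))"
      using A True by (simp add: XX_def lin_def algebra_simps)
    from GG_near[OF GG[OF le_refl]] have y: "Y (s + u) \<omega> \<in> {a..b}" "\<bar>VV \<eta> N N \<omega> - Y (s + u) \<omega>\<bar> \<le> \<eta>"
      unfolding gp_N by auto
    have xS: "VV \<eta> N N \<omega> \<in> S" and yS: "Y (s + u) \<omega> \<in> S" using y \<eta> h by auto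
    have "\<bar>\<psi>0 (VV \<eta> N N \<omega>) - \<psi>0 (Y (s + u) \<omega>)\<bar> \<le> C * \<eta>"
      unfolding psi_eq[OF xS] psi_eq[OF yS] using order_trans[OF l0[OF xS yS] mult_left_mono[OF y(2)]] C by simp
    moreover have "C * \<eta> \<le> 2 * C * \<eta>" using C \<eta> by simp
    ultimately show ?thesis unfolding e abs_mult[of "DD \<eta> N N \<omega>"] using DD_bound[of N \<omega>] Dm1 by (intro mult_mono) auto
  next
    case False
    define k where "k = (LEAST k. k \<le> N \<and> Y (gp N k) \<omega> \<notin> {a..b})"
    have ex: "\<exists>k. k \<le> N \<and> Y (gp N k) \<omega> \<notin> {a..b}" using False w(1) by (auto simp: GS_def)
    then have k: "k \<le> N" "Y (gp N k) \<omega> \<notin> {a..b}" unfolding k_def by (metis (mono_tags, lifting) LeastI)+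
    have j: "Y (gp N j) \<omega> \<in> {a..b}" if "j < k" for j
      using not_less_Least[of j "\<lambda>k. k \<le> N \<and> Y (gp N k) \<omega> \<notin> {a..b}"] that k(1) unfolding k_def by auto
    have k0: "k > 0"
    proof (rule ccontr)
      assume "\<not> k > 0"
      then have "gp N k = s" by (simp add: gp_def)
      then show False using k(2) AY[OF A] by simp
    qed
    have VV: "VV \<eta> N N \<omega> = usum s \<delta> k \<omega>" by (rule exit_structure[OF w k(1) j]) (use k in auto)
    have near: "\<bar>usum s \<delta> k \<omega> - Y (gp N k) \<omega>\<bar> \<le> \<eta>" by (rule not_badD[OF w k(1) j])
    have jump: "\<bar>Y (gp N k) \<omega> - Y (gp N (k - 1)) \<omega>\<bar> \<le> \<eta>"
      using J w(1) k(1) unfolding JJ_def by (auto simp: not_less)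
    have prev: "Y (gp N (k - 1)) \<omega> \<in> {a..b}" using j[of "k - 1"] k0 by simp
    have uniq: "k' = k" if "k' \<le> N" "Y (gp N k') \<omega> \<notin> {a..b}" "\<forall>j\<in>{..<k'}. Y (gp N j) \<omega> \<in> {a..b}" for k'
      using that j[of k'] k(2) by (meson lessThan_iff linorder_neqE_nat)
    obtain e where e: "e = a \<or> e = b" "\<bar>usum s \<delta> k \<omega> - e\<bar> \<le> 2 * \<eta>"
       "lin \<omega> = DD \<eta> N N \<omega> * \<phi> e"
    proof (cases "Y (gp N k) \<omega> < a")
      case True
      have ia: "\<omega> \<in> EA N" unfolding EA_def using w(1) k(1) True j by auto
      have "\<omega> \<notin> EB N"
      proof
        assume "\<omega> \<in> EB N"
        then obtain k' where "k' \<le> N" "Y (gp N k') \<omega> > b" "\<forall>j\<in>{..<k'}. Y (gp N j) \<omega> \<in> {a..b}" unfolding EB_def by auto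
        then have "k' = k" by (intro uniq) auto
        then show False using \<open>Y (gp N k') \<omega> > b\<close> True ab by simp
      qed
      then have "lin \<omega> = DD \<eta> N N \<omega> * \<phi> a" using ia A False by (simp add: lin_def)
      moreover have "\<bar>usum s \<delta> k \<omega> - a\<bar> \<le> 2 * \<eta>" using near jump prev True by auto
      ultimately show ?thesis using that[of a] by auto
    next
      case F: False
      then have gb: "Y (gp N k) \<omega> > b" using k(2) by auto
      have ia: "\<omega> \<in> EB N" unfolding EB_def using w(1) k(1) gb j by auto
      have "\<omega> \<notin> EA N"
      proof
        assume "\<omega> \<in> EA N"
        then obtain k' where "k' \<le> N" "Y (gp N k') \<omega> < a" "\<forall>j\<in>{..<k'}. Y (gp N j) \<omega> \<in> {a..b}" unfolding EA_def by auto
        then have "k' = k" by (intro uniq) auto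
        then show False using \<open>Y (gp N k') \<omega> < a\<close> gb ab by simp
      qed
      then have "lin \<omega> = DD \<eta> N N \<omega> * \<phi> b" using ia A False by (simp add: lin_def)
      moreover have "\<bar>usum s \<delta> k \<omega> - b\<bar> \<le> 2 * \<eta>" using near jump prev gb by auto
      ultimately show ?thesis using that[of b] by auto
    qed
    have xS: "usum s \<delta> k \<omega> \<in> S" and eS: "e \<in> S" using near e ab \<eta> h by auto
    have "XX \<eta> N N \<omega> - lin \<omega> = DD \<eta> N N \<omega> * (\<phi> (usum s \<delta> k \<omega>) - \<phi> e)"
      unfolding XX_def e(3) VV psi_eq[OF xS] using A by (simp add: algebra_simps)
    moreover have "\<bar>\<phi> (usum s \<delta> k \<omega>) - \<phi> e\<bar> \<le> 2 * C * \<eta>"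
      using order_trans[OF l0[OF xS eS] mult_left_mono[OF e(2)]] C by simp
    ultimately show ?thesis using DD_bound[of N \<omega>] Dm1 by (simp only: abs_mult) (intro mult_mono, auto)
  qed
qed

lemma lin_bound: "\<bar>lin \<omega>\<bar> \<le> 3 * (Dm * C)"
proof -
  have pw: "\<bar>(1 - c * \<delta>)^N\<bar> \<le> Dm"
  proof -
    have "\<bar>(1 - c * \<delta>)^N\<bar> \<le> (1 + \<bar>c\<bar> * \<delta>)^N"
      unfolding power_abs using fac[of UNIV] by (intro power_mono) auto
    also have "\<dots> \<le> exp (\<bar>c\<bar> * \<delta>)^N" using u by (intro power_mono exp_ge_add_one_self) auto
    also have "\<dots> = exp (real N * (\<bar>c\<bar> * \<delta>))" by (simp only: exp_of_nat_mult)
    also have "real N * (\<bar>c\<bar> * \<delta>) = \<bar>c\<bar> * u" using N by simp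
    finally show ?thesis by (simp add: Dm_def)
  qed
  have aS: "a \<in> S" "b \<in> S" using ab h by auto
  have ib: "\<bar>indicator H \<omega> * indicator H' \<omega> * x * y\<bar> \<le> Dm * C" if "\<bar>x\<bar> \<le> Dm" "\<bar>y\<bar> \<le> C" for x y :: real and H H'
  proof -
    have "\<bar>x * y\<bar> \<le> Dm * C" unfolding abs_mult using that Dm1 by (intro mult_mono) auto
    moreover have "0 \<le> Dm * C" using Dm1 C by simp
    ultimately show ?thesis by (auto simp: indicator_def)
  qed
  have dd: "\<bar>DD \<eta> N N \<omega>\<bar> \<le> Dm" using DD_bound[of N \<omega>] by simp
  show ?thesis unfolding lin_def
    using ib[OF pw psi_bound(1), of A "GS N" "Y (s + u) \<omega>"] ib[OF dd p0[OF aS(1)], of A "EA N"] ib[OF dd p0[OF aS(2)], of A "EB N"]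
    by linarith
qed

lemma XX_lin_integral:
  "\<bar>(\<integral>\<omega>. XX \<eta> N N \<omega> \<partial>M) - (\<integral>\<omega>. lin \<omega> \<partial>M)\<bar> \<le> Dm * (2 * C * \<eta>) + 4 * (Dm * C) * (prob (bad s u {a..b} \<eta> N) + prob (JJ \<eta> N))"
proof -
  have [measurable]: "Y (s + u) \<in> borel_measurable M" using s u by (intro Y_meas_M) auto
  have lm[measurable]: "lin \<in> borel_measurable M" unfolding lin_def by measurable
  have li: "integrable M lin" by (rule integrable_const_bound[where B="3 * (Dm * C)"]) (use lin_bound in auto)
  have Xi: "integrable M (XX \<eta> N N)" by (rule XX_int) simp
  have DC: "0 \<le> Dm * C" using Dm1 C by simp
  have Xb: "\<bar>XX \<eta> N N \<omega>\<bar> \<le> Dm * C" for \<omega>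
  proof -
    have "\<bar>DD \<eta> N N \<omega> * \<psi>0 (VV \<eta> N N \<omega>)\<bar> \<le> Dm * C"
      unfolding abs_mult using DD_bound[of N \<omega>] psi_bound(1) Dm1 by (intro mult_mono) auto
    then show ?thesis using DC by (auto simp: XX_def indicator_def)
  qed
  \<comment> \<open>Off the two exceptional events \<open>XX_lin\<close> applies; on them the crude
    bounds \<open>Dm * C\<close> for \<open>XX\<close> and \<open>3 * (Dm * C)\<close> for
    \<open>lin\<close> are added.\<close>
  let ?bd = "\<lambda>\<omega>. Dm * (2 * C * \<eta>) + 4 * (Dm * C) * (indicator (bad s u {a..b} \<eta> N) \<omega> + indicator (JJ \<eta> N) \<omega>)"
  have bdi: "integrable M ?bd" using bad_M JJ_M by (intro Bochner_Integration.integrable_add integrable_mult_right) auto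
  have pt: "\<bar>XX \<eta> N N \<omega> - lin \<omega>\<bar> \<le> ?bd \<omega>" if "\<omega> \<in> space M" for \<omega>
  proof (cases "\<omega> \<in> bad s u {a..b} \<eta> N \<or> \<omega> \<in> JJ \<eta> N")
    case True
    then have "(1::real) \<le> indicator (bad s u {a..b} \<eta> N) \<omega> + indicator (JJ \<eta> N) \<omega>" by (auto simp: indicator_def)
    then have "4 * (Dm * C) * 1 \<le> 4 * (Dm * C) * (indicator (bad s u {a..b} \<eta> N) \<omega> + indicator (JJ \<eta> N) \<omega>)"
      using DC by (intro mult_left_mono) auto
    moreover have "0 \<le> Dm * (2 * C * \<eta>)" using Dm1 C \<eta> by simp
    ultimately show ?thesis using Xb[of \<omega>] lin_bound[of \<omega>] by linarith
  next
    case False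
    then show ?thesis using XX_lin[OF that] by simp
  qed
  have "\<bar>(\<integral>\<omega>. XX \<eta> N N \<omega> \<partial>M) - (\<integral>\<omega>. lin \<omega> \<partial>M)\<bar> = \<bar>\<integral>\<omega>. XX \<eta> N N \<omega> - lin \<omega> \<partial>M\<bar>"
    using Xi li by simp
  also have "\<dots> \<le> (\<integral>\<omega>. \<bar>XX \<eta> N N \<omega> - lin \<omega>\<bar> \<partial>M)" by (rule integral_abs_bound)
  also have "\<dots> \<le> (\<integral>\<omega>. ?bd \<omega> \<partial>M)"
    using Xi li bdi pt by (intro integral_mono integrable_abs Bochner_Integration.integrable_diff) auto
  also have "\<dots> = Dm * (2 * C * \<eta>) + 4 * (Dm * C) * (prob (bad s u {a..b} \<eta> N) + prob (JJ \<eta> N))"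
    by (simp add: prob_space)
  finally show ?thesis .
qed

lemma lin_integral: "(\<integral>\<omega>. lin \<omega> \<partial>M) = (1 - c * \<delta>)^N * (\<integral>\<omega>. indicator A \<omega> * indicator (GS N) \<omega> * \<psi>0 (Y (s + u) \<omega>) \<partial>M)
   + \<phi> a * (\<integral>\<omega>. indicator A \<omega> * indicator (EA N) \<omega> * DD \<eta> N N \<omega> \<partial>M) + \<phi> b * (\<integral>\<omega>. indicator A \<omega> * indicator (EB N) \<omega> * DD \<eta> N N \<omega> \<partial>M)"
proof -
  have [measurable]: "Y (s + u) \<in> borel_measurable M" using s u by (intro Y_meas_M) auto
  let ?f = "\<lambda>\<omega>. indicator A \<omega> * indicator (GS N) \<omega> * \<psi>0 (Y (s + u) \<omega>)"
  let ?g = "\<lambda>H \<omega>. indicator A \<omega> * indicator H \<omega> * DD \<eta> N N \<omega>"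
  have f: "integrable M ?f"
    by (rule integrable_const_bound[where B=C]) (use psi_bound(1) C in \<open>auto simp: indicator_def\<close>)
  have g: "integrable M (?g H)" if [measurable]: "H \<in> events" for H
    by (rule integrable_const_bound[where B=Dm]) (use DD_bound[of N] Dm1 in \<open>auto simp: indicator_def\<close>)
  have "lin \<omega> = (1 - c * \<delta>)^N * ?f \<omega> + \<phi> a * ?g (EA N) \<omega> + \<phi> b * ?g (EB N) \<omega>" for \<omega>
    unfolding lin_def by (simp only: mult_ac)
  then show ?thesis using f g[OF EA_M] g[OF EB_M] by simp
qed

lemma exit_weight:
  assumes X[measurable]: "X \<in> events" and H: "H \<in> events" "X \<subseteq> H"
  shows "0 \<le> (\<integral>\<omega>. indicator A \<omega> * indicator X \<omega> * DD \<eta> N N \<omega> \<partial>M)" "(\<integral>\<omega>. indicator A \<omega> * indicator X \<omega> * DD \<eta> N N \<omega> \<partial>M) \<le> Dm * prob H"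
proof -
  show "0 \<le> (\<integral>\<omega>. indicator A \<omega> * indicator X \<omega> * DD \<eta> N N \<omega> \<partial>M)"
    using DD_bound[of N] by (intro Bochner_Integration.integral_nonneg) auto
  have "(\<integral>\<omega>. indicator A \<omega> * indicator X \<omega> * DD \<eta> N N \<omega> \<partial>M) \<le> (\<integral>\<omega>. Dm * indicator H \<omega> \<partial>M)"
  proof (rule integral_mono)
    show "integrable M (\<lambda>\<omega>. indicator A \<omega> * indicator X \<omega> * DD \<eta> N N \<omega>)"
      by (rule integrable_const_bound[where B=Dm]) (use DD_bound[of N] Dm1 in \<open>auto simp: indicator_def\<close>)
    show "integrable M (\<lambda>\<omega>. Dm * indicator H \<omega>)" using H by (intro integrable_mult_right) auto
    show "indicator A \<omega> * indicator X \<omega> * DD \<eta> N N \<omega> \<le> Dm * indicator H \<omega>" for \<omega>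
      using DD_bound[of N \<omega>] Dm1 H(2) by (auto simp: indicator_def)
  qed
  also have "\<dots> = Dm * prob H" using sets.sets_into_space[OF H(1)] H(1) by (simp add: Int_absorb2)
  finally show "(\<integral>\<omega>. indicator A \<omega> * indicator X \<omega> * DD \<eta> N N \<omega> \<partial>M) \<le> Dm * prob H" .
qed

end

end

context dynkin_grid begin

abbreviation "stay \<equiv> {\<omega>\<in>space M. \<forall>r\<in>{s..s+u}. Y r \<omega> \<in> {a..b}}"

lemma grid_limits:
  fixes N :: "nat \<Rightarrow> nat"
  assumes N: "\<And>L. N L > 0" "filterlim N at_top sequentially" and \<eta>: "\<eta> > 0"
  shows "(\<lambda>L. u / real (N L)) \<longlonglongrightarrow> 0"
    and "(\<lambda>L. prob (JJ \<eta> (N L))) \<longlonglongrightarrow> 0"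
    and "(\<lambda>L. (1 - c * (u / real (N L))) ^ N L) \<longlonglongrightarrow> exp (- c * u)"
    and "(\<lambda>L. \<integral>\<omega>. indicator A \<omega> * indicator (GS (N L)) \<omega> * \<psi>0 (Y (s + u) \<omega>) \<partial>M)
       \<longlonglongrightarrow> (\<integral>\<omega>. indicator A \<omega> * indicator stay \<omega> * \<phi> (Y (s + u) \<omega>) \<partial>M)"
proof -
  have "filterlim (\<lambda>L. real (N L)) at_top sequentially"
    using N(2) filterlim_compose filterlim_real_sequentially by blast
  then show lim: "(\<lambda>L. u / real (N L)) \<longlonglongrightarrow> 0"
    by (rule tendsto_divide_0[OF tendsto_const filterlim_at_top_imp_at_infinity])
  show "(\<lambda>L. prob (JJ \<eta> (N L))) \<longlonglongrightarrow> 0"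
    unfolding JJ_def
  proof (rule osc_tendsto(1)[OF s _ lim _ \<eta>])
    fix L k assume k: "k \<le> N L"
    have "gp (N L) k \<in> {s..s + u}" "gp (N L) (k - 1) \<in> {s..s + u}"
      unfolding gp_def by (rule grid_point_bounds[OF u N(1)], use k in simp)+
    then show "gp (N L) k \<in> {s..s + u} \<and> gp (N L) (k - 1) \<in> {s..s + u}" by blast
    show "\<bar>gp (N L) k - gp (N L) (k - 1)\<bar> \<le> u / real (N L)"
    proof (cases k)
      case 0
      then show ?thesis using u by (simp add: gp_def)
    next
      case (Suc m)
      have "gp (N L) k - gp (N L) (k - 1) = u / real (N L)" unfolding gp_def Suc by (simp add: algebra_simps add_divide_distrib)
      then show ?thesis using u by simp
    qed
  qed
  have "(\<lambda>n. (1 + (- c * u) / real n) ^ n) \<longlonglongrightarrow> exp (- c * u)" by (rule tendsto_exp_limit_sequentially)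
  from filterlim_compose[OF this N(2)]
  show "(\<lambda>L. (1 - c * (u / real (N L))) ^ N L) \<longlonglongrightarrow> exp (- c * u)" by simp
  have SM: "stay \<in> events"
  proof (rule stay_sets)
    show "Y r \<in> borel_measurable M" if "r \<in> {s..s+u}" for r using that s by (intro Y_meas_M) auto
    show "continuous_on {s..s+u} (\<lambda>r. Y r \<omega>)" if "\<omega> \<in> space M" for \<omega>
      by (rule continuous_on_subset[OF Y_cont[OF that]]) (use s in auto)
  qed simp
  have eq: "(\<integral>\<omega>. indicator A \<omega> * indicator stay \<omega> * \<phi> (Y (s + u) \<omega>) \<partial>M) = (\<integral>\<omega>. indicator A \<omega> * indicator stay \<omega> * \<psi>0 (Y (s + u) \<omega>) \<partial>M)"
  proof (rule Bochner_Integration.integral_cong[OF refl])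
    fix \<omega>
    show "indicator A \<omega> * indicator stay \<omega> * \<phi> (Y (s + u) \<omega>) = indicator A \<omega> * indicator stay \<omega> * \<psi>0 (Y (s + u) \<omega>)"
    proof (cases "\<omega> \<in> stay")
      case True
      then have "Y (s + u) \<omega> \<in> {a..b}" using u by simp
      then have "Y (s + u) \<omega> \<in> S" using h by auto
      then show ?thesis using psi_eq(1) by simp
    qed simp
  qed
  have [measurable]: "Y (s + u) \<in> borel_measurable M" using s u by (intro Y_meas_M) auto
  have AM: "A \<in> events" by (rule F_sets_M[OF A s])
  have GM: "GS (N L) \<in> events" for L
  proof -
    have [measurable]: "Y (gp (N L) k) \<in> borel_measurable M" for k
      using s u by (intro Y_meas_M) (auto simp: gp_def)
    show ?thesis unfolding GS_def by measurable
  qed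
  have mI: "(\<lambda>\<omega>. indicator A \<omega> * indicator H \<omega> * \<psi>0 (Y (s + u) \<omega>)) \<in> borel_measurable M" if "H \<in> events" for H
  proof -
    have "(\<lambda>\<omega>. \<psi>0 (Y (s + u) \<omega>)) \<in> borel_measurable M"
      by (rule measurable_compose[OF _ psi_meas(1)]) fact
    then show ?thesis using AM that by (intro borel_measurable_times borel_measurable_indicator)
  qed
  show "(\<lambda>L. \<integral>\<omega>. indicator A \<omega> * indicator (GS (N L)) \<omega> * \<psi>0 (Y (s + u) \<omega>) \<partial>M)
       \<longlonglongrightarrow> (\<integral>\<omega>. indicator A \<omega> * indicator stay \<omega> * \<phi> (Y (s + u) \<omega>) \<partial>M)"
    unfolding eq
  proof (rule integral_dominated_convergence[where w="\<lambda>_. C"])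
    show "AE \<omega> in M. (\<lambda>L. indicator A \<omega> * indicator (GS (N L)) \<omega> * \<psi>0 (Y (s + u) \<omega>)) \<longlonglongrightarrow> indicator A \<omega> * indicator stay \<omega> * \<psi>0 (Y (s + u) \<omega>)"
    proof (rule AE_I2)
      fix \<omega> assume w: "\<omega> \<in> space M"
      have ct: "continuous_on {s..s+u} (\<lambda>r. Y r \<omega>)"
        by (rule continuous_on_subset[OF Y_cont[OF w]]) (use s in auto)
      have "(\<lambda>L. if \<forall>k\<le>N L. Y (s + real k * (u / real (N L))) \<omega> \<in> {a..b} then 1 else 0 :: real)
         \<longlonglongrightarrow> (if \<forall>r\<in>{s..s+u}. Y r \<omega> \<in> {a..b} then 1 else 0)"
        by (rule grid_stay_tendsto[OF ct u _ N(2) N(1)]) simp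
      moreover have "(if \<forall>k\<le>N L. Y (s + real k * (u / real (N L))) \<omega> \<in> {a..b} then 1 else 0 :: real) = indicator (GS (N L)) \<omega>" for L
        using w unfolding GS_def gp_def indicator_def of_bool_def by (simp only: mem_Collect_eq atMost_iff Ball_def simp_thms)
      moreover have "(if \<forall>r\<in>{s..s+u}. Y r \<omega> \<in> {a..b} then 1 else 0 :: real) = indicator stay \<omega>"
        using w by (simp add: indicator_def)
      ultimately have "(\<lambda>L. indicator (GS (N L)) \<omega> :: real) \<longlonglongrightarrow> indicator stay \<omega>" by simp
      then show "(\<lambda>L. indicator A \<omega> * indicator (GS (N L)) \<omega> * \<psi>0 (Y (s + u) \<omega>)) \<longlonglongrightarrow> indicator A \<omega> * indicator stay \<omega> * \<psi>0 (Y (s + u) \<omega>)"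
        by (intro tendsto_intros)
    qed
    show "(\<lambda>\<omega>. indicator A \<omega> * indicator stay \<omega> * \<psi>0 (Y (s + u) \<omega>)) \<in> borel_measurable M" by (rule mI[OF SM])
    show "(\<lambda>\<omega>. indicator A \<omega> * indicator (GS (N L)) \<omega> * \<psi>0 (Y (s + u) \<omega>)) \<in> borel_measurable M" for L by (rule mI[OF GM])
    show "AE \<omega> in M. norm (indicator A \<omega> * indicator (GS (N L)) \<omega> * \<psi>0 (Y (s + u) \<omega>)) \<le> C" for L
      using psi_bound(1) C by (intro AE_I2) (auto simp: indicator_def)
  qed simp
qed

text \<open>The exit weights \<open>ra\<close> and \<open>rb\<close> depend on the grid, and no
  limit of them is taken. All that is kept is that they are nonnegative and dominated by the
  probabilities of passing the ends, which is enough once the end points move out to the boundary of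
  \<open>I\<close>.\<close>

lemma dynkin_eps:
  assumes i: "s = u * real i" and \<epsilon>: "\<epsilon> > 0"
  shows "\<exists>ra rb. 0 \<le> ra \<and> ra \<le> Dm * prob {\<omega>\<in>space M. \<exists>r\<in>{s..s+u}. Y r \<omega> < a} \<and>
     0 \<le> rb \<and> rb \<le> Dm * prob {\<omega>\<in>space M. \<exists>r\<in>{s..s+u}. Y r \<omega> > b} \<and>
     \<bar>exp (- c * u) * (\<integral>\<omega>. indicator A \<omega> * indicator stay \<omega> * \<phi> (Y (s + u) \<omega>) \<partial>M)
       + \<phi> a * ra + \<phi> b * rb - (\<integral>\<omega>. indicator A \<omega> * \<phi> (Y s \<omega>) \<partial>M)\<bar> \<le> \<epsilon>"
proof -
  obtain N :: "nat \<Rightarrow> nat" where N: "\<And>L. N L > 0" "filterlim N at_top sequentially"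
    and bd: "\<And>\<eta>. \<eta> > 0 \<Longrightarrow> (\<lambda>L. prob (bad s u {a..b} \<eta> (N L))) \<longlonglongrightarrow> 0"
    using good_grids[OF u, of "{a..b}" i] unfolding i by (metis compact_Icc)
  \<comment> \<open>\<open>Q * \<eta>\<close> is the limit of the total error as the mesh vanishes.
    The tolerance \<open>\<eta>\<close> is fixed first and the grid chosen afterwards.\<close>
  define Q where "Q = Dm * ((C^3 + \<bar>c\<bar> * C) * u) + Dm * (2 * C)"
  have Q: "Q > 0" using Dm1 C u by (auto simp: Q_def intro!: add_nonneg_pos add_nonneg_nonneg mult_nonneg_nonneg)
  define \<eta> where "\<eta> = min h (\<epsilon> / (2 * Q))"
  have \<eta>: "\<eta> > 0" "\<eta> \<le> h" using h Q \<epsilon> by (auto simp: \<eta>_def)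
  have "\<eta> \<le> \<epsilon> / (2 * Q)" by (simp add: \<eta>_def)
  then have "Q * \<eta> \<le> Q * (\<epsilon> / (2 * Q))" using Q by (intro mult_left_mono) auto
  then have Q\<eta>: "Q * \<eta> < \<epsilon>" using Q \<epsilon> by simp
  note gl = grid_limits[OF N \<eta>(1)]
  let ?es = "\<integral>\<omega>. indicator A \<omega> * indicator stay \<omega> * \<phi> (Y (s + u) \<omega>) \<partial>M"
  let ?eg = "\<lambda>L. \<integral>\<omega>. indicator A \<omega> * indicator (GS (N L)) \<omega> * \<psi>0 (Y (s + u) \<omega>) \<partial>M"
  let ?d = "\<lambda>L. u / real (N L)"
  define T1 where "T1 = (\<lambda>L. Dm * ((C^3 + \<bar>c\<bar> * C) * \<eta> * u + 4 * C^4 * (u * sqrt (?d L)) + \<bar>c\<bar> * C^3 * (u * ?d L)))"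
  define T2 where "T2 = (\<lambda>L. Dm * (2 * C * \<eta>) + 4 * (Dm * C) * (prob (bad s u {a..b} \<eta> (N L)) + prob (JJ \<eta> (N L))))"
  define T3 where "T3 = (\<lambda>L. \<bar>(1 - c * ?d L) ^ N L * ?eg L - exp (- c * u) * ?es\<bar>)"
  have l1: "T1 \<longlonglongrightarrow> Dm * ((C^3 + \<bar>c\<bar> * C) * \<eta> * u + 4 * C^4 * (u * sqrt 0) + \<bar>c\<bar> * C^3 * (u * 0))"
    unfolding T1_def by (intro tendsto_intros gl(1))
  have l2: "T2 \<longlonglongrightarrow> Dm * (2 * C * \<eta>) + 4 * (Dm * C) * (0 + 0)"
    unfolding T2_def by (intro tendsto_intros gl(2) bd[OF \<eta>(1)])
  have l3: "T3 \<longlonglongrightarrow> \<bar>exp (- c * u) * ?es - exp (- c * u) * ?es\<bar>"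
    unfolding T3_def by (intro tendsto_intros gl(3,4))
  have "(\<lambda>L. T1 L + T2 L + T3 L) \<longlonglongrightarrow> Q * \<eta>"
    using tendsto_add[OF tendsto_add[OF l1 l2] l3] by (simp add: Q_def algebra_simps)
  then have ev1: "eventually (\<lambda>L. T1 L + T2 L + T3 L < \<epsilon>) sequentially" using Q\<eta> by (rule order_tendstoD)
  have "(\<lambda>L. \<bar>c\<bar> * ?d L) \<longlonglongrightarrow> \<bar>c\<bar> * 0" by (intro tendsto_intros gl(1))
  then have ev2: "eventually (\<lambda>L. \<bar>c\<bar> * ?d L < 1) sequentially" by (intro order_tendstoD(2)) auto
  obtain L where L: "T1 L + T2 L + T3 L < \<epsilon>" "\<bar>c\<bar> * ?d L < 1"
    using eventually_happens'[OF sequentially_bot eventually_conj[OF ev1 ev2]] by blast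
  have cN: "\<bar>c\<bar> * ?d L \<le> 1" using L(2) by simp
  note hyp = N(1)[of L] \<eta> cN
  define ra where "ra = (\<integral>\<omega>. indicator A \<omega> * indicator (EA (N L)) \<omega> * DD \<eta> (N L) (N L) \<omega> \<partial>M)"
  define rb where "rb = (\<integral>\<omega>. indicator A \<omega> * indicator (EB (N L)) \<omega> * DD \<eta> (N L) (N L) \<omega> \<partial>M)"
  let ?Ha = "{\<omega>\<in>space M. \<exists>r\<in>{s..s+u}. Y r \<omega> < a}" and ?Hb = "{\<omega>\<in>space M. \<exists>r\<in>{s..s+u}. Y r \<omega> > b}"
  have "EA (N L) \<subseteq> ?Ha" "EB (N L) \<subseteq> ?Hb"
    unfolding EA_def EB_def using gp_in[OF hyp] by blast+
  note ew = exit_weight[OF hyp EA_M[OF hyp] range_sets(1)[OF s] this(1)] exit_weight[OF hyp EB_M[OF hyp] range_sets(2)[OF s] this(2)]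
  have e1: "\<bar>(\<integral>\<omega>. XX \<eta> (N L) (N L) \<omega> \<partial>M) - (\<integral>\<omega>. indicator A \<omega> * \<phi> (Y s \<omega>) \<partial>M)\<bar> \<le> T1 L"
  proof -
    have "real (N L) * rate (N L) \<eta> = T1 L"
    proof -
      have "rate (N L) \<eta> = Dm * ((C^3 + \<bar>c\<bar> * C) * \<eta> + 4 * C^4 * sqrt (?d L) + \<bar>c\<bar> * C^3 * ?d L) * ?d L"
        unfolding rate_def[OF hyp] power2_eq_square by (simp only: distrib_left distrib_right mult_ac)
      then have "real (N L) * rate (N L) \<eta> = Dm * ((C^3 + \<bar>c\<bar> * C) * \<eta> + 4 * C^4 * sqrt (?d L) + \<bar>c\<bar> * C^3 * ?d L) * (real (N L) * ?d L)"
        by (simp only: mult_ac)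
      also have "real (N L) * ?d L = u" using N(1)[of L] by simp
      finally show ?thesis unfolding T1_def by (simp only: distrib_left distrib_right mult_ac)
    qed
    then show ?thesis using XX_total[OF hyp] by simp
  qed
  have e2: "\<bar>(\<integral>\<omega>. XX \<eta> (N L) (N L) \<omega> \<partial>M) - (\<integral>\<omega>. lin (N L) \<eta> \<omega> \<partial>M)\<bar> \<le> T2 L"
    unfolding T2_def by (rule XX_lin_integral[OF hyp])
  have e3: "(\<integral>\<omega>. lin (N L) \<eta> \<omega> \<partial>M) = (1 - c * ?d L) ^ N L * ?eg L + \<phi> a * ra + \<phi> b * rb"
    unfolding ra_def rb_def by (rule lin_integral[OF hyp])
  have "\<bar>exp (- c * u) * ?es + \<phi> a * ra + \<phi> b * rb - (\<integral>\<omega>. indicator A \<omega> * \<phi> (Y s \<omega>) \<partial>M)\<bar> \<le> T1 L + T2 L + T3 L"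
    using e1 e2 unfolding e3 T3_def by linarith
  then have "\<bar>exp (- c * u) * ?es + \<phi> a * ra + \<phi> b * rb - (\<integral>\<omega>. indicator A \<omega> * \<phi> (Y s \<omega>) \<partial>M)\<bar> \<le> \<epsilon>"
    using L(1) by linarith
  then show ?thesis using ew unfolding ra_def[symmetric] rb_def[symmetric] by blast
qed

end

context sde_test begin

lemma dynkin:
  assumes "a \<le> b" "{a..b} \<subseteq> I" "0 < u" "s = u * real i" "A \<in> sets (F s)" "\<And>\<omega>. \<omega> \<in> A \<Longrightarrow> Y s \<omega> \<in> {a..b}" "\<epsilon> > 0"
  shows "\<exists>ra rb. 0 \<le> ra \<and> ra \<le> exp (\<bar>c\<bar> * u) * prob {\<omega>\<in>space M. \<exists>r\<in>{s..s+u}. Y r \<omega> < a} \<and>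
     0 \<le> rb \<and> rb \<le> exp (\<bar>c\<bar> * u) * prob {\<omega>\<in>space M. \<exists>r\<in>{s..s+u}. Y r \<omega> > b} \<and>
     \<bar>exp (- c * u) * (\<integral>\<omega>. indicator A \<omega> * indicator {\<omega>\<in>space M. \<forall>r\<in>{s..s+u}. Y r \<omega> \<in> {a..b}} \<omega> * \<phi> (Y (s + u) \<omega>) \<partial>M)
       + \<phi> a * ra + \<phi> b * rb - (\<integral>\<omega>. indicator A \<omega> * \<phi> (Y s \<omega>) \<partial>M)\<bar> \<le> \<epsilon>"
proof -
  obtain h C :: real where C: "h > 0" "C > 0" "{a - 2 * h..b + 2 * h} \<subseteq> I"
    "\<And>x. x \<in> {a - 2 * h..b + 2 * h} \<Longrightarrow> \<bar>\<phi> x\<bar> \<le> C"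
    "\<And>x. x \<in> {a - 2 * h..b + 2 * h} \<Longrightarrow> \<bar>\<phi>1 x\<bar> \<le> C"
    "\<And>x. x \<in> {a - 2 * h..b + 2 * h} \<Longrightarrow> \<bar>\<phi>2 x\<bar> \<le> C"
    "\<And>x y. x \<in> {a - 2 * h..b + 2 * h} \<Longrightarrow> y \<in> {a - 2 * h..b + 2 * h} \<Longrightarrow> \<bar>\<phi> x - \<phi> y\<bar> \<le> C * \<bar>x - y\<bar>"
    "\<And>x y. x \<in> {a - 2 * h..b + 2 * h} \<Longrightarrow> y \<in> {a - 2 * h..b + 2 * h} \<Longrightarrow> \<bar>\<phi>2 x - \<phi>2 y\<bar> \<le> C * \<bar>x - y\<bar>"
    "\<And>x. x \<in> {a..b} \<Longrightarrow> \<bar>P x\<bar> \<le> C"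
    "\<And>x t. x \<in> {a - h..b + h} \<Longrightarrow> \<bar>indicator {a - 2 * h..b + 2 * h} (x + t) * \<phi> (x + t) - \<phi> x - \<phi>1 x * t - \<phi>2 x / 2 * t\<^sup>2\<bar> \<le> C * \<bar>t\<bar>^3"
    using constants[OF assms(1,2)] by blast
  have s: "0 \<le> s" using assms by simp
  interpret dynkin_grid M F B P y0 Y \<phi> \<phi>1 \<phi>2 \<phi>3 I c a b h C s u A
    by (unfold_locales; (rule assms(1) C(1,2,3) assms(3,5) s)?) (use C assms in blast)+
  show ?thesis using dynkin_eps[OF assms(4,7)] unfolding Dm_def .
qed

end

section \<open>From compact intervals to a whole component\<close>

lemma choice2: "\<forall>n. \<exists>x y. R n x y \<Longrightarrow> \<exists>f g. \<forall>n. R n (f n) (g n)"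
  by metis

lemma continuous_image_exhaust:
  fixes p :: "real \<Rightarrow> real" and a b :: "nat \<Rightarrow> real"
  assumes p: "continuous_on {s..t} p" and st: "s \<le> t"
    and ab: "decseq a" "incseq b" "(\<Union>n. {a n..b n}) = I" and st_I: "\<forall>r\<in>{s..t}. p r \<in> I"
  shows "\<exists>n0. \<forall>n\<ge>n0. \<forall>r\<in>{s..t}. p r \<in> {a n..b n}"
proof -
  obtain x where x: "x \<in> {s..t}" "\<forall>y\<in>{s..t}. p x \<le> p y"
    using continuous_attains_inf[OF compact_Icc _ p] st by auto
  obtain y where y: "y \<in> {s..t}" "\<forall>z\<in>{s..t}. p z \<le> p y"
    using continuous_attains_sup[OF compact_Icc _ p] st by auto
  obtain n where n: "p x \<in> {a n..b n}" using x(1) st_I ab(3) by blast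
  obtain m where m: "p y \<in> {a m..b m}" using y(1) st_I ab(3) by blast
  have "p r \<in> {a k..b k}" if k: "k \<ge> max n m" and r: "r \<in> {s..t}" for k r
  proof -
    have "a k \<le> a n" using decseqD[OF ab(1), of n k] k by simp
    moreover have "b m \<le> b k" using incseqD[OF ab(2), of m k] k by simp
    moreover have "p x \<le> p r" "p r \<le> p y" using x(2) y(2) r by blast+
    ultimately show ?thesis using n m by auto
  qed
  then show ?thesis by blast
qed

lemma stay_exhaust_sets:
  fixes X :: "real \<Rightarrow> 'a \<Rightarrow> real"
  assumes X: "\<And>r. r \<in> {s..t} \<Longrightarrow> X r \<in> borel_measurable M"
    and cont: "\<And>\<omega>. \<omega> \<in> space M \<Longrightarrow> continuous_on {s..t} (\<lambda>r. X r \<omega>)" and st: "s \<le> t"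
    and ab: "decseq a" "incseq b" "(\<Union>n. {a n..b n}) = I"
  shows "{\<omega>\<in>space M. \<forall>r\<in>{s..t}. X r \<omega> \<in> I} \<in> sets M"
proof -
  have "{\<omega>\<in>space M. \<forall>r\<in>{s..t}. X r \<omega> \<in> I} = (\<Union>n. {\<omega>\<in>space M. \<forall>r\<in>{s..t}. X r \<omega> \<in> {a n..b n}})"
  proof (intro equalityI subsetI)
    fix \<omega> assume w: "\<omega> \<in> {\<omega>\<in>space M. \<forall>r\<in>{s..t}. X r \<omega> \<in> I}"
    then have "\<exists>n0. \<forall>n\<ge>n0. \<forall>r\<in>{s..t}. X r \<omega> \<in> {a n..b n}"
      by (intro continuous_image_exhaust[OF cont st ab]) auto
    then show "\<omega> \<in> (\<Union>n. {\<omega>\<in>space M. \<forall>r\<in>{s..t}. X r \<omega> \<in> {a n..b n}})" using w by blast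
  next
    fix \<omega> assume "\<omega> \<in> (\<Union>n. {\<omega>\<in>space M. \<forall>r\<in>{s..t}. X r \<omega> \<in> {a n..b n}})"
    then show "\<omega> \<in> {\<omega>\<in>space M. \<forall>r\<in>{s..t}. X r \<omega> \<in> I}" using ab(3) by blast
  qed
  moreover have "{\<omega>\<in>space M. \<forall>r\<in>{s..t}. X r \<omega> \<in> {a n..b n}} \<in> sets M" for n
    by (rule stay_sets[OF X cont closed_atLeastAtMost])
  ultimately show ?thesis by auto
qed

context sde_test begin

text \<open>Along an exhaustion of \<open>I\<close> the exit terms of \<open>dynkin\<close> vanish
  by \<open>la\<close> and \<open>lb\<close>. Each of these is a product, so it is enough that
  either the function or the probability tends to 0. What remains is an exact relation for the
  process killed on leaving \<open>I\<close>, without boundary terms.\<close>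

lemma dynkin_interval:
  assumes ab: "\<And>n. a n \<le> b n" "decseq a" "incseq b" "(\<Union>n. {a n..b n}) = I"
    and C: "\<And>x. x \<in> I \<Longrightarrow> \<bar>\<phi> x\<bar> \<le> C"
    and la: "(\<lambda>n. \<phi> (a n) * prob {\<omega>\<in>space M. \<exists>r\<in>{s..s+u}. Y r \<omega> < a n}) \<longlonglongrightarrow> 0"
    and lb: "(\<lambda>n. \<phi> (b n) * prob {\<omega>\<in>space M. \<exists>r\<in>{s..s+u}. Y r \<omega> > b n}) \<longlonglongrightarrow> 0"
    and u: "0 < u" and i: "s = u * real i" and A: "A \<in> sets (F s)"
  shows "(\<integral>\<omega>. indicator A \<omega> * indicator {\<omega>\<in>space M. \<forall>r\<in>{s..s+u}. Y r \<omega> \<in> I} \<omega> * \<phi> (Y (s + u) \<omega>) \<partial>M)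
     = exp (c * u) * (\<integral>\<omega>. indicator A \<omega> * indicator I (Y s \<omega>) * \<phi> (Y s \<omega>) \<partial>M)"
proof -
  have s: "0 \<le> s" using i u by simp
  define K where "K = (\<lambda>n. {a n..b n})"
  have KI: "K n \<subseteq> I" for n using ab(4) by (auto simp: K_def)
  define \<psi> where "\<psi> = (\<lambda>x. indicator I x *\<^sub>R \<phi> x)"
  have [measurable]: "I \<in> sets borel" using I by auto
  have pm[measurable]: "\<psi> \<in> borel_measurable borel"
    unfolding \<psi>_def by (rule borel_measurable_continuous_on_indicator[OF _ cont_phi(1)]) simp
  have pe: "x \<in> I \<Longrightarrow> \<phi> x = \<psi> x" for x by (simp add: \<psi>_def)
  have "I \<noteq> {}" using ab(1)[of 0] KI[of 0] by (auto simp: K_def)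
  then have C0: "0 \<le> C" using C abs_ge_zero order_trans by blast
  have pC: "\<bar>\<psi> x\<bar> \<le> C" for x using C[of x] C0 by (cases "x \<in> I") (auto simp: \<psi>_def)
  have [measurable]: "Y (s + u) \<in> borel_measurable M" "Y s \<in> borel_measurable M" using s u by (auto intro!: Y_meas_M)
  have Am[measurable]: "A \<in> events" by (rule F_sets_M[OF A s])
  define SK where "SK = (\<lambda>n. {\<omega>\<in>space M. \<forall>r\<in>{s..s+u}. Y r \<omega> \<in> K n})"
  define SI where "SI = {\<omega>\<in>space M. \<forall>r\<in>{s..s+u}. Y r \<omega> \<in> I}"
  have Ym: "Y r \<in> borel_measurable M" if "r \<in> {s..s+u}" for r using that s by (intro Y_meas_M) auto
  have Yc: "continuous_on {s..s+u} (\<lambda>r. Y r \<omega>)" if "\<omega> \<in> space M" for \<omega>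
    by (rule continuous_on_subset[OF Y_cont[OF that]]) (use s in auto)
  have [measurable]: "SK n \<in> events" for n unfolding SK_def K_def by (rule stay_sets[OF Ym Yc closed_atLeastAtMost])
  have [measurable]: "SI \<in> events" unfolding SI_def
    by (rule stay_exhaust_sets[OF Ym Yc _ ab(2-4)]) (use u in auto)
  \<comment> \<open>The Dynkin estimate needs a start in a compact interval, so \<open>A\<close> is
    restricted accordingly; the restriction disappears in the limit.\<close>
  define An where "An = (\<lambda>n. A \<inter> {\<omega>\<in>space M. Y s \<omega> \<in> K n})"
  have AnF: "An n \<in> sets (F s)" for n
  proof -
    have "{\<omega>\<in>space (F s). Y s \<omega> \<in> K n} \<in> sets (F s)"
      using Y_meas[OF s] unfolding K_def by measurable
    then show ?thesis unfolding An_def space_F[OF s] using A by auto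
  qed
  have AnY: "Y s \<omega> \<in> {a n..b n}" if "\<omega> \<in> An n" for n \<omega> using that by (simp add: An_def K_def)
  have KI': "{a n..b n} \<subseteq> I" for n using KI by (simp add: K_def)
  let ?pa = "\<lambda>n. prob {\<omega>\<in>space M. \<exists>r\<in>{s..s+u}. Y r \<omega> < a n}"
  let ?pb = "\<lambda>n. prob {\<omega>\<in>space M. \<exists>r\<in>{s..s+u}. Y r \<omega> > b n}"
  let ?e = "\<lambda>n. \<integral>\<omega>. indicator (An n) \<omega> * indicator (SK n) \<omega> * \<phi> (Y (s + u) \<omega>) \<partial>M"
  let ?f = "\<lambda>n. \<integral>\<omega>. indicator (An n) \<omega> * \<phi> (Y s \<omega>) \<partial>M"
  have "\<forall>n. \<exists>ra rb. 0 \<le> ra \<and> ra \<le> exp (\<bar>c\<bar> * u) * ?pa n \<and> 0 \<le> rb \<and> rb \<le> exp (\<bar>c\<bar> * u) * ?pb n \<and>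
     \<bar>exp (- c * u) * ?e n + \<phi> (a n) * ra + \<phi> (b n) * rb - ?f n\<bar> \<le> 1 / real (Suc n)"
  proof
    fix n
    have "0 < 1 / real (Suc n)" by simp
    from dynkin[OF ab(1) KI' u i AnF AnY this]
    show "\<exists>ra rb. 0 \<le> ra \<and> ra \<le> exp (\<bar>c\<bar> * u) * ?pa n \<and> 0 \<le> rb \<and> rb \<le> exp (\<bar>c\<bar> * u) * ?pb n \<and>
     \<bar>exp (- c * u) * ?e n + \<phi> (a n) * ra + \<phi> (b n) * rb - ?f n\<bar> \<le> 1 / real (Suc n)"
      unfolding SK_def K_def .
  qed
  from choice2[OF this] obtain ra rb where rr: "\<forall>n. 0 \<le> ra n \<and> ra n \<le> exp (\<bar>c\<bar> * u) * ?pa n \<and> 0 \<le> rb n \<and> rb n \<le> exp (\<bar>c\<bar> * u) * ?pb n \<and>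
     \<bar>exp (- c * u) * ?e n + \<phi> (a n) * ra n + \<phi> (b n) * rb n - ?f n\<bar> \<le> 1 / real (Suc n)"
    by (elim exE)
  have r: "0 \<le> ra n" "ra n \<le> exp (\<bar>c\<bar> * u) * ?pa n" "0 \<le> rb n" "rb n \<le> exp (\<bar>c\<bar> * u) * ?pb n"
    "\<bar>exp (- c * u) * ?e n + \<phi> (a n) * ra n + \<phi> (b n) * rb n - ?f n\<bar> \<le> 1 / real (Suc n)" for n
    using rr[rule_format, of n] by blast+
  have z: "(\<lambda>n. g n * q n) \<longlonglongrightarrow> 0" if q: "\<And>n. 0 \<le> q n" "\<And>n. q n \<le> exp (\<bar>c\<bar> * u) * pp n" and l: "(\<lambda>n. g n * pp n) \<longlonglongrightarrow> 0" for g q pp :: "nat \<Rightarrow> real"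
  proof (rule Lim_null_comparison)
    show "(\<lambda>n. exp (\<bar>c\<bar> * u) * \<bar>g n * pp n\<bar>) \<longlonglongrightarrow> 0"
      using tendsto_mult_right_zero[OF tendsto_rabs_zero[OF l]] by blast
    show "eventually (\<lambda>n. norm (g n * q n) \<le> exp (\<bar>c\<bar> * u) * \<bar>g n * pp n\<bar>) sequentially"
    proof (intro always_eventually allI)
      fix n
      have "0 \<le> exp (\<bar>c\<bar> * u) * pp n" using q[of n] by linarith
      then have pp: "0 \<le> pp n" by (simp add: zero_le_mult_iff)
      have "\<bar>g n\<bar> * q n \<le> \<bar>g n\<bar> * (exp (\<bar>c\<bar> * u) * pp n)" using q by (intro mult_left_mono) auto
      then show "norm (g n * q n) \<le> exp (\<bar>c\<bar> * u) * \<bar>g n * pp n\<bar>"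
        using q(1)[of n] pp by (simp add: abs_mult mult_ac)
    qed
  qed
  have za: "(\<lambda>n. \<phi> (a n) * ra n) \<longlonglongrightarrow> 0" by (rule z[OF r(1,2) la])
  have zb: "(\<lambda>n. \<phi> (b n) * rb n) \<longlonglongrightarrow> 0" by (rule z[OF r(3,4) lb])
  have e1: "?e n = (\<integral>\<omega>. indicator A \<omega> * indicator (SK n) \<omega> * \<psi> (Y (s + u) \<omega>) \<partial>M)" for n
  proof (rule Bochner_Integration.integral_cong[OF refl])
    fix \<omega> assume w: "\<omega> \<in> space M"
    show "indicator (An n) \<omega> * indicator (SK n) \<omega> * \<phi> (Y (s + u) \<omega>) = indicator A \<omega> * indicator (SK n) \<omega> * \<psi> (Y (s + u) \<omega>)"
    proof (cases "\<omega> \<in> SK n")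
      case True
      then have "Y (s + u) \<omega> \<in> K n" "Y s \<omega> \<in> K n" using u by (auto simp: SK_def)
      then have "Y (s + u) \<omega> \<in> I" "\<omega> \<in> An n \<longleftrightarrow> \<omega> \<in> A" using KI w by (auto simp: An_def)
      then show ?thesis using pe by (simp add: indicator_def)
    qed simp
  qed
  have le: "?e \<longlonglongrightarrow> (\<integral>\<omega>. indicator A \<omega> * indicator SI \<omega> * \<psi> (Y (s + u) \<omega>) \<partial>M)"
    unfolding e1
  proof (rule integral_dominated_convergence[where w="\<lambda>_. C"])
    show "AE \<omega> in M. (\<lambda>n. indicator A \<omega> * indicator (SK n) \<omega> * \<psi> (Y (s + u) \<omega>)) \<longlonglongrightarrow> indicator A \<omega> * indicator SI \<omega> * \<psi> (Y (s + u) \<omega>)"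
    proof (rule AE_I2)
      fix \<omega> assume w: "\<omega> \<in> space M"
      have "(\<lambda>n. indicator (SK n) \<omega> :: real) \<longlonglongrightarrow> indicator SI \<omega>"
      proof (cases "\<omega> \<in> SI")
        case True
        then have "\<forall>r\<in>{s..s+u}. Y r \<omega> \<in> I" by (simp add: SI_def)
        from continuous_image_exhaust[OF Yc[OF w] _ ab(2-4) this] u
        obtain n0 where "\<forall>n\<ge>n0. \<forall>r\<in>{s..s+u}. Y r \<omega> \<in> {a n..b n}" by auto
        then have "\<forall>n\<ge>n0. \<omega> \<in> SK n" using w unfolding SK_def K_def by blast
        then have "eventually (\<lambda>n. (indicator (SK n) \<omega> :: real) = indicator SI \<omega>) sequentially"
          using True unfolding eventually_sequentially by (intro exI[of _ n0]) simp
        then show ?thesis by (rule tendsto_eventually)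
      next
        case False
        then have "\<omega> \<notin> SK n" for n using KI by (auto simp: SI_def SK_def)
        then show ?thesis using False by simp
      qed
      then show "(\<lambda>n. indicator A \<omega> * indicator (SK n) \<omega> * \<psi> (Y (s + u) \<omega>)) \<longlonglongrightarrow> indicator A \<omega> * indicator SI \<omega> * \<psi> (Y (s + u) \<omega>)"
        by (intro tendsto_intros)
    qed
    show "AE \<omega> in M. norm (indicator A \<omega> * indicator (SK n) \<omega> * \<psi> (Y (s + u) \<omega>)) \<le> C" for n
      using pC C0 by (intro AE_I2) (auto simp: indicator_def)
  qed (simp_all, measurable)
  have f1: "?f n = (\<integral>\<omega>. indicator A \<omega> * indicator (K n) (Y s \<omega>) * \<psi> (Y s \<omega>) \<partial>M)" for n
  proof (rule Bochner_Integration.integral_cong[OF refl])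
    fix \<omega> assume w: "\<omega> \<in> space M"
    show "indicator (An n) \<omega> * \<phi> (Y s \<omega>) = indicator A \<omega> * indicator (K n) (Y s \<omega>) * \<psi> (Y s \<omega>)"
      using w pe[of "Y s \<omega>"] KI[of n] by (cases "Y s \<omega> \<in> K n") (auto simp: An_def indicator_def)
  qed
  have [measurable]: "K n \<in> sets borel" for n by (simp add: K_def)
  have lf: "?f \<longlonglongrightarrow> (\<integral>\<omega>. indicator A \<omega> * indicator I (Y s \<omega>) * \<psi> (Y s \<omega>) \<partial>M)"
    unfolding f1
  proof (rule integral_dominated_convergence[where w="\<lambda>_. C"])
    show "AE \<omega> in M. (\<lambda>n. indicator A \<omega> * indicator (K n) (Y s \<omega>) * \<psi> (Y s \<omega>)) \<longlonglongrightarrow> indicator A \<omega> * indicator I (Y s \<omega>) * \<psi> (Y s \<omega>)"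
    proof (rule AE_I2)
      fix \<omega> assume w: "\<omega> \<in> space M"
      have "incseq K"
        unfolding K_def
      proof (intro incseq_SucI)
        fix n
        show "{a n..b n} \<subseteq> {a (Suc n)..b (Suc n)}" using decseq_SucD[OF ab(2), of n] incseq_SucD[OF ab(3), of n] by auto
      qed
      from LIMSEQ_indicator_incseq[OF this, of "Y s \<omega>"]
      have "(\<lambda>n. indicator (K n) (Y s \<omega>) :: real) \<longlonglongrightarrow> indicator I (Y s \<omega>)"
        unfolding ab(4)[symmetric] K_def .
      then show "(\<lambda>n. indicator A \<omega> * indicator (K n) (Y s \<omega>) * \<psi> (Y s \<omega>)) \<longlonglongrightarrow> indicator A \<omega> * indicator I (Y s \<omega>) * \<psi> (Y s \<omega>)"
        by (intro tendsto_intros)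
    qed
    show "AE \<omega> in M. norm (indicator A \<omega> * indicator (K n) (Y s \<omega>) * \<psi> (Y s \<omega>)) \<le> C" for n
      using pC C0 by (intro AE_I2) (auto simp: indicator_def)
  qed (simp_all, measurable)
  let ?E = "\<integral>\<omega>. indicator A \<omega> * indicator SI \<omega> * \<psi> (Y (s + u) \<omega>) \<partial>M"
  let ?G = "\<integral>\<omega>. indicator A \<omega> * indicator I (Y s \<omega>) * \<psi> (Y s \<omega>) \<partial>M"
  have "(\<lambda>n. exp (- c * u) * ?e n + \<phi> (a n) * ra n + \<phi> (b n) * rb n - ?f n) \<longlonglongrightarrow> exp (- c * u) * ?E + 0 + 0 - ?G"
    by (intro tendsto_add tendsto_diff tendsto_mult tendsto_const le lf za zb)
  moreover have "(\<lambda>n. exp (- c * u) * ?e n + \<phi> (a n) * ra n + \<phi> (b n) * rb n - ?f n) \<longlonglongrightarrow> 0"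
  proof (rule Lim_null_comparison)
    show "(\<lambda>n. 1 / real (Suc n)) \<longlonglongrightarrow> 0" by real_asymp
  qed (intro always_eventually allI, simp only: real_norm_def r(5))
  ultimately have "exp (- c * u) * ?E + 0 + 0 - ?G = 0" by (rule LIMSEQ_unique)
  then have "?G = exp (- (c * u)) * ?E" by simp
  then have "exp (c * u) * ?G = exp (c * u) * (exp (- (c * u)) * ?E)" by simp
  also have "\<dots> = ?E" unfolding mult.assoc[symmetric] exp_minus_inverse by simp
  finally have EG: "?E = exp (c * u) * ?G" by simp
  have "(\<integral>\<omega>. indicator A \<omega> * indicator SI \<omega> * \<phi> (Y (s + u) \<omega>) \<partial>M) = ?E"
  proof (rule Bochner_Integration.integral_cong[OF refl])
    fix \<omega>
    have "\<omega> \<in> SI \<Longrightarrow> Y (s + u) \<omega> \<in> I" using u by (simp add: SI_def)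
    then show "indicator A \<omega> * indicator SI \<omega> * \<phi> (Y (s + u) \<omega>) = indicator A \<omega> * indicator SI \<omega> * \<psi> (Y (s + u) \<omega>)"
      using pe by (cases "\<omega> \<in> SI") simp_all
  qed
  moreover have "(\<integral>\<omega>. indicator A \<omega> * indicator I (Y s \<omega>) * \<phi> (Y s \<omega>) \<partial>M) = ?G"
    by (rule Bochner_Integration.integral_cong[OF refl]) (use pe in \<open>auto simp: indicator_def\<close>)
  ultimately show ?thesis using EG unfolding SI_def by simp
qed

end

section \<open>Geometric Brownian motion stopped at 1\<close>

text \<open>Fourth central moment of a lognormal variable of mean 1 and log-variance
  \<open>v\<close>, from \<open>E (q^p) = exp (v * p * (p - 1) / 2)\<close>. For small
  \<open>v\<close> it is of order \<open>v^2\<close>.\<close>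

definition m4 :: "real \<Rightarrow> real" where "m4 v = exp (6 * v) - 4 * exp (3 * v) + 6 * exp v - 3"

lemma integral_std_normal_trig:
  shows "(\<integral>x. std_normal_density x * cos (t * x) \<partial>lborel) = exp (- t\<^sup>2 / 2)"
    and "(\<integral>x. std_normal_density x * sin (t * x) \<partial>lborel) = 0"
proof -
  let ?S = "density lborel (\<lambda>x. ennreal (std_normal_density x))"
  interpret S: prob_space ?S by (rule prob_space_normal_density) simp
  have int: "integrable ?S (\<lambda>x. iexp (t * x))"
    by (rule S.integrable_const_bound[where B=1]) auto
  have "char ?S t = complex_of_real (exp (- t\<^sup>2 / 2))"
    using char_std_normal_distribution by (simp add: fun_eq_iff)
  then have c: "(CLINT x|?S. iexp (t * x)) = complex_of_real (exp (- t\<^sup>2 / 2))"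
    by (simp add: char_def)
  have re: "Re (iexp (t * x)) = cos (t * x)" "Im (iexp (t * x)) = sin (t * x)" for x
    by (simp_all add: Re_exp Im_exp)
  have "(\<integral>x. cos (t * x) \<partial>?S) = exp (- t\<^sup>2 / 2)"
    using integral_Re[OF int] unfolding c re by simp
  moreover have "(\<integral>x. sin (t * x) \<partial>?S) = 0"
    using integral_Im[OF int] unfolding c re by simp
  ultimately show "(\<integral>x. std_normal_density x * cos (t * x) \<partial>lborel) = exp (- t\<^sup>2 / 2)"
    "(\<integral>x. std_normal_density x * sin (t * x) \<partial>lborel) = 0"
    by (simp_all add: integral_density)
qed

lemma integrable_std_normal_trig:
  "integrable lborel (\<lambda>x. std_normal_density x * cos (t * x))"
  "integrable lborel (\<lambda>x. std_normal_density x * sin (t * x))"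
proof -
  have i: "integrable lborel std_normal_density" by simp
  show "integrable lborel (\<lambda>x. std_normal_density x * cos (t * x))" "integrable lborel (\<lambda>x. std_normal_density x * sin (t * x))"
    by (rule integrable_mult_bounded[OF i, where C=1]; simp)+
qed

lemma has_bochner_integral_affineI:
  fixes f :: "real \<Rightarrow> real"
  assumes "q > 0" "has_bochner_integral lborel (\<lambda>y. q * f (m + q * y)) v"
  shows "has_bochner_integral lborel f v"
proof -
  have "has_bochner_integral lborel (\<lambda>y. 1 / q * (q * f (m + q * y))) (1 / q * v)"
    by (rule has_bochner_integral_mult_right[OF assms(2)])
  moreover have "(\<lambda>y. 1 / q * (q * f (m + q * y))) = (\<lambda>y. f (m + q * y))" using assms(1) by simp
  moreover have "1 / q * v = v /\<^sub>R \<bar>q\<bar>" using assms(1) by (simp add: divide_inverse)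
  ultimately have "has_bochner_integral lborel (\<lambda>y. f (m + q * y)) (v /\<^sub>R \<bar>q\<bar>)" by simp
  then show ?thesis
    using lborel_has_bochner_integral_real_affine_iff[of q f v m] assms(1) by simp
qed

text \<open>Real and imaginary part of
  \<open>exp ((\<alpha> + i * \<gamma>)^2 * \<tau> / 2)\<close>, the Laplace transform of a centred
  Gaussian of variance \<open>\<tau>\<close> at a complex argument.\<close>

lemma normal_exp_trig:
  assumes "\<tau> > 0"
  shows "has_bochner_integral lborel (\<lambda>x. normal_density 0 (sqrt \<tau>) x * (exp (\<alpha> * x) * cos (\<gamma> * x)))
      (exp ((\<alpha>\<^sup>2 - \<gamma>\<^sup>2) * \<tau> / 2) * cos (\<alpha> * \<gamma> * \<tau>))" (is ?c)
    and "has_bochner_integral lborel (\<lambda>x. normal_density 0 (sqrt \<tau>) x * (exp (\<alpha> * x) * sin (\<gamma> * x)))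
      (exp ((\<alpha>\<^sup>2 - \<gamma>\<^sup>2) * \<tau> / 2) * sin (\<alpha> * \<gamma> * \<tau>))" (is ?s)
proof -
  \<comment> \<open>Completing the square: tilting the density by \<open>exp (\<alpha> * x)\<close>
    moves its mean to \<open>\<alpha> * \<tau>\<close> and leaves the variance as it is.\<close>
  define m where "m = \<alpha> * \<tau>"
  let ?q = "sqrt \<tau>"
  have q: "?q > 0" "?q * ?q = \<tau>" using assms by auto
  have d: "normal_density 0 ?q (m + ?q * y) * exp (\<alpha> * (m + ?q * y)) * ?q = exp (\<alpha>\<^sup>2 * \<tau> / 2) * std_normal_density y" for y
  proof -
    have "- (m + ?q * y)\<^sup>2 / (2 * ?q\<^sup>2) + \<alpha> * (m + ?q * y) = \<alpha>\<^sup>2 * \<tau> / 2 + - y\<^sup>2 / 2"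
    proof -
      have "(m + ?q * y)\<^sup>2 = m\<^sup>2 + 2 * m * ?q * y + \<tau> * y\<^sup>2"
        using q(2) by (simp add: power2_eq_square algebra_simps)
      then show ?thesis using assms by (simp add: m_def field_simps power2_eq_square)
    qed
    then have "exp (- (m + ?q * y)\<^sup>2 / (2 * ?q\<^sup>2)) * exp (\<alpha> * (m + ?q * y)) = exp (\<alpha>\<^sup>2 * \<tau> / 2) * exp (- y\<^sup>2 / 2)"
      unfolding exp_add[symmetric] by simp
    moreover have "1 / sqrt (2 * pi * ?q\<^sup>2) * ?q = 1 / sqrt (2 * pi)"
      using assms by (simp add: real_sqrt_mult)
    ultimately have "(1 / sqrt (2 * pi * ?q\<^sup>2) * ?q) * (exp (- (m + ?q * y)\<^sup>2 / (2 * ?q\<^sup>2)) * exp (\<alpha> * (m + ?q * y)))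
      = 1 / sqrt (2 * pi) * (exp (\<alpha>\<^sup>2 * \<tau> / 2) * exp (- y\<^sup>2 / 2))" by simp
    then show ?thesis unfolding normal_density_def by (simp add: mult_ac)
  qed
  have e0: "exp ((\<alpha>\<^sup>2 - \<gamma>\<^sup>2) * \<tau> / 2) = exp (\<alpha>\<^sup>2 * \<tau> / 2) * exp (- (\<gamma> * ?q)\<^sup>2 / 2)"
    unfolding exp_add[symmetric] using assms by (simp add: power_mult_distrib algebra_simps diff_divide_distrib)
  have gm: "\<gamma> * m = \<alpha> * \<gamma> * \<tau>" by (simp add: m_def)
  have bc: "has_bochner_integral lborel (\<lambda>y. std_normal_density y * cos ((\<gamma> * ?q) * y)) (exp (- (\<gamma> * ?q)\<^sup>2 / 2))"
    and bs: "has_bochner_integral lborel (\<lambda>y. std_normal_density y * sin ((\<gamma> * ?q) * y)) 0"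
    using integral_std_normal_trig integrable_std_normal_trig by (auto simp: has_bochner_integral_iff)
  have "has_bochner_integral lborel (\<lambda>y. exp (\<alpha>\<^sup>2 * \<tau> / 2) * (std_normal_density y * cos ((\<gamma> * ?q) * y) * cos (\<gamma> * m) - std_normal_density y * sin ((\<gamma> * ?q) * y) * sin (\<gamma> * m)))
     (exp (\<alpha>\<^sup>2 * \<tau> / 2) * (exp (- (\<gamma> * ?q)\<^sup>2 / 2) * cos (\<gamma> * m) - 0 * sin (\<gamma> * m)))"
    by (intro has_bochner_integral_mult_right has_bochner_integral_diff has_bochner_integral_mult_left bc bs)
  also have "(\<lambda>y. exp (\<alpha>\<^sup>2 * \<tau> / 2) * (std_normal_density y * cos ((\<gamma> * ?q) * y) * cos (\<gamma> * m) - std_normal_density y * sin ((\<gamma> * ?q) * y) * sin (\<gamma> * m)))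
    = (\<lambda>y. ?q * (normal_density 0 ?q (m + ?q * y) * (exp (\<alpha> * (m + ?q * y)) * cos (\<gamma> * (m + ?q * y)))))"
  proof
    fix y
    have cc: "cos (\<gamma> * (m + ?q * y)) = cos ((\<gamma> * ?q) * y) * cos (\<gamma> * m) - sin ((\<gamma> * ?q) * y) * sin (\<gamma> * m)"
      unfolding cos_add[symmetric] by (simp add: algebra_simps)
    have "exp (\<alpha>\<^sup>2 * \<tau> / 2) * (std_normal_density y * cos ((\<gamma> * ?q) * y) * cos (\<gamma> * m) - std_normal_density y * sin ((\<gamma> * ?q) * y) * sin (\<gamma> * m))
      = (exp (\<alpha>\<^sup>2 * \<tau> / 2) * std_normal_density y) * cos (\<gamma> * (m + ?q * y))" unfolding cc by (simp only: right_diff_distrib distrib_left mult_ac)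
    then show "exp (\<alpha>\<^sup>2 * \<tau> / 2) * (std_normal_density y * cos ((\<gamma> * ?q) * y) * cos (\<gamma> * m) - std_normal_density y * sin ((\<gamma> * ?q) * y) * sin (\<gamma> * m))
      = ?q * (normal_density 0 ?q (m + ?q * y) * (exp (\<alpha> * (m + ?q * y)) * cos (\<gamma> * (m + ?q * y))))"
      unfolding d[symmetric] by (simp only: mult_ac)
  qed
  finally have "has_bochner_integral lborel (\<lambda>y. ?q * (normal_density 0 ?q (m + ?q * y) * (exp (\<alpha> * (m + ?q * y)) * cos (\<gamma> * (m + ?q * y)))))
     (exp ((\<alpha>\<^sup>2 - \<gamma>\<^sup>2) * \<tau> / 2) * cos (\<alpha> * \<gamma> * \<tau>))"
    unfolding gm e0 by (simp add: mult_ac)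
  then show ?c
    by (rule has_bochner_integral_affineI[OF q(1), where f="\<lambda>x. normal_density 0 ?q x * (exp (\<alpha> * x) * cos (\<gamma> * x))"])
  have "has_bochner_integral lborel (\<lambda>y. exp (\<alpha>\<^sup>2 * \<tau> / 2) * (std_normal_density y * sin ((\<gamma> * ?q) * y) * cos (\<gamma> * m) + std_normal_density y * cos ((\<gamma> * ?q) * y) * sin (\<gamma> * m)))
     (exp (\<alpha>\<^sup>2 * \<tau> / 2) * (0 * cos (\<gamma> * m) + exp (- (\<gamma> * ?q)\<^sup>2 / 2) * sin (\<gamma> * m)))"
    by (intro has_bochner_integral_mult_right has_bochner_integral_add has_bochner_integral_mult_left bc bs)
  also have "(\<lambda>y. exp (\<alpha>\<^sup>2 * \<tau> / 2) * (std_normal_density y * sin ((\<gamma> * ?q) * y) * cos (\<gamma> * m) + std_normal_density y * cos ((\<gamma> * ?q) * y) * sin (\<gamma> * m)))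
    = (\<lambda>y. ?q * (normal_density 0 ?q (m + ?q * y) * (exp (\<alpha> * (m + ?q * y)) * sin (\<gamma> * (m + ?q * y)))))"
  proof
    fix y
    have cc: "sin (\<gamma> * (m + ?q * y)) = sin ((\<gamma> * ?q) * y) * cos (\<gamma> * m) + cos ((\<gamma> * ?q) * y) * sin (\<gamma> * m)"
      unfolding sin_add[symmetric] by (simp add: algebra_simps)
    have "exp (\<alpha>\<^sup>2 * \<tau> / 2) * (std_normal_density y * sin ((\<gamma> * ?q) * y) * cos (\<gamma> * m) + std_normal_density y * cos ((\<gamma> * ?q) * y) * sin (\<gamma> * m))
      = (exp (\<alpha>\<^sup>2 * \<tau> / 2) * std_normal_density y) * sin (\<gamma> * (m + ?q * y))" unfolding cc by (simp only: right_diff_distrib distrib_left mult_ac)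
    then show "exp (\<alpha>\<^sup>2 * \<tau> / 2) * (std_normal_density y * sin ((\<gamma> * ?q) * y) * cos (\<gamma> * m) + std_normal_density y * cos ((\<gamma> * ?q) * y) * sin (\<gamma> * m))
      = ?q * (normal_density 0 ?q (m + ?q * y) * (exp (\<alpha> * (m + ?q * y)) * sin (\<gamma> * (m + ?q * y))))"
      unfolding d[symmetric] by (simp only: mult_ac)
  qed
  finally have "has_bochner_integral lborel (\<lambda>y. ?q * (normal_density 0 ?q (m + ?q * y) * (exp (\<alpha> * (m + ?q * y)) * sin (\<gamma> * (m + ?q * y)))))
     (exp ((\<alpha>\<^sup>2 - \<gamma>\<^sup>2) * \<tau> / 2) * sin (\<alpha> * \<gamma> * \<tau>))"
    unfolding gm e0 by (simp add: mult_ac)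
  then show ?s
    by (rule has_bochner_integral_affineI[OF q(1), where f="\<lambda>x. normal_density 0 ?q x * (exp (\<alpha> * x) * sin (\<gamma> * x))"])
qed

context brownian begin

lemma exp_trig_inc:
  assumes "0 \<le> s" "s < t"
  shows "has_bochner_integral M (\<lambda>\<omega>. exp (\<alpha> * (B t \<omega> - B s \<omega>)) * cos (\<gamma> * (B t \<omega> - B s \<omega>)))
      (exp ((\<alpha>\<^sup>2 - \<gamma>\<^sup>2) * (t - s) / 2) * cos (\<alpha> * \<gamma> * (t - s)))"
    and "has_bochner_integral M (\<lambda>\<omega>. exp (\<alpha> * (B t \<omega> - B s \<omega>)) * sin (\<gamma> * (B t \<omega> - B s \<omega>)))
      (exp ((\<alpha>\<^sup>2 - \<gamma>\<^sup>2) * (t - s) / 2) * sin (\<alpha> * \<gamma> * (t - s)))"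
proof -
  have D: "distributed M lborel (\<lambda>\<omega>. B t \<omega> - B s \<omega>) (normal_density 0 (sqrt (t - s)))" by (rule inc_dist[OF assms])
  have tr: "has_bochner_integral M (\<lambda>\<omega>. g (B t \<omega> - B s \<omega>)) v"
    if "g \<in> borel_measurable borel" "has_bochner_integral lborel (\<lambda>x. normal_density 0 (sqrt (t - s)) x * g x) v" for g v
    using distributed_integral[OF D, of g] distributed_integrable[OF D, of g] that by (auto simp: has_bochner_integral_iff)
  show "has_bochner_integral M (\<lambda>\<omega>. exp (\<alpha> * (B t \<omega> - B s \<omega>)) * cos (\<gamma> * (B t \<omega> - B s \<omega>)))
      (exp ((\<alpha>\<^sup>2 - \<gamma>\<^sup>2) * (t - s) / 2) * cos (\<alpha> * \<gamma> * (t - s)))"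
    by (rule tr[OF _ normal_exp_trig(1)]) (use assms in auto)
  show "has_bochner_integral M (\<lambda>\<omega>. exp (\<alpha> * (B t \<omega> - B s \<omega>)) * sin (\<gamma> * (B t \<omega> - B s \<omega>)))
      (exp ((\<alpha>\<^sup>2 - \<gamma>\<^sup>2) * (t - s) / 2) * sin (\<alpha> * \<gamma> * (t - s)))"
    by (rule tr[OF _ normal_exp_trig(2)]) (use assms in auto)
qed

lemma exp_inc:
  assumes "0 \<le> s" "s < t"
  shows "has_bochner_integral M (\<lambda>\<omega>. exp (\<alpha> * (B t \<omega> - B s \<omega>))) (exp (\<alpha>\<^sup>2 * (t - s) / 2))"
  using exp_trig_inc(1)[OF assms, of \<alpha> 0] by simp

definition qe :: "real \<Rightarrow> real \<Rightarrow> real \<Rightarrow> 'a \<Rightarrow> real" where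
  "qe \<sigma> s t \<omega> = exp (\<sigma> * (B t \<omega> - B s \<omega>) - \<sigma>\<^sup>2 * (t - s) / 2)"

lemma qe_power:
  assumes "0 \<le> s" "s < t"
  shows "has_bochner_integral M (\<lambda>\<omega>. qe \<sigma> s t \<omega> ^ p) (exp (\<sigma>\<^sup>2 * (t - s) * (real p * (real p - 1) / 2)))"
proof -
  have "qe \<sigma> s t \<omega> ^ p = exp (- (real p * \<sigma>\<^sup>2 * (t - s) / 2)) * exp ((real p * \<sigma>) * (B t \<omega> - B s \<omega>))" for \<omega>
    unfolding qe_def exp_of_nat_mult[symmetric] exp_add[symmetric] by (simp add: algebra_simps)
  moreover have "exp (\<sigma>\<^sup>2 * (t - s) * (real p * (real p - 1) / 2)) = exp (- (real p * \<sigma>\<^sup>2 * (t - s) / 2)) * exp ((real p * \<sigma>)\<^sup>2 * (t - s) / 2)"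
    unfolding exp_add[symmetric] by (simp add: field_simps power2_eq_square)
  ultimately show ?thesis
    using has_bochner_integral_mult_right[OF exp_inc[OF assms, of "real p * \<sigma>"], of "exp (- (real p * \<sigma>\<^sup>2 * (t - s) / 2))"] by simp
qed

lemma qe_fourth:
  assumes "0 \<le> s" "s < t"
  shows "has_bochner_integral M (\<lambda>\<omega>. (qe \<sigma> s t \<omega> - 1) ^ 4) (m4 (\<sigma>\<^sup>2 * (t - s)))"
proof -
  have e: "(qe \<sigma> s t \<omega> - 1) ^ 4 = qe \<sigma> s t \<omega> ^ 4 - 4 * qe \<sigma> s t \<omega> ^ 3 + 6 * qe \<sigma> s t \<omega> ^ 2 - 4 * qe \<sigma> s t \<omega> ^ 1 + qe \<sigma> s t \<omega> ^ 0" for \<omega>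
    by (simp add: eval_nat_numeral algebra_simps)
  let ?v = "\<sigma>\<^sup>2 * (t - s)"
  let ?x = "exp (?v * (real 4 * (real 4 - 1) / 2)) - 4 * exp (?v * (real 3 * (real 3 - 1) / 2)) + 6 * exp (?v * (real 2 * (real 2 - 1) / 2))
       - 4 * exp (?v * (real 1 * (real 1 - 1) / 2)) + exp (?v * (real 0 * (real 0 - 1) / 2))"
  have x: "?x = m4 ?v" by (simp add: m4_def mult.commute)
  have "has_bochner_integral M (\<lambda>\<omega>. (qe \<sigma> s t \<omega> - 1) ^ 4) ?x"
    unfolding e by (intro has_bochner_integral_add has_bochner_integral_diff has_bochner_integral_mult_right qe_power[OF assms])
  then show ?thesis unfolding x .
qed

end

lemma m4_limit:
  fixes N :: "nat \<Rightarrow> nat"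
  assumes "filterlim N at_top sequentially"
  shows "(\<lambda>L. real (N L) * m4 (\<kappa> * (u / real (N L)))) \<longlonglongrightarrow> 0"
proof -
  have "(\<lambda>n. real n * m4 (x / real n)) \<longlonglongrightarrow> 0" for x
    unfolding m4_def by real_asymp
  from filterlim_compose[OF this[of "\<kappa> * u"] assms] show ?thesis by simp
qed

lemma le_add_pow4:
  fixes x \<eta> :: real
  assumes "0 \<le> x" "\<eta> > 0" shows "x \<le> \<eta> + x^4 / \<eta>^3"
proof (cases "x \<le> \<eta>")
  case True
  have "0 \<le> x^4 / \<eta>^3" using assms by simp
  then show ?thesis using True by linarith
next
  case False
  then have "x * \<eta>^3 \<le> x * x^3" using assms by (intro mult_left_mono power_mono) auto
  then have "x \<le> x^4 / \<eta>^3" using assms by (simp add: pos_le_divide_eq eval_nat_numeral)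
  then show ?thesis using assms by linarith
qed

text \<open>Before the step \<open>z\<close> is at least \<open>\<epsilon>\<close> away from 1. If
  the step stops short of 1, its end is within \<open>\<epsilon>\<close> of 1; if it passes 1, the
  overshoot is at most \<open>\<bar>q - 1\<bar>\<close>, that of a step starting from 1
  itself.\<close>

lemma crossing_bound:
  fixes z q z0 \<epsilon> :: real
  assumes "q > 0" "z * z0 > 0" "sgn (1 - z0) * (1 - z) \<ge> \<epsilon>" "\<epsilon> > 0" "sgn (1 - z0) * (1 - z * q) < \<epsilon>"
  shows "\<bar>1 - z * q\<bar> \<le> \<epsilon> + \<bar>q - 1\<bar>"
proof -
  consider "z0 < 1" | "z0 > 1" | "z0 = 1" by linarith
  then show ?thesis
  proof cases
    case 1
    then have a: "1 - z \<ge> \<epsilon>" "1 - z * q < \<epsilon>" using assms by auto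
    show ?thesis
    proof (cases "z * q \<le> 1")
      case True then show ?thesis using a by linarith
    next
      case False
      have "z < 1" using a assms by linarith
      then have "z * q \<le> 1 * q" using assms by (intro mult_right_mono) auto
      then show ?thesis using False assms by linarith
    qed
  next
    case 2
    then have a: "z - 1 \<ge> \<epsilon>" "z * q - 1 < \<epsilon>" using assms by auto
    show ?thesis
    proof (cases "z * q \<ge> 1")
      case True then show ?thesis using a by linarith
    next
      case False
      have "z > 1" using a assms by linarith
      then have "z * q \<ge> 1 * q" using assms by (intro mult_right_mono) auto
      then show ?thesis using False assms by linarith
    qed
  next
    case 3 then show ?thesis using assms by simp
  qed
qed

text \<open>Real form, with phase \<open>\<kappa>\<close>, of the power \<open>\<bar>z\<bar>\<close>
  to the exponent \<open>1/2 + i * \<theta>\<close>. Powers are eigenfunctions of the generator of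
  geometric Brownian motion.\<close>

definition trig_mode :: "real \<Rightarrow> real \<Rightarrow> real \<Rightarrow> real" where
  "trig_mode \<theta> \<kappa> z = sqrt \<bar>z\<bar> * cos (\<theta> * ln \<bar>z\<bar> + \<kappa>)"

context brownian begin

lemma gbm_meas: "0 \<le> t \<Longrightarrow> gbm z0 \<sigma> B t \<in> borel_measurable (F t)"
proof -
  assume "0 \<le> t"
  note [measurable] = B_meas[OF this]
  show ?thesis unfolding gbm_def[abs_def] by measurable
qed

lemma gbm_cont: "\<omega> \<in> space M \<Longrightarrow> continuous_on {0..} (\<lambda>t. gbm z0 \<sigma> B t \<omega>)"
  unfolding gbm_def by (intro continuous_intros B_cont) auto

lemma gbm_step: "gbm z0 \<sigma> B t \<omega> = gbm z0 \<sigma> B s \<omega> * qe \<sigma> s t \<omega>"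
proof -
  have "\<sigma> * B t \<omega> - \<sigma>\<^sup>2 * t / 2 = (\<sigma> * B s \<omega> - \<sigma>\<^sup>2 * s / 2) + (\<sigma> * (B t \<omega> - B s \<omega>) - \<sigma>\<^sup>2 * (t - s) / 2)"
    by (simp add: algebra_simps diff_divide_distrib)
  then show ?thesis unfolding gbm_def qe_def by (simp only: exp_add mult.assoc)
qed

lemma qe_pos: "qe \<sigma> s t \<omega> > 0" by (simp add: qe_def)

lemma gbm_0: "\<omega> \<in> space M \<Longrightarrow> gbm z0 \<sigma> B 0 \<omega> = z0" by (simp add: gbm_def B_0)

lemma gbm_sign:
  assumes "z0 \<noteq> 0" shows "gbm z0 \<sigma> B t \<omega> * z0 > 0"
proof -
  have "z0 * z0 > 0" using assms not_real_square_gt_zero by blast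
  then have "(z0 * z0) * exp (\<sigma> * B t \<omega> - \<sigma>\<^sup>2 * t / 2) > 0" by (rule mult_pos_pos) simp
  then show ?thesis unfolding gbm_def by (simp only: mult_ac)
qed

lemma gbm_nonzero: "z0 \<noteq> 0 \<Longrightarrow> gbm z0 \<sigma> B t \<omega> \<noteq> 0" by (simp add: gbm_def)

lemma gbm_integrable:
  assumes "0 \<le> t" shows "integrable M (gbm z0 \<sigma> B t)"
proof (cases "t = 0")
  case True
  have "integrable M (gbm z0 \<sigma> B 0) \<longleftrightarrow> integrable M (\<lambda>_. z0)"
    by (rule Bochner_Integration.integrable_cong) (auto simp: gbm_0)
  then show ?thesis using True by simp
next
  case False
  then have t: "0 < t" using assms by simp
  have "integrable M (\<lambda>\<omega>. z0 * qe \<sigma> 0 t \<omega> ^ 1)"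
    using qe_power[OF order_refl t, of \<sigma> 1] by (intro integrable_mult_right) (simp add: has_bochner_integral_iff)
  moreover have "integrable M (\<lambda>\<omega>. z0 * qe \<sigma> 0 t \<omega> ^ 1) \<longleftrightarrow> integrable M (gbm z0 \<sigma> B t)"
    by (rule Bochner_Integration.integrable_cong) (auto simp: gbm_step[of z0 \<sigma> t _ 0] gbm_0)
  ultimately show ?thesis by simp
qed

text \<open>The martingale property of \<open>exp (- c * t) * w (Z t)\<close>, expressed through
  integrals over past events in place of conditional expectations.\<close>

definition eigen_mart :: "real \<Rightarrow> real \<Rightarrow> (real \<Rightarrow> real) \<Rightarrow> real \<Rightarrow> bool" where
  "eigen_mart z0 \<sigma> w c \<longleftrightarrow> w \<in> borel_measurable borel \<and> (\<forall>s t A. 0 \<le> s \<longrightarrow> s < t \<longrightarrow> A \<in> sets (F s) \<longrightarrow>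
     (\<integral>\<omega>. indicator A \<omega> * w (gbm z0 \<sigma> B t \<omega>) \<partial>M) = exp (c * (t - s)) * (\<integral>\<omega>. indicator A \<omega> * w (gbm z0 \<sigma> B s \<omega>) \<partial>M))"

lemma eigen_mart_linear: "eigen_mart z0 \<sigma> (\<lambda>z. 1 - z) 0"
  unfolding eigen_mart_def
proof (intro conjI allI impI)
  fix s t A assume s: "0 \<le> s" "s < t" and A: "A \<in> sets (F s)"
  let ?Z = "gbm z0 \<sigma> B"
  have [measurable]: "A \<in> events" by (rule F_sets_M[OF A s(1)])
  let ?g = "\<lambda>\<omega>. ?Z s \<omega> * indicator A \<omega>"
  have gF: "?g \<in> borel_measurable (F s)" using gbm_meas[OF s(1)] A by (intro borel_measurable_times borel_measurable_indicator)
  have gi: "integrable M ?g" using gbm_integrable[OF s(1)] by (intro integrable_mult_bounded[where C=1]) auto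
  have f: "(\<lambda>x. exp (\<sigma> * x - \<sigma>\<^sup>2 * (t - s) / 2)) \<in> borel_measurable borel" by measurable
  have q: "has_bochner_integral M (\<lambda>\<omega>. exp (\<sigma> * (B t \<omega> - B s \<omega>) - \<sigma>\<^sup>2 * (t - s) / 2)) 1"
    using qe_power[OF s, of \<sigma> 1] by (simp add: qe_def[abs_def])
  have e: "(\<integral>\<omega>. ?g \<omega> * qe \<sigma> s t \<omega> \<partial>M) = (\<integral>\<omega>. ?g \<omega> \<partial>M)" "integrable M (\<lambda>\<omega>. ?g \<omega> * qe \<sigma> s t \<omega>)"
    using inc_mult_integral[OF s gF f gi] inc_mult_integrable[OF s gF f gi] q by (auto simp: qe_def has_bochner_integral_iff)
  have "(\<integral>\<omega>. indicator A \<omega> * (1 - ?Z t \<omega>) \<partial>M) = (\<integral>\<omega>. indicator A \<omega> - ?g \<omega> * qe \<sigma> s t \<omega> \<partial>M)"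
    unfolding gbm_step[of z0 \<sigma> t _ s] by (rule Bochner_Integration.integral_cong) (auto simp: algebra_simps)
  also have "\<dots> = (\<integral>\<omega>. indicator A \<omega> - ?g \<omega> \<partial>M)"
    using e gi by simp
  also have "\<dots> = (\<integral>\<omega>. indicator A \<omega> * (1 - ?Z s \<omega>) \<partial>M)"
    by (rule Bochner_Integration.integral_cong) (auto simp: algebra_simps)
  finally show "(\<integral>\<omega>. indicator A \<omega> * (1 - ?Z t \<omega>) \<partial>M) = exp (0 * (t - s)) * (\<integral>\<omega>. indicator A \<omega> * (1 - ?Z s \<omega>) \<partial>M)"
    by simp
qed measurable

text \<open>\<open>Z t\<close> is \<open>Z s\<close> times a function of an independent increment,
  so the addition theorem for the cosine splits the mode into two products of a past factor and an
  increment factor. The increment factors have Gaussian means \<open>K * cos \<beta>\<close> and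
  \<open>K * sin \<beta>\<close>, and the addition theorem reassembles the mode at time
  \<open>s\<close>.\<close>

lemma eigen_mart_trig:
  assumes z0: "z0 \<noteq> 0"
  shows "eigen_mart z0 \<sigma> (trig_mode \<theta> \<kappa>) (- (1/4 + \<theta>\<^sup>2) * \<sigma>\<^sup>2 / 2)"
  unfolding eigen_mart_def
proof (intro conjI allI impI)
  show "trig_mode \<theta> \<kappa> \<in> borel_measurable borel" unfolding trig_mode_def[abs_def] by measurable
  fix s t A assume s: "0 \<le> s" "s < t" and A: "A \<in> sets (F s)"
  let ?Z = "gbm z0 \<sigma> B"
  define \<tau> where "\<tau> = t - s"
  have Am[measurable]: "A \<in> events" by (rule F_sets_M[OF A s(1)])
  have ZF[measurable]: "?Z s \<in> borel_measurable (F s)" by (rule gbm_meas[OF s(1)])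
  have ZM[measurable]: "?Z s \<in> borel_measurable M" by (rule F_M[OF ZF s(1)])
  note A[measurable]
  \<comment> \<open>The drift \<open>- \<sigma>\<^sup>2 / 2\<close> of
    \<open>ln \<bar>Z\<bar>\<close> shifts the phase by
    \<open>- \<theta> * \<sigma>\<^sup>2 * \<tau> / 2\<close>. The angle \<open>\<beta>\<close>
    produced by the Gaussian integral is exactly the opposite, so the phase at time \<open>s\<close>
    comes out unshifted.\<close>
  define ph where "ph = (\<lambda>\<omega>. \<theta> * (ln \<bar>?Z s \<omega>\<bar> - \<sigma>\<^sup>2 * \<tau> / 2) + \<kappa>)"
  define gc where "gc = (\<lambda>\<omega>. sqrt \<bar>?Z s \<omega>\<bar> * (cos (ph \<omega>) * indicator A \<omega>))"
  define gs where "gs = (\<lambda>\<omega>. sqrt \<bar>?Z s \<omega>\<bar> * (sin (ph \<omega>) * indicator A \<omega>))"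
  have gF: "gc \<in> borel_measurable (F s)" "gs \<in> borel_measurable (F s)" unfolding gc_def gs_def ph_def by measurable
  have sq: "integrable M (\<lambda>\<omega>. sqrt \<bar>?Z s \<omega>\<bar>)"
  proof (rule Bochner_Integration.integrable_bound)
    show "integrable M (\<lambda>\<omega>. 1 + \<bar>?Z s \<omega>\<bar>)" using gbm_integrable[OF s(1)] by auto
    show "AE \<omega> in M. norm (sqrt \<bar>?Z s \<omega>\<bar>) \<le> norm (1 + \<bar>?Z s \<omega>\<bar>)"
    proof (rule AE_I2)
      fix \<omega>
      have "sqrt \<bar>?Z s \<omega>\<bar> \<le> 1 + \<bar>?Z s \<omega>\<bar>"
        by (rule real_le_lsqrt) (simp_all add: power2_eq_square algebra_simps)
      then show "norm (sqrt \<bar>?Z s \<omega>\<bar>) \<le> norm (1 + \<bar>?Z s \<omega>\<bar>)" by simp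
    qed
  qed measurable
  have gi: "integrable M gc" "integrable M gs"
    unfolding gc_def gs_def ph_def by (intro integrable_mult_bounded[where C=1] sq; auto simp: indicator_def)+
  define fc where "fc = (\<lambda>x. exp (\<sigma> / 2 * x) * cos (\<theta> * \<sigma> * x))"
  define fs where "fs = (\<lambda>x. exp (\<sigma> / 2 * x) * sin (\<theta> * \<sigma> * x))"
  have f: "fc \<in> borel_measurable borel" "fs \<in> borel_measurable borel" unfolding fc_def fs_def by measurable
  define K where "K = exp (((\<sigma> / 2)\<^sup>2 - (\<theta> * \<sigma>)\<^sup>2) * \<tau> / 2)"
  define \<beta> where "\<beta> = \<sigma> / 2 * (\<theta> * \<sigma>) * \<tau>"
  have hc: "has_bochner_integral M (\<lambda>\<omega>. fc (B t \<omega> - B s \<omega>)) (K * cos \<beta>)"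
    and hs: "has_bochner_integral M (\<lambda>\<omega>. fs (B t \<omega> - B s \<omega>)) (K * sin \<beta>)"
    unfolding fc_def fs_def K_def \<beta>_def \<tau>_def by (rule exp_trig_inc[OF s])+
  have ic: "integrable M (\<lambda>\<omega>. fc (B t \<omega> - B s \<omega>))" "(\<integral>\<omega>. fc (B t \<omega> - B s \<omega>) \<partial>M) = K * cos \<beta>"
    and isn: "integrable M (\<lambda>\<omega>. fs (B t \<omega> - B s \<omega>))" "(\<integral>\<omega>. fs (B t \<omega> - B s \<omega>) \<partial>M) = K * sin \<beta>"
    using hc hs by (auto simp: has_bochner_integral_iff)
  have wt: "indicator A \<omega> * trig_mode \<theta> \<kappa> (?Z t \<omega>) = exp (- \<sigma>\<^sup>2 * \<tau> / 4) * (gc \<omega> * fc (B t \<omega> - B s \<omega>) - gs \<omega> * fs (B t \<omega> - B s \<omega>))" for \<omega>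
  proof -
    let ?x = "B t \<omega> - B s \<omega>"
    have Z: "\<bar>?Z t \<omega>\<bar> = \<bar>?Z s \<omega>\<bar> * exp (\<sigma> * ?x - \<sigma>\<^sup>2 * \<tau> / 2)"
      unfolding gbm_step[of z0 \<sigma> t \<omega> s] qe_def \<tau>_def by (simp add: abs_mult)
    have n: "\<bar>?Z s \<omega>\<bar> > 0" using gbm_nonzero[OF z0] by simp
    have lnZ: "ln \<bar>?Z t \<omega>\<bar> = ln \<bar>?Z s \<omega>\<bar> + (\<sigma> * ?x - \<sigma>\<^sup>2 * \<tau> / 2)"
      unfolding Z using n by (simp add: ln_mult)
    have "sqrt (exp (\<sigma> * ?x - \<sigma>\<^sup>2 * \<tau> / 2)) = exp ((\<sigma> * ?x - \<sigma>\<^sup>2 * \<tau> / 2) / 2)"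
      by (rule real_sqrt_unique) (simp_all add: power2_eq_square flip: exp_add)
    also have "\<dots> = exp (- \<sigma>\<^sup>2 * \<tau> / 4) * exp (\<sigma> / 2 * ?x)"
      unfolding exp_add[symmetric] by (simp add: field_simps)
    finally have sqZ: "sqrt \<bar>?Z t \<omega>\<bar> = sqrt \<bar>?Z s \<omega>\<bar> * (exp (- \<sigma>\<^sup>2 * \<tau> / 4) * exp (\<sigma> / 2 * ?x))"
      unfolding Z by (simp add: real_sqrt_mult)
    have "\<theta> * ln \<bar>?Z t \<omega>\<bar> + \<kappa> = ph \<omega> + \<theta> * \<sigma> * ?x" unfolding lnZ ph_def by (simp add: algebra_simps)
    then have co: "cos (\<theta> * ln \<bar>?Z t \<omega>\<bar> + \<kappa>) = cos (ph \<omega>) * cos (\<theta> * \<sigma> * ?x) - sin (ph \<omega>) * sin (\<theta> * \<sigma> * ?x)"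
      by (simp only: cos_add)
    show ?thesis unfolding trig_mode_def sqZ co gc_def gs_def fc_def fs_def
      by (simp only: right_diff_distrib left_diff_distrib mult_ac)
  qed
  have ws: "gc \<omega> * cos \<beta> - gs \<omega> * sin \<beta> = indicator A \<omega> * trig_mode \<theta> \<kappa> (?Z s \<omega>)" for \<omega>
  proof -
    have "\<theta> * ln \<bar>?Z s \<omega>\<bar> + \<kappa> = ph \<omega> + \<beta>" unfolding ph_def \<beta>_def by (simp add: field_simps power2_eq_square)
    then have co: "cos (\<theta> * ln \<bar>?Z s \<omega>\<bar> + \<kappa>) = cos (ph \<omega>) * cos \<beta> - sin (ph \<omega>) * sin \<beta>" by (simp only: cos_add)
    show ?thesis unfolding trig_mode_def co gc_def gs_def
      by (simp only: right_diff_distrib left_diff_distrib mult_ac)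
  qed
  have "(\<integral>\<omega>. indicator A \<omega> * trig_mode \<theta> \<kappa> (?Z t \<omega>) \<partial>M)
    = exp (- \<sigma>\<^sup>2 * \<tau> / 4) * ((\<integral>\<omega>. gc \<omega> * fc (B t \<omega> - B s \<omega>) \<partial>M) - (\<integral>\<omega>. gs \<omega> * fs (B t \<omega> - B s \<omega>) \<partial>M))"
    unfolding wt using inc_mult_integrable[OF s gF(1) f(1) gi(1) ic(1)] inc_mult_integrable[OF s gF(2) f(2) gi(2) isn(1)] by simp
  also have "\<dots> = exp (- \<sigma>\<^sup>2 * \<tau> / 4) * ((\<integral>\<omega>. gc \<omega> \<partial>M) * (K * cos \<beta>) - (\<integral>\<omega>. gs \<omega> \<partial>M) * (K * sin \<beta>))"
    unfolding inc_mult_integral[OF s gF(1) f(1) gi(1) ic(1)] inc_mult_integral[OF s gF(2) f(2) gi(2) isn(1)] ic(2) isn(2) ..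
  also have "\<dots> = (exp (- \<sigma>\<^sup>2 * \<tau> / 4) * K) * ((\<integral>\<omega>. gc \<omega> \<partial>M) * cos \<beta> - (\<integral>\<omega>. gs \<omega> \<partial>M) * sin \<beta>)"
    by (simp only: right_diff_distrib left_diff_distrib mult_ac)
  also have "(\<integral>\<omega>. gc \<omega> \<partial>M) * cos \<beta> - (\<integral>\<omega>. gs \<omega> \<partial>M) * sin \<beta> = (\<integral>\<omega>. gc \<omega> * cos \<beta> - gs \<omega> * sin \<beta> \<partial>M)"
    using gi by simp
  also have "\<dots> = (\<integral>\<omega>. indicator A \<omega> * trig_mode \<theta> \<kappa> (?Z s \<omega>) \<partial>M)" unfolding ws ..
  also have "exp (- \<sigma>\<^sup>2 * \<tau> / 4) * K = exp (- (1/4 + \<theta>\<^sup>2) * \<sigma>\<^sup>2 / 2 * (t - s))"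
    unfolding K_def exp_add[symmetric] \<tau>_def[symmetric] by (simp add: field_simps power2_eq_square)
  finally show "(\<integral>\<omega>. indicator A \<omega> * trig_mode \<theta> \<kappa> (?Z t \<omega>) \<partial>M)
    = exp (- (1/4 + \<theta>\<^sup>2) * \<sigma>\<^sup>2 / 2 * (t - s)) * (\<integral>\<omega>. indicator A \<omega> * trig_mode \<theta> \<kappa> (?Z s \<omega>) \<partial>M)" .
qed

end

section \<open>Killing geometric Brownian motion at 1\<close>

lemma drift_algebra:
  fixes E C a p q r m :: real
  shows "E * (C * (a * (p - q) + real k * m)) + E * (C * (a * (q - r) + m)) = E * (C * (a * (p - r) + real (Suc k) * m))"
  by (simp add: algebra_simps)

context brownian begin

context
  fixes z0 \<sigma> c C s u :: real and w :: "real \<Rightarrow> real" and A :: "'a set"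
  assumes z0: "z0 \<noteq> 0" "z0 \<noteq> 1" and em: "eigen_mart z0 \<sigma> w c"
    and wC: "\<And>z. z * z0 > 0 \<Longrightarrow> \<bar>w z\<bar> \<le> C * \<bar>1 - z\<bar>" and C: "0 \<le> C"
    and s: "0 \<le> s" and u: "0 < u" and A: "A \<in> sets (F s)"
begin

abbreviation "Z \<equiv> gbm z0 \<sigma> B"

text \<open>The distance from 1 with a sign that makes the side of the starting point positive, so
  that both positions of \<open>z0\<close> relative to 1 are treated together.\<close>

definition "side z = sgn (1 - z0) * (1 - z)"

lemma w_meas: "w \<in> borel_measurable borel" using em by (simp add: eigen_mart_def)

lemma side_meas[measurable]: "side \<in> borel_measurable borel" unfolding side_def[abs_def] by measurable

lemma Z_M: "0 \<le> t \<Longrightarrow> Z t \<in> borel_measurable M" by (rule F_M[OF gbm_meas])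

lemma wZ_M: "0 \<le> t \<Longrightarrow> (\<lambda>\<omega>. w (Z t \<omega>)) \<in> borel_measurable M"
  by (rule measurable_compose[OF Z_M w_meas])

lemma wZ_bound: "\<bar>w (Z t \<omega>)\<bar> \<le> C * \<bar>1 - Z t \<omega>\<bar>" by (rule wC[OF gbm_sign[OF z0(1)]])

lemma dom_int: "0 \<le> t \<Longrightarrow> integrable M (\<lambda>\<omega>. C * \<bar>1 - Z t \<omega>\<bar>)"
  using gbm_integrable by (intro integrable_mult_right integrable_abs Bochner_Integration.integrable_diff) auto

lemma wZ_int: assumes "0 \<le> t" shows "integrable M (\<lambda>\<omega>. w (Z t \<omega>))"
  by (rule Bochner_Integration.integrable_bound[OF dom_int[OF assms] wZ_M[OF assms]])
    (use wZ_bound C in \<open>simp add: abs_mult\<close>)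

lemma indwZ_int: assumes "0 \<le> t" "H \<in> events" shows "integrable M (\<lambda>\<omega>. indicator H \<omega> * w (Z t \<omega>))"
  using integrable_mult_bounded[OF wZ_int[OF assms(1)], of "indicator H" 1] assms(2) by (simp add: mult.commute indicator_def)

context
  fixes N :: nat and \<epsilon> :: real
  assumes N: "N > 0" and \<epsilon>: "\<epsilon> > 0"
begin

abbreviation "dl \<equiv> u / real N"
definition "tp j = s + real j * dl"
definition "HH k = {\<omega>\<in>space M. \<forall>j\<in>{..k}. side (Z (tp j) \<omega>) \<in> {\<epsilon>..}}"

lemma dl: "0 < dl" using u N by simp
lemma tp0: "0 \<le> tp j" using s u by (simp add: tp_def)
lemma tp_mono: "i \<le> j \<Longrightarrow> tp i \<le> tp j"
  using mult_right_mono[of "real i" "real j" dl] dl by (simp add: tp_def)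
lemma tp_Suc: "tp k < tp (Suc k)" "tp (Suc k) - tp k = dl"
  using binc_step[OF s dl, of k] by (simp_all add: tp_def)

lemma HH_F: "HH k \<in> sets (F (tp k))"
  unfolding HH_def space_F[OF tp0, of k, symmetric]
proof (rule sets.sets_Collect_finite_All)
  fix j assume "j \<in> {..k}"
  then have "Z (tp j) \<in> borel_measurable (F (tp k))" by (intro F_mono[OF gbm_meas[OF tp0] tp0 tp_mono]) auto
  then have "(\<lambda>\<omega>. side (Z (tp j) \<omega>)) \<in> borel_measurable (F (tp k))" by (rule measurable_compose) (rule side_meas)
  from measurable_sets[OF this, of "{\<epsilon>..}"]
  show "{\<omega> \<in> space (F (tp k)). side (Z (tp j) \<omega>) \<in> {\<epsilon>..}} \<in> sets (F (tp k))"
    by (simp add: vimage_def Int_def conj_commute)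
qed simp

lemma HH_M: "HH k \<in> events" by (rule F_sets_M[OF HH_F tp0])
lemma A_M': "A \<in> events" by (rule F_sets_M[OF A s])
lemma A_F': "A \<in> sets (F (tp k))" by (rule F_sets_mono[OF A s]) (use u in \<open>simp add: tp_def\<close>)
lemma HH_anti: "HH (Suc k) \<subseteq> HH k" unfolding HH_def by auto

text \<open>\<open>xx\<close> is the expectation with killing on the grid below level
  \<open>\<epsilon>\<close>. One step multiplies it by the eigenvalue factor and removes
  \<open>yy k\<close>, the contribution of the paths that are killed in that step.\<close>

definition "xx k = (\<integral>\<omega>. indicator (A \<inter> HH k) \<omega> * w (Z (tp k) \<omega>) \<partial>M)"
definition "yy k = (\<integral>\<omega>. indicator (A \<inter> (HH k - HH (Suc k))) \<omega> * w (Z (tp (Suc k)) \<omega>) \<partial>M)"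

lemma xx_Suc: "xx (Suc k) = exp (c * dl) * xx k - yy k"
proof -
  have AH: "A \<inter> HH k \<in> sets (F (tp k))" using A_F' HH_F by (rule sets.Int)
  have st: "tp k < tp (Suc k)" by (rule tp_Suc(1))
  have "(\<integral>\<omega>. indicator (A \<inter> HH k) \<omega> * w (Z (tp (Suc k)) \<omega>) \<partial>M) = exp (c * (tp (Suc k) - tp k)) * xx k"
    using em tp0[of k] st AH unfolding eigen_mart_def xx_def by blast
  then have e: "(\<integral>\<omega>. indicator (A \<inter> HH k) \<omega> * w (Z (tp (Suc k)) \<omega>) \<partial>M) = exp (c * dl) * xx k" unfolding tp_Suc(2) .
  have i1: "A \<inter> HH k \<in> events" and i2: "A \<inter> (HH k - HH (Suc k)) \<in> events" using A_M' HH_M by auto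
  have "xx (Suc k) = (\<integral>\<omega>. indicator (A \<inter> HH k) \<omega> * w (Z (tp (Suc k)) \<omega>) - indicator (A \<inter> (HH k - HH (Suc k))) \<omega> * w (Z (tp (Suc k)) \<omega>) \<partial>M)"
    unfolding xx_def by (rule Bochner_Integration.integral_cong) (use HH_anti[of k] in \<open>auto simp: indicator_def\<close>)
  also have "\<dots> = exp (c * dl) * xx k - yy k"
    unfolding yy_def e[symmetric] by (rule Bochner_Integration.integral_diff[OF indwZ_int[OF tp0 i1] indwZ_int[OF tp0 i2]])
  finally show ?thesis .
qed

text \<open>\<open>w\<close> is at most linear in the distance from 1, and that distance is at most
  \<open>\<epsilon> + \<bar>q - 1\<bar>\<close> at a crossing. Trading the second summand for
  \<open>\<epsilon>\<close> plus a fourth moment makes the bound summable: over all steps the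
  crossing probabilities telescope, and the fourth moments add up to order
  \<open>1 / N\<close>.\<close>

lemma yy_bound: "\<bar>yy k\<bar> \<le> C * (2 * \<epsilon> * (prob (HH k) - prob (HH (Suc k))) + m4 (\<sigma>\<^sup>2 * dl) / \<epsilon>^3)"
proof -
  let ?X = "HH k - HH (Suc k)" and ?q = "qe \<sigma> (tp k) (tp (Suc k))"
  have X: "?X \<in> events" using HH_M by auto
  have i2: "A \<inter> ?X \<in> events" using A_M' X by auto
  have q4: "has_bochner_integral M (\<lambda>\<omega>. (?q \<omega> - 1) ^ 4) (m4 (\<sigma>\<^sup>2 * dl))"
    using qe_fourth[OF tp0 tp_Suc(1), of \<sigma> k] unfolding tp_Suc(2) .
  let ?b = "\<lambda>\<omega>. C * (2 * \<epsilon> * indicator ?X \<omega> + (?q \<omega> - 1) ^ 4 / \<epsilon>^3)"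
  have bi: "has_bochner_integral M ?b (C * (2 * \<epsilon> * prob ?X + m4 (\<sigma>\<^sup>2 * dl) / \<epsilon>^3))"
  proof (intro has_bochner_integral_mult_right has_bochner_integral_add has_bochner_integral_divide q4)
    show "has_bochner_integral M (indicator ?X) (prob ?X)"
      using X sets.sets_into_space[OF X] by (simp add: has_bochner_integral_iff Int_absorb2)
  qed
  have pt: "\<bar>indicator (A \<inter> ?X) \<omega> * w (Z (tp (Suc k)) \<omega>)\<bar> \<le> ?b \<omega>" for \<omega>
  proof (cases "\<omega> \<in> A \<inter> ?X")
    case True
    then have wX: "\<omega> \<in> ?X" by blast
    have g1: "side (Z (tp k) \<omega>) \<ge> \<epsilon>" using wX unfolding HH_def by auto
    have g2: "side (Z (tp (Suc k)) \<omega>) < \<epsilon>"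
    proof (rule ccontr)
      assume "\<not> side (Z (tp (Suc k)) \<omega>) < \<epsilon>"
      then have "\<omega> \<in> HH (Suc k)" using wX unfolding HH_def by (auto simp: le_Suc_eq not_less)
      then show False using wX by blast
    qed
    have Zq: "Z (tp (Suc k)) \<omega> = Z (tp k) \<omega> * ?q \<omega>" by (rule gbm_step)
    have "\<bar>1 - Z (tp (Suc k)) \<omega>\<bar> \<le> \<epsilon> + \<bar>?q \<omega> - 1\<bar>"
      unfolding Zq by (rule crossing_bound[OF qe_pos gbm_sign[OF z0(1)] _ \<epsilon>]) (use g1 g2 in \<open>simp_all add: side_def Zq\<close>)
    also have "\<dots> \<le> \<epsilon> + (\<epsilon> + \<bar>?q \<omega> - 1\<bar>^4 / \<epsilon>^3)" using le_add_pow4[of "\<bar>?q \<omega> - 1\<bar>" \<epsilon>] \<epsilon> by simp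
    also have "\<dots> = 2 * \<epsilon> * indicator ?X \<omega> + (?q \<omega> - 1)^4 / \<epsilon>^3" using wX by (simp add: power_even_abs_numeral)
    finally have "C * \<bar>1 - Z (tp (Suc k)) \<omega>\<bar> \<le> ?b \<omega>" using C by (intro mult_left_mono)
    then show ?thesis using wZ_bound[of "tp (Suc k)" \<omega>] True by simp
  next
    case False
    have "0 \<le> ?b \<omega>" using C \<epsilon> by (intro mult_nonneg_nonneg add_nonneg_nonneg divide_nonneg_pos) (auto simp: indicator_def)
    then show ?thesis using False by simp
  qed
  have "\<bar>yy k\<bar> \<le> (\<integral>\<omega>. \<bar>indicator (A \<inter> ?X) \<omega> * w (Z (tp (Suc k)) \<omega>)\<bar> \<partial>M)"
    unfolding yy_def by (rule integral_abs_bound)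
  also have "\<dots> \<le> (\<integral>\<omega>. ?b \<omega> \<partial>M)"
    using bi pt indwZ_int[OF tp0 i2] by (intro integral_mono integrable_abs) (auto simp: has_bochner_integral_iff)
  also have "\<dots> = C * (2 * \<epsilon> * prob ?X + m4 (\<sigma>\<^sup>2 * dl) / \<epsilon>^3)" using bi by (rule has_bochner_integral_integral_eq)
  also have "prob ?X = prob (HH k) - prob (HH (Suc k))"
    using HH_M HH_anti[of k] by (intro finite_measure_Diff) auto
  finally show ?thesis .
qed

lemma xx_drift:
  assumes "k \<le> N"
  shows "\<bar>exp (- c * (real k * dl)) * xx k - xx 0\<bar> \<le> exp (\<bar>c\<bar> * u) * (C * (2 * \<epsilon> * (prob (HH 0) - prob (HH k)) + real k * (m4 (\<sigma>\<^sup>2 * dl) / \<epsilon>^3)))"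
  using assms
proof (induction k)
  case 0 then show ?case by simp
next
  case (Suc k)
  let ?E = "\<lambda>k. exp (- c * (real k * dl))"
  have E: "?E (Suc k) * exp (c * dl) = ?E k" unfolding exp_add[symmetric] by (simp add: algebra_simps add_divide_distrib)
  have "?E (Suc k) * xx (Suc k) = (?E (Suc k) * exp (c * dl)) * xx k - ?E (Suc k) * yy k"
    unfolding xx_Suc by (simp only: right_diff_distrib mult.assoc)
  then have d: "?E (Suc k) * xx (Suc k) = ?E k * xx k - ?E (Suc k) * yy k" unfolding E .
  have ek: "?E (Suc k) \<le> exp (\<bar>c\<bar> * u)"
  proof -
    have l: "real (Suc k) * dl \<le> u" "0 \<le> real (Suc k) * dl" using grid_point_bounds[OF u N Suc.prems, of 0] by auto
    have "- c * (real (Suc k) * dl) \<le> \<bar>c\<bar> * (real (Suc k) * dl)" using l(2) by (intro mult_right_mono) auto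
    also have "\<dots> \<le> \<bar>c\<bar> * u" using l(1) by (intro mult_left_mono) auto
    finally show ?thesis by simp
  qed
  have "\<bar>?E (Suc k) * yy k\<bar> \<le> exp (\<bar>c\<bar> * u) * (C * (2 * \<epsilon> * (prob (HH k) - prob (HH (Suc k))) + m4 (\<sigma>\<^sup>2 * dl) / \<epsilon>^3))"
    unfolding abs_mult using ek yy_bound[of k] by (intro mult_mono) auto
  moreover have "\<bar>?E k * xx k - xx 0\<bar> \<le> exp (\<bar>c\<bar> * u) * (C * (2 * \<epsilon> * (prob (HH 0) - prob (HH k)) + real k * (m4 (\<sigma>\<^sup>2 * dl) / \<epsilon>^3)))"
    using Suc by simp
  ultimately have "\<bar>?E (Suc k) * xx (Suc k) - xx 0\<bar> \<le> exp (\<bar>c\<bar> * u) * (C * (2 * \<epsilon> * (prob (HH 0) - prob (HH k)) + real k * (m4 (\<sigma>\<^sup>2 * dl) / \<epsilon>^3)))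
     + exp (\<bar>c\<bar> * u) * (C * (2 * \<epsilon> * (prob (HH k) - prob (HH (Suc k))) + m4 (\<sigma>\<^sup>2 * dl) / \<epsilon>^3))"
    unfolding d by linarith
  also have "\<dots> = exp (\<bar>c\<bar> * u) * (C * (2 * \<epsilon> * (prob (HH 0) - prob (HH (Suc k))) + real (Suc k) * (m4 (\<sigma>\<^sup>2 * dl) / \<epsilon>^3)))"
    by (rule drift_algebra)
  finally show ?case .
qed

lemma xx_total:
  "\<bar>exp (- c * u) * (\<integral>\<omega>. indicator (A \<inter> HH N) \<omega> * w (Z (s + u) \<omega>) \<partial>M) - (\<integral>\<omega>. indicator (A \<inter> {\<omega>\<in>space M. side (Z s \<omega>) \<ge> \<epsilon>}) \<omega> * w (Z s \<omega>) \<partial>M)\<bar>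
    \<le> exp (\<bar>c\<bar> * u) * (C * (2 * \<epsilon> + real N * (m4 (\<sigma>\<^sup>2 * dl) / \<epsilon>^3)))"
proof -
  have N1: "real N * dl = u" using N by simp
  have tN: "tp N = s + u" unfolding tp_def N1 ..
  have t0: "tp 0 = s" by (simp add: tp_def)
  have H0: "HH 0 = {\<omega>\<in>space M. side (Z s \<omega>) \<ge> \<epsilon>}" unfolding HH_def using t0 by simp
  have "prob (HH 0) - prob (HH N) \<le> 1" using measure_nonneg[of M "HH N"] prob_le_1[of "HH 0"] by linarith
  then have "exp (\<bar>c\<bar> * u) * (C * (2 * \<epsilon> * (prob (HH 0) - prob (HH N)) + real N * (m4 (\<sigma>\<^sup>2 * dl) / \<epsilon>^3)))
    \<le> exp (\<bar>c\<bar> * u) * (C * (2 * \<epsilon> * 1 + real N * (m4 (\<sigma>\<^sup>2 * dl) / \<epsilon>^3)))"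
    using C \<epsilon> by (intro mult_left_mono add_right_mono) auto
  from order_trans[OF xx_drift[OF order_refl] this] show ?thesis
    unfolding xx_def tN t0 H0 N1 mult_1_right .
qed

end

lemma Z_cont_on: "\<omega> \<in> space M \<Longrightarrow> continuous_on {s..s+u} (\<lambda>r. side (Z r \<omega>))"
  unfolding side_def by (intro continuous_intros continuous_on_subset[OF gbm_cont]) (use s in auto)

lemma side_Z_meas: "r \<in> {s..s+u} \<Longrightarrow> (\<lambda>\<omega>. side (Z r \<omega>)) \<in> borel_measurable M"
  using s by (intro measurable_compose[OF Z_M side_meas]) auto

text \<open>For fixed \<open>\<epsilon>\<close> the mesh tends to 0: the fourth moments disappear
  and staying on the grid becomes staying at all times. Only the crossing error proportional to
  \<open>\<epsilon>\<close> is left.\<close>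

lemma stopped_eps:
  assumes \<epsilon>: "\<epsilon> > 0"
  shows "\<bar>exp (- c * u) * (\<integral>\<omega>. indicator (A \<inter> {\<omega>\<in>space M. \<forall>r\<in>{s..s+u}. side (Z r \<omega>) \<in> {\<epsilon>..}}) \<omega> * w (Z (s + u) \<omega>) \<partial>M)
     - (\<integral>\<omega>. indicator (A \<inter> {\<omega>\<in>space M. side (Z s \<omega>) \<ge> \<epsilon>}) \<omega> * w (Z s \<omega>) \<partial>M)\<bar> \<le> exp (\<bar>c\<bar> * u) * (C * (2 * \<epsilon>))"
proof -
  let ?St = "{\<omega>\<in>space M. \<forall>r\<in>{s..s+u}. side (Z r \<omega>) \<in> {\<epsilon>..}}"
  have su: "0 \<le> s + u" using s u by simp
  have St: "?St \<in> events" by (rule stay_sets[OF side_Z_meas Z_cont_on closed_atLeast])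
  have Am: "A \<in> events" by (rule F_sets_M[OF A s])
  have SN: "filterlim Suc at_top sequentially" by (rule filterlim_Suc)
  have l1: "(\<lambda>L. \<integral>\<omega>. indicator (A \<inter> HH (Suc L) \<epsilon> (Suc L)) \<omega> * w (Z (s + u) \<omega>) \<partial>M) \<longlonglongrightarrow> (\<integral>\<omega>. indicator (A \<inter> ?St) \<omega> * w (Z (s + u) \<omega>) \<partial>M)"
  proof (rule integral_dominated_convergence[where w="\<lambda>\<omega>. C * \<bar>1 - Z (s + u) \<omega>\<bar>"])
    show "(\<lambda>\<omega>. indicator (A \<inter> ?St) \<omega> * w (Z (s + u) \<omega>)) \<in> borel_measurable M"
      using indwZ_int[OF su sets.Int[OF Am St]] by (rule borel_measurable_integrable)
    show "(\<lambda>\<omega>. indicator (A \<inter> HH (Suc L) \<epsilon> (Suc L)) \<omega> * w (Z (s + u) \<omega>)) \<in> borel_measurable M" for L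
      using indwZ_int[OF su sets.Int[OF Am HH_M[OF _ \<epsilon>]]] by (rule borel_measurable_integrable) simp
    show "integrable M (\<lambda>\<omega>. C * \<bar>1 - Z (s + u) \<omega>\<bar>)" by (rule dom_int[OF su])
    show "AE \<omega> in M. (\<lambda>L. indicator (A \<inter> HH (Suc L) \<epsilon> (Suc L)) \<omega> * w (Z (s + u) \<omega>)) \<longlonglongrightarrow> indicator (A \<inter> ?St) \<omega> * w (Z (s + u) \<omega>)"
    proof (rule AE_I2)
      fix \<omega> assume om: "\<omega> \<in> space M"
      have "(\<lambda>L. if \<forall>k\<le>Suc L. side (Z (s + real k * (u / real (Suc L))) \<omega>) \<in> {\<epsilon>..} then 1 else 0 :: real)
         \<longlonglongrightarrow> (if \<forall>r\<in>{s..s+u}. side (Z r \<omega>) \<in> {\<epsilon>..} then 1 else 0)"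
        by (rule grid_stay_tendsto[OF Z_cont_on[OF om] u closed_atLeast SN]) simp
      moreover have "(if \<forall>k\<le>Suc L. side (Z (s + real k * (u / real (Suc L))) \<omega>) \<in> {\<epsilon>..} then 1 else 0 :: real) = indicator (HH (Suc L) \<epsilon> (Suc L)) \<omega>" for L
        using om unfolding HH_def[OF zero_less_Suc \<epsilon>] tp_def[OF zero_less_Suc \<epsilon>] indicator_def of_bool_def
        by (simp only: mem_Collect_eq atMost_iff Ball_def simp_thms)
      moreover have "(if \<forall>r\<in>{s..s+u}. side (Z r \<omega>) \<in> {\<epsilon>..} then 1 else 0 :: real) = indicator ?St \<omega>"
        using om unfolding indicator_def of_bool_def by (simp only: mem_Collect_eq simp_thms)
      ultimately have "(\<lambda>L. indicator (HH (Suc L) \<epsilon> (Suc L)) \<omega> :: real) \<longlonglongrightarrow> indicator ?St \<omega>" by (simp only:)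
      then show "(\<lambda>L. indicator (A \<inter> HH (Suc L) \<epsilon> (Suc L)) \<omega> * w (Z (s + u) \<omega>)) \<longlonglongrightarrow> indicator (A \<inter> ?St) \<omega> * w (Z (s + u) \<omega>)"
        unfolding indicator_inter_arith by (intro tendsto_intros)
    qed
    show "AE \<omega> in M. norm (indicator (A \<inter> HH (Suc L) \<epsilon> (Suc L)) \<omega> * w (Z (s + u) \<omega>)) \<le> C * \<bar>1 - Z (s + u) \<omega>\<bar>" for L
    proof (rule AE_I2)
      fix \<omega>
      have "0 \<le> C * \<bar>1 - Z (s + u) \<omega>\<bar>" using C by simp
      then show "norm (indicator (A \<inter> HH (Suc L) \<epsilon> (Suc L)) \<omega> * w (Z (s + u) \<omega>)) \<le> C * \<bar>1 - Z (s + u) \<omega>\<bar>"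
        using wZ_bound[of "s + u" \<omega>] by (auto simp: indicator_def)
    qed
  qed
  have l2: "(\<lambda>L. real (Suc L) * m4 (\<sigma>\<^sup>2 * (u / real (Suc L)))) \<longlonglongrightarrow> 0" by (rule m4_limit[OF SN])
  let ?x0 = "\<integral>\<omega>. indicator (A \<inter> {\<omega>\<in>space M. side (Z s \<omega>) \<ge> \<epsilon>}) \<omega> * w (Z s \<omega>) \<partial>M"
  have L: "(\<lambda>L. \<bar>exp (- c * u) * (\<integral>\<omega>. indicator (A \<inter> HH (Suc L) \<epsilon> (Suc L)) \<omega> * w (Z (s + u) \<omega>) \<partial>M) - ?x0\<bar>)
      \<longlonglongrightarrow> \<bar>exp (- c * u) * (\<integral>\<omega>. indicator (A \<inter> ?St) \<omega> * w (Z (s + u) \<omega>) \<partial>M) - ?x0\<bar>"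
    by (intro tendsto_intros l1)
  have R: "(\<lambda>L. exp (\<bar>c\<bar> * u) * (C * (2 * \<epsilon> + real (Suc L) * m4 (\<sigma>\<^sup>2 * (u / real (Suc L))) / \<epsilon>^3))) \<longlonglongrightarrow> exp (\<bar>c\<bar> * u) * (C * (2 * \<epsilon> + 0 / \<epsilon>^3))"
    by (intro tendsto_intros l2) (use \<epsilon> in simp)
  have "\<bar>exp (- c * u) * (\<integral>\<omega>. indicator (A \<inter> ?St) \<omega> * w (Z (s + u) \<omega>) \<partial>M) - ?x0\<bar> \<le> exp (\<bar>c\<bar> * u) * (C * (2 * \<epsilon> + 0 / \<epsilon>^3))"
  proof (rule LIMSEQ_le[OF L R], intro exI allI impI)
    fix L :: nat
    show "\<bar>exp (- c * u) * (\<integral>\<omega>. indicator (A \<inter> HH (Suc L) \<epsilon> (Suc L)) \<omega> * w (Z (s + u) \<omega>) \<partial>M) - ?x0\<bar>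
      \<le> exp (\<bar>c\<bar> * u) * (C * (2 * \<epsilon> + real (Suc L) * m4 (\<sigma>\<^sup>2 * (u / real (Suc L))) / \<epsilon>^3))"
      using xx_total[OF zero_less_Suc \<epsilon>, of L] unfolding times_divide_eq_right .
  qed
  then show ?thesis by simp
qed

text \<open>Optional stopping at the hitting time of 1. As \<open>w\<close> vanishes there, stopping
  is the same as killing and leaves no boundary term. The levels \<open>e n\<close> decrease to 0;
  by compactness a path that stays positive stays above one of them.\<close>

lemma stopped_mart:
  "(\<integral>\<omega>. indicator A \<omega> * indicator {\<omega>\<in>space M. \<forall>r\<in>{s..s+u}. side (Z r \<omega>) > 0} \<omega> * w (Z (s + u) \<omega>) \<partial>M)
   = exp (c * u) * (\<integral>\<omega>. indicator A \<omega> * indicator {\<omega>\<in>space M. side (Z s \<omega>) > 0} \<omega> * w (Z s \<omega>) \<partial>M)"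
proof -
  define e where "e = (\<lambda>n. 1 / real (Suc n))"
  have e: "e n > 0" for n by (simp add: e_def)
  have el: "e \<longlonglongrightarrow> 0" unfolding e_def by real_asymp
  have su: "0 \<le> s + u" using s u by simp
  have Am: "A \<in> events" by (rule F_sets_M[OF A s])
  let ?S = "\<lambda>n. {\<omega>\<in>space M. \<forall>r\<in>{s..s+u}. side (Z r \<omega>) \<in> {e n..}}"
  let ?SI = "{\<omega>\<in>space M. \<forall>r\<in>{s..s+u}. side (Z r \<omega>) > 0}"
  let ?T = "\<lambda>n. {\<omega>\<in>space M. side (Z s \<omega>) \<ge> e n}"
  let ?TI = "{\<omega>\<in>space M. side (Z s \<omega>) > 0}"
  have S: "?S n \<in> events" for n by (rule stay_sets[OF side_Z_meas Z_cont_on closed_atLeast])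
  have pS: "(\<lambda>n. indicator (?S n) \<omega> :: real) \<longlonglongrightarrow> indicator ?SI \<omega>" if om: "\<omega> \<in> space M" for \<omega>
  proof (cases "\<omega> \<in> ?SI")
    case True
    obtain x where x: "x \<in> {s..s+u}" "\<forall>y\<in>{s..s+u}. side (Z x \<omega>) \<le> side (Z y \<omega>)"
      using continuous_attains_inf[OF compact_Icc _ Z_cont_on[OF om]] u by auto
    have "side (Z x \<omega>) > 0" using True x(1) by blast
    with el have "eventually (\<lambda>n. e n < side (Z x \<omega>)) sequentially" by (rule order_tendstoD)
    then have "eventually (\<lambda>n. (indicator (?S n) \<omega> :: real) = indicator ?SI \<omega>) sequentially"
    proof eventually_elim
      case (elim n)
      have "\<omega> \<in> ?S n" using om x(2) elim by (auto intro: less_imp_le order_trans)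
      then show ?case using True by (simp only: indicator_simps)
    qed
    then show ?thesis by (rule tendsto_eventually)
  next
    case False
    have "\<omega> \<notin> ?S n" for n using False e[of n] om less_le_trans by fastforce
    then have i1: "(indicator (?S n) \<omega> :: real) = 0" for n by (rule indicator_simps(2))
    have i2: "(indicator ?SI \<omega> :: real) = 0" using False by (rule indicator_simps(2))
    show ?thesis unfolding i1 i2 by (rule tendsto_const)
  qed
  have pT: "(\<lambda>n. indicator (?T n) \<omega> :: real) \<longlonglongrightarrow> indicator ?TI \<omega>" if om: "\<omega> \<in> space M" for \<omega>
  proof (cases "\<omega> \<in> ?TI")
    case True
    then have "side (Z s \<omega>) > 0" by blast
    with el have "eventually (\<lambda>n. e n < side (Z s \<omega>)) sequentially" by (rule order_tendstoD)
    then have "eventually (\<lambda>n. (indicator (?T n) \<omega> :: real) = indicator ?TI \<omega>) sequentially"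
    proof eventually_elim
      case (elim n)
      have "\<omega> \<in> ?T n" using om elim by simp
      then show ?case using True by (simp only: indicator_simps)
    qed
    then show ?thesis by (rule tendsto_eventually)
  next
    case False
    have "\<omega> \<notin> ?T n" for n using False e[of n] om by auto
    then have i1: "(indicator (?T n) \<omega> :: real) = 0" for n by (rule indicator_simps(2))
    have i2: "(indicator ?TI \<omega> :: real) = 0" using False by (rule indicator_simps(2))
    show ?thesis unfolding i1 i2 by (rule tendsto_const)
  qed
  have SI: "?SI \<in> events"
  proof -
    have "(\<lambda>\<omega>. indicator ?SI \<omega> :: real) \<in> borel_measurable M"
      by (rule borel_measurable_LIMSEQ_real[OF pS]) (use S in auto)
    then have "?SI \<inter> space M \<in> events" by (simp only: borel_measurable_indicator_iff)
    moreover have "?SI \<inter> space M = ?SI" by blast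
    ultimately show ?thesis by simp
  qed
  have sideZs: "(\<lambda>\<omega>. side (Z s \<omega>)) \<in> borel_measurable M" using u by (intro side_Z_meas) auto
  have T: "?T n \<in> events" for n using sideZs by measurable
  have TI: "?TI \<in> events" using sideZs by measurable
  have conv: "(\<lambda>n. \<integral>\<omega>. indicator (A \<inter> X n) \<omega> * w (Z t \<omega>) \<partial>M) \<longlonglongrightarrow> (\<integral>\<omega>. indicator (A \<inter> XI) \<omega> * w (Z t \<omega>) \<partial>M)"
    if X: "\<And>n. X n \<in> events" and XI: "XI \<in> events" and p: "\<And>\<omega>. \<omega> \<in> space M \<Longrightarrow> (\<lambda>n. indicator (X n) \<omega> :: real) \<longlonglongrightarrow> indicator XI \<omega>"
      and t: "0 \<le> t" for X XI t
  proof (rule integral_dominated_convergence[where w="\<lambda>\<omega>. C * \<bar>1 - Z t \<omega>\<bar>"])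
    show "(\<lambda>\<omega>. indicator (A \<inter> XI) \<omega> * w (Z t \<omega>)) \<in> borel_measurable M"
      using indwZ_int[OF t sets.Int[OF Am XI]] by (rule borel_measurable_integrable)
    show "(\<lambda>\<omega>. indicator (A \<inter> X n) \<omega> * w (Z t \<omega>)) \<in> borel_measurable M" for n
      using indwZ_int[OF t sets.Int[OF Am X]] by (rule borel_measurable_integrable)
    show "integrable M (\<lambda>\<omega>. C * \<bar>1 - Z t \<omega>\<bar>)" by (rule dom_int[OF t])
    show "AE \<omega> in M. (\<lambda>n. indicator (A \<inter> X n) \<omega> * w (Z t \<omega>)) \<longlonglongrightarrow> indicator (A \<inter> XI) \<omega> * w (Z t \<omega>)"
      unfolding indicator_inter_arith by (intro AE_I2 tendsto_intros p)
    show "AE \<omega> in M. norm (indicator (A \<inter> X n) \<omega> * w (Z t \<omega>)) \<le> C * \<bar>1 - Z t \<omega>\<bar>" for n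
    proof (rule AE_I2)
      fix \<omega>
      have "0 \<le> C * \<bar>1 - Z t \<omega>\<bar>" using C by simp
      then show "norm (indicator (A \<inter> X n) \<omega> * w (Z t \<omega>)) \<le> C * \<bar>1 - Z t \<omega>\<bar>"
        using wZ_bound[of t \<omega>] by (auto simp: indicator_def)
    qed
  qed
  note c1 = conv[OF S SI pS su] and c2 = conv[OF T TI pT s]
  let ?a = "\<integral>\<omega>. indicator (A \<inter> ?SI) \<omega> * w (Z (s + u) \<omega>) \<partial>M" and ?b = "\<integral>\<omega>. indicator (A \<inter> ?TI) \<omega> * w (Z s \<omega>) \<partial>M"
  have "(\<lambda>n. exp (- c * u) * (\<integral>\<omega>. indicator (A \<inter> ?S n) \<omega> * w (Z (s + u) \<omega>) \<partial>M) - (\<integral>\<omega>. indicator (A \<inter> ?T n) \<omega> * w (Z s \<omega>) \<partial>M)) \<longlonglongrightarrow> exp (- c * u) * ?a - ?b"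
    by (intro tendsto_intros c1 c2)
  moreover have "(\<lambda>n. exp (- c * u) * (\<integral>\<omega>. indicator (A \<inter> ?S n) \<omega> * w (Z (s + u) \<omega>) \<partial>M) - (\<integral>\<omega>. indicator (A \<inter> ?T n) \<omega> * w (Z s \<omega>) \<partial>M)) \<longlonglongrightarrow> 0"
  proof (rule Lim_null_comparison)
    have "(\<lambda>n. exp (\<bar>c\<bar> * u) * (C * (2 * e n))) \<longlonglongrightarrow> exp (\<bar>c\<bar> * u) * (C * (2 * 0))" by (intro tendsto_intros el)
    then show "(\<lambda>n. exp (\<bar>c\<bar> * u) * (C * (2 * e n))) \<longlonglongrightarrow> 0" by simp
  qed (intro always_eventually allI, unfold real_norm_def, rule stopped_eps[OF e])
  ultimately have z: "exp (- c * u) * ?a - ?b = 0" by (rule LIMSEQ_unique)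
  have "?a = exp (c * u) * (exp (- c * u) * ?a)" unfolding mult.assoc[symmetric] exp_add[symmetric] by simp
  also have "exp (- c * u) * ?a = ?b" using z by simp
  finally show ?thesis unfolding indicator_inter_arith .
qed

end

end

section \<open>Separation of measures by eigenfunctions\<close>

text \<open>\<open>\<theta> = 0\<close> gives equal total masses. After normalisation the cosine and
  sine integrals are the real and imaginary parts of the characteristic functions, and Levy's
  uniqueness theorem applies; mass 0 is treated apart.\<close>

lemma finite_measure_eqI_char:
  fixes m1 m2 :: "real measure"
  assumes f: "finite_measure m1" "finite_measure m2" and s: "sets m1 = sets borel" "sets m2 = sets borel"
    and c: "\<And>\<theta>. (\<integral>x. cos (\<theta> * x) \<partial>m1) = (\<integral>x. cos (\<theta> * x) \<partial>m2)"
    and sn: "\<And>\<theta>. (\<integral>x. sin (\<theta> * x) \<partial>m1) = (\<integral>x. sin (\<theta> * x) \<partial>m2)"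
  shows "m1 = m2"
proof -
  define K where "K = measure m1 UNIV"
  have sp: "space m1 = UNIV" "space m2 = UNIV" using s by (auto dest: sets_eq_imp_space_eq)
  have K2: "measure m2 UNIV = K" using c[of 0] sp by (simp add: K_def)
  have eU: "emeasure m1 UNIV = ennreal K" "emeasure m2 UNIV = ennreal K"
    using finite_measure.emeasure_eq_measure[OF f(1)] finite_measure.emeasure_eq_measure[OF f(2)] K2 by (simp_all add: K_def)
  show ?thesis
  proof (cases "K = 0")
    case True
    have "emeasure m1 A = emeasure m2 A" for A
    proof -
      have "emeasure m1 A \<le> emeasure m1 UNIV" "emeasure m2 A \<le> emeasure m2 UNIV"
        using emeasure_space[of m1 A] emeasure_space[of m2 A] sp by auto
      then show ?thesis using eU True by simp
    qed
    then show ?thesis using s by (intro measure_eqI) auto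
  next
    case False
    then have K: "K > 0" by (simp add: K_def less_le)
    have rd: "real_distribution (density m (\<lambda>_. ennreal (1 / K)))"
      if "emeasure m UNIV = ennreal K" "sets m = sets borel" "space m = UNIV" for m :: "real measure"
    proof -
      have "UNIV \<in> sets m" using that(3) sets.top[of m] by simp
      then have "emeasure (density m (\<lambda>_. ennreal (1 / K))) UNIV = ennreal (1 / K) * ennreal K"
        using that by (simp add: emeasure_density_const)
      also have "\<dots> = 1" using K by (simp flip: ennreal_mult)
      finally have "prob_space (density m (\<lambda>_. ennreal (1 / K)))" using that by (intro prob_spaceI) simp
      then show ?thesis using that by (simp add: real_distribution_def real_distribution_axioms_def)
    qed
    have ch: "char (density m (\<lambda>_. ennreal (1 / K))) t = complex_of_real (1 / K * (\<integral>x. cos (t * x) \<partial>m)) + \<i> * complex_of_real (1 / K * (\<integral>x. sin (t * x) \<partial>m))"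
      if fm: "finite_measure m" and sm: "sets m = sets borel" for m :: "real measure" and t
    proof -
      note [measurable_cong] = sm
      have int: "integrable m (\<lambda>x. iexp (t * x))"
        by (rule finite_measure.integrable_const_bound[OF fm, where B=1]) (simp, measurable)
      have re: "Re (iexp (t * x)) = cos (t * x)" "Im (iexp (t * x)) = sin (t * x)" for x
        by (simp_all add: Re_exp Im_exp)
      have "char (density m (\<lambda>_. ennreal (1 / K))) t = (\<integral>x. (1 / K) *\<^sub>R iexp (t * x) \<partial>m)"
        unfolding char_def using K by (subst integral_density) auto
      also have "\<dots> = (1 / K) *\<^sub>R (\<integral>x. iexp (t * x) \<partial>m)" by (rule integral_scaleR_right)
      also have "(\<integral>x. iexp (t * x) \<partial>m) = Complex (\<integral>x. cos (t * x) \<partial>m) (\<integral>x. sin (t * x) \<partial>m)"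
        using integral_Re[OF int] integral_Im[OF int] unfolding re by (simp add: complex_eq_iff)
      finally show ?thesis by (simp add: complex_eq_iff)
    qed
    have "density m1 (\<lambda>_. ennreal (1 / K)) = density m2 (\<lambda>_. ennreal (1 / K))"
      by (rule Levy_uniqueness[OF rd[OF eU(1) s(1) sp(1)] rd[OF eU(2) s(2) sp(2)]])
        (rule ext, simp only: ch[OF f(1) s(1)] ch[OF f(2) s(2)] c sn)
    then have ed: "emeasure (density m1 (\<lambda>_. ennreal (1 / K))) A = emeasure (density m2 (\<lambda>_. ennreal (1 / K))) A" for A by simp
    have "emeasure m1 A = emeasure m2 A" if A: "A \<in> sets borel" for A
    proof -
      have "ennreal (1 / K) * emeasure m1 A = ennreal (1 / K) * emeasure m2 A"
        using ed[of A] emeasure_density_const[of A m1 "ennreal (1 / K)"] emeasure_density_const[of A m2 "ennreal (1 / K)"] A s by simp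
      then show ?thesis using K by (simp add: ennreal_mult_cancel_left)
    qed
    then show ?thesis using s by (intro measure_eqI) auto
  qed
qed

text \<open>On the positive half-line the cosine transform alone determines a measure: adding the
  mirror image doubles the cosine integrals and cancels the sine integrals, and the original is
  recovered by restriction to positive numbers. The mirror image is added by pushing the product
  with counting measure on the two signs forward under multiplication.\<close>

lemma finite_measure_abs_eqI_cos:
  fixes m1 m2 :: "real measure"
  assumes f: "finite_measure m1" "finite_measure m2" and s: "sets m1 = sets borel" "sets m2 = sets borel"
    and c: "\<And>\<theta>. (\<integral>x. cos (\<theta> * x) \<partial>m1) = (\<integral>x. cos (\<theta> * x) \<partial>m2)"
    and pos: "AE x in m1. 0 < x" "AE x in m2. 0 < x"
  shows "m1 = m2"
proof -
  define C where "C = count_space {1, - 1 :: real}"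
  define sy where "sy = (\<lambda>m :: real measure. distr (m \<Otimes>\<^sub>M C) borel (\<lambda>p. snd p * fst p))"
  have fC: "finite_measure C" unfolding C_def by (rule finite_measure_count_space) simp
  have props: "finite_measure (sy m) \<and> sets (sy m) = sets borel \<and> (\<forall>\<theta>. (\<integral>x. cos (\<theta> * x) \<partial>sy m) = 2 * (\<integral>x. cos (\<theta> * x) \<partial>m)) \<and>
     (\<forall>\<theta>. (\<integral>x. sin (\<theta> * x) \<partial>sy m) = 0) \<and> (AE x in m. 0 < x \<longrightarrow> True) \<and>
     (\<forall>A\<in>sets borel. A \<subseteq> {0<..} \<longrightarrow> (AE x in m. 0 < x) \<longrightarrow> emeasure (sy m) A = emeasure m A)"
    if fm: "finite_measure m" and sm: "sets m = sets borel" for m :: "real measure"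
  proof -
    interpret m: finite_measure m by (rule fm)
    interpret C: finite_measure C by (rule fC)
    interpret mC: finite_measure "m \<Otimes>\<^sub>M C" by (rule finite_measure_pair_measure[OF fC fm])
    interpret p: pair_sigma_finite m C by unfold_locales
    note [measurable_cong] = sm
    have [measurable]: "(\<lambda>e. e) \<in> borel_measurable C" unfolding C_def by simp
    have mm[measurable]: "(\<lambda>p. snd p * fst p) \<in> borel_measurable (m \<Otimes>\<^sub>M C)" by measurable
    have I: "(\<integral>x. h x \<partial>sy m) = (\<integral>x. h x + h (- x) \<partial>m)" if hm[measurable]: "h \<in> borel_measurable borel" and hb: "\<And>x. \<bar>h x\<bar> \<le> 1" for h :: "real \<Rightarrow> real"
    proof -
      have int: "integrable (m \<Otimes>\<^sub>M C) (case_prod (\<lambda>x e. h (e * x)))"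
        by (rule mC.integrable_const_bound[where B=1]) (use hb in \<open>auto simp: split_beta\<close>)
      have "(\<integral>x. h x \<partial>sy m) = (\<integral>p. (case_prod (\<lambda>x e. h (e * x))) p \<partial>(m \<Otimes>\<^sub>M C))"
        unfolding sy_def by (subst integral_distr) (auto simp: case_prod_beta')
      also have "\<dots> = (\<integral>x. (\<integral>e. h (e * x) \<partial>C) \<partial>m)" by (rule p.integral_fst'[OF int, symmetric, simplified])
      also have "\<dots> = (\<integral>x. h x + h (- x) \<partial>m)"
        unfolding C_def by (simp add: lebesgue_integral_count_space_finite)
      finally show ?thesis .
    qed
    have fin: "finite_measure (sy m)" unfolding sy_def by (rule mC.finite_measure_distr) measurable
    have em: "emeasure (sy m) A = emeasure m A" if A: "A \<in> sets borel" "A \<subseteq> {0<..}" and ae: "AE x in m. 0 < x" for A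
    proof -
      have "emeasure (sy m) A = emeasure (m \<Otimes>\<^sub>M C) ((\<lambda>p. snd p * fst p) -` A \<inter> space (m \<Otimes>\<^sub>M C))"
        unfolding sy_def by (rule emeasure_distr) (use A in auto)
      also have "\<dots> = (\<integral>\<^sup>+x. emeasure C (Pair x -` ((\<lambda>p. snd p * fst p) -` A \<inter> space (m \<Otimes>\<^sub>M C))) \<partial>m)"
        by (rule C.emeasure_pair_measure_alt) (rule measurable_sets[OF mm A(1)])
      also have "\<dots> = (\<integral>\<^sup>+x. indicator A x \<partial>m)"
      proof (rule nn_integral_cong_AE)
        show "AE x in m. emeasure C (Pair x -` ((\<lambda>p. snd p * fst p) -` A \<inter> space (m \<Otimes>\<^sub>M C))) = indicator A x"
          using ae
        proof (eventually_elim)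
          fix x :: real assume x: "0 < x"
          have sp: "space m = UNIV" using sm by (auto dest: sets_eq_imp_space_eq)
          have "Pair x -` ((\<lambda>p. snd p * fst p) -` A \<inter> space (m \<Otimes>\<^sub>M C)) = (if x \<in> A then {1} else {})"
            using A(2) x sp by (auto simp: space_pair_measure C_def subset_eq)
          then show "emeasure C (Pair x -` ((\<lambda>p. snd p * fst p) -` A \<inter> space (m \<Otimes>\<^sub>M C))) = indicator A x"
            by (simp add: C_def indicator_def)
        qed
      qed
      also have "\<dots> = emeasure m A" using A sm by simp
      finally show ?thesis .
    qed
    have ci: "integrable m (\<lambda>x. cos (\<theta> * x))" for \<theta>
    proof (rule m.integrable_const_bound[where B=1])
      show "(\<lambda>x. cos (\<theta> * x)) \<in> borel_measurable m"
        by (subst measurable_cong_sets[OF sm refl]) (intro borel_measurable_continuous_onI continuous_intros)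
    qed simp
    have "(\<integral>x. cos (\<theta> * x) \<partial>sy m) = 2 * (\<integral>x. cos (\<theta> * x) \<partial>m)" for \<theta>
      by (subst I) (auto simp: ci)
    moreover have "(\<integral>x. sin (\<theta> * x) \<partial>sy m) = 0" for \<theta>
      by (subst I) auto
    ultimately show ?thesis using fin em by (auto simp: sy_def)
  qed
  note p1 = props[OF f(1) s(1)] and p2 = props[OF f(2) s(2)]
  have eq: "sy m1 = sy m2"
    by (rule finite_measure_eqI_char) (use p1 p2 c in simp_all)
  show ?thesis
  proof (rule measure_eqI)
    show "sets m1 = sets m2" using s by simp
    fix A assume "A \<in> sets m1"
    then have A: "A \<in> sets borel" using s by simp
    have A': "A \<inter> {0<..} \<in> sets borel" "A \<inter> {0<..} \<subseteq> {0<..}" using A by auto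
    have "emeasure m1 A = emeasure m1 (A \<inter> {0<..})"
      by (rule emeasure_eq_AE) (use pos(1) A s A' in auto)
    also have "\<dots> = emeasure m2 (A \<inter> {0<..})"
      using p1 p2 A' pos eq by metis
    also have "\<dots> = emeasure m2 A"
      by (rule emeasure_eq_AE) (use pos(2) A s A' in auto)
    finally show "emeasure m1 A = emeasure m2 A" .
  qed
qed

text \<open>\<open>cos (\<theta> * x)\<close> is the derivative of
  \<open>sin (\<theta> * x) / x\<close> in \<open>\<theta>\<close>. The difference quotients are
  bounded by 1, since the sine is Lipschitz, so differentiation under the integral is dominated
  convergence along the steps \<open>1 / Suc n\<close>.\<close>

lemma cos_integral_from_sinc:
  fixes m :: "real measure"
  assumes f: "finite_measure m" and s: "sets m = sets borel" and pos: "AE x in m. 0 < x"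
  shows "(\<lambda>n. (\<integral>x. sin ((\<theta> + 1 / real (Suc n)) * x) / x \<partial>m) * real (Suc n) - (\<integral>x. sin (\<theta> * x) / x \<partial>m) * real (Suc n)) \<longlonglongrightarrow> (\<integral>x. cos (\<theta> * x) \<partial>m)"
proof -
  interpret finite_measure m by (rule f)
  note [measurable_cong] = s
  define e where "e = (\<lambda>n. 1 / real (Suc n))"
  have e: "e n \<noteq> 0" "e n > 0" for n by (simp_all add: e_def)
  have el: "e \<longlonglongrightarrow> 0" unfolding e_def by real_asymp
  have lip: "\<bar>sin a - sin b\<bar> \<le> \<bar>a - b\<bar>" for a b :: real
  proof -
    have "\<bar>sin a - sin b\<bar> \<le> 1 * \<bar>a - b\<bar>"
      by (rule lipschitz_from_deriv[of "min a b" "max a b" sin cos]) (auto intro!: derivative_eq_intros)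
    then show ?thesis by simp
  qed
  have int: "integrable m (\<lambda>x. sin (a * x) / x)" for a
  proof (rule integrable_const_bound[where B="\<bar>a\<bar>"])
    show "AE x in m. norm (sin (a * x) / x) \<le> \<bar>a\<bar>"
      using pos
    proof eventually_elim
      fix x :: real assume x: "0 < x"
      have "\<bar>sin (a * x)\<bar> \<le> \<bar>a\<bar> * x" using lip[of "a * x" 0] x by (simp add: abs_mult)
      then show "norm (sin (a * x) / x) \<le> \<bar>a\<bar>" using x by (simp add: pos_divide_le_eq)
    qed
  qed measurable
  have "(\<lambda>n. \<integral>x. (sin ((\<theta> + e n) * x) / x - sin (\<theta> * x) / x) / e n \<partial>m) \<longlonglongrightarrow> (\<integral>x. cos (\<theta> * x) \<partial>m)"
  proof (rule integral_dominated_convergence[where w="\<lambda>_. 1"])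
    show "AE x in m. (\<lambda>n. (sin ((\<theta> + e n) * x) / x - sin (\<theta> * x) / x) / e n) \<longlonglongrightarrow> cos (\<theta> * x)"
      using pos
    proof eventually_elim
      fix x :: real assume x: "0 < x"
      have "((\<lambda>y. sin (y * x) / x) has_real_derivative cos (\<theta> * x)) (at \<theta>)"
        using x by (auto intro!: derivative_eq_intros)
      then have "((\<lambda>h. (sin ((\<theta> + h) * x) / x - sin (\<theta> * x) / x) / h) \<longlongrightarrow> cos (\<theta> * x)) (at 0)"
        by (simp add: DERIV_def)
      moreover have "filterlim e (at 0) sequentially"
        unfolding filterlim_at using el e by auto
      ultimately show "(\<lambda>n. (sin ((\<theta> + e n) * x) / x - sin (\<theta> * x) / x) / e n) \<longlonglongrightarrow> cos (\<theta> * x)"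
        by (rule filterlim_compose)
    qed
    show "AE x in m. norm ((sin ((\<theta> + e n) * x) / x - sin (\<theta> * x) / x) / e n) \<le> 1" for n
      using pos
    proof eventually_elim
      fix x :: real assume x: "0 < x"
      have "\<bar>sin ((\<theta> + e n) * x) - sin (\<theta> * x)\<bar> \<le> e n * x"
        using lip[of "(\<theta> + e n) * x" "\<theta> * x"] x e(2)[of n] by (simp add: algebra_simps abs_mult)
      then have "\<bar>(sin ((\<theta> + e n) * x) - sin (\<theta> * x)) / (x * e n)\<bar> \<le> 1"
        using x e(2)[of n] by (simp add: abs_mult pos_divide_le_eq mult.commute)
      then show "norm ((sin ((\<theta> + e n) * x) / x - sin (\<theta> * x) / x) / e n) \<le> 1"
        by (simp add: diff_divide_distrib)
    qed
  qed auto
  moreover have "(\<integral>x. (sin ((\<theta> + e n) * x) / x - sin (\<theta> * x) / x) / e n \<partial>m)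
    = (\<integral>x. sin ((\<theta> + 1 / real (Suc n)) * x) / x \<partial>m) * real (Suc n) - (\<integral>x. sin (\<theta> * x) / x \<partial>m) * real (Suc n)" for n
  proof -
    have "(\<integral>x. (sin ((\<theta> + e n) * x) / x - sin (\<theta> * x) / x) / e n \<partial>m) = ((\<integral>x. sin ((\<theta> + e n) * x) / x \<partial>m) - (\<integral>x. sin (\<theta> * x) / x \<partial>m)) / e n"
      using int[of "\<theta> + e n"] int[of \<theta>] by simp
    then show ?thesis unfolding e_def by (simp add: left_diff_distrib del: of_nat_Suc)
  qed
  ultimately show ?thesis by simp
qed

text \<open>The weight is positive and \<open>l\<close> is injective on \<open>I\<close>, so the
  measure is recovered from the image of its weighted version by pulling back and dividing by the
  weight. This lets Fourier uniqueness be applied in the coordinate \<open>l\<close>.\<close>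

lemma measure_eqI_weighted_distr:
  fixes m1 m2 :: "real measure" and q l linv :: "real \<Rightarrow> real"
  assumes s: "sets m1 = sets borel" "sets m2 = sets borel"
    and ae: "AE y in m1. y \<in> I" "AE y in m2. y \<in> I"
    and q[measurable]: "q \<in> borel_measurable borel" and l[measurable]: "l \<in> borel_measurable borel" and linv[measurable]: "linv \<in> borel_measurable borel"
    and qp: "\<And>y. y \<in> I \<Longrightarrow> q y > 0" and inv: "\<And>y. y \<in> I \<Longrightarrow> linv (l y) = y"
    and eq: "distr (density m1 (\<lambda>y. ennreal (q y))) borel l = distr (density m2 (\<lambda>y. ennreal (q y))) borel l"
  shows "m1 = m2"
proof -
  have rec: "emeasure m A = (\<integral>\<^sup>+x. ennreal (1 / q (linv x)) * indicator A (linv x) \<partial>distr (density m (\<lambda>y. ennreal (q y))) borel l)"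
    if sm: "sets m = sets borel" and aem: "AE y in m. y \<in> I" and A[measurable]: "A \<in> sets borel" for m A
  proof -
    note [measurable_cong] = sm
    have "(\<integral>\<^sup>+x. ennreal (1 / q (linv x)) * indicator A (linv x) \<partial>distr (density m (\<lambda>y. ennreal (q y))) borel l)
      = (\<integral>\<^sup>+y. ennreal (q y) * (ennreal (1 / q (linv (l y))) * indicator A (linv (l y))) \<partial>m)"
      by (subst nn_integral_distr, measurable, subst nn_integral_density) auto
    also have "\<dots> = (\<integral>\<^sup>+y. indicator A y \<partial>m)"
    proof (rule nn_integral_cong_AE)
      show "AE y in m. ennreal (q y) * (ennreal (1 / q (linv (l y))) * indicator A (linv (l y))) = indicator A y"
        using aem
      proof eventually_elim
        fix y assume y: "y \<in> I"
        have "ennreal (q y) * ennreal (1 / q y) = 1" using qp[OF y] by (simp flip: ennreal_mult)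
        then show "ennreal (q y) * (ennreal (1 / q (linv (l y))) * indicator A (linv (l y))) = indicator A y"
          unfolding inv[OF y] mult.assoc[symmetric] by simp
      qed
    qed
    also have "\<dots> = emeasure m A" using sm A by simp
    finally show ?thesis by simp
  qed
  show ?thesis
    by (rule measure_eqI) (use s rec[OF s(1) ae(1)] rec[OF s(2) ae(2)] eq in auto)
qed

section \<open>Bounds and derivatives of the eigenfunctions\<close>

lemma ln_le_half_diff: "1 \<le> t \<Longrightarrow> 2 * ln t \<le> t - 1 / t" for t :: real
proof -
  assume t: "1 \<le> t"
  let ?f = "\<lambda>x::real. x - 1 / x - 2 * ln x"
  have "?f 1 \<le> ?f t"
  proof (rule DERIV_nonneg_imp_nondecreasing[OF t])
    fix x :: real assume x: "1 \<le> x" "x \<le> t"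
    have "(?f has_real_derivative (1 + 1 / x\<^sup>2 - 2 / x)) (at x)"
      using x by (auto intro!: derivative_eq_intros simp: power2_eq_square field_simps)
    moreover have "1 + 1 / x\<^sup>2 - 2 / x = (1 - 1 / x)\<^sup>2"
      using x by (simp add: power2_eq_square field_simps)
    ultimately show "\<exists>y. (?f has_real_derivative y) (at x) \<and> 0 \<le> y" by auto
  qed
  then show ?thesis by simp
qed

text \<open>For \<open>z \<ge> 1\<close> this is \<open>2 * ln t \<le> t - 1 / t\<close> at
  \<open>t = sqrt z\<close>, multiplied by \<open>t\<close>. The inequality is compatible with
  replacing \<open>z\<close> by \<open>1 / z\<close>, which covers the rest.\<close>

lemma sqrt_ln_bound: "0 < z \<Longrightarrow> sqrt z * \<bar>ln z\<bar> \<le> \<bar>1 - z\<bar>" for z :: real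
proof -
  have ge1: "sqrt z * \<bar>ln z\<bar> \<le> \<bar>1 - z\<bar>" if z: "1 \<le> z" for z :: real
  proof -
    have t: "1 \<le> sqrt z" using z by simp
    have "ln z = 2 * ln (sqrt z)" using z by (simp add: ln_sqrt)
    also have "\<dots> \<le> sqrt z - 1 / sqrt z" by (rule ln_le_half_diff[OF t])
    finally have "sqrt z * ln z \<le> sqrt z * (sqrt z - 1 / sqrt z)" using t by (intro mult_left_mono) auto
    also have "\<dots> = z - 1" using z by (simp add: right_diff_distrib)
    finally show ?thesis using z by simp
  qed
  assume z: "0 < z"
  show ?thesis
  proof (cases "1 \<le> z")
    case True then show ?thesis by (rule ge1)
  next
    case False
    then have "1 \<le> 1 / z" using z by simp
    from ge1[OF this] have "sqrt (1 / z) * \<bar>ln z\<bar> \<le> 1 / z - 1"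
      using z False by (simp add: ln_div)
    then have "z * (sqrt (1 / z) * \<bar>ln z\<bar>) \<le> z * (1 / z - 1)" using z by (intro mult_left_mono) auto
    moreover have "z * sqrt (1 / z) = sqrt z" using z by (simp add: real_sqrt_divide real_div_sqrt)
    moreover have "z * (1 / z - 1) = 1 - z" using z by (simp add: right_diff_distrib)
    ultimately show ?thesis using False by (simp add: mult.assoc[symmetric])
  qed
qed

lemma ln_square: "x \<noteq> 0 \<Longrightarrow> ln (x\<^sup>2) = 2 * ln \<bar>x\<bar>" for x :: real
  by (subst power2_abs[symmetric], subst ln_realpow) auto

lemma sqrt_abs_mult: "a \<noteq> 0 \<Longrightarrow> sqrt (\<bar>a\<bar> * \<bar>b\<bar>) = \<bar>a\<bar> * sqrt \<bar>b / a\<bar>" for a b :: real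
proof -
  assume a: "a \<noteq> 0"
  have aux: "x * y = x * x * (y / x)" if "x \<noteq> 0" for x y :: real using that by simp
  have "\<bar>a\<bar> * \<bar>b\<bar> = \<bar>a\<bar>\<^sup>2 * \<bar>b / a\<bar>" unfolding power2_eq_square abs_divide by (rule aux) (use a in simp)
  then show ?thesis by (simp only: real_sqrt_mult real_sqrt_abs abs_abs)
qed

text \<open>Real form, with phase \<open>\<kappa>\<close>, of \<open>\<bar>y - r1\<bar>\<close> to
  the power \<open>1/2 - i * \<theta>\<close> times \<open>\<bar>y - r2\<bar>\<close> to the power
  \<open>1/2 + i * \<theta>\<close>. Logarithms of squares replace absolute values, so that one
  differentiable formula serves all three components.\<close>

definition eigf :: "real \<Rightarrow> real \<Rightarrow> real \<Rightarrow> real \<Rightarrow> real \<Rightarrow> real" where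
  "eigf r1 r2 \<theta> \<kappa> y = exp ((ln ((y - r1)\<^sup>2) + ln ((y - r2)\<^sup>2)) / 4) * cos (\<theta> / 2 * (ln ((y - r2)\<^sup>2) - ln ((y - r1)\<^sup>2)) + \<kappa>)"

lemma eigf_trig_mode:
  assumes "y \<noteq> r1" "y \<noteq> r2"
  shows "eigf r1 r2 \<theta> \<kappa> y = \<bar>y - r1\<bar> * trig_mode \<theta> \<kappa> ((y - r2) / (y - r1))"
proof -
  have l: "ln ((y - r1)\<^sup>2) = 2 * ln \<bar>y - r1\<bar>" "ln ((y - r2)\<^sup>2) = 2 * ln \<bar>y - r2\<bar>"
    using ln_square[of "y - r1"] ln_square[of "y - r2"] assms by simp_all
  have "exp ((ln ((y - r1)\<^sup>2) + ln ((y - r2)\<^sup>2)) / 4) = sqrt (\<bar>y - r1\<bar> * \<bar>y - r2\<bar>)"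
  proof -
    have "sqrt (\<bar>y - r1\<bar> * \<bar>y - r2\<bar>) = exp (ln (\<bar>y - r1\<bar> * \<bar>y - r2\<bar>) / 2)"
      using assms by (simp add: ln_sqrt[symmetric] abs_mult[symmetric])
    then show ?thesis unfolding l using assms by (simp add: ln_mult add_divide_distrib)
  qed
  also have "sqrt (\<bar>y - r1\<bar> * \<bar>y - r2\<bar>) = \<bar>y - r1\<bar> * sqrt \<bar>(y - r2) / (y - r1)\<bar>"
    by (rule sqrt_abs_mult) (use assms in simp)
  finally have e: "exp ((ln ((y - r1)\<^sup>2) + ln ((y - r2)\<^sup>2)) / 4) = \<bar>y - r1\<bar> * sqrt \<bar>(y - r2) / (y - r1)\<bar>" .
  have e2: "ln \<bar>(y - r2) / (y - r1)\<bar> = ln \<bar>y - r2\<bar> - ln \<bar>y - r1\<bar>" using assms by (simp add: ln_div)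
  have "\<theta> / 2 * (ln ((y - r2)\<^sup>2) - ln ((y - r1)\<^sup>2)) = \<theta> * ln \<bar>(y - r2) / (y - r1)\<bar>" unfolding l e2 by (simp add: algebra_simps)
  then show ?thesis unfolding eigf_def e trig_mode_def by (simp only: mult.assoc)
qed

lemma eigf_abs_le: "y \<noteq> r1 \<Longrightarrow> y \<noteq> r2 \<Longrightarrow> \<bar>eigf r1 r2 \<theta> \<kappa> y\<bar> \<le> sqrt (\<bar>y - r1\<bar> * \<bar>y - r2\<bar>)"
proof -
  assume y: "y \<noteq> r1" "y \<noteq> r2"
  have e: "sqrt (\<bar>y - r1\<bar> * \<bar>y - r2\<bar>) = \<bar>y - r1\<bar> * sqrt \<bar>(y - r2) / (y - r1)\<bar>"
    by (rule sqrt_abs_mult) (use y in simp)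
  have "\<bar>y - r1\<bar> * (sqrt \<bar>(y - r2) / (y - r1)\<bar> * \<bar>cos (\<theta> * ln \<bar>(y - r2) / (y - r1)\<bar> + \<kappa>)\<bar>) \<le> \<bar>y - r1\<bar> * (sqrt \<bar>(y - r2) / (y - r1)\<bar> * 1)"
    by (intro mult_left_mono) auto
  then show ?thesis unfolding e eigf_trig_mode[OF y] trig_mode_def by (simp add: abs_mult)
qed

lemma trig_mode_bound_neg: "z < 0 \<Longrightarrow> \<bar>trig_mode \<theta> \<kappa> z\<bar> \<le> 1 * \<bar>1 - z\<bar>" for z :: real
proof -
  assume z: "z < 0"
  have "\<bar>trig_mode \<theta> \<kappa> z\<bar> \<le> sqrt \<bar>z\<bar> * 1"
    unfolding trig_mode_def abs_mult by (intro mult_mono) auto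
  also have "sqrt \<bar>z\<bar> \<le> 1 + \<bar>z\<bar>" by (rule real_le_lsqrt) (simp_all add: power2_eq_square algebra_simps)
  finally show ?thesis using z by simp
qed

lemma trig_mode_bound_pos: "0 < z \<Longrightarrow> \<bar>trig_mode \<theta> (- (pi / 2)) z\<bar> \<le> \<bar>\<theta>\<bar> * \<bar>1 - z\<bar>" for z :: real
proof -
  assume z: "0 < z"
  have c: "cos (x + - (pi / 2)) = sin x" for x :: real by (simp add: cos_diff)
  have "\<bar>sin (\<theta> * ln z)\<bar> \<le> \<bar>\<theta> * ln z\<bar>" by (rule abs_sin_x_le_abs_x)
  then have "sqrt z * \<bar>sin (\<theta> * ln z)\<bar> \<le> sqrt z * (\<bar>\<theta>\<bar> * \<bar>ln z\<bar>)" using z by (intro mult_left_mono) (auto simp: abs_mult)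
  also have "\<dots> = \<bar>\<theta>\<bar> * (sqrt z * \<bar>ln z\<bar>)" by simp
  also have "\<dots> \<le> \<bar>\<theta>\<bar> * \<bar>1 - z\<bar>" by (intro mult_left_mono sqrt_ln_bound[OF z]) auto
  finally show ?thesis unfolding trig_mode_def c abs_mult using z by simp
qed

text \<open>The sine phase vanishes linearly where the ratio is 1, and
  \<open>\<bar>y - r1\<bar>\<close> times the distance of the ratio from 1 is the constant
  \<open>r2 - r1\<close>. The linear growth of the prefactor at infinity is thus exactly
  compensated.\<close>

lemma eigf_bound_outer:
  assumes y: "0 < (y - r2) / (y - r1)"
  shows "\<bar>eigf r1 r2 \<theta> (- (pi / 2)) y\<bar> \<le> \<bar>\<theta>\<bar> * \<bar>r2 - r1\<bar>"
proof -
  have n: "y \<noteq> r1" "y \<noteq> r2" using y by auto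
  have "1 - (y - r2) / (y - r1) = (r2 - r1) / (y - r1)" using n by (simp add: field_simps)
  then have e: "\<bar>y - r1\<bar> * \<bar>1 - (y - r2) / (y - r1)\<bar> = \<bar>r2 - r1\<bar>" using n by (simp add: abs_divide)
  have "\<bar>y - r1\<bar> * \<bar>trig_mode \<theta> (- (pi / 2)) ((y - r2) / (y - r1))\<bar> \<le> \<bar>y - r1\<bar> * (\<bar>\<theta>\<bar> * \<bar>1 - (y - r2) / (y - r1)\<bar>)"
    by (intro mult_left_mono trig_mode_bound_pos[OF y]) auto
  also have "\<dots> = \<bar>\<theta>\<bar> * (\<bar>y - r1\<bar> * \<bar>1 - (y - r2) / (y - r1)\<bar>)" by simp
  finally have "\<bar>y - r1\<bar> * \<bar>trig_mode \<theta> (- (pi / 2)) ((y - r2) / (y - r1))\<bar> \<le> \<bar>\<theta>\<bar> * \<bar>r2 - r1\<bar>" unfolding e .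
  then show ?thesis by (simp only: eigf_trig_mode[OF n] abs_mult abs_abs)
qed

context
  fixes r1 r2 \<theta> :: real
begin

text \<open>\<open>em\<close> is the logarithmic derivative of the amplitude, \<open>ed\<close> the
  derivative of the phase. Sine terms are written as a phase shift by \<open>pi / 2\<close>, so that
  differentiation stays within the family \<open>eigf\<close>.\<close>

definition "em y = (1 / (y - r1) + 1 / (y - r2)) / 2"
definition "ed y = \<theta> * (1 / (y - r2) - 1 / (y - r1))"
definition "eigf1 \<kappa> y = em y * eigf r1 r2 \<theta> \<kappa> y + ed y * eigf r1 r2 \<theta> (\<kappa> + pi / 2) y"
definition "eigf2 \<kappa> y = - (1/4 + \<theta>\<^sup>2) * (1 / (y - r1) - 1 / (y - r2))\<^sup>2 * eigf r1 r2 \<theta> \<kappa> y"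
definition "eigf3 \<kappa> y = - (1/4 + \<theta>\<^sup>2) * (2 * (1 / (y - r1) - 1 / (y - r2)) * (1 / (y - r2)\<^sup>2 - 1 / (y - r1)\<^sup>2) * eigf r1 r2 \<theta> \<kappa> y
    + (1 / (y - r1) - 1 / (y - r2))\<^sup>2 * eigf1 \<kappa> y)"

lemma DERIV_ln_square: "y \<noteq> r \<Longrightarrow> ((\<lambda>y. ln ((y - r)\<^sup>2)) has_real_derivative 2 / (y - r)) (at y)" for r y :: real
proof -
  assume y: "y \<noteq> r"
  have aux: "1 / d\<^sup>2 * (2 * d) = 2 / d" if "d \<noteq> 0" for d :: real using that by (simp add: power2_eq_square)
  have pos: "0 < (y - r)\<^sup>2" using y by simp
  have "((\<lambda>y. (y - r)\<^sup>2) has_real_derivative 2 * (y - r)) (at y)" by (auto intro!: derivative_eq_intros)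
  then have "((\<lambda>y. ln ((y - r)\<^sup>2)) has_real_derivative 1 / (y - r)\<^sup>2 * (2 * (y - r))) (at y)"
    by (rule DERIV_chain2[where f=ln and g="\<lambda>y. (y - r)\<^sup>2", OF DERIV_ln_divide[OF pos]])
  then show ?thesis using aux[of "y - r"] y by simp
qed

lemma eigf_DERIV:
  assumes "y \<noteq> r1" "y \<noteq> r2"
  shows "(eigf r1 r2 \<theta> \<kappa> has_real_derivative eigf1 \<kappa> y) (at y)"
proof -
  note d = DERIV_ln_square[OF assms(1)] DERIV_ln_square[OF assms(2)]
  let ?E = "\<lambda>y. exp ((ln ((y - r1)\<^sup>2) + ln ((y - r2)\<^sup>2)) / 4)"
  let ?T = "\<lambda>y. \<theta> / 2 * (ln ((y - r2)\<^sup>2) - ln ((y - r1)\<^sup>2)) + \<kappa>"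
  have "((\<lambda>y. ?E y * cos (?T y)) has_real_derivative
     ?E y * ((2 / (y - r1) + 2 / (y - r2)) / 4) * cos (?T y) + - sin (?T y) * (\<theta> / 2 * (2 / (y - r2) - 2 / (y - r1)) + 0) * ?E y) (at y)"
    by (intro DERIV_mult DERIV_chain2[OF DERIV_exp] DERIV_chain2[OF DERIV_cos] DERIV_cdivide DERIV_add DERIV_diff DERIV_cmult d DERIV_const)
  moreover have "?E y * ((2 / (y - r1) + 2 / (y - r2)) / 4) * cos (?T y) + - sin (?T y) * (\<theta> / 2 * (2 / (y - r2) - 2 / (y - r1)) + 0) * ?E y = eigf1 \<kappa> y"
  proof -
    have "cos (?T y + pi / 2) = - sin (?T y)" by (simp add: cos_add)
    then have s: "cos (\<theta> / 2 * (ln ((y - r2)\<^sup>2) - ln ((y - r1)\<^sup>2)) + (\<kappa> + pi / 2)) = - sin (?T y)" by (simp only: add.assoc)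
    have m: "em y = (2 / (y - r1) + 2 / (y - r2)) / 4" "ed y = \<theta> / 2 * (2 / (y - r2) - 2 / (y - r1)) + 0"
      unfolding em_def ed_def by (simp_all add: field_simps)
    show ?thesis unfolding eigf1_def m eigf_def s by (simp only: mult_ac)
  qed
  ultimately show ?thesis unfolding eigf_def[abs_def] by simp
qed

lemma eigf_shift_pi: "eigf r1 r2 \<theta> (\<kappa> + pi / 2 + pi / 2) y = - eigf r1 r2 \<theta> \<kappa> y"
proof -
  have "cos (x + (\<kappa> + pi / 2 + pi / 2)) = - cos (x + \<kappa>)" for x
    using cos_periodic_pi[of "x + \<kappa>"] by (simp add: add.assoc)
  then show ?thesis unfolding eigf_def by simp
qed

lemma inv_square: "1 / x\<^sup>2 = (1 / x)\<^sup>2" for x :: real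
  by (simp add: power_divide)

lemma inv_DERIV: "y \<noteq> r \<Longrightarrow> ((\<lambda>y. 1 / (y - r)) has_real_derivative - (1 / (y - r)\<^sup>2)) (at y)" for r y :: real
  by (auto intro!: derivative_eq_intros simp: power2_eq_square)

text \<open>The phase-shifted function enters with the coefficient \<open>ed' + 2 * em * ed\<close>,
  which vanishes; this reflects that the two exponents add up to 1. The remaining coefficient
  \<open>em' + em^2 - ed^2\<close> is a multiple of a square, by a polynomial identity in
  \<open>a = 1 / (y - r1)\<close> and \<open>b = 1 / (y - r2)\<close>.\<close>

lemma eigf1_DERIV:
  assumes "y \<noteq> r1" "y \<noteq> r2"
  shows "(eigf1 \<kappa> has_real_derivative eigf2 \<kappa> y) (at y)"
proof -
  note i = inv_DERIV[OF assms(1)] inv_DERIV[OF assms(2)]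
  have dm: "(em has_real_derivative (- (1 / (y - r1)\<^sup>2) + - (1 / (y - r2)\<^sup>2)) / 2) (at y)"
    unfolding em_def[abs_def] by (intro DERIV_cdivide DERIV_add i)
  have dd: "(ed has_real_derivative \<theta> * (- (1 / (y - r2)\<^sup>2) - - (1 / (y - r1)\<^sup>2))) (at y)"
    unfolding ed_def[abs_def] by (intro DERIV_cmult DERIV_diff i)
  let ?m' = "(- (1 / (y - r1)\<^sup>2) + - (1 / (y - r2)\<^sup>2)) / 2" and ?d' = "\<theta> * (- (1 / (y - r2)\<^sup>2) - - (1 / (y - r1)\<^sup>2))"
  let ?p = "eigf r1 r2 \<theta> \<kappa>" and ?q = "eigf r1 r2 \<theta> (\<kappa> + pi / 2)"
  have "(eigf1 \<kappa> has_real_derivative (?m' * ?p y + eigf1 \<kappa> y * em y) + (?d' * ?q y + eigf1 (\<kappa> + pi / 2) y * ed y)) (at y)"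
    unfolding eigf1_def[of \<kappa>, abs_def] by (intro DERIV_add DERIV_mult dm dd eigf_DERIV[OF assms, unfolded eigf1_def[abs_def]] eigf_DERIV[OF assms])
  moreover have "(?m' * ?p y + eigf1 \<kappa> y * em y) + (?d' * ?q y + eigf1 (\<kappa> + pi / 2) y * ed y)
     = (?m' + em y * em y - ed y * ed y) * ?p y + (?d' + 2 * (em y * ed y)) * ?q y"
    unfolding eigf1_def eigf_shift_pi by (simp add: algebra_simps)
  moreover have "?d' + 2 * (em y * ed y) = 0"
  proof -
    have aux: "\<theta> * (- (b\<^sup>2) - - (a\<^sup>2)) + 2 * ((a + b) / 2 * (\<theta> * (b - a))) = 0" for a b :: real
      by (simp add: power2_eq_square field_simps)
    show ?thesis unfolding em_def ed_def inv_square by (rule aux)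
  qed
  moreover have "?m' + em y * em y - ed y * ed y = - (1/4 + \<theta>\<^sup>2) * (1 / (y - r1) - 1 / (y - r2))\<^sup>2"
  proof -
    have aux: "(- (a\<^sup>2) + - (b\<^sup>2)) / 2 + (a + b) / 2 * ((a + b) / 2) - \<theta> * (b - a) * (\<theta> * (b - a)) = - (1/4 + \<theta>\<^sup>2) * (a - b)\<^sup>2" for a b :: real
      by (simp add: power2_eq_square field_simps)
    show ?thesis unfolding em_def ed_def inv_square by (rule aux)
  qed
  ultimately show ?thesis unfolding eigf2_def by simp
qed

lemma eigf2_DERIV:
  assumes "y \<noteq> r1" "y \<noteq> r2"
  shows "(eigf2 \<kappa> has_real_derivative eigf3 \<kappa> y) (at y)"
proof -
  note i = inv_DERIV[OF assms(1)] inv_DERIV[OF assms(2)]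
  let ?D = "\<lambda>y. 1 / (y - r1) - 1 / (y - r2)" and ?D' = "- (1 / (y - r1)\<^sup>2) - - (1 / (y - r2)\<^sup>2)"
  have D: "(?D has_real_derivative ?D') (at y)" by (intro DERIV_diff i)
  have "((\<lambda>y. - (1/4 + \<theta>\<^sup>2) * ((?D y * ?D y) * eigf r1 r2 \<theta> \<kappa> y)) has_real_derivative
     - (1/4 + \<theta>\<^sup>2) * ((?D' * ?D y + ?D' * ?D y) * eigf r1 r2 \<theta> \<kappa> y + eigf1 \<kappa> y * (?D y * ?D y))) (at y)"
    by (intro DERIV_cmult DERIV_mult D eigf_DERIV[OF assms])
  moreover have "(\<lambda>y. - (1/4 + \<theta>\<^sup>2) * ((?D y * ?D y) * eigf r1 r2 \<theta> \<kappa> y)) = eigf2 \<kappa>"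
    by (rule ext) (simp only: eigf2_def power2_eq_square mult.assoc)
  moreover have "- (1/4 + \<theta>\<^sup>2) * ((?D' * ?D y + ?D' * ?D y) * eigf r1 r2 \<theta> \<kappa> y + eigf1 \<kappa> y * (?D y * ?D y)) = eigf3 \<kappa> y"
  proof -
    have "?D' = 1 / (y - r2)\<^sup>2 - 1 / (y - r1)\<^sup>2" by simp
    then have e: "(?D' * ?D y + ?D' * ?D y) = 2 * ?D y * (1 / (y - r2)\<^sup>2 - 1 / (y - r1)\<^sup>2)" by (simp only: mult.commute mult_2_right distrib_left mult.assoc)
    show ?thesis unfolding eigf3_def e power2_eq_square[of "?D y"] by (simp only: mult.commute)
  qed
  ultimately show ?thesis by simp
qed

lemma eigf3_cont: "I \<inter> {r1, r2} = {} \<Longrightarrow> continuous_on I (eigf3 \<kappa>)"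
proof -
  assume I: "I \<inter> {r1, r2} = {}"
  have n: "y \<noteq> r1" "y \<noteq> r2" if "y \<in> I" for y using I that by auto
  have c: "continuous_on I (eigf r1 r2 \<theta> \<kappa>)" for \<kappa>
    using eigf_DERIV n by (intro continuous_at_imp_continuous_on ballI DERIV_isCont) blast
  have c1: "continuous_on I (eigf1 \<kappa>)"
    using eigf1_DERIV n by (intro continuous_at_imp_continuous_on ballI DERIV_isCont) blast
  show ?thesis unfolding eigf3_def by (intro continuous_intros c c1) (use n in auto)
qed

end

text \<open>\<open>(1 / (x - r1) - 1 / (x - r2)) * P x\<close> is the constant
  \<open>- e1 * (r2 - r1)\<close>. Hence the factor in \<open>eigf2\<close> cancels against
  \<open>P^2\<close> and a genuine eigenvalue is left.\<close>

lemma (in sde) sde_test_eigf: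
  assumes P: "P = qnv_poly e1 r1 r2" and I: "open I" "I \<inter> {r1, r2} = {}"
  shows "sde_test M F B P y0 Y (eigf r1 r2 \<theta> \<kappa>) (eigf1 r1 r2 \<theta> \<kappa>) (eigf2 r1 r2 \<theta> \<kappa>) (eigf3 r1 r2 \<theta> \<kappa>) I
    (- (1/4 + \<theta>\<^sup>2) * (e1 * (r2 - r1))\<^sup>2 / 2)"
proof unfold_locales
  have n: "y \<noteq> r1" "y \<noteq> r2" if "y \<in> I" for y using I that by auto
  show "open I" by (rule I)
  show "(eigf r1 r2 \<theta> \<kappa> has_real_derivative eigf1 r1 r2 \<theta> \<kappa> x) (at x)" if "x \<in> I" for x
    by (rule eigf_DERIV[OF n[OF that]])
  show "(eigf1 r1 r2 \<theta> \<kappa> has_real_derivative eigf2 r1 r2 \<theta> \<kappa> x) (at x)" if "x \<in> I" for x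
    by (rule eigf1_DERIV[OF n[OF that]])
  show "(eigf2 r1 r2 \<theta> \<kappa> has_real_derivative eigf3 r1 r2 \<theta> \<kappa> x) (at x)" if "x \<in> I" for x
    by (rule eigf2_DERIV[OF n[OF that]])
  show "continuous_on I (eigf3 r1 r2 \<theta> \<kappa>)" by (rule eigf3_cont[OF I(2)])
  show "eigf2 r1 r2 \<theta> \<kappa> x / 2 * (P x)\<^sup>2 = - (1/4 + \<theta>\<^sup>2) * (e1 * (r2 - r1))\<^sup>2 / 2 * eigf r1 r2 \<theta> \<kappa> x" if "x \<in> I" for x
  proof -
    have "(1 / (x - r1) - 1 / (x - r2)) * P x = - (e1 * (r2 - r1))"
    proof -
      have aux: "(1 / p - 1 / q) * (e1 * p * q) = e1 * (q - p)" if "p \<noteq> 0" "q \<noteq> 0" for p q :: real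
        using that by (simp add: field_simps)
      show ?thesis unfolding P qnv_poly_def using aux[of "x - r1" "x - r2"] n[OF that] by (simp add: algebra_simps)
    qed
    then have "((1 / (x - r1) - 1 / (x - r2)) * P x)\<^sup>2 = (e1 * (r2 - r1))\<^sup>2" by simp
    then have e: "(1 / (x - r1) - 1 / (x - r2))\<^sup>2 * (P x)\<^sup>2 = (e1 * (r2 - r1))\<^sup>2" by (simp only: power_mult_distrib)
    have "eigf2 r1 r2 \<theta> \<kappa> x / 2 * (P x)\<^sup>2 = - (1/4 + \<theta>\<^sup>2) * ((1 / (x - r1) - 1 / (x - r2))\<^sup>2 * (P x)\<^sup>2) / 2 * eigf r1 r2 \<theta> \<kappa> x"
      unfolding eigf2_def by (simp add: mult_ac)
    then show ?thesis unfolding e .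
  qed
qed

section \<open>Separation of measures on each component\<close>

context
  fixes r1 r2 :: real
  assumes r: "r1 < r2"
begin

definition "eamp y = exp ((ln ((y - r1)\<^sup>2) + ln ((y - r2)\<^sup>2)) / 4)"
definition "elog y = (ln ((y - r2)\<^sup>2) - ln ((y - r1)\<^sup>2)) / 2"

lemma eamp_pos: "eamp y > 0" by (simp add: eamp_def)

lemma eamp_elog_meas[measurable]: "eamp \<in> borel_measurable borel" "elog \<in> borel_measurable borel"
  unfolding eamp_def[abs_def] elog_def[abs_def] by measurable

lemma eigf_eamp_elog: "eigf r1 r2 \<theta> \<kappa> y = eamp y * cos (\<theta> * elog y + \<kappa>)"
  unfolding eigf_def eamp_def elog_def by simp

lemma elog_ratio: "y \<noteq> r1 \<Longrightarrow> y \<noteq> r2 \<Longrightarrow> elog y = ln \<bar>(y - r2) / (y - r1)\<bar>"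
  unfolding elog_def by (simp add: ln_square ln_div)

lemma eamp_ratio: "y \<noteq> r1 \<Longrightarrow> y \<noteq> r2 \<Longrightarrow> eamp y = \<bar>y - r1\<bar> * sqrt \<bar>(y - r2) / (y - r1)\<bar>"
  using eigf_eamp_elog[of 0 0 y] eigf_trig_mode[of y r1 r2 0 0] by (simp add: trig_mode_def)

lemma eigf_meas[measurable]: "eigf r1 r2 \<theta> \<kappa> \<in> borel_measurable borel"
  unfolding eigf_def[abs_def] by measurable

lemma cos_minus_half_pi: "cos (x + - (pi / 2)) = sin x" for x :: real by (simp add: cos_diff)

lemma finite_measure_density_bounded:
  fixes m :: "real measure" and q :: "real \<Rightarrow> real"
  assumes "finite_measure m" "AE y in m. q y \<le> K" "q \<in> borel_measurable m"
  shows "finite_measure (density m (\<lambda>y. ennreal (q y)))"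
proof (rule finite_measureI)
  have "emeasure (density m (\<lambda>y. ennreal (q y))) (space m) = (\<integral>\<^sup>+y. ennreal (q y) * indicator (space m) y \<partial>m)"
    using assms(3) by (intro emeasure_density) auto
  also have "\<dots> \<le> (\<integral>\<^sup>+y. ennreal K \<partial>m)"
    by (rule nn_integral_mono_AE) (use assms(2) in \<open>eventually_elim, auto simp: indicator_def intro: ennreal_leI\<close>)
  also have "\<dots> = ennreal K * emeasure m (space m)" by simp
  also have "\<dots> < \<infinity>" using finite_measure.emeasure_finite[OF assms(1)] by (simp add: ennreal_mult_less_top top.not_eq_extremum)
  finally show "emeasure (density m (\<lambda>y. ennreal (q y))) (space (density m (\<lambda>y. ennreal (q y)))) \<noteq> \<infinity>" by simp
qed

lemma integral_weighted_distr:
  fixes m :: "real measure" and q l h :: "real \<Rightarrow> real"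
  assumes s: "sets m = sets borel" and q: "q \<in> borel_measurable borel" "\<And>y. 0 \<le> q y" and l: "l \<in> borel_measurable borel" and h: "h \<in> borel_measurable borel"
  shows "(\<integral>x. h x \<partial>distr (density m (\<lambda>y. ennreal (q y))) borel l) = (\<integral>y. q y * h (l y) \<partial>m)"
proof -
  note [measurable_cong] = s
  note [measurable] = q(1) l h
  have "(\<integral>x. h x \<partial>distr (density m (\<lambda>y. ennreal (q y))) borel l) = (\<integral>y. h (l y) \<partial>density m (\<lambda>y. ennreal (q y)))"
    by (rule integral_distr) measurable
  also have "\<dots> = (\<integral>y. q y *\<^sub>R h (l y) \<partial>m)"
    by (rule integral_density) (use q(2) in \<open>auto\<close>)
  finally show ?thesis by simp
qed

text \<open>Weighted by the bounded amplitude \<open>eamp\<close> and transported by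
  \<open>elog\<close>, a measure has the integrals of \<open>eigf\<close> as its cosine transform
  (phase 0) and sine transform (phase \<open>- pi / 2\<close>). The logistic map in the rule inverts
  \<open>elog\<close> on the bounded component.\<close>

lemma separation_inner:
  fixes m1 m2 :: "real measure"
  assumes f: "finite_measure m1" "finite_measure m2" and s: "sets m1 = sets borel" "sets m2 = sets borel"
    and ae: "AE y in m1. y \<in> {r1<..<r2}" "AE y in m2. y \<in> {r1<..<r2}"
    and e: "\<And>\<theta> \<kappa>. (\<integral>y. eigf r1 r2 \<theta> \<kappa> y \<partial>m1) = (\<integral>y. eigf r1 r2 \<theta> \<kappa> y \<partial>m2)"
  shows "m1 = m2"
proof (rule measure_eqI_weighted_distr[where q=eamp and l=elog and linv="\<lambda>x. (r2 + r1 * exp x) / (1 + exp x)", OF s ae])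
  show "(r2 + r1 * exp (elog y)) / (1 + exp (elog y)) = y" if y: "y \<in> {r1<..<r2}" for y
  proof -
    have n: "y \<noteq> r1" "y \<noteq> r2" using y by auto
    have "exp (elog y) = \<bar>(y - r2) / (y - r1)\<bar>" unfolding elog_ratio[OF n] by (rule exp_ln) (use n in simp)
    then have x: "exp (elog y) = (r2 - y) / (y - r1)" using y by (simp add: abs_divide)
    have "1 + (r2 - y) / (y - r1) = (r2 - r1) / (y - r1)" using y by (simp add: field_simps)
    moreover have "r2 + r1 * ((r2 - y) / (y - r1)) = y * ((r2 - r1) / (y - r1))" using y by (simp add: field_simps)
    ultimately show ?thesis unfolding x using y r by simp
  qed
  have b: "eamp y \<le> r2 - r1" if y: "y \<in> {r1<..<r2}" for y
  proof -
    have n: "y \<noteq> r1" "y \<noteq> r2" using y by auto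
    have "eamp y \<le> sqrt (\<bar>y - r1\<bar> * \<bar>y - r2\<bar>)" using eigf_abs_le[OF n, of 0 0] by (simp add: eigf_eamp_elog eamp_pos)
    also have "\<dots> \<le> sqrt ((r2 - r1) * (r2 - r1))" using y by (intro real_sqrt_le_mono mult_mono) auto
    finally show ?thesis using r by simp
  qed
  let ?d = "\<lambda>m. distr (density m (\<lambda>y. ennreal (eamp y))) borel elog"
  have fd: "finite_measure (?d m)" if "finite_measure m" "sets m = sets borel" "AE y in m. y \<in> {r1<..<r2}" for m
  proof -
    note [measurable_cong] = that(2)
    have "finite_measure (density m (\<lambda>y. ennreal (eamp y)))"
      by (rule finite_measure_density_bounded[OF that(1), where K="r2 - r1"]) (rule eventually_mono[OF that(3) b], simp, measurable)
    then show ?thesis by (rule finite_measure.finite_measure_distr) measurable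
  qed
  have nn: "0 \<le> eamp y" for y using eamp_pos[of y] by simp
  show "?d m1 = ?d m2"
  proof (rule finite_measure_eqI_char[OF fd[OF f(1) s(1) ae(1)] fd[OF f(2) s(2) ae(2)]])
    fix \<theta>
    have c: "(\<lambda>x::real. cos (\<theta> * x)) \<in> borel_measurable borel" and sn: "(\<lambda>x::real. sin (\<theta> * x)) \<in> borel_measurable borel" by measurable
    show "(\<integral>x. cos (\<theta> * x) \<partial>?d m1) = (\<integral>x. cos (\<theta> * x) \<partial>?d m2)"
      unfolding integral_weighted_distr[OF s(1) eamp_elog_meas(1) nn eamp_elog_meas(2) c] integral_weighted_distr[OF s(2) eamp_elog_meas(1) nn eamp_elog_meas(2) c]
      using e[of \<theta> 0] unfolding eigf_eamp_elog by simp
    show "(\<integral>x. sin (\<theta> * x) \<partial>?d m1) = (\<integral>x. sin (\<theta> * x) \<partial>?d m2)"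
      unfolding integral_weighted_distr[OF s(1) eamp_elog_meas(1) nn eamp_elog_meas(2) sn] integral_weighted_distr[OF s(2) eamp_elog_meas(1) nn eamp_elog_meas(2) sn]
      using e[of \<theta> "- (pi / 2)"] unfolding eigf_eamp_elog cos_minus_half_pi .
  qed simp_all
qed (auto simp: eamp_pos)

text \<open>On the unbounded components only the sine phase is available. Weighting by \<open>\<bar>elog y\<bar>\<close> turns it into
  \<open>sin (\<theta> x) / x\<close>, whose derivative in \<open>\<theta>\<close> is the cosine transform.\<close>

lemma separation_outer:
  fixes m1 m2 :: "real measure"
  assumes I: "I = {r2<..} \<or> I = {..<r1}"
    and f: "finite_measure m1" "finite_measure m2" and s: "sets m1 = sets borel" "sets m2 = sets borel"
    and ae: "AE y in m1. y \<in> I" "AE y in m2. y \<in> I"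
    and e: "\<And>\<theta>. (\<integral>y. eigf r1 r2 \<theta> (- (pi / 2)) y \<partial>m1) = (\<integral>y. eigf r1 r2 \<theta> (- (pi / 2)) y \<partial>m2)"
  shows "m1 = m2"
proof -
  \<comment> \<open>The sign of \<open>elog\<close> on \<open>I\<close>: the ratio is below 1 to the
    right of \<open>r2\<close> and above 1 to the left of \<open>r1\<close>.\<close>
  define sg :: real where "sg = (if I = {r2<..} then - 1 else 1)"
  have zI: "(y - r2) / (y - r1) > 0 \<and> (y - r2) / (y - r1) \<noteq> 1 \<and> y \<noteq> r1 \<and> y \<noteq> r2 \<and> sg * elog y > 0" if y: "y \<in> I" for y
  proof (cases "I = {r2<..}")
    case True
    then have y': "r2 < y" using y by auto
    have n: "y \<noteq> r1" "y \<noteq> r2" using y' r by auto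
    have z: "0 < (y - r2) / (y - r1)" "(y - r2) / (y - r1) < 1" using y' r by auto
    then have "elog y < 0" unfolding elog_ratio[OF n] abs_of_pos[OF z(1)] by simp
    then show ?thesis using z n True r by (simp add: sg_def)
  next
    case False
    then have y': "y < r1" using y I by auto
    have n: "y \<noteq> r1" "y \<noteq> r2" using y' r by auto
    have "(y - r2) / (y - r1) = (r2 - y) / (r1 - y)" by (metis minus_diff_eq minus_divide_divide)
    then have z: "1 < (y - r2) / (y - r1)" using y' r by simp
    then have z0: "0 < (y - r2) / (y - r1)" by linarith
    have "elog y > 0" unfolding elog_ratio[OF n] abs_of_pos[OF z0] using z by simp
    then show ?thesis using z n False r by (simp add: sg_def)
  qed
  \<comment> \<open>The amplitude alone is unbounded at infinity; \<open>\<bar>elog y\<bar>\<close>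
    tends to 0 there and keeps the weighted measure finite.\<close>
  define q where "q = (\<lambda>y. eamp y * \<bar>elog y\<bar>)"
  define l where "l = (\<lambda>y. \<bar>elog y\<bar>)"
  have [measurable]: "q \<in> borel_measurable borel" "l \<in> borel_measurable borel" unfolding q_def l_def by measurable
  have qm: "q \<in> borel_measurable borel" and lm: "l \<in> borel_measurable borel" by measurable
  have nn: "0 \<le> q y" for y using eamp_pos[of y] by (simp add: q_def)
  have qb: "q y \<le> r2 - r1" if y: "y \<in> I" for y
  proof -
    let ?z = "(y - r2) / (y - r1)"
    note z = zI[OF y]
    have n: "y \<noteq> r1" "y \<noteq> r2" using z by auto
    have zp: "0 < ?z" using z by blast
    have "q y = \<bar>y - r1\<bar> * (sqrt ?z * \<bar>ln ?z\<bar>)"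
      unfolding q_def eamp_ratio[OF n] elog_ratio[OF n] abs_of_pos[OF zp] by (rule mult.assoc)
    also have "\<dots> \<le> \<bar>y - r1\<bar> * \<bar>1 - ?z\<bar>" by (intro mult_left_mono sqrt_ln_bound[OF zp]) simp
    also have "1 - ?z = (r2 - r1) / (y - r1)" using n by (simp add: field_simps)
    finally show ?thesis using n r by (simp add: abs_divide)
  qed
  let ?d = "\<lambda>m. distr (density m (\<lambda>y. ennreal (q y))) borel l"
  have fd: "finite_measure (?d m)" if "finite_measure m" "sets m = sets borel" "AE y in m. y \<in> I" for m
  proof -
    note [measurable_cong] = that(2)
    have "finite_measure (density m (\<lambda>y. ennreal (q y)))"
      by (rule finite_measure_density_bounded[OF that(1), where K="r2 - r1"]) (rule eventually_mono[OF that(3) qb], simp, measurable)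
    then show ?thesis by (rule finite_measure.finite_measure_distr) measurable
  qed
  have pd: "AE x in ?d m. 0 < x" if "sets m = sets borel" "AE y in m. y \<in> I" for m
  proof -
    note [measurable_cong] = that(1)
    have "AE y in m. 0 < l y"
      using that(2)
    proof eventually_elim
      fix y assume "y \<in> I"
      then have "sg * elog y > 0" using zI by blast
      then have "elog y \<noteq> 0" by auto
      then show "0 < l y" by (simp add: l_def)
    qed
    then have "AE y in density m (\<lambda>y. ennreal (q y)). 0 < l y" by (subst AE_density) (auto elim: eventually_mono)
    then show ?thesis by (subst AE_distr_iff) auto
  qed
  have sl: "(\<integral>x. sin (\<theta> * x) / x \<partial>?d m) = sg * (\<integral>y. eigf r1 r2 \<theta> (- (pi / 2)) y \<partial>m)"
    if sm: "sets m = sets borel" and am: "AE y in m. y \<in> I" for m \<theta>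
  proof -
    note [measurable_cong] = sm
    have h: "(\<lambda>x::real. sin (\<theta> * x) / x) \<in> borel_measurable borel" by measurable
    have "(\<integral>x. sin (\<theta> * x) / x \<partial>?d m) = (\<integral>y. q y * (sin (\<theta> * l y) / l y) \<partial>m)"
      by (rule integral_weighted_distr[OF sm qm nn lm h])
    also have "\<dots> = (\<integral>y. sg * eigf r1 r2 \<theta> (- (pi / 2)) y \<partial>m)"
    proof (rule integral_cong_AE)
      show "AE y in m. q y * (sin (\<theta> * l y) / l y) = sg * eigf r1 r2 \<theta> (- (pi / 2)) y"
        using am
      proof eventually_elim
        fix y assume "y \<in> I"
        then have p: "sg * elog y > 0" using zI by blast
        have "\<bar>elog y\<bar> = sg * elog y"
          using p by (cases "I = {r2<..}") (auto simp: sg_def)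
        then have a: "\<bar>elog y\<bar> = sg * elog y" "\<bar>elog y\<bar> \<noteq> 0" using p by auto
        have "sin (\<theta> * (sg * elog y)) = sg * sin (\<theta> * elog y)" by (simp add: sg_def)
        then have "sin (\<theta> * \<bar>elog y\<bar>) = sg * sin (\<theta> * elog y)" unfolding a(1) .
        then show "q y * (sin (\<theta> * l y) / l y) = sg * eigf r1 r2 \<theta> (- (pi / 2)) y"
          unfolding q_def l_def eigf_eamp_elog cos_minus_half_pi using a(2) by simp
      qed
    qed measurable
    finally show ?thesis by simp
  qed
  have ceq: "(\<integral>x. cos (\<theta> * x) \<partial>?d m1) = (\<integral>x. cos (\<theta> * x) \<partial>?d m2)" for \<theta>
  proof -
    have sets: "sets (?d m) = sets borel" for m by simp
    note c1 = cos_integral_from_sinc[OF fd[OF f(1) s(1) ae(1)] sets pd[OF s(1) ae(1)], of \<theta>]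
    note c2 = cos_integral_from_sinc[OF fd[OF f(2) s(2) ae(2)] sets pd[OF s(2) ae(2)], of \<theta>]
    show ?thesis
      by (rule LIMSEQ_unique[OF c1[unfolded sl[OF s(1) ae(1)]] c2[unfolded sl[OF s(2) ae(2)], folded e]])
  qed
  have deq: "?d m1 = ?d m2"
    by (rule finite_measure_abs_eqI_cos[OF fd[OF f(1) s(1) ae(1)] fd[OF f(2) s(2) ae(2)] _ _ ceq pd[OF s(1) ae(1)] pd[OF s(2) ae(2)]]) simp_all
  show ?thesis
  proof (rule measure_eqI_weighted_distr[where q=q and l=l and linv="\<lambda>x. (r2 - r1 * exp (sg * x)) / (1 - exp (sg * x))", OF s ae _ _ _ _ _ deq])
    fix y assume y: "y \<in> I"
    let ?z = "(y - r2) / (y - r1)"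
    have p: "sg * elog y > 0" and z: "?z > 0" "?z \<noteq> 1" and n: "y \<noteq> r1" "y \<noteq> r2" using zI[OF y] by auto
    show "q y > 0" unfolding q_def using eamp_pos[of y] p by (auto intro!: mult_pos_pos)
    have "sg * l y = elog y" unfolding l_def using p by (cases "I = {r2<..}") (auto simp: sg_def)
    then have x: "exp (sg * l y) = ?z" unfolding elog_ratio[OF n] abs_of_pos[OF z(1)] using z by simp
    have "1 - ?z = (r2 - r1) / (y - r1)" using n by (simp add: field_simps)
    moreover have "r2 - r1 * ?z = y * ((r2 - r1) / (y - r1))" using n by (simp add: field_simps)
    ultimately show "(r2 - r1 * exp (sg * l y)) / (1 - exp (sg * l y)) = y" unfolding x using n r by simp
  qed measurable
qed

definition "state_interval I \<longleftrightarrow> I = {r1<..<r2} \<or> I = {r2<..} \<or> I = {..<r1}"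
text \<open>The sine phase vanishes where \<open>(y - r2) / (y - r1) = 1\<close>, that is at infinity, which keeps the
  eigenfunctions bounded on the unbounded components.\<close>

definition "admissible I \<kappa> \<longleftrightarrow> I = {r1<..<r2} \<or> \<kappa> = - (pi / 2)"

lemma separation:
  fixes m1 m2 :: "real measure"
  assumes I: "state_interval I"
    and f: "finite_measure m1" "finite_measure m2" and s: "sets m1 = sets borel" "sets m2 = sets borel"
    and ae: "AE y in m1. y \<in> I" "AE y in m2. y \<in> I"
    and e: "\<And>\<theta> \<kappa>. admissible I \<kappa> \<Longrightarrow> (\<integral>y. eigf r1 r2 \<theta> \<kappa> y \<partial>m1) = (\<integral>y. eigf r1 r2 \<theta> \<kappa> y \<partial>m2)"
  shows "m1 = m2"
proof (cases "I = {r1<..<r2}")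
  case True
  show ?thesis by (rule separation_inner[OF f s]) (use ae e True in \<open>auto simp: admissible_def\<close>)
next
  case False
  then have I': "I = {r2<..} \<or> I = {..<r1}" using I by (auto simp: state_interval_def)
  show ?thesis by (rule separation_outer[OF I' f s ae]) (use e in \<open>auto simp: admissible_def\<close>)
qed

text \<open>The summand 1 serves the bounded component, where the amplitude is at most
  \<open>r2 - r1\<close>; the summand \<open>\<bar>\<theta>\<bar>\<close> serves the sine phase on
  the unbounded ones.\<close>

lemma eigf_bound:
  assumes I: "state_interval I" and a: "admissible I \<kappa>" and y: "y \<in> I"
  shows "\<bar>eigf r1 r2 \<theta> \<kappa> y\<bar> \<le> (1 + \<bar>\<theta>\<bar>) * (r2 - r1)"
proof (cases "I = {r1<..<r2}")
  case True
  then have y': "r1 < y" "y < r2" using y by auto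
  then have n: "y \<noteq> r1" "y \<noteq> r2" by auto
  have "\<bar>eigf r1 r2 \<theta> \<kappa> y\<bar> \<le> sqrt (\<bar>y - r1\<bar> * \<bar>y - r2\<bar>)" by (rule eigf_abs_le[OF n])
  also have "\<dots> \<le> sqrt ((r2 - r1) * (r2 - r1))" using y' by (intro real_sqrt_le_mono mult_mono) auto
  also have "\<dots> = 1 * (r2 - r1)" using r by simp
  also have "\<dots> \<le> (1 + \<bar>\<theta>\<bar>) * (r2 - r1)" using r by (intro mult_right_mono) auto
  finally show ?thesis .
next
  case False
  then have k: "\<kappa> = - (pi / 2)" using a by (simp add: admissible_def)
  have "(y - r2) / (y - r1) > 0"
  proof -
    have "y > r2 \<or> y < r1" using I y False by (auto simp: state_interval_def)
    then show ?thesis using r by (auto simp: zero_less_divide_iff)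
  qed
  from eigf_bound_outer[OF this, of \<theta>] have "\<bar>eigf r1 r2 \<theta> \<kappa> y\<bar> \<le> \<bar>\<theta>\<bar> * (r2 - r1)" using r by (simp add: k)
  also have "\<dots> \<le> (1 + \<bar>\<theta>\<bar>) * (r2 - r1)" using r by (intro mult_right_mono) auto
  finally show ?thesis .
qed

end

section \<open>One time step of the killed solution\<close>

lemma union_intervals_eqI:
  fixes a b :: "nat \<Rightarrow> real"
  assumes "\<And>n. {a n..b n} \<subseteq> I" "\<And>x. x \<in> I \<Longrightarrow> eventually (\<lambda>n. a n < x) sequentially" "\<And>x. x \<in> I \<Longrightarrow> eventually (\<lambda>n. x < b n) sequentially"
  shows "(\<Union>n. {a n..b n}) = I"
proof (intro equalityI subsetI)
  fix x assume x: "x \<in> I"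
  have "eventually (\<lambda>n. a n < x \<and> x < b n) sequentially" using assms(2,3)[OF x] by (rule eventually_conj)
  from eventually_happens'[OF sequentially_bot this] obtain n where "a n < x \<and> x < b n" by blast
  then have "x \<in> {a n..b n}" by simp
  then show "x \<in> (\<Union>n. {a n..b n})" by blast
qed (use assms(1) in blast)

lemma eigf_null_at_root:
  fixes x p :: "nat \<Rightarrow> real"
  assumes n: "\<And>n. x n \<noteq> r1" "\<And>n. x n \<noteq> r2" and l: "x \<longlonglongrightarrow> l" "l = r1 \<or> l = r2" and p: "\<And>n. 0 \<le> p n" "\<And>n. p n \<le> 1"
  shows "(\<lambda>n. eigf r1 r2 \<theta> \<kappa> (x n) * p n) \<longlonglongrightarrow> 0"
proof (rule Lim_null_comparison)
  have "(\<lambda>n. sqrt (\<bar>x n - r1\<bar> * \<bar>x n - r2\<bar>)) \<longlonglongrightarrow> sqrt (\<bar>l - r1\<bar> * \<bar>l - r2\<bar>)" by (intro tendsto_intros l(1))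
  moreover have "sqrt (\<bar>l - r1\<bar> * \<bar>l - r2\<bar>) = 0" using l(2) by auto
  ultimately show "(\<lambda>n. sqrt (\<bar>x n - r1\<bar> * \<bar>x n - r2\<bar>)) \<longlonglongrightarrow> 0" by simp
  show "eventually (\<lambda>k. norm (eigf r1 r2 \<theta> \<kappa> (x k) * p k) \<le> sqrt (\<bar>x k - r1\<bar> * \<bar>x k - r2\<bar>)) sequentially"
  proof (intro always_eventually allI)
    fix k
    have "\<bar>eigf r1 r2 \<theta> \<kappa> (x k)\<bar> * \<bar>p k\<bar> \<le> sqrt (\<bar>x k - r1\<bar> * \<bar>x k - r2\<bar>) * 1"
      using eigf_abs_le[OF n] p by (intro mult_mono) auto
    then show "norm (eigf r1 r2 \<theta> \<kappa> (x k) * p k) \<le> sqrt (\<bar>x k - r1\<bar> * \<bar>x k - r2\<bar>)" by (simp add: abs_mult)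
  qed
qed

lemma bounded_times_null:
  fixes x p :: "nat \<Rightarrow> real"
  assumes "\<And>n. \<bar>x n\<bar> \<le> C" "p \<longlonglongrightarrow> 0"
  shows "(\<lambda>n. x n * p n) \<longlonglongrightarrow> 0"
proof (rule Lim_null_comparison)
  show "(\<lambda>n. C * \<bar>p n\<bar>) \<longlonglongrightarrow> 0" using tendsto_mult_right_zero[OF tendsto_rabs_zero[OF assms(2)]] .
  show "eventually (\<lambda>n. norm (x n * p n) \<le> C * \<bar>p n\<bar>) sequentially"
    using assms(1) by (intro always_eventually allI) (auto simp: abs_mult intro: mult_right_mono)
qed

context sde begin

text \<open>Paths are continuous for all times, hence bounded on compact time intervals. This
  absence of explosion makes an infinite end of a component contribute nothing.\<close>

lemma range_prob_tendsto:
  assumes s: "0 \<le> s" and b: "filterlim b at_top sequentially"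
  shows "(\<lambda>n. prob {\<omega>\<in>space M. \<exists>r\<in>{s..s+u}. Y r \<omega> < - b n}) \<longlonglongrightarrow> 0"
    "(\<lambda>n. prob {\<omega>\<in>space M. \<exists>r\<in>{s..s+u}. Y r \<omega> > b n}) \<longlonglongrightarrow> 0"
proof -
  have ex: "eventually (\<lambda>n. \<forall>r\<in>{s..s+u}. \<bar>Y r \<omega>\<bar> < b n) sequentially" if w: "\<omega> \<in> space M" for \<omega>
  proof -
    have "continuous_on {s..s+u} (\<lambda>r. Y r \<omega>)" by (rule continuous_on_subset[OF Y_cont[OF w]]) (use s in auto)
    then obtain C where C: "\<And>r. r \<in> {s..s+u} \<Longrightarrow> \<bar>Y r \<omega>\<bar> \<le> C" using compact_bound_real[OF _ compact_Icc] by blast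
    have "eventually (\<lambda>n. C < b n) sequentially" using b unfolding filterlim_at_top_dense by blast
    then show ?thesis by eventually_elim (use C in force)
  qed
  show "(\<lambda>n. prob {\<omega>\<in>space M. \<exists>r\<in>{s..s+u}. Y r \<omega> < - b n}) \<longlonglongrightarrow> 0"
  proof (rule prob_tendsto_0[OF range_sets(1)[OF s]])
    fix \<omega> assume "\<omega> \<in> space M"
    from ex[OF this] show "eventually (\<lambda>n. \<omega> \<notin> {\<omega>\<in>space M. \<exists>r\<in>{s..s+u}. Y r \<omega> < - b n}) sequentially"
      by eventually_elim force
  qed
  show "(\<lambda>n. prob {\<omega>\<in>space M. \<exists>r\<in>{s..s+u}. Y r \<omega> > b n}) \<longlonglongrightarrow> 0"
  proof (rule prob_tendsto_0[OF range_sets(2)[OF s]])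
    fix \<omega> assume "\<omega> \<in> space M"
    from ex[OF this] show "eventually (\<lambda>n. \<omega> \<notin> {\<omega>\<in>space M. \<exists>r\<in>{s..s+u}. Y r \<omega> > b n}) sequentially"
      by eventually_elim force
  qed
qed

text \<open>Each component is exhausted by compact intervals. At an end that tends to a root the
  amplitude vanishes; at an end that tends to infinity the eigenfunction is bounded and the
  probability of getting there vanishes.\<close>

lemma eigf_step:
  assumes P: "P = qnv_poly e1 r1 r2" and r: "r1 < r2" and I: "state_interval r1 r2 I" and adm: "admissible r1 r2 I \<kappa>"
    and u: "0 < u" and i: "s = u * real i" and A: "A \<in> sets (F s)"
  shows "(\<integral>\<omega>. indicator A \<omega> * indicator {\<omega>\<in>space M. \<forall>r\<in>{s..s+u}. Y r \<omega> \<in> I} \<omega> * eigf r1 r2 \<theta> \<kappa> (Y (s + u) \<omega>) \<partial>M)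
     = exp (- (1/4 + \<theta>\<^sup>2) * (e1 * (r2 - r1))\<^sup>2 / 2 * u) * (\<integral>\<omega>. indicator A \<omega> * indicator I (Y s \<omega>) * eigf r1 r2 \<theta> \<kappa> (Y s \<omega>) \<partial>M)"
proof -
  have s: "0 \<le> s" using i u by simp
  have oI: "open I" "I \<inter> {r1, r2} = {}" using I r by (auto simp: state_interval_def[OF r])
  interpret T: sde_test M F B P y0 Y "eigf r1 r2 \<theta> \<kappa>" "eigf1 r1 r2 \<theta> \<kappa>" "eigf2 r1 r2 \<theta> \<kappa>" "eigf3 r1 r2 \<theta> \<kappa>" I
    "- (1/4 + \<theta>\<^sup>2) * (e1 * (r2 - r1))\<^sup>2 / 2"
    by (rule sde_test_eigf[OF P oI])
  have bd: "\<bar>eigf r1 r2 \<theta> \<kappa> y\<bar> \<le> (1 + \<bar>\<theta>\<bar>) * (r2 - r1)" if "y \<in> I" for y by (rule eigf_bound[OF r I adm that])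
  have fin: ?thesis
    if ab: "\<And>n. a n \<le> b n" "decseq a" "incseq b" "(\<Union>n. {a n..b n}) = I"
    and la: "a \<longlonglongrightarrow> r1 \<or> a \<longlonglongrightarrow> r2 \<or> filterlim (\<lambda>n. - a n) at_top sequentially"
    and lb: "b \<longlonglongrightarrow> r1 \<or> b \<longlonglongrightarrow> r2 \<or> filterlim b at_top sequentially" for a b
  proof (rule T.dynkin_interval[OF ab bd _ _ u i A])
    have aI: "a n \<in> I" "b n \<in> I" for n using ab(1)[of n] ab(4) by force+
    have n: "a n \<noteq> r1" "a n \<noteq> r2" "b n \<noteq> r1" "b n \<noteq> r2" for n using aI[of n] oI(2) by auto
    show "(\<lambda>n. eigf r1 r2 \<theta> \<kappa> (a n) * prob {\<omega>\<in>space M. \<exists>r\<in>{s..s+u}. Y r \<omega> < a n}) \<longlonglongrightarrow> 0"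
    proof (cases "a \<longlonglongrightarrow> r1 \<or> a \<longlonglongrightarrow> r2")
      case True
      then obtain l where l: "a \<longlonglongrightarrow> l" "l = r1 \<or> l = r2" by blast
      show ?thesis by (rule eigf_null_at_root[OF n(1,2) l]) auto
    next
      case False
      then have "filterlim (\<lambda>n. - a n) at_top sequentially" using la by blast
      from range_prob_tendsto(1)[OF s this] show ?thesis
        by (intro bounded_times_null[OF bd[OF aI(1)]]) simp
    qed
    show "(\<lambda>n. eigf r1 r2 \<theta> \<kappa> (b n) * prob {\<omega>\<in>space M. \<exists>r\<in>{s..s+u}. Y r \<omega> > b n}) \<longlonglongrightarrow> 0"
    proof (cases "b \<longlonglongrightarrow> r1 \<or> b \<longlonglongrightarrow> r2")
      case True
      then obtain l where l: "b \<longlonglongrightarrow> l" "l = r1 \<or> l = r2" by blast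
      show ?thesis by (rule eigf_null_at_root[OF n(3,4) l]) auto
    next
      case False
      then have "filterlim b at_top sequentially" using lb by blast
      from range_prob_tendsto(2)[OF s this] show ?thesis
        by (intro bounded_times_null[OF bd[OF aI(2)]])
    qed
  qed
  have inv: "1 / real (Suc n + 2) \<le> 1 / real (n + 2)" "0 < 1 / real (n + 2)" "1 / real (n + 2) \<le> 1 / 2" for n
    by (simp_all add: field_simps)
  define d where "d = r2 - r1"
  have d: "d > 0" using r by (simp add: d_def)
  \<comment> \<open>\<open>q n \<le> d / 2\<close> ensures that even the first interval
    \<open>{r1 + q n..r2 - q n}\<close> is nonempty.\<close>
  define q where "q = (\<lambda>n. d * (1 / real (n + 2)))"
  have q: "0 < q n" "q n \<le> d / 2" "q (Suc n) \<le> q n" for n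
    using d inv[of n] mult_left_mono[OF inv(1), of d n] mult_left_mono[OF inv(3), of d n] by (simp_all add: q_def)
  have ql: "q \<longlonglongrightarrow> 0" unfolding q_def by real_asymp
  have top: "filterlim (\<lambda>n. x + real n) at_top sequentially" for x by real_asymp
  have qe: "eventually (\<lambda>n. q n < x) sequentially" if "0 < x" for x using ql that by (rule order_tendstoD)
  have te: "eventually (\<lambda>n. x < y + real n) sequentially" for x y using top[of y] unfolding filterlim_at_top_dense by blast
  consider "I = {r1<..<r2}" | "I = {r2<..}" | "I = {..<r1}" using I by (auto simp: state_interval_def[OF r])
  then show ?thesis
  proof cases
    case 1
    have l: "(\<lambda>n. r1 + q n) \<longlonglongrightarrow> r1 + 0" "(\<lambda>n. r2 - q n) \<longlonglongrightarrow> r2 - 0" by (intro tendsto_intros ql)+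
    show ?thesis
    proof (rule fin[of "\<lambda>n. r1 + q n" "\<lambda>n. r2 - q n"])
      show "r1 + q n \<le> r2 - q n" for n using q(2)[of n] by (simp add: d_def)
      show "(\<Union>n. {r1 + q n..r2 - q n}) = I"
      proof (rule union_intervals_eqI)
        show "{r1 + q n..r2 - q n} \<subseteq> I" for n using q(1)[of n] 1 by auto
        fix x assume x: "x \<in> I"
        have p: "0 < x - r1" "0 < r2 - x" using x 1 by auto
        from qe[OF p(1)] show "eventually (\<lambda>n. r1 + q n < x) sequentially" by eventually_elim linarith
        from qe[OF p(2)] show "eventually (\<lambda>n. x < r2 - q n) sequentially" by eventually_elim linarith
      qed
    qed (use q(3) l in \<open>auto intro!: decseq_SucI incseq_SucI\<close>)
  next
    case 2
    have l: "(\<lambda>n. r2 + q n) \<longlonglongrightarrow> r2 + 0" by (intro tendsto_intros ql)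
    show ?thesis
    proof (rule fin[of "\<lambda>n. r2 + q n" "\<lambda>n. r2 + d + real n"])
      show "r2 + q n \<le> r2 + d + real n" for n using q(2)[of n] d by simp
      show "(\<Union>n. {r2 + q n..r2 + d + real n}) = I"
      proof (rule union_intervals_eqI)
        show "{r2 + q n..r2 + d + real n} \<subseteq> I" for n using q(1)[of n] 2 by auto
        fix x assume x: "x \<in> I"
        have "0 < x - r2" using x 2 by auto
        from qe[OF this] show "eventually (\<lambda>n. r2 + q n < x) sequentially" by eventually_elim linarith
        show "eventually (\<lambda>n. x < r2 + d + real n) sequentially" by (rule te)
      qed
    qed (use q(3) l top in \<open>auto intro!: decseq_SucI incseq_SucI\<close>)
  next
    case 3
    have l: "(\<lambda>n. r1 - q n) \<longlonglongrightarrow> r1 - 0" by (intro tendsto_intros ql)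
    have t3: "filterlim (\<lambda>n. - (r1 - d - real n)) at_top sequentially" by real_asymp
    show ?thesis
    proof (rule fin[of "\<lambda>n. r1 - d - real n" "\<lambda>n. r1 - q n"])
      show "r1 - d - real n \<le> r1 - q n" for n using q(2)[of n] d by simp
      show "(\<Union>n. {r1 - d - real n..r1 - q n}) = I"
      proof (rule union_intervals_eqI)
        show "{r1 - d - real n..r1 - q n} \<subseteq> I" for n using q(1)[of n] 3 by auto
        fix x assume x: "x \<in> I"
        have "0 < r1 - x" using x 3 by auto
        from qe[OF this] show "eventually (\<lambda>n. x < r1 - q n) sequentially" by eventually_elim linarith
        show "eventually (\<lambda>n. r1 - d - real n < x) sequentially" using te[of "r1 - d - x" 0] by eventually_elim linarith
      qed
    qed (use q(3) l t3 in \<open>auto intro!: decseq_SucI incseq_SucI\<close>)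
  qed
qed

end

section \<open>Finite-dimensional distributions\<close>

lemma null_sequence_ex:
  "\<exists>q :: nat \<Rightarrow> real. (\<forall>n. 0 < q n) \<and> decseq q \<and> (\<forall>x>0. \<exists>n. q n < x)"
proof (intro exI[of _ "\<lambda>n. inverse (real (Suc n))"] conjI allI impI)
  show "decseq (\<lambda>n. inverse (real (Suc n)))"
    by (rule decseq_SucI, rule le_imp_inverse_le) simp_all
qed (use reals_Archimedean in simp_all)

locale qnv_pair = sde M F Bt "qnv_poly e1 r1 r2" y0 Y + N: brownian N G B
  for M :: "'a measure" and F Bt e1 r1 r2 y0 Y and N :: "'b measure" and G B +
  fixes I :: "real set"
  assumes r: "r1 < r2" and SI: "state_interval r1 r2 I" and y0I: "y0 \<in> I"
begin

definition "z0 = (y0 - r2) / (y0 - r1)"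
definition "\<sigma> = e1 * (r2 - r1)"
abbreviation "ZN \<equiv> gbm z0 \<sigma> B"
text \<open>The Moebius inverse of the map from \<open>y\<close> to
  \<open>(y - r2) / (y - r1)\<close>; \<open>z = 1\<close> corresponds to infinity and
  \<open>z = 0\<close> to \<open>r2\<close>.\<close>

definition "f z = (r2 - r1 * z) / (1 - z)"
text \<open>The density of the change of measure, normalised to 1 at time 0. The factor
  \<open>1 / (1 - z0)\<close> is \<open>(y0 - r1) / (r2 - r1)\<close>, and it makes the weight
  positive on the side of 1 where \<open>Z\<close> starts.\<close>

definition "wt t \<omega> = (1 - ZN t \<omega>) / (1 - z0)"
abbreviation "sd \<equiv> N.side z0"

lemma I_cases: "I = {r1<..<r2} \<or> I = {r2<..} \<or> I = {..<r1}"
  using SI by (simp add: state_interval_def[OF r])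

lemma y0_ne: "y0 \<noteq> r1" "y0 \<noteq> r2" using I_cases y0I r by auto

lemma one_minus_z0: "1 - z0 = (r2 - r1) / (y0 - r1)"
  unfolding z0_def using y0_ne by (simp add: field_simps)

lemma z0_ne: "z0 \<noteq> 0" "z0 \<noteq> 1"
  using y0_ne r one_minus_z0 by (auto simp: z0_def)

lemma z0_inner: "I = {r1<..<r2} \<Longrightarrow> z0 < 0"
  using y0I by (simp add: z0_def divide_neg_pos)

lemma z0_outer: "I \<noteq> {r1<..<r2} \<Longrightarrow> 0 < z0"
  using I_cases y0I r by (auto simp: z0_def zero_less_divide_iff)

lemma z0_upper: "I = {r2<..} \<Longrightarrow> z0 < 1"
  using y0I r by (simp add: z0_def)

lemma z0_lower: "I = {..<r1} \<Longrightarrow> 1 < z0"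
proof -
  assume "I = {..<r1}"
  then have "1 - z0 < 0" unfolding one_minus_z0 using y0I r by (simp add: divide_pos_neg)
  then show ?thesis by simp
qed

text \<open>The definition of \<open>side\<close> carries the hypotheses of the stopping argument,
  so it unfolds only for data satisfying them. The linear martingale with volatility 0 on the unit
  time interval supplies such data.\<close>

lemma sd_eq: "sd z = sgn (1 - z0) * (1 - z)"
proof -
  have A: "space N \<in> sets (G 0)" using N.space_F[of 0] sets.top[of "G 0"] by simp
  show ?thesis
    by (rule N.side_def[OF z0_ne N.eigen_mart_linear[of z0 0] _ zero_le_one order_refl zero_less_one A]) simp
qed

lemma side_pos_iff: "sd z > 0 \<longleftrightarrow> (1 - z) / (1 - z0) > 0"
  unfolding sd_eq using z0_ne(2) by (cases "z0 < 1") (auto simp: zero_less_divide_iff)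

lemma side_z0: "sd z0 > 0" unfolding side_pos_iff using z0_ne by simp

lemma f_props:
  assumes z: "z * z0 > 0" and sp: "sd z > 0"
  shows "f z \<in> I" "f z - r1 = (r2 - r1) / (1 - z)" "(f z - r2) / (f z - r1) = z" "f z \<noteq> r1" "f z \<noteq> r2"
proof -
  have z1: "z \<noteq> 1" using sp by (auto simp: sd_eq)
  have zn: "z \<noteq> 0" using z by auto
  show a: "f z - r1 = (r2 - r1) / (1 - z)" unfolding f_def using z1 by (simp add: field_simps)
  have b: "f z - r2 = z * ((r2 - r1) / (1 - z))" unfolding f_def using z1 by (simp add: field_simps)
  have c: "(r2 - r1) / (1 - z) \<noteq> 0" using z1 r by simp
  show "(f z - r2) / (f z - r1) = z" unfolding a b using c by simp
  show ne: "f z \<noteq> r1" "f z \<noteq> r2" using a b c zn by auto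
  consider "I = {r1<..<r2}" | "I = {r2<..}" | "I = {..<r1}" using I_cases by blast
  then show "f z \<in> I"
  proof cases
    case 1
    have "z < 0" using z0_inner[OF 1] z by (simp add: zero_less_mult_iff)
    then have q: "(r2 - r1) / (1 - z) > 0" using r by simp
    then have "f z - r1 > 0" "f z - r2 < 0" unfolding a b using mult_neg_pos[OF \<open>z < 0\<close> q] by simp_all
    then show ?thesis using 1 by simp
  next
    case 2
    have "r2 + 1 \<in> I" "r2 + 1 \<notin> {r1<..<r2}" unfolding 2 by simp_all
    then have "0 < z0" by (intro z0_outer) blast
    moreover have "z0 < 1" using z0_upper 2 by blast
    ultimately have "0 < z" "z < 1" using z sp by (simp_all add: zero_less_mult_iff sd_eq)
    then have "f z - r2 > 0" unfolding b using r by (intro mult_pos_pos divide_pos_pos) simp_all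
    then show ?thesis using 2 by simp
  next
    case 3
    then have "1 < z0" using z0_lower by blast
    then have "1 < z" using sp by (simp add: sd_eq)
    then have "f z - r1 < 0" unfolding a using r by (intro divide_pos_neg) simp_all
    then show ?thesis using 3 by simp
  qed
qed

lemma f_z0: "f z0 = y0"
proof -
  have "y0 - r1 \<noteq> 0" using y0_ne by simp
  moreover have "r2 - r1 * z0 = y0 * ((r2 - r1) / (y0 - r1))"
    unfolding z0_def using y0_ne by (simp add: field_simps)
  ultimately show ?thesis unfolding f_def one_minus_z0 using r by simp
qed

lemma wt_pos: "sd (ZN t \<omega>) > 0 \<Longrightarrow> wt t \<omega> > 0"
  unfolding side_pos_iff wt_def .

definition "K0 = (r2 - r1) / \<bar>1 - z0\<bar>"

text \<open>\<open>f z - r1 = (r2 - r1) / (1 - z)\<close>, so the prefactor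
  \<open>\<bar>y - r1\<bar>\<close> of the eigenfunction cancels the factor
  \<open>\<bar>1 - z\<bar>\<close> of the weight. Up to a constant, weighted eigenfunctions of
  \<open>Y\<close> are unweighted ones of \<open>Z\<close>.\<close>

lemma wt_eigf:
  assumes sp: "sd (ZN t \<omega>) > 0"
  shows "wt t \<omega> * eigf r1 r2 \<theta> \<kappa> (f (ZN t \<omega>)) = K0 * trig_mode \<theta> \<kappa> (ZN t \<omega>)"
proof -
  note fp = f_props[OF N.gbm_sign[OF z0_ne(1)] sp]
  have w: "wt t \<omega> = \<bar>1 - ZN t \<omega>\<bar> / \<bar>1 - z0\<bar>"
    using abs_of_pos[OF wt_pos[OF sp]] unfolding wt_def by (simp only: abs_divide)
  have z1: "\<bar>1 - ZN t \<omega>\<bar> \<noteq> 0" using sp by (auto simp: sd_eq)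
  have "eigf r1 r2 \<theta> \<kappa> (f (ZN t \<omega>)) = (r2 - r1) / \<bar>1 - ZN t \<omega>\<bar> * trig_mode \<theta> \<kappa> (ZN t \<omega>)"
    unfolding eigf_trig_mode[OF fp(4,5)] fp(3) unfolding fp(2) using r by (simp add: abs_divide)
  then show ?thesis unfolding w K0_def using z1 by simp
qed

definition "rate_c \<theta> = - (1/4 + \<theta>\<^sup>2) * \<sigma>\<^sup>2 / 2"

lemma N_step:
  assumes adm: "admissible r1 r2 I \<kappa>" and s: "0 \<le> s" and u: "0 < u" and A: "A \<in> sets (G s)"
  shows "(\<integral>\<omega>. indicator A \<omega> * indicator {\<omega>\<in>space N. \<forall>r\<in>{s..s+u}. sd (ZN r \<omega>) > 0} \<omega> * trig_mode \<theta> \<kappa> (ZN (s + u) \<omega>) \<partial>N)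
   = exp (rate_c \<theta> * u) * (\<integral>\<omega>. indicator A \<omega> * indicator {\<omega>\<in>space N. sd (ZN s \<omega>) > 0} \<omega> * trig_mode \<theta> \<kappa> (ZN s \<omega>) \<partial>N)"
proof -
  note em = N.eigen_mart_trig[OF z0_ne(1), of \<sigma> \<theta> \<kappa>]
  show ?thesis
  proof (cases "I = {r1<..<r2}")
    case True
    have w: "\<bar>trig_mode \<theta> \<kappa> z\<bar> \<le> 1 * \<bar>1 - z\<bar>" if "z * z0 > 0" for z
      by (rule trig_mode_bound_neg) (use that z0_inner[OF True] in \<open>simp add: zero_less_mult_iff\<close>)
    show ?thesis unfolding rate_c_def by (rule N.stopped_mart[OF z0_ne em w _ s u A]) simp_all
  next
    case False
    then have k: "\<kappa> = - (pi / 2)" using adm by (simp add: admissible_def[OF r])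
    have w: "\<bar>trig_mode \<theta> \<kappa> z\<bar> \<le> \<bar>\<theta>\<bar> * \<bar>1 - z\<bar>" if "z * z0 > 0" for z
      unfolding k by (rule trig_mode_bound_pos) (use that z0_outer[OF False] in \<open>simp add: zero_less_mult_iff\<close>)
    show ?thesis unfolding rate_c_def by (rule N.stopped_mart[OF z0_ne em w _ s u A]) simp_all
  qed
qed

text \<open>\<open>1 - z\<close> has eigenvalue 0 and vanishes at 1, so killing at 1 takes nothing
  away from its expectation.\<close>

lemma total_mass:
  assumes u: "0 < u"
  shows "(\<integral>\<omega>. indicator {\<omega>\<in>space N. \<forall>r\<in>{0..u}. sd (ZN r \<omega>) > 0} \<omega> * wt u \<omega> \<partial>N) = 1"
proof -
  have SG: "space N \<in> sets (G 0)" using N.space_F[of 0] sets.top[of "G 0"] by simp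
  have "(\<integral>\<omega>. indicator (space N) \<omega> * indicator {\<omega>\<in>space N. \<forall>r\<in>{0..0+u}. sd (ZN r \<omega>) > 0} \<omega> * (1 - ZN (0 + u) \<omega>) \<partial>N)
   = exp (0 * u) * (\<integral>\<omega>. indicator (space N) \<omega> * indicator {\<omega>\<in>space N. sd (ZN 0 \<omega>) > 0} \<omega> * (1 - ZN 0 \<omega>) \<partial>N)"
    by (rule N.stopped_mart[OF z0_ne N.eigen_mart_linear _ _ order_refl u SG, where C=1]) simp_all
  also have "(\<integral>\<omega>. indicator (space N) \<omega> * indicator {\<omega>\<in>space N. sd (ZN 0 \<omega>) > 0} \<omega> * (1 - ZN 0 \<omega>) \<partial>N) = (\<integral>\<omega>. 1 - z0 \<partial>N)"
    by (rule Bochner_Integration.integral_cong[OF refl]) (use side_z0 in \<open>simp add: N.gbm_0\<close>)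
  also have "\<dots> = 1 - z0" by (simp add: N.prob_space)
  finally have e: "(\<integral>\<omega>. indicator (space N) \<omega> * indicator {\<omega>\<in>space N. \<forall>r\<in>{0..0+u}. sd (ZN r \<omega>) > 0} \<omega> * (1 - ZN (0 + u) \<omega>) \<partial>N) = 1 - z0" by simp
  have "(\<integral>\<omega>. indicator {\<omega>\<in>space N. \<forall>r\<in>{0..u}. sd (ZN r \<omega>) > 0} \<omega> * wt u \<omega> \<partial>N)
     = (\<integral>\<omega>. (indicator (space N) \<omega> * indicator {\<omega>\<in>space N. \<forall>r\<in>{0..0+u}. sd (ZN r \<omega>) > 0} \<omega> * (1 - ZN (0 + u) \<omega>)) / (1 - z0) \<partial>N)"
    by (rule Bochner_Integration.integral_cong[OF refl]) (simp add: wt_def)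
  also have "\<dots> = 1" using e z0_ne by simp
  finally show ?thesis .
qed

lemma M_step:
  assumes adm: "admissible r1 r2 I \<kappa>" and u: "0 < u" and i: "s = u * real i" and A: "A \<in> sets (F s)"
  shows "(\<integral>\<omega>. indicator A \<omega> * indicator {\<omega>\<in>space M. \<forall>r\<in>{s..s+u}. Y r \<omega> \<in> I} \<omega> * eigf r1 r2 \<theta> \<kappa> (Y (s + u) \<omega>) \<partial>M)
     = exp (rate_c \<theta> * u) * (\<integral>\<omega>. indicator A \<omega> * indicator I (Y s \<omega>) * eigf r1 r2 \<theta> \<kappa> (Y s \<omega>) \<partial>M)"
  unfolding rate_c_def \<sigma>_def by (rule eigf_step[OF refl r SI adm u i A])

lemma I_exhaust: obtains a b :: "nat \<Rightarrow> real" where "decseq a" "incseq b" "(\<Union>n. {a n..b n}) = I"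
proof -
  note exhaustI = that
  from null_sequence_ex obtain q :: "nat \<Rightarrow> real" where q0: "(\<forall>n. 0 < q n) \<and> decseq q \<and> (\<forall>x>0. \<exists>n. q n < x)" ..
  have q: "0 < q n" "decseq q" "0 < x \<Longrightarrow> \<exists>n. q n < x" for n x using q0 by simp_all
  have lo: "\<exists>n. p + q n \<le> x" if px: "p < x" for p x :: real
  proof -
    from px have "0 < x - p" by simp
    from q(3)[OF this] obtain n where "q n < x - p" ..
    then have "p + q n \<le> x" by linarith
    then show ?thesis ..
  qed
  have hi: "\<exists>n. x \<le> p - q n" if px: "x < p" for p x :: real
  proof -
    from px have "0 < p - x" by simp
    from q(3)[OF this] obtain n where "q n < p - x" ..
    then have "x \<le> p - q n" by linarith
    then show ?thesis ..
  qed
  have m: "q n \<le> q k" if "k \<le> n" for n k using decseqD[OF q(2) that] .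
  have sq: thesis if ab: "decseq a" "incseq b" and s: "\<And>n. {a n..b n} \<subseteq> I" and e: "\<And>x. x \<in> I \<Longrightarrow> \<exists>n. a n \<le> x" "\<And>x. x \<in> I \<Longrightarrow> \<exists>n. x \<le> b n" for a b :: "nat \<Rightarrow> real"
  proof (rule exhaustI[OF ab])
    show "(\<Union>n. {a n..b n}) = I"
    proof (intro equalityI subsetI)
      fix x assume x: "x \<in> I"
      obtain n k where nk: "a n \<le> x" "x \<le> b k" using e[OF x] by blast
      have "a (max n k) \<le> a n" "b k \<le> b (max n k)" using decseqD[OF ab(1), of n "max n k"] incseqD[OF ab(2), of k "max n k"] by auto
      then have "x \<in> {a (max n k)..b (max n k)}" using nk by auto
      then show "x \<in> (\<Union>n. {a n..b n})" by blast
    qed (use s in blast)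
  qed
  consider "I = {r1<..<r2}" | "I = {r2<..}" | "I = {..<r1}" using I_cases by blast
  then show thesis
  proof cases
    case 1
    show thesis
    proof (rule sq[of "\<lambda>n. r1 + q n" "\<lambda>n. r2 - q n"])
      show "{r1 + q n..r2 - q n} \<subseteq> I" for n
      proof
        fix x assume x: "x \<in> {r1 + q n..r2 - q n}"
        have "0 < q n" by (rule q(1))
        then show "x \<in> I" using x unfolding 1 greaterThanLessThan_iff greaterThan_iff lessThan_iff atLeastAtMost_iff by linarith
      qed
      show "\<exists>n. r1 + q n \<le> x" if "x \<in> I" for x by (rule lo) (use that 1 in simp)
      show "\<exists>n. x \<le> r2 - q n" if "x \<in> I" for x by (rule hi) (use that 1 in simp)
    qed (use m in \<open>auto simp: decseq_def incseq_def\<close>)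
  next
    case 2
    \<comment> \<open>The first few intervals may be empty, which is harmless: only monotonicity of
      the ends and the union matter here.\<close>
    show thesis
    proof (rule sq[of "\<lambda>n. r2 + q n" "\<lambda>n. real n"])
      show "{r2 + q n..real n} \<subseteq> I" for n
      proof
        fix x assume x: "x \<in> {r2 + q n..real n}"
        have "0 < q n" by (rule q(1))
        then show "x \<in> I" using x unfolding 2 greaterThanLessThan_iff greaterThan_iff lessThan_iff atLeastAtMost_iff by linarith
      qed
      show "\<exists>n. r2 + q n \<le> x" if "x \<in> I" for x by (rule lo) (use that 2 in simp)
      show "\<exists>n. x \<le> real n" for x by (rule real_arch_simple)
    qed (use m in \<open>auto simp: decseq_def incseq_def\<close>)
  next
    case 3
    show thesis
    proof (rule sq[of "\<lambda>n. - real n" "\<lambda>n. r1 - q n"])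
      show "{- real n..r1 - q n} \<subseteq> I" for n
      proof
        fix x assume x: "x \<in> {- real n..r1 - q n}"
        have "0 < q n" by (rule q(1))
        then show "x \<in> I" using x unfolding 3 greaterThanLessThan_iff greaterThan_iff lessThan_iff atLeastAtMost_iff by linarith
      qed
      show "\<exists>n. x \<le> r1 - q n" if "x \<in> I" for x by (rule hi) (use that 3 in simp)
      show "\<exists>n. - real n \<le> x" for x using real_arch_simple[of "- x"] by (auto simp: minus_le_iff)
    qed (use m in \<open>auto simp: decseq_def incseq_def\<close>)
  qed
qed

definition "ST t = {\<omega>\<in>space M. \<forall>r\<in>{0..t}. Y r \<omega> \<in> I}"
definition "SN t = {\<omega>\<in>space N. \<forall>r\<in>{0..t}. sd (ZN r \<omega>) > 0}"

lemma ST_F: assumes "0 \<le> t" shows "ST t \<in> sets (F t)"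
proof -
  obtain a b where ab: "decseq a" "incseq b" "(\<Union>n. {a n..b n}) = I" by (rule I_exhaust)
  have Ym: "Y r \<in> borel_measurable (F t)" if "r \<in> {0..t}" for r using that by (intro F_mono[OF Y_meas]) auto
  have Yc: "continuous_on {0..t} (\<lambda>r. Y r \<omega>)" if "\<omega> \<in> space (F t)" for \<omega>
    using that unfolding space_F[OF assms] by (intro continuous_on_subset[OF Y_cont]) auto
  show ?thesis using stay_exhaust_sets[OF Ym Yc assms ab] unfolding ST_def space_F[OF assms] .
qed

lemma SN_F: assumes "0 \<le> t" shows "SN t \<in> sets (G t)"
proof -
  from null_sequence_ex obtain q :: "nat \<Rightarrow> real" where q0: "(\<forall>n. 0 < q n) \<and> decseq q \<and> (\<forall>x>0. \<exists>n. q n < x)" ..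
  have q: "0 < q n" "decseq q" "0 < x \<Longrightarrow> \<exists>n. q n < x" for n x using q0 by simp_all
  let ?a = q and ?b = "\<lambda>n. real n"
  have ab: "decseq ?a" "incseq ?b" "(\<Union>n. {?a n..?b n}) = {0<..}"
  proof -
    show d: "decseq ?a" "incseq ?b" using q(2) by (simp_all add: incseq_def)
    show "(\<Union>n. {?a n..?b n}) = {0<..}"
    proof (intro equalityI subsetI)
      fix x assume "x \<in> (\<Union>n. {?a n..?b n})"
      then obtain n where n: "?a n \<le> x" by auto
      have "0 < ?a n" by (rule q(1))
      then have "0 < x" using n by (rule less_le_trans)
      then show "x \<in> {0<..}" by simp
    next
      fix x :: real assume "x \<in> {0<..}"
      then obtain n k where nk: "?a n < x" "x \<le> ?b k" using q(3)[of x] real_arch_simple[of x] by auto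
      have "?a (max n k) \<le> ?a n" "?b k \<le> ?b (max n k)" using decseqD[OF d(1), of n "max n k"] incseqD[OF d(2), of k "max n k"] by auto
      then have "x \<in> {?a (max n k)..?b (max n k)}" using nk by (simp del: of_nat_Suc)
      then show "x \<in> (\<Union>n. {?a n..?b n})" by blast
    qed
  qed
  have sdm: "sd \<in> borel_measurable borel" unfolding sd_eq[abs_def] by measurable
  have Zm: "(\<lambda>\<omega>. sd (ZN r \<omega>)) \<in> borel_measurable (G t)" if "r \<in> {0..t}" for r
    using that by (intro measurable_compose[OF N.F_mono[OF N.gbm_meas] sdm]) auto
  have Zc: "continuous_on {0..t} (\<lambda>r. sd (ZN r \<omega>))" if "\<omega> \<in> space (G t)" for \<omega>
    using that unfolding N.space_F[OF assms] sd_eq by (intro continuous_intros continuous_on_subset[OF N.gbm_cont]) auto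
  show ?thesis using stay_exhaust_sets[OF Zm Zc assms ab] unfolding SN_def N.space_F[OF assms] by simp
qed

end

section \<open>The laws killed along a time grid\<close>

context qnv_pair begin

lemma I_borel: "I \<in> sets borel" using I_cases by auto

lemma f_meas[measurable]: "f \<in> borel_measurable borel" unfolding f_def[abs_def] by measurable

lemma ZN_M: "0 \<le> t \<Longrightarrow> ZN t \<in> borel_measurable N" by (rule N.F_M[OF N.gbm_meas])

lemma fZ_G: "0 \<le> r \<Longrightarrow> r \<le> t \<Longrightarrow> (\<lambda>\<omega>. f (ZN r \<omega>)) \<in> borel_measurable (G t)"
  by (rule measurable_compose[OF N.F_mono[OF N.gbm_meas] f_meas]) auto

lemma wt_M: "0 \<le> t \<Longrightarrow> wt t \<in> borel_measurable N"
  unfolding wt_def[abs_def] using ZN_M by (intro borel_measurable_divide borel_measurable_diff) auto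

lemma wt_integrable: "0 \<le> t \<Longrightarrow> integrable N (wt t)"
  unfolding wt_def[abs_def] by (intro integrable_divide Bochner_Integration.integrable_diff N.gbm_integrable) auto

lemma SN_pos: "\<omega> \<in> SN t \<Longrightarrow> r \<in> {0..t} \<Longrightarrow> sd (ZN r \<omega>) > 0"
  unfolding SN_def by blast

lemma SN_f: assumes "\<omega> \<in> SN t" "r \<in> {0..t}" shows "f (ZN r \<omega>) \<in> I"
  by (rule f_props(1)[OF N.gbm_sign[OF z0_ne(1)] SN_pos[OF assms]])

lemma wt_indicator_nonneg: assumes "E \<subseteq> SN t" "0 \<le> t" shows "0 \<le> wt t \<omega> * indicator E \<omega>"
proof (cases "\<omega> \<in> E")
  case True
  then have "sd (ZN t \<omega>) > 0" using assms by (intro SN_pos[of \<omega> t t]) auto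
  then show ?thesis using wt_pos[of t \<omega>] by simp
qed simp

lemma wt_indicator_integrable: "0 \<le> t \<Longrightarrow> E \<in> N.events \<Longrightarrow> integrable N (\<lambda>\<omega>. wt t \<omega> * indicator E \<omega>)"
  using integrable_real_mult_indicator[OF _ wt_integrable] .

context
  fixes u :: real and C :: "nat \<Rightarrow> real set"
  assumes u: "0 < u" and C: "\<And>i. C i \<in> sets borel"
begin

text \<open>\<open>D1 k\<close> and \<open>D2 k\<close> are the laws of \<open>Y\<close> and of the weighted \<open>f (Z)\<close> at time \<open>u * k\<close>, killed on leaving the
  component \<open>I\<close> and on missing one of the sets \<open>C i\<close> at an earlier grid time.\<close>

definition "ES k = {\<omega>\<in>ST (u * real k). \<forall>i\<in>{..<k}. Y (u * real i) \<omega> \<in> C i}"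
definition "FS k = {\<omega>\<in>SN (u * real k). \<forall>i\<in>{..<k}. f (ZN (u * real i) \<omega>) \<in> C i}"
definition "D1 k = distr (density M (\<lambda>\<omega>. ennreal (indicator (ES k) \<omega>))) borel (Y (u * real k))"
definition "D2 k = distr (density N (\<lambda>\<omega>. ennreal (wt (u * real k) \<omega> * indicator (FS k) \<omega>))) borel (\<lambda>\<omega>. f (ZN (u * real k) \<omega>))"

lemma uk: "0 \<le> u * real k" using u by simp
lemma uk_mono: "i \<le> k \<Longrightarrow> u * real i \<le> u * real k" using u by simp
lemma uk_Suc: "u * real (Suc k) = u * real k + u" by (simp add: algebra_simps)

lemma ES_F: "ES k \<in> sets (F (u * real k))"
proof -
  have Ym: "Y (u * real i) \<in> borel_measurable (F (u * real k))" if "i \<in> {..<k}" for i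
    using that by (intro F_mono[OF Y_meas] uk uk_mono) simp
  have 1: "{\<omega>\<in>space (F (u * real k)). Y (u * real i) \<omega> \<in> C i} \<in> sets (F (u * real k))" if "i \<in> {..<k}" for i
    using measurable_sets[OF Ym[OF that] C] by (simp add: vimage_def Int_def conj_commute)
  have "{\<omega>\<in>space (F (u * real k)). \<forall>i\<in>{..<k}. Y (u * real i) \<omega> \<in> C i} \<in> sets (F (u * real k))"
    by (rule sets.sets_Collect_finite_All[OF 1]) simp_all
  from sets.Int[OF ST_F[OF uk] this]
  have "ST (u * real k) \<inter> {\<omega>\<in>space (F (u * real k)). \<forall>i\<in>{..<k}. Y (u * real i) \<omega> \<in> C i} \<in> sets (F (u * real k))" .
  moreover have "ST (u * real k) \<inter> {\<omega>\<in>space (F (u * real k)). \<forall>i\<in>{..<k}. Y (u * real i) \<omega> \<in> C i} = ES k"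
    unfolding ES_def space_F[OF uk] ST_def by blast
  ultimately show ?thesis by simp
qed

lemma FS_F: "FS k \<in> sets (G (u * real k))"
proof -
  have 1: "{\<omega>\<in>space (G (u * real k)). f (ZN (u * real i) \<omega>) \<in> C i} \<in> sets (G (u * real k))" if "i \<in> {..<k}" for i
  proof -
    have "(\<lambda>\<omega>. f (ZN (u * real i) \<omega>)) \<in> borel_measurable (G (u * real k))"
      using that by (intro fZ_G uk uk_mono) simp
    from measurable_sets[OF this C] show ?thesis by (simp add: vimage_def Int_def conj_commute)
  qed
  have "{\<omega>\<in>space (G (u * real k)). \<forall>i\<in>{..<k}. f (ZN (u * real i) \<omega>) \<in> C i} \<in> sets (G (u * real k))"
    by (rule sets.sets_Collect_finite_All[OF 1]) simp_all
  from sets.Int[OF SN_F[OF uk] this]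
  have "SN (u * real k) \<inter> {\<omega>\<in>space (G (u * real k)). \<forall>i\<in>{..<k}. f (ZN (u * real i) \<omega>) \<in> C i} \<in> sets (G (u * real k))" .
  moreover have "SN (u * real k) \<inter> {\<omega>\<in>space (G (u * real k)). \<forall>i\<in>{..<k}. f (ZN (u * real i) \<omega>) \<in> C i} = FS k"
    unfolding FS_def N.space_F[OF uk] SN_def by blast
  ultimately show ?thesis by simp
qed

lemma ES_M: "ES k \<in> events" by (rule F_sets_M[OF ES_F uk])
lemma FS_M: "FS k \<in> N.events" by (rule N.F_sets_M[OF FS_F uk])
lemma Yk_M: "Y (u * real k) \<in> borel_measurable M" by (rule Y_meas_M[OF uk])
lemma fZk_M: "(\<lambda>\<omega>. f (ZN (u * real k) \<omega>)) \<in> borel_measurable N" by (rule measurable_compose[OF ZN_M[OF uk] f_meas])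

lemma FS_SN: "FS k \<subseteq> SN (u * real k)" unfolding FS_def by blast

lemma wt_FS_nonneg: "0 \<le> wt (u * real k) \<omega> * indicator (FS k) \<omega>"
  by (rule wt_indicator_nonneg[OF FS_SN uk])

lemma wt_FS_M: "(\<lambda>\<omega>. wt (u * real k) \<omega> * indicator (FS k) \<omega>) \<in> borel_measurable N"
  using wt_M[OF uk] FS_M by measurable

lemma D1_integral:
  fixes h :: "real \<Rightarrow> real"
  assumes [measurable]: "h \<in> borel_measurable borel"
  shows "(\<integral>y. h y \<partial>D1 k) = (\<integral>\<omega>. indicator (ES k) \<omega> * h (Y (u * real k) \<omega>) \<partial>M)"
proof -
  note [measurable] = Yk_M ES_M
  show ?thesis unfolding D1_def by (subst integral_distr) (simp_all add: integral_density)
qed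

lemma D2_integral:
  fixes h :: "real \<Rightarrow> real"
  assumes [measurable]: "h \<in> borel_measurable borel"
  shows "(\<integral>y. h y \<partial>D2 k) = (\<integral>\<omega>. wt (u * real k) \<omega> * indicator (FS k) \<omega> * h (f (ZN (u * real k) \<omega>)) \<partial>N)"
proof -
  note [measurable] = fZk_M wt_FS_M
  have "(\<integral>y. h y \<partial>D2 k) = (\<integral>\<omega>. h (f (ZN (u * real k) \<omega>)) \<partial>density N (\<lambda>\<omega>. ennreal (wt (u * real k) \<omega> * indicator (FS k) \<omega>)))"
    unfolding D2_def by (rule integral_distr) measurable
  also have "\<dots> = (\<integral>\<omega>. (wt (u * real k) \<omega> * indicator (FS k) \<omega>) *\<^sub>R h (f (ZN (u * real k) \<omega>)) \<partial>N)"
    by (rule integral_density) (use wt_FS_nonneg in auto)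
  finally show ?thesis unfolding real_scaleR_def .
qed

lemma D1_finite: "finite_measure (D1 k)"
proof -
  note [measurable] = Yk_M ES_M
  have "finite_measure (density M (\<lambda>\<omega>. ennreal (indicator (ES k) \<omega>)))"
    by (rule finite_measureI) (simp add: emeasure_density ennreal_indicator)
  then show ?thesis unfolding D1_def by (rule finite_measure.finite_measure_distr) measurable
qed

lemma D2_finite: "finite_measure (D2 k)"
proof -
  note [measurable] = fZk_M wt_FS_M
  have "emeasure (density N (\<lambda>\<omega>. ennreal (wt (u * real k) \<omega> * indicator (FS k) \<omega>))) (space N) = (\<integral>\<^sup>+\<omega>. ennreal (wt (u * real k) \<omega> * indicator (FS k) \<omega>) \<partial>N)"
    by (subst emeasure_density) (auto intro!: nn_integral_cong)
  also have "\<dots> = ennreal (\<integral>\<omega>. wt (u * real k) \<omega> * indicator (FS k) \<omega> \<partial>N)"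
    by (rule nn_integral_eq_integral[OF wt_indicator_integrable[OF uk FS_M]]) (use wt_FS_nonneg in auto)
  finally have "finite_measure (density N (\<lambda>\<omega>. ennreal (wt (u * real k) \<omega> * indicator (FS k) \<omega>)))"
    by (intro finite_measureI) simp
  then show ?thesis unfolding D2_def by (rule finite_measure.finite_measure_distr) measurable
qed

lemma D1_AE: "AE y in D1 k. y \<in> I"
proof -
  note [measurable] = Yk_M ES_M I_borel
  have "AE \<omega> in density M (\<lambda>\<omega>. ennreal (indicator (ES k) \<omega>)). Y (u * real k) \<omega> \<in> I"
  proof (subst AE_density)
    have "\<omega> \<in> ES k \<Longrightarrow> Y (u * real k) \<omega> \<in> I" for \<omega> unfolding ES_def ST_def using uk[of k] by auto
    then show "AE \<omega> in M. 0 < ennreal (indicator (ES k) \<omega>) \<longrightarrow> Y (u * real k) \<omega> \<in> I"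
      by (intro AE_I2) (auto simp: indicator_def split: if_splits)
  qed measurable
  then show ?thesis unfolding D1_def by (subst AE_distr_iff) auto
qed

lemma D2_AE: "AE y in D2 k. y \<in> I"
proof -
  note [measurable] = fZk_M wt_FS_M I_borel
  have "AE \<omega> in density N (\<lambda>\<omega>. ennreal (wt (u * real k) \<omega> * indicator (FS k) \<omega>)). f (ZN (u * real k) \<omega>) \<in> I"
  proof (subst AE_density)
    have "\<omega> \<in> FS k \<Longrightarrow> f (ZN (u * real k) \<omega>) \<in> I" for \<omega>
      using FS_SN[of k] uk[of k] by (intro SN_f[of \<omega> "u * real k"]) auto
    then show "AE \<omega> in N. 0 < ennreal (wt (u * real k) \<omega> * indicator (FS k) \<omega>) \<longrightarrow> f (ZN (u * real k) \<omega>) \<in> I"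
      by (intro AE_I2) (auto simp: indicator_def split: if_splits)
  qed measurable
  then show ?thesis unfolding D2_def by (subst AE_distr_iff) auto
qed

text \<open>The conditions at earlier times and membership in \<open>C k\<close> form a single event
  known at time \<open>u * k\<close>, and the one-step identity holds on every such event. So the
  integrals after the step depend on the past through \<open>D1 k\<close> only, which stands in for
  a Markov property.\<close>

lemma eigf_D1_step:
  assumes adm: "admissible r1 r2 I \<kappa>"
  shows "(\<integral>y. eigf r1 r2 \<theta> \<kappa> y \<partial>D1 (Suc k)) = exp (rate_c \<theta> * u) * (\<integral>y. indicator (C k) y * eigf r1 r2 \<theta> \<kappa> y \<partial>D1 k)"
proof -
  let ?s = "u * real k"
  let ?A = "ES k \<inter> {\<omega>\<in>space (F ?s). Y ?s \<omega> \<in> C k}"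
  have "{\<omega>\<in>space (F ?s). Y ?s \<omega> \<in> C k} \<in> sets (F ?s)"
    using measurable_sets[OF Y_meas[OF uk] C] by (simp add: vimage_def Int_def conj_commute)
  then have A: "?A \<in> sets (F ?s)" using ES_F by (rule sets.Int[rotated])
  have split: "indicator (ES (Suc k)) \<omega> = (indicator ?A \<omega> * indicator {\<omega>\<in>space M. \<forall>r\<in>{?s..?s+u}. Y r \<omega> \<in> I} \<omega> :: real)" for \<omega>
  proof -
    have "?s \<le> ?s + u" using u by simp
    from ivl_disj_un_two_touch(4)[OF uk this] have "{0..?s + u} = {0..?s} \<union> {?s..?s+u}" by (rule sym)
    then have "\<omega> \<in> ES (Suc k) \<longleftrightarrow> \<omega> \<in> ?A \<and> \<omega> \<in> {\<omega>\<in>space M. \<forall>r\<in>{?s..?s+u}. Y r \<omega> \<in> I}"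
      unfolding ES_def ST_def uk_Suc lessThan_Suc space_F[OF uk] by blast
    then show ?thesis by (simp add: indicator_def)
  qed
  have "(\<integral>y. eigf r1 r2 \<theta> \<kappa> y \<partial>D1 (Suc k)) = (\<integral>\<omega>. indicator ?A \<omega> * indicator {\<omega>\<in>space M. \<forall>r\<in>{?s..?s+u}. Y r \<omega> \<in> I} \<omega> * eigf r1 r2 \<theta> \<kappa> (Y (?s + u) \<omega>) \<partial>M)"
    unfolding D1_integral[OF eigf_meas[OF r]] split uk_Suc ..
  also have "\<dots> = exp (rate_c \<theta> * u) * (\<integral>\<omega>. indicator ?A \<omega> * indicator I (Y ?s \<omega>) * eigf r1 r2 \<theta> \<kappa> (Y ?s \<omega>) \<partial>M)"
    by (rule M_step[OF adm u refl A])
  also have "(\<integral>\<omega>. indicator ?A \<omega> * indicator I (Y ?s \<omega>) * eigf r1 r2 \<theta> \<kappa> (Y ?s \<omega>) \<partial>M)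
     = (\<integral>\<omega>. indicator (ES k) \<omega> * (indicator (C k) (Y ?s \<omega>) * eigf r1 r2 \<theta> \<kappa> (Y ?s \<omega>)) \<partial>M)"
  proof (rule Bochner_Integration.integral_cong[OF refl])
    fix \<omega> assume w: "\<omega> \<in> space M"
    have "\<omega> \<in> ES k \<Longrightarrow> Y ?s \<omega> \<in> I" unfolding ES_def ST_def using uk[of k] by auto
    then show "indicator ?A \<omega> * indicator I (Y ?s \<omega>) * eigf r1 r2 \<theta> \<kappa> (Y ?s \<omega>) = indicator (ES k) \<omega> * (indicator (C k) (Y ?s \<omega>) * eigf r1 r2 \<theta> \<kappa> (Y ?s \<omega>))"
      using w unfolding space_F[OF uk] by (auto simp: indicator_def)
  qed
  also have "\<dots> = (\<integral>y. indicator (C k) y * eigf r1 r2 \<theta> \<kappa> y \<partial>D1 k)"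
    by (rule D1_integral[symmetric]) (use C eigf_meas[OF r] in measurable)
  finally show ?thesis .
qed

lemma eigf_D2_step:
  assumes adm: "admissible r1 r2 I \<kappa>"
  shows "(\<integral>y. eigf r1 r2 \<theta> \<kappa> y \<partial>D2 (Suc k)) = exp (rate_c \<theta> * u) * (\<integral>y. indicator (C k) y * eigf r1 r2 \<theta> \<kappa> y \<partial>D2 k)"
proof -
  let ?s = "u * real k"
  let ?A = "FS k \<inter> {\<omega>\<in>space (G ?s). f (ZN ?s \<omega>) \<in> C k}"
  let ?S = "{\<omega>\<in>space N. \<forall>r\<in>{?s..?s+u}. sd (ZN r \<omega>) > 0}"
  have "{\<omega>\<in>space (G ?s). f (ZN ?s \<omega>) \<in> C k} \<in> sets (G ?s)"
    using measurable_sets[OF fZ_G[OF uk order_refl] C] by (simp add: vimage_def Int_def conj_commute)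
  then have A: "?A \<in> sets (G ?s)" using FS_F by (rule sets.Int[rotated])
  have split: "\<omega> \<in> FS (Suc k) \<longleftrightarrow> \<omega> \<in> ?A \<and> \<omega> \<in> ?S" for \<omega>
  proof -
    have "?s \<le> ?s + u" using u by simp
    from ivl_disj_un_two_touch(4)[OF uk this] have "{0..?s + u} = {0..?s} \<union> {?s..?s+u}" by (rule sym)
    then show ?thesis unfolding FS_def SN_def uk_Suc lessThan_Suc N.space_F[OF uk] by blast
  qed
  have wk: "wt t \<omega> * indicator E \<omega> * eigf r1 r2 \<theta> \<kappa> (f (ZN t \<omega>)) = indicator E \<omega> * (K0 * trig_mode \<theta> \<kappa> (ZN t \<omega>))"
    if "\<omega> \<in> E \<longrightarrow> sd (ZN t \<omega>) > 0" for t \<omega> and E :: "'b set"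
    using wt_eigf[of t \<omega> \<theta> \<kappa>] that by (cases "\<omega> \<in> E") simp_all
  have "(\<integral>y. eigf r1 r2 \<theta> \<kappa> y \<partial>D2 (Suc k)) = (\<integral>\<omega>. wt (?s + u) \<omega> * indicator (FS (Suc k)) \<omega> * eigf r1 r2 \<theta> \<kappa> (f (ZN (?s + u) \<omega>)) \<partial>N)"
    unfolding D2_integral[OF eigf_meas[OF r]] uk_Suc ..
  also have "\<dots> = (\<integral>\<omega>. K0 * (indicator ?A \<omega> * indicator ?S \<omega> * trig_mode \<theta> \<kappa> (ZN (?s + u) \<omega>)) \<partial>N)"
  proof (rule Bochner_Integration.integral_cong[OF refl])
    fix \<omega>
    have "\<omega> \<in> FS (Suc k) \<longrightarrow> sd (ZN (?s + u) \<omega>) > 0" using split u by simp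
    note w = wk[OF this]
    have e: "indicator (FS (Suc k)) \<omega> = (indicator ?A \<omega> * indicator ?S \<omega> :: real)"
      using split[of \<omega>] unfolding indicator_def by simp
    show "wt (?s + u) \<omega> * indicator (FS (Suc k)) \<omega> * eigf r1 r2 \<theta> \<kappa> (f (ZN (?s + u) \<omega>)) = K0 * (indicator ?A \<omega> * indicator ?S \<omega> * trig_mode \<theta> \<kappa> (ZN (?s + u) \<omega>))"
      unfolding w unfolding e by (simp only: mult_ac)
  qed
  also have "\<dots> = K0 * (exp (rate_c \<theta> * u) * (\<integral>\<omega>. indicator ?A \<omega> * indicator {\<omega>\<in>space N. sd (ZN ?s \<omega>) > 0} \<omega> * trig_mode \<theta> \<kappa> (ZN ?s \<omega>) \<partial>N))"
    unfolding integral_mult_right_zero N_step[OF adm uk u A] ..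
  also have "\<dots> = exp (rate_c \<theta> * u) * (\<integral>\<omega>. K0 * (indicator ?A \<omega> * indicator {\<omega>\<in>space N. sd (ZN ?s \<omega>) > 0} \<omega> * trig_mode \<theta> \<kappa> (ZN ?s \<omega>)) \<partial>N)"
    unfolding integral_mult_right_zero by (simp only: mult_ac)
  also have "(\<integral>\<omega>. K0 * (indicator ?A \<omega> * indicator {\<omega>\<in>space N. sd (ZN ?s \<omega>) > 0} \<omega> * trig_mode \<theta> \<kappa> (ZN ?s \<omega>)) \<partial>N)
     = (\<integral>\<omega>. wt ?s \<omega> * indicator (FS k) \<omega> * (indicator (C k) (f (ZN ?s \<omega>)) * eigf r1 r2 \<theta> \<kappa> (f (ZN ?s \<omega>))) \<partial>N)"
  proof (rule Bochner_Integration.integral_cong[OF refl])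
    fix \<omega> assume w: "\<omega> \<in> space N"
    have p: "\<omega> \<in> FS k \<longrightarrow> sd (ZN ?s \<omega>) > 0" using FS_SN[of k] uk[of k] by (intro impI SN_pos[of \<omega> ?s]) auto
    have "indicator ?A \<omega> * indicator {\<omega>\<in>space N. sd (ZN ?s \<omega>) > 0} \<omega> = (indicator (FS k) \<omega> * indicator (C k) (f (ZN ?s \<omega>)) :: real)"
      using w p unfolding N.space_F[OF uk] indicator_def by simp
    then have "K0 * (indicator ?A \<omega> * indicator {\<omega>\<in>space N. sd (ZN ?s \<omega>) > 0} \<omega> * trig_mode \<theta> \<kappa> (ZN ?s \<omega>))
      = indicator (C k) (f (ZN ?s \<omega>)) * (indicator (FS k) \<omega> * (K0 * trig_mode \<theta> \<kappa> (ZN ?s \<omega>)))"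
      by (simp only: mult_ac)
    also have "\<dots> = indicator (C k) (f (ZN ?s \<omega>)) * (wt ?s \<omega> * indicator (FS k) \<omega> * eigf r1 r2 \<theta> \<kappa> (f (ZN ?s \<omega>)))"
      using wk[OF p] by (simp only:)
    finally show "K0 * (indicator ?A \<omega> * indicator {\<omega>\<in>space N. sd (ZN ?s \<omega>) > 0} \<omega> * trig_mode \<theta> \<kappa> (ZN ?s \<omega>))
      = wt ?s \<omega> * indicator (FS k) \<omega> * (indicator (C k) (f (ZN ?s \<omega>)) * eigf r1 r2 \<theta> \<kappa> (f (ZN ?s \<omega>)))"
      by (simp only: mult_ac)
  qed
  also have "\<dots> = (\<integral>y. indicator (C k) y * eigf r1 r2 \<theta> \<kappa> y \<partial>D2 k)"
    by (rule D2_integral[symmetric]) (use C eigf_meas[OF r] in measurable)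
  finally show ?thesis .
qed

lemma D1_emeasure:
  assumes X[measurable]: "X \<in> sets borel"
  shows "emeasure (D1 k) X = emeasure M {\<omega>\<in>ES k. Y (u * real k) \<omega> \<in> X}"
proof -
  note [measurable] = Yk_M[of k] ES_M[of k]
  have "emeasure (D1 k) X = (\<integral>\<^sup>+\<omega>. ennreal (indicator (ES k) \<omega>) * indicator (Y (u * real k) -` X \<inter> space M) \<omega> \<partial>M)"
    unfolding D1_def by (subst emeasure_distr, measurable, subst emeasure_density) measurable
  also have "\<dots> = (\<integral>\<^sup>+\<omega>. indicator {\<omega>\<in>ES k. Y (u * real k) \<omega> \<in> X} \<omega> \<partial>M)"
    by (rule nn_integral_cong) (auto simp: indicator_def)
  also have "\<dots> = emeasure M {\<omega>\<in>ES k. Y (u * real k) \<omega> \<in> X}"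
    by (rule nn_integral_indicator) (use ES_M[of k, THEN sets.sets_into_space] in measurable)
  finally show ?thesis .
qed

lemma D2_emeasure:
  assumes X[measurable]: "X \<in> sets borel"
  shows "emeasure (D2 k) X = (\<integral>\<^sup>+\<omega>. ennreal (wt (u * real k) \<omega>) * indicator {\<omega>\<in>FS k. f (ZN (u * real k) \<omega>) \<in> X} \<omega> \<partial>N)"
proof -
  note [measurable] = fZk_M[of k] wt_FS_M[of k]
  have "emeasure (D2 k) X = (\<integral>\<^sup>+\<omega>. ennreal (wt (u * real k) \<omega> * indicator (FS k) \<omega>) * indicator ((\<lambda>\<omega>. f (ZN (u * real k) \<omega>)) -` X \<inter> space N) \<omega> \<partial>N)"
    unfolding D2_def by (subst emeasure_distr, measurable, subst emeasure_density) measurable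
  also have "\<dots> = (\<integral>\<^sup>+\<omega>. ennreal (wt (u * real k) \<omega>) * indicator {\<omega>\<in>FS k. f (ZN (u * real k) \<omega>) \<in> X} \<omega> \<partial>N)"
    by (rule nn_integral_cong) (auto simp: indicator_def)
  finally show ?thesis .
qed

text \<open>\<open>C k\<close> constrains only times before the current one, so the induction
  compares whole measures at the current time: equality on all Borel sets is what allows the next
  constraint \<open>C k\<close> to be inserted. Both laws start as the point mass at
  \<open>y0\<close>, and both steps multiply by the same factor.\<close>

lemma fdd_eq: "D1 k = D2 k"
proof (induction k)
  case 0
  have ES0: "ES 0 = space M" unfolding ES_def ST_def using Y_0 y0I by auto
  have FS0: "FS 0 = space N" unfolding FS_def SN_def using N.gbm_0 side_z0 by auto
  show ?case
  proof (rule measure_eqI)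
    show "sets (D1 0) = sets (D2 0)" by (simp add: D1_def D2_def)
    fix X assume "X \<in> sets (D1 0)"
    then have X[measurable]: "X \<in> sets borel" by (simp add: D1_def)
    note [measurable] = Yk_M[of 0] ES_M[of 0] fZk_M[of 0] wt_FS_M[of 0]
    have wt0: "wt 0 \<omega> = 1" if "\<omega> \<in> space N" for \<omega> using that z0_ne by (simp add: wt_def N.gbm_0)
    have "emeasure (D1 0) X = emeasure M {\<omega>\<in>space M. y0 \<in> X}"
      unfolding D1_emeasure[OF X] by (rule arg_cong[where f="emeasure M"]) (auto simp: ES0 Y_0)
    also have "\<dots> = indicator X y0" by (cases "y0 \<in> X") (simp_all add: emeasure_space_1)
    finally have 1: "emeasure (D1 0) X = indicator X y0" .
    have "emeasure (D2 0) X = (\<integral>\<^sup>+\<omega>. indicator X y0 \<partial>N)"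
      unfolding D2_emeasure[OF X] by (rule nn_integral_cong) (simp add: FS0 N.gbm_0 f_z0 wt0 indicator_def)
    also have "\<dots> = indicator X y0" by (simp add: N.emeasure_space_1)
    finally show "emeasure (D1 0) X = emeasure (D2 0) X" using 1 by simp
  qed
next
  case (Suc k)
  show ?case
  proof (rule separation[OF r SI D1_finite D2_finite _ _ D1_AE D2_AE])
    show "sets (D1 (Suc k)) = sets borel" "sets (D2 (Suc k)) = sets borel" by (simp_all add: D1_def D2_def)
    fix \<theta> \<kappa> assume "admissible r1 r2 I \<kappa>"
    note e = eigf_D1_step[OF this] eigf_D2_step[OF this]
    show "(\<integral>y. eigf r1 r2 \<theta> \<kappa> y \<partial>D1 (Suc k)) = (\<integral>y. eigf r1 r2 \<theta> \<kappa> y \<partial>D2 (Suc k))"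
      unfolding e Suc ..
  qed
qed

lemma cylinder_eq:
  assumes "X \<in> sets borel"
  shows "emeasure M {\<omega>\<in>ES k. Y (u * real k) \<omega> \<in> X} = (\<integral>\<^sup>+\<omega>. ennreal (wt (u * real k) \<omega>) * indicator {\<omega>\<in>FS k. f (ZN (u * real k) \<omega>) \<in> X} \<omega> \<partial>N)"
  using D1_emeasure[OF assms] D2_emeasure[OF assms] fdd_eq by simp

end

end

section \<open>Path space\<close>

definition dyadic_cylinder :: "real \<Rightarrow> nat \<Rightarrow> (nat \<Rightarrow> real set) \<Rightarrow> (real \<Rightarrow> real) set" where
  "dyadic_cylinder T m C = {p\<in>cpaths T. \<forall>i\<in>{..2^m}. p (T / 2^m * real i) \<in> C i}"

definition dyadic_cylinders :: "real \<Rightarrow> (real \<Rightarrow> real) set set" where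
  "dyadic_cylinders T = {dyadic_cylinder T m C | m C. \<forall>i. C i \<in> sets borel}"

lemma path_space_gen_Pow: "{{f \<in> cpaths T. f t \<in> A} | t A. t \<in> {0..T} \<and> A \<in> sets borel} \<subseteq> Pow (cpaths T)" by blast

lemma space_path_space: "space (path_space T) = cpaths T"
  unfolding path_space_def using path_space_gen_Pow by (rule space_measure_of)

lemma sets_path_space: "sets (path_space T) = sigma_sets (cpaths T) {{f \<in> cpaths T. f t \<in> A} | t A. t \<in> {0..T} \<and> A \<in> sets borel}"
  unfolding path_space_def using path_space_gen_Pow by (rule sets_measure_of)

lemma dyadic_time: "T > 0 \<Longrightarrow> i \<le> 2^m \<Longrightarrow> T / 2^m * real i \<in> {0..T}"
proof -
  assume T: "T > 0" and i: "i \<le> 2^m"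
  have "real i \<le> 2^m" using i by (metis of_nat_le_iff of_nat_numeral of_nat_power)
  then have "T / 2^m * real i \<le> T / 2^m * 2^m" using T by (intro mult_left_mono) auto
  then show ?thesis using T by simp
qed

text \<open>A coarse cylinder is a fine one with no condition at the new grid points. Two cylinders
  can therefore be brought onto a common grid and intersected there.\<close>

lemma dyadic_cylinder_refine:
  assumes "m \<le> m'"
  shows "dyadic_cylinder T m C = dyadic_cylinder T m' (\<lambda>j. if 2^(m' - m) dvd j then C (j div 2^(m' - m)) else UNIV)"
proof -
  define q where "q = m' - m"
  have m': "m' = m + q" using assms by (simp add: q_def)
  have tm: "T / 2^m' * real (2^q * i) = T / 2^m * real i" for i
    by (simp add: m' power_add)
  have le: "2^q * i \<le> (2::nat)^m' \<longleftrightarrow> i \<le> 2^m" for i by (simp add: m' power_add)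
  have "(\<forall>i\<in>{..2^m}. p (T / 2^m * real i) \<in> C i) \<longleftrightarrow>
      (\<forall>j\<in>{..2^m'}. p (T / 2^m' * real j) \<in> (if 2^q dvd j then C (j div 2^q) else UNIV))" for p
  proof (intro iffI ballI)
    fix j assume a: "\<forall>i\<in>{..2^m}. p (T / 2^m * real i) \<in> C i" and j: "j \<in> {..(2::nat)^m'}"
    show "p (T / 2^m' * real j) \<in> (if 2^q dvd j then C (j div 2^q) else UNIV)"
    proof (cases "2^q dvd j")
      case True
      then obtain i where i: "j = 2^q * i" by (rule dvdE)
      have "i \<in> {..2^m}" using j le[of i] unfolding i by simp
      with a have "p (T / 2^m * real i) \<in> C i" by blast
      then show ?thesis unfolding i tm by simp
    qed simp
  next
    fix i assume a: "\<forall>j\<in>{..2^m'}. p (T / 2^m' * real j) \<in> (if 2^q dvd j then C (j div 2^q) else UNIV)" and i: "i \<in> {..(2::nat)^m}"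
    have "2^q * i \<in> {..2^m'}" using i le[of i] by simp
    with a have "p (T / 2^m' * real (2^q * i)) \<in> (if 2^q dvd 2^q * i then C (2^q * i div 2^q) else UNIV)" by blast
    then show "p (T / 2^m * real i) \<in> C i" unfolding tm by simp
  qed
  then show ?thesis unfolding dyadic_cylinder_def q_def by blast
qed

lemma Int_stable_dyadic_cylinders: "Int_stable (dyadic_cylinders T)"
proof (rule Int_stableI)
  fix a b assume "a \<in> dyadic_cylinders T" "b \<in> dyadic_cylinders T"
  then obtain m C m' C' where a: "a = dyadic_cylinder T m C" "\<And>i. C i \<in> sets borel" and b: "b = dyadic_cylinder T m' C'" "\<And>i. C' i \<in> sets borel"
    unfolding dyadic_cylinders_def by blast
  define k where "k = max m m'"
  define D where "D = (\<lambda>j. if 2^(k - m) dvd j then C (j div 2^(k - m)) else UNIV)"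
  define D' where "D' = (\<lambda>j. if 2^(k - m') dvd j then C' (j div 2^(k - m')) else UNIV)"
  have "a = dyadic_cylinder T k D" unfolding a D_def by (rule dyadic_cylinder_refine) (simp add: k_def)
  moreover have "b = dyadic_cylinder T k D'" unfolding b D'_def by (rule dyadic_cylinder_refine) (simp add: k_def)
  ultimately have "a \<inter> b = dyadic_cylinder T k (\<lambda>j. D j \<inter> D' j)" unfolding dyadic_cylinder_def by blast
  moreover have "\<forall>j. D j \<inter> D' j \<in> sets borel" using a(2) b(2) unfolding D_def D'_def by simp
  ultimately show "a \<inter> b \<in> dyadic_cylinders T" unfolding dyadic_cylinders_def by blast
qed

lemma dyadic_cylinders_Pow: "dyadic_cylinders T \<subseteq> Pow (cpaths T)"
  unfolding dyadic_cylinders_def dyadic_cylinder_def by blast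

lemma coordinate_sets: "t \<in> {0..T} \<Longrightarrow> A \<in> sets borel \<Longrightarrow> {f \<in> cpaths T. f t \<in> A} \<in> sets (path_space T)"
  unfolding sets_path_space by (rule sigma_sets.Basic) blast

lemma dyadic_cylinder_sets:
  assumes T: "T > 0" and C: "\<And>i. C i \<in> sets borel"
  shows "dyadic_cylinder T m C \<in> sets (path_space T)"
proof -
  have "{p \<in> space (path_space T). p (T / 2^m * real i) \<in> C i} \<in> sets (path_space T)" if "i \<in> {..2^m}" for i
    unfolding space_path_space by (rule coordinate_sets[OF dyadic_time[OF T] C]) (use that in simp)
  then have "{p \<in> space (path_space T). \<forall>i\<in>{..2^m}. p (T / 2^m * real i) \<in> C i} \<in> sets (path_space T)"
    by (rule sets.sets_Collect_finite_All) auto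
  then show ?thesis unfolding dyadic_cylinder_def space_path_space .
qed

lemma dyadic_approx:
  assumes T: "(T::real) > 0" and t: "t \<in> {0..T}"
  obtains k :: "nat \<Rightarrow> nat" where "\<And>m. k m \<le> 2^m" "(\<lambda>m. T / 2^m * real (k m)) \<longlonglongrightarrow> t"
proof (rule that[of "\<lambda>m. nat \<lfloor>t / T * 2^m\<rfloor>"])
  have x: "0 \<le> t / T" "t / T \<le> 1" using T t by auto
  have nn: "0 \<le> t / T * 2^m" for m :: nat by (rule mult_nonneg_nonneg[OF x(1)]) simp
  show "nat \<lfloor>t / T * 2^m\<rfloor> \<le> 2^m" for m
  proof -
    have "t / T * 2^m \<le> 1 * 2^m" using x by (intro mult_right_mono) auto
    then have "\<lfloor>t / T * 2^m\<rfloor> \<le> \<lfloor>real_of_int (2^m)\<rfloor>" by (intro floor_mono) simp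
    then show ?thesis unfolding floor_of_int by (simp add: nat_le_iff)
  qed
  show "(\<lambda>m. T / 2^m * real (nat \<lfloor>t / T * 2^m\<rfloor>)) \<longlonglongrightarrow> t"
  proof (rule tendsto_sandwich)
    have r: "real (nat \<lfloor>t / T * 2^m\<rfloor>) = of_int \<lfloor>t / T * 2^m\<rfloor>" for m using nn[of m] by simp
    have b: "t / T * 2^m - 1 \<le> real (nat \<lfloor>t / T * 2^m\<rfloor>)" "real (nat \<lfloor>t / T * 2^m\<rfloor>) \<le> t / T * 2^m" for m
      unfolding r by linarith+
    have "t - T / 2^m \<le> T / 2^m * real (nat \<lfloor>t / T * 2^m\<rfloor>)" for m
    proof -
      have "T / 2^m * (t / T * 2^m - 1) \<le> T / 2^m * real (nat \<lfloor>t / T * 2^m\<rfloor>)" by (rule mult_left_mono[OF b(1)]) (use T in simp)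
      moreover have "T / 2^m * (t / T * 2^m - 1) = t - T / 2^m" using T by (simp add: field_simps)
      ultimately show ?thesis by simp
    qed
    then show "\<forall>\<^sub>F m in sequentially. t - T / 2^m \<le> T / 2^m * real (nat \<lfloor>t / T * 2^m\<rfloor>)" by simp
    have "T / 2^m * real (nat \<lfloor>t / T * 2^m\<rfloor>) \<le> t" for m
    proof -
      have "T / 2^m * real (nat \<lfloor>t / T * 2^m\<rfloor>) \<le> T / 2^m * (t / T * 2^m)" by (rule mult_left_mono[OF b(2)]) (use T in simp)
      moreover have "T / 2^m * (t / T * 2^m) = t" using T by simp
      ultimately show ?thesis by simp
    qed
    then show "\<forall>\<^sub>F m in sequentially. T / 2^m * real (nat \<lfloor>t / T * 2^m\<rfloor>) \<le> t" by simp
    show "(\<lambda>m. t - T / 2^m) \<longlonglongrightarrow> t" by real_asymp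
  qed simp
qed

text \<open>By continuity of the paths each coordinate is the pointwise limit of coordinates at
  dyadic fractions of \<open>T\<close>, so these already generate the sigma-algebra.\<close>

lemma sets_path_space_dyadic:
  assumes T: "T > 0"
  shows "sets (path_space T) = sigma_sets (cpaths T) (dyadic_cylinders T)"
proof
  show "sigma_sets (cpaths T) (dyadic_cylinders T) \<subseteq> sets (path_space T)"
    using dyadic_cylinder_sets[OF T] unfolding dyadic_cylinders_def
    by (intro sets.sigma_sets_subset[of _ "path_space T", unfolded space_path_space]) blast
  let ?S = "sigma (cpaths T) (dyadic_cylinders T)"
  have sp: "space ?S = cpaths T" by (rule space_measure_of[OF dyadic_cylinders_Pow])
  have st: "sets ?S = sigma_sets (cpaths T) (dyadic_cylinders T)" by (rule sets_measure_of[OF dyadic_cylinders_Pow])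
  have dy: "(\<lambda>p. p (T / 2^m * real i)) \<in> borel_measurable ?S" if i: "i \<le> 2^m" for m i
  proof (rule measurableI)
    fix A :: "real set" assume A: "A \<in> sets borel"
    have "(\<lambda>p. p (T / 2^m * real i)) -` A \<inter> space ?S = dyadic_cylinder T m (\<lambda>j. if j = i then A else UNIV)"
      unfolding sp dyadic_cylinder_def using i by auto
    moreover have "\<dots> \<in> dyadic_cylinders T" unfolding dyadic_cylinders_def using A by (intro CollectI exI conjI refl) auto
    ultimately show "(\<lambda>p. p (T / 2^m * real i)) -` A \<inter> space ?S \<in> sets ?S" unfolding st by (metis sigma_sets.Basic)
  qed simp
  have co: "(\<lambda>p. p t) \<in> borel_measurable ?S" if t: "t \<in> {0..T}" for t
  proof -
    obtain k where k: "\<And>m. k m \<le> 2^m" "(\<lambda>m. T / 2^m * real (k m)) \<longlonglongrightarrow> t" using dyadic_approx[OF T t] by metis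
    show ?thesis
    proof (rule borel_measurable_LIMSEQ_real[OF _ dy[OF k(1)]])
      fix p assume "p \<in> space ?S"
      then have "continuous_on {0..T} p" unfolding sp unfolding cpaths_def by blast
      then show "(\<lambda>m. p (T / 2^m * real (k m))) \<longlonglongrightarrow> p t"
        by (rule continuous_on_tendsto_compose[OF _ k(2) t]) (use dyadic_time[OF T k(1)] in simp)
    qed
  qed
  have "{f \<in> cpaths T. f t \<in> A} \<in> sigma_sets (cpaths T) (dyadic_cylinders T)" if "t \<in> {0..T}" "A \<in> sets borel" for t A
    using measurable_sets[OF co[OF that(1)] that(2)] unfolding sp st by (simp add: vimage_def Int_def conj_commute)
  then show "sets (path_space T) \<subseteq> sigma_sets (cpaths T) (dyadic_cylinders T)"
    unfolding sets_path_space by (intro sigma_sets_mono) blast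
qed

lemma path_measure_eqI:
  assumes T: "T > 0" and s: "sets \<mu> = sets (path_space T)" "sets \<nu> = sets (path_space T)"
    and fin: "emeasure \<mu> (cpaths T) \<noteq> \<infinity>"
    and e: "\<And>m C. (\<And>i. C i \<in> sets borel) \<Longrightarrow> emeasure \<mu> (dyadic_cylinder T m C) = emeasure \<nu> (dyadic_cylinder T m C)"
  shows "\<mu> = \<nu>"
proof (rule measure_eqI_generator_eq[OF Int_stable_dyadic_cylinders dyadic_cylinders_Pow, of T _ _ "\<lambda>_. cpaths T"])
  show "emeasure \<mu> X = emeasure \<nu> X" if "X \<in> dyadic_cylinders T" for X
    using that e unfolding dyadic_cylinders_def by blast
  have "cpaths T = dyadic_cylinder T 0 (\<lambda>_. UNIV)" unfolding dyadic_cylinder_def by blast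
  moreover have "dyadic_cylinder T 0 (\<lambda>_. UNIV) \<in> dyadic_cylinders T"
    unfolding dyadic_cylinders_def by (rule CollectI, rule exI[of _ 0], rule exI[of _ "\<lambda>_. UNIV"]) simp
  ultimately show "range (\<lambda>_::nat. cpaths T) \<subseteq> dyadic_cylinders T" by auto
qed (use s fin sets_path_space_dyadic[OF T] in auto)

lemma restrict_path_measurable:
  assumes X: "\<And>t. t \<in> {0..T} \<Longrightarrow> X t \<in> borel_measurable M"
    and c: "\<And>\<omega>. \<omega> \<in> space M \<Longrightarrow> continuous_on {0..T} (\<lambda>t. X t \<omega>)"
  shows "(\<lambda>\<omega>. restrict_path T (\<lambda>t. X t \<omega>)) \<in> measurable M (path_space T)"
  unfolding path_space_def
proof (rule measurable_measure_of[OF path_space_gen_Pow])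
  show mem: "(\<lambda>\<omega>. restrict_path T (\<lambda>t. X t \<omega>)) \<in> space M \<rightarrow> cpaths T"
  proof
    fix \<omega> assume "\<omega> \<in> space M"
    have "continuous_on {0..T} (restrict_path T (\<lambda>t. X t \<omega>)) \<longleftrightarrow> continuous_on {0..T} (\<lambda>t. X t \<omega>)"
      by (rule continuous_on_cong) (simp_all add: restrict_path_def)
    then show "restrict_path T (\<lambda>t. X t \<omega>) \<in> cpaths T"
      using c[OF \<open>\<omega> \<in> space M\<close>] by (auto simp: cpaths_def restrict_path_def)
  qed
  fix y assume "y \<in> {{f \<in> cpaths T. f t \<in> A} | t A. t \<in> {0..T} \<and> A \<in> sets borel}"
  then obtain t A where y: "y = {f \<in> cpaths T. f t \<in> A}" and t: "t \<in> {0..T}" and A: "A \<in> sets borel" by blast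
  have "(\<lambda>\<omega>. restrict_path T (\<lambda>t. X t \<omega>)) -` y \<inter> space M = X t -` A \<inter> space M"
  proof -
    have "restrict_path T (\<lambda>t. X t \<omega>) t = X t \<omega>" for \<omega> using t by (simp add: restrict_path_def)
    then show ?thesis using mem unfolding y by auto
  qed
  then show "(\<lambda>\<omega>. restrict_path T (\<lambda>t. X t \<omega>)) -` y \<inter> space M \<in> sets M"
    using measurable_sets[OF X[OF t] A] by simp
qed

section \<open>Equality of the laws on path space\<close>

context qnv_pair begin

text \<open>The path of \<open>Z\<close> starts on the positive side, so by the intermediate value
  theorem staying there up to \<open>T\<close> is the same as never meeting 1, that is, as the
  hitting time of 1 exceeding \<open>T\<close>.\<close>

lemma SN_eq: "SN T = {\<omega>\<in>space N. \<forall>t\<in>{0..T}. ZN t \<omega> \<noteq> 1}"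
proof (intro equalityI subsetI)
  fix \<omega> assume "\<omega> \<in> SN T"
  then have w: "\<omega> \<in> space N" "\<forall>t\<in>{0..T}. sd (ZN t \<omega>) > 0" unfolding SN_def by blast+
  have "ZN t \<omega> \<noteq> 1" if "t \<in> {0..T}" for t
  proof
    assume "ZN t \<omega> = 1"
    then have "sd (ZN t \<omega>) = 0" by (simp add: sd_eq)
    then show False using w(2) that by force
  qed
  then show "\<omega> \<in> {\<omega>\<in>space N. \<forall>t\<in>{0..T}. ZN t \<omega> \<noteq> 1}" using w(1) by blast
next
  fix \<omega> assume "\<omega> \<in> {\<omega>\<in>space N. \<forall>t\<in>{0..T}. ZN t \<omega> \<noteq> 1}"
  then have w: "\<omega> \<in> space N" "\<And>t. t \<in> {0..T} \<Longrightarrow> ZN t \<omega> \<noteq> 1" by blast+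
  have "sd (ZN t \<omega>) > 0" if t: "t \<in> {0..T}" for t
  proof (rule ccontr)
    assume "\<not> sd (ZN t \<omega>) > 0"
    then have "sd (ZN t \<omega>) \<le> 0" by simp
    moreover have "0 \<le> sd (ZN 0 \<omega>)" using side_z0 N.gbm_0[OF w(1)] by simp
    moreover have "continuous_on {0..t} (\<lambda>r. sd (ZN r \<omega>))"
      unfolding sd_eq by (intro continuous_intros continuous_on_subset[OF N.gbm_cont[OF w(1)]]) auto
    ultimately obtain x where x: "0 \<le> x" "x \<le> t" "sd (ZN x \<omega>) = 0"
      using IVT2'[of "\<lambda>r. sd (ZN r \<omega>)" t 0 0] t by auto
    then have "ZN x \<omega> = 1" using z0_ne(2) by (auto simp: sd_eq sgn_if split: if_splits)
    then show False using w(2)[of x] x t by auto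
  qed
  then show "\<omega> \<in> SN T" unfolding SN_def using w(1) by blast
qed

context
  fixes T :: real and h :: "(real \<Rightarrow> real) \<Rightarrow> ennreal"
  assumes T: "0 < T" and h: "h \<in> borel_measurable (path_space T)"
begin

definition "Yp \<omega> = restrict_path T (\<lambda>t. Y t \<omega>)"
text \<open>Off \<open>SN T\<close> the transformed path would run into the pole at
  \<open>z = 1\<close>. The value 0 keeps every path continuous, and the weight vanishes there
  anyway.\<close>

definition "Xp t \<omega> = (if \<omega> \<in> SN T then f (ZN t \<omega>) else 0)"
definition "Zp \<omega> = restrict_path T (\<lambda>t. Xp t \<omega>)"
definition "d1 = density M (\<lambda>\<omega>. ennreal (indicator (ST T) \<omega>))"
definition "d2 = density N (\<lambda>\<omega>. ennreal (wt T \<omega> * indicator (SN T) \<omega>))"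
definition "\<mu>1 = distr d1 (path_space T) Yp"
definition "\<mu>2 = distr d2 (path_space T) Zp"

lemma T0: "0 \<le> T" using T by simp
lemma ST_M: "ST T \<in> events" by (rule F_sets_M[OF ST_F[OF T0] T0])
lemma SN_M: "SN T \<in> N.events" by (rule N.F_sets_M[OF SN_F[OF T0] T0])

lemma wt_SN_M: "(\<lambda>\<omega>. wt T \<omega> * indicator (SN T) \<omega>) \<in> borel_measurable N"
  using wt_M[OF T0] SN_M by measurable

lemma wt_SN_nonneg: "0 \<le> wt T \<omega> * indicator (SN T) \<omega>"
  by (rule wt_indicator_nonneg[OF order_refl T0])

lemma Yp_meas: "Yp \<in> measurable M (path_space T)"
  unfolding Yp_def[abs_def]
  by (rule restrict_path_measurable[OF Y_meas_M continuous_on_subset[OF Y_cont]]) auto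

lemma Zp_meas: "Zp \<in> measurable N (path_space T)"
  unfolding Zp_def[abs_def]
proof (rule restrict_path_measurable)
  fix t assume t: "t \<in> {0..T}"
  have "(\<lambda>\<omega>. f (ZN t \<omega>)) \<in> borel_measurable N" using t by (intro measurable_compose[OF ZN_M f_meas]) auto
  then show "Xp t \<in> borel_measurable N" unfolding Xp_def[abs_def] using SN_M by measurable
next
  fix \<omega> assume w: "\<omega> \<in> space N"
  show "continuous_on {0..T} (\<lambda>t. Xp t \<omega>)"
  proof (cases "\<omega> \<in> SN T")
    case True
    then have "ZN t \<omega> \<noteq> 1" if "t \<in> {0..T}" for t using that unfolding SN_eq by blast
    then have ne: "\<forall>t\<in>{0..T}. 1 - ZN t \<omega> \<noteq> 0" by force
    have "continuous_on {0..T} (\<lambda>t. ZN t \<omega>)" by (rule continuous_on_subset[OF N.gbm_cont[OF w]]) auto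
    then have "continuous_on {0..T} (\<lambda>t. f (ZN t \<omega>))" unfolding f_def using ne by (intro continuous_intros)
    then show ?thesis unfolding Xp_def using True by simp
  qed (simp add: Xp_def)
qed

lemma \<mu>1_nn_integral:
  assumes g: "g \<in> borel_measurable (path_space T)"
  shows "(\<integral>\<^sup>+p. g p \<partial>\<mu>1) = (\<integral>\<^sup>+\<omega>. ennreal (indicator (ST T) \<omega>) * g (Yp \<omega>) \<partial>M)"
proof -
  have m: "(\<lambda>\<omega>. ennreal (indicator (ST T) \<omega>)) \<in> borel_measurable M" using ST_M by measurable
  have "(\<integral>\<^sup>+p. g p \<partial>\<mu>1) = (\<integral>\<^sup>+\<omega>. g (Yp \<omega>) \<partial>d1)"
    unfolding \<mu>1_def by (rule nn_integral_distr) (use Yp_meas g in \<open>auto simp: d1_def\<close>)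
  also have "\<dots> = (\<integral>\<^sup>+\<omega>. ennreal (indicator (ST T) \<omega>) * g (Yp \<omega>) \<partial>M)"
    unfolding d1_def by (rule nn_integral_density[OF m measurable_compose[OF Yp_meas g]])
  finally show ?thesis .
qed

lemma \<mu>2_nn_integral:
  assumes g: "g \<in> borel_measurable (path_space T)"
  shows "(\<integral>\<^sup>+p. g p \<partial>\<mu>2) = (\<integral>\<^sup>+\<omega>. ennreal (wt T \<omega> * indicator (SN T) \<omega>) * g (Zp \<omega>) \<partial>N)"
proof -
  have m: "(\<lambda>\<omega>. ennreal (wt T \<omega> * indicator (SN T) \<omega>)) \<in> borel_measurable N" using wt_SN_M by measurable
  have "(\<integral>\<^sup>+p. g p \<partial>\<mu>2) = (\<integral>\<^sup>+\<omega>. g (Zp \<omega>) \<partial>d2)"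
    unfolding \<mu>2_def by (rule nn_integral_distr) (use Zp_meas g in \<open>auto simp: d2_def\<close>)
  also have "\<dots> = (\<integral>\<^sup>+\<omega>. ennreal (wt T \<omega> * indicator (SN T) \<omega>) * g (Zp \<omega>) \<partial>N)"
    unfolding d2_def by (rule nn_integral_density[OF m measurable_compose[OF Zp_meas g]])
  finally show ?thesis .
qed

lemma \<mu>1_emeasure: "X \<in> sets (path_space T) \<Longrightarrow> emeasure \<mu>1 X = (\<integral>\<^sup>+\<omega>. ennreal (indicator (ST T) \<omega>) * indicator X (Yp \<omega>) \<partial>M)"
  using \<mu>1_nn_integral[of "indicator X"] nn_integral_indicator[of X \<mu>1] by (simp add: \<mu>1_def)

lemma \<mu>2_emeasure: "X \<in> sets (path_space T) \<Longrightarrow> emeasure \<mu>2 X = (\<integral>\<^sup>+\<omega>. ennreal (wt T \<omega> * indicator (SN T) \<omega>) * indicator X (Zp \<omega>) \<partial>N)"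
  using \<mu>2_nn_integral[of "indicator X"] nn_integral_indicator[of X \<mu>2] by (simp add: \<mu>2_def)

lemma Yp_cpaths: "\<omega> \<in> space M \<Longrightarrow> Yp \<omega> \<in> cpaths T"
  using measurable_space[OF Yp_meas] unfolding space_path_space .

lemma Zp_cpaths: "\<omega> \<in> space N \<Longrightarrow> Zp \<omega> \<in> cpaths T"
  using measurable_space[OF Zp_meas] unfolding space_path_space .

lemma dyadic_cylinder_split:
  assumes "p \<in> cpaths T"
  shows "p \<in> dyadic_cylinder T m C \<longleftrightarrow> (\<forall>i\<in>{..<2^m}. p (T / 2^m * real i) \<in> C i) \<and> p T \<in> C (2^m)"
proof -
  have "{..2^m} = insert (2^m) {..<(2::nat)^m}" by auto
  moreover have "T / 2^m * real (2^m) = T" by simp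
  ultimately show ?thesis unfolding dyadic_cylinder_def using assms by auto
qed

text \<open>The last grid time \<open>T\<close> has index \<open>2^m\<close>; its condition plays
  the role of the terminal set \<open>X\<close> in \<open>cylinder_eq\<close>, the earlier ones that
  of the killing conditions.\<close>

lemma cylinder_measure_eq:
  assumes C: "\<And>i. C i \<in> sets borel"
  shows "emeasure \<mu>1 (dyadic_cylinder T m C) = emeasure \<mu>2 (dyadic_cylinder T m C)"
proof -
  define u where "u = T / 2^m"
  have u: "0 < u" using T by (simp add: u_def)
  have uT: "u * real (2^m) = T" by (simp add: u_def)
  have ti: "u * real i \<in> {0..T}" if "i \<in> {..<2^m}" for i
    unfolding u_def by (rule dyadic_time[OF T]) (use that in simp)
  have TT: "T \<in> {0..T}" using T by simp
  note cs = dyadic_cylinder_sets[OF T C]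
  note cyl = cylinder_eq[OF u C C[of "2^m"], where k="2^m", unfolded uT ES_def[OF u C] FS_def[OF u C]]
  have Y: "Yp \<omega> t = Y t \<omega>" if "t \<in> {0..T}" for t \<omega> using that by (simp add: Yp_def restrict_path_def)
  have Z: "Zp \<omega> t = f (ZN t \<omega>)" if "t \<in> {0..T}" "\<omega> \<in> SN T" for t \<omega> using that by (simp add: Zp_def Xp_def restrict_path_def)
  let ?E = "{\<omega> \<in> {\<omega> \<in> ST T. \<forall>i\<in>{..<2 ^ m}. Y (u * real i) \<omega> \<in> C i}. Y T \<omega> \<in> C (2 ^ m)}"
  let ?F = "{\<omega> \<in> {\<omega> \<in> SN T. \<forall>i\<in>{..<2 ^ m}. f (ZN (u * real i) \<omega>) \<in> C i}. f (ZN T \<omega>) \<in> C (2 ^ m)}"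
  have memY: "\<omega> \<in> ?E \<longleftrightarrow> \<omega> \<in> ST T \<and> Yp \<omega> \<in> dyadic_cylinder T m C" if "\<omega> \<in> space M" for \<omega>
    unfolding dyadic_cylinder_split[OF Yp_cpaths[OF that]] u_def[symmetric] using Y[OF TT] Y[OF ti] by auto
  have memZ: "\<omega> \<in> ?F \<longleftrightarrow> \<omega> \<in> SN T \<and> Zp \<omega> \<in> dyadic_cylinder T m C" if "\<omega> \<in> space N" for \<omega>
    unfolding dyadic_cylinder_split[OF Zp_cpaths[OF that]] u_def[symmetric] using Z[OF TT] Z[OF ti] by auto
  have E: "?E = {\<omega>\<in>space M. \<omega> \<in> ST T \<and> Yp \<omega> \<in> dyadic_cylinder T m C}"
    using memY ST_M[THEN sets.sets_into_space] by blast
  have "?E = ST T \<inter> (Yp -` dyadic_cylinder T m C \<inter> space M)" unfolding E by blast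
  then have Es: "?E \<in> events" using ST_M measurable_sets[OF Yp_meas cs] by auto
  have "emeasure \<mu>1 (dyadic_cylinder T m C) = (\<integral>\<^sup>+\<omega>. indicator ?E \<omega> \<partial>M)"
    unfolding \<mu>1_emeasure[OF cs] by (rule nn_integral_cong) (use memY in \<open>auto simp: indicator_def\<close>)
  also have "\<dots> = emeasure M ?E" by (rule nn_integral_indicator[OF Es])
  also have "\<dots> = (\<integral>\<^sup>+\<omega>. ennreal (wt T \<omega>) * indicator ?F \<omega> \<partial>N)" by (rule cyl)
  also have "\<dots> = emeasure \<mu>2 (dyadic_cylinder T m C)"
    unfolding \<mu>2_emeasure[OF cs] by (rule nn_integral_cong) (use memZ in \<open>auto simp: indicator_def\<close>)
  finally show ?thesis .
qed

lemma path_law_eq: "\<mu>1 = \<mu>2"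
proof (rule path_measure_eqI[OF T _ _ _ cylinder_measure_eq])
  show "sets \<mu>1 = sets (path_space T)" "sets \<mu>2 = sets (path_space T)" by (simp_all add: \<mu>1_def \<mu>2_def)
  have c: "cpaths T \<in> sets (path_space T)" using sets.top[of "path_space T"] unfolding space_path_space .
  have "emeasure \<mu>1 (cpaths T) \<le> (\<integral>\<^sup>+\<omega>. 1 \<partial>M)"
    unfolding \<mu>1_emeasure[OF c] by (intro nn_integral_mono) (auto simp: indicator_def)
  also have "\<dots> < \<infinity>" by (simp add: emeasure_space_1)
  finally show "emeasure \<mu>1 (cpaths T) \<noteq> \<infinity>" by simp
qed

lemma stays_in_interval: "AE \<omega> in M. \<omega> \<in> ST T"
proof -
  have c: "cpaths T \<in> sets (path_space T)" using sets.top[of "path_space T"] unfolding space_path_space .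
  have "emeasure M (ST T) = (\<integral>\<^sup>+\<omega>. indicator (ST T) \<omega> \<partial>M)" by (rule nn_integral_indicator[OF ST_M, symmetric])
  also have "\<dots> = emeasure \<mu>1 (cpaths T)"
    unfolding \<mu>1_emeasure[OF c] by (rule nn_integral_cong) (use Yp_cpaths in \<open>auto simp: indicator_def\<close>)
  also have "\<dots> = (\<integral>\<^sup>+\<omega>. ennreal (wt T \<omega> * indicator (SN T) \<omega>) \<partial>N)"
    unfolding path_law_eq \<mu>2_emeasure[OF c] by (rule nn_integral_cong) (use Zp_cpaths in \<open>auto simp: indicator_def\<close>)
  also have "\<dots> = ennreal (\<integral>\<omega>. wt T \<omega> * indicator (SN T) \<omega> \<partial>N)"
    by (rule nn_integral_eq_integral[OF wt_indicator_integrable[OF T0 SN_M]]) (use wt_SN_nonneg in auto)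
  also have "(\<integral>\<omega>. wt T \<omega> * indicator (SN T) \<omega> \<partial>N) = 1"
    using total_mass[OF T] unfolding SN_def[symmetric] by (simp only: mult.commute)
  finally have "prob (ST T) = 1" by (simp add: measure_def)
  then show ?thesis using prob_eq_1[OF ST_M] by simp
qed

lemma path_law: "(\<integral>\<^sup>+ \<omega>. h (restrict_path T (\<lambda>t. Y t \<omega>)) \<partial>M) =
    (\<integral>\<^sup>+ \<omega>. h (restrict_path T (\<lambda>t. f (ZN t \<omega>))) * indicator {\<omega>'\<in>space N. \<forall>t\<in>{0..T}. ZN t \<omega>' \<noteq> 1} \<omega>
      * ennreal ((y0 - r1) / (r2 - r1) * (1 - ZN T \<omega>)) \<partial>N)"
proof -
  have "(\<integral>\<^sup>+ \<omega>. h (restrict_path T (\<lambda>t. Y t \<omega>)) \<partial>M) = (\<integral>\<^sup>+\<omega>. ennreal (indicator (ST T) \<omega>) * h (Yp \<omega>) \<partial>M)"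
    by (rule nn_integral_cong_AE) (rule eventually_mono[OF stays_in_interval], simp add: Yp_def)
  also have "\<dots> = (\<integral>\<^sup>+\<omega>. ennreal (wt T \<omega> * indicator (SN T) \<omega>) * h (Zp \<omega>) \<partial>N)"
    unfolding \<mu>1_nn_integral[OF h, symmetric] path_law_eq by (rule \<mu>2_nn_integral[OF h])
  also have "\<dots> = (\<integral>\<^sup>+ \<omega>. h (restrict_path T (\<lambda>t. f (ZN t \<omega>))) * indicator {\<omega>'\<in>space N. \<forall>t\<in>{0..T}. ZN t \<omega>' \<noteq> 1} \<omega>
      * ennreal ((y0 - r1) / (r2 - r1) * (1 - ZN T \<omega>)) \<partial>N)"
  proof (rule nn_integral_cong)
    fix \<omega> assume w: "\<omega> \<in> space N"
    have wt: "wt T \<omega> = (y0 - r1) / (r2 - r1) * (1 - ZN T \<omega>)" unfolding wt_def one_minus_z0 by simp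
    show "ennreal (wt T \<omega> * indicator (SN T) \<omega>) * h (Zp \<omega>) = h (restrict_path T (\<lambda>t. f (ZN t \<omega>)))
        * indicator {\<omega>'\<in>space N. \<forall>t\<in>{0..T}. ZN t \<omega>' \<noteq> 1} \<omega> * ennreal ((y0 - r1) / (r2 - r1) * (1 - ZN T \<omega>))"
      unfolding SN_eq[symmetric] wt[symmetric]
    proof (cases "\<omega> \<in> SN T")
      case True
      then have "Zp \<omega> = restrict_path T (\<lambda>t. f (ZN t \<omega>))" unfolding Zp_def Xp_def by simp
      then show "ennreal (wt T \<omega> * indicator (SN T) \<omega>) * h (Zp \<omega>) = h (restrict_path T (\<lambda>t. f (ZN t \<omega>))) * indicator (SN T) \<omega> * ennreal (wt T \<omega>)"
        using True by (simp add: mult.commute)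
    qed simp
  qed
  finally show ?thesis .
qed

end

end

section \<open>Start at the root r2\<close>

text \<open>The partial fraction form of \<open>(y - r2)\<^sup>2 / (y - r1)\<close>. It belongs to
  the same family of solutions with real exponents -1 and 2, that is, imaginary
  \<open>\<theta>\<close>, and its eigenvalue is \<open>(e1 * (r2 - r1))\<^sup>2\<close>.\<close>

definition "lyap r1 r2 y = (y - r1) - 2 * (r2 - r1) + (r2 - r1)\<^sup>2 / (y - r1)" for y :: real

lemma lyap_eq: "y \<noteq> r1 \<Longrightarrow> lyap r1 r2 y = (y - r2)\<^sup>2 / (y - r1)"
  unfolding lyap_def by (simp add: field_simps power2_eq_square)

lemma lyap_nonneg: "y > r1 \<Longrightarrow> 0 \<le> lyap r1 r2 y"
  by (subst lyap_eq) auto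

lemma lyap_eq_0: "y > r1 \<Longrightarrow> lyap r1 r2 y = 0 \<longleftrightarrow> y = r2"
  by (subst lyap_eq) auto

lemma lyap_meas[measurable]: "lyap r1 r2 \<in> borel_measurable borel"
  unfolding lyap_def[abs_def] by measurable

lemma (in sde) sde_test_lyap:
  assumes P: "P = qnv_poly e1 r1 r2"
  shows "sde_test M F B P y0 Y (lyap r1 r2) (\<lambda>y. 1 - (r2 - r1)\<^sup>2 / (y - r1)\<^sup>2) (\<lambda>y. 2 * (r2 - r1)\<^sup>2 / (y - r1)^3)
    (\<lambda>y. - 6 * (r2 - r1)\<^sup>2 / (y - r1)^4) {r1<..} ((e1 * (r2 - r1))\<^sup>2)"
proof unfold_locales
  define k where "k = (r2 - r1)\<^sup>2"
  show "(lyap r1 r2 has_real_derivative 1 - (r2 - r1)\<^sup>2 / (x - r1)\<^sup>2) (at x)" if "x \<in> {r1<..}" for x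
    unfolding lyap_def[abs_def] k_def[symmetric] using that by (auto intro!: derivative_eq_intros simp: power2_eq_square)
  show "((\<lambda>y. 1 - (r2 - r1)\<^sup>2 / (y - r1)\<^sup>2) has_real_derivative 2 * (r2 - r1)\<^sup>2 / (x - r1)^3) (at x)" if "x \<in> {r1<..}" for x
  proof -
    have x: "x - r1 \<noteq> 0" using that by simp
    have D: "((\<lambda>y. 1 - k / (y - r1)\<^sup>2) has_real_derivative k * (2 * (x - r1)) / ((x - r1)\<^sup>2)\<^sup>2) (at x)"
      using x by (auto intro!: derivative_eq_intros simp: power2_eq_square)
    have "k * (2 * p) / (p\<^sup>2)\<^sup>2 = 2 * k / p^3" if "p \<noteq> 0" for p
      using that by (simp add: power2_eq_square power3_eq_cube mult_ac)
    from this[OF x] have "k * (2 * (x - r1)) / ((x - r1)\<^sup>2)\<^sup>2 = 2 * k / (x - r1)^3" .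
    with D show ?thesis unfolding k_def[symmetric] by simp
  qed
  show "((\<lambda>y. 2 * (r2 - r1)\<^sup>2 / (y - r1)^3) has_real_derivative - 6 * (r2 - r1)\<^sup>2 / (x - r1)^4) (at x)" if "x \<in> {r1<..}" for x
  proof -
    have x: "x - r1 \<noteq> 0" using that by simp
    have D: "((\<lambda>y. 2 * k / (y - r1)^3) has_real_derivative - (2 * k * (3 * (x - r1)\<^sup>2)) / ((x - r1)^3)\<^sup>2) (at x)"
      using x by (auto intro!: derivative_eq_intros simp: power2_eq_square)
    have "- (2 * k * (3 * p\<^sup>2)) / (p^3)\<^sup>2 = - 6 * k / p^4" if "p \<noteq> 0" for p
      using that by (simp add: power2_eq_square power3_eq_cube power4_eq_xxxx mult_ac)
    from this[OF x] have "- (2 * k * (3 * (x - r1)\<^sup>2)) / ((x - r1)^3)\<^sup>2 = - 6 * k / (x - r1)^4" .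
    with D show ?thesis unfolding k_def[symmetric] by simp
  qed
  show "continuous_on {r1<..} (\<lambda>y. - 6 * (r2 - r1)\<^sup>2 / (y - r1)^4)" by (intro continuous_intros) auto
  show "2 * (r2 - r1)\<^sup>2 / (x - r1)^3 / 2 * (P x)\<^sup>2 = (e1 * (r2 - r1))\<^sup>2 * lyap r1 r2 x" if "x \<in> {r1<..}" for x
  proof -
    have x: "x - r1 \<noteq> 0" "x \<noteq> r1" using that by simp_all
    have aux: "2 * k / p^3 / 2 * (e1 * p * q)\<^sup>2 = (e1\<^sup>2 * k) * (q\<^sup>2 / p)" if "p \<noteq> 0" for p q :: real
      using that by (simp add: power2_eq_square power3_eq_cube mult_ac)
    show ?thesis unfolding lyap_eq[OF x(2)] P qnv_poly_def power_mult_distrib[of e1 "r2 - r1"] using aux[OF x(1), of "x - r2"] unfolding k_def .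
  qed
qed simp

context sde begin

text \<open>Up to the exit from a neighbourhood of \<open>r2\<close>, the discounted
  \<open>lyap (Y t)\<close> has expectation at most its starting value 0, and it is nonnegative with
  \<open>r2\<close> as its only zero to the right of \<open>r1\<close>. This fixes \<open>Y\<close>
  at a given time almost surely on the event of no exit; rational times give one null set for all of
  them. A path that moves away would have to be at \<open>r2\<close> at rational times just before
  it first gets to distance \<open>e\<close>, against continuity. Taking \<open>e \<le> d\<close>
  keeps the path inside \<open>{a..b}\<close> until then.\<close>

lemma absorbed_at_root:
  assumes P: "P = qnv_poly e1 r1 r2" and r: "r1 < r2" and y0: "y0 = r2"
  shows "AE \<omega> in M. \<forall>t\<ge>0. Y t \<omega> = r2"
proof -
  interpret T: sde_test M F B P y0 Y "lyap r1 r2" "\<lambda>y. 1 - (r2 - r1)\<^sup>2 / (y - r1)\<^sup>2" "\<lambda>y. 2 * (r2 - r1)\<^sup>2 / (y - r1)^3"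
    "\<lambda>y. - 6 * (r2 - r1)\<^sup>2 / (y - r1)^4" "{r1<..}" "(e1 * (r2 - r1))\<^sup>2"
    by (rule sde_test_lyap[OF P])
  define d where "d = (r2 - r1) / 2"
  define a where "a = r2 - d"
  define b where "b = r2 + d"
  have d: "0 < d" "r1 < a" using r by (simp_all add: d_def a_def field_simps)
  have ab: "a \<le> b" "{a..b} \<subseteq> {r1<..}" using d by (auto simp: a_def b_def)
  define St where "St u = {\<omega>\<in>space M. \<forall>r\<in>{0..u}. Y r \<omega> \<in> {a..b}}" for u
  have step: "AE \<omega> in M. \<omega> \<in> St u \<longrightarrow> Y u \<omega> = r2" if u: "0 < u" for u
  proof -
    define E where "E = (\<integral>\<omega>. indicator (St u) \<omega> * lyap r1 r2 (Y u \<omega>) \<partial>M)"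
    have nn: "0 \<le> indicator (St u) \<omega> * lyap r1 r2 (Y u \<omega>)" for \<omega>
    proof (cases "\<omega> \<in> St u")
      case True
      then have "Y u \<omega> \<in> {a..b}" using u by (auto simp: St_def)
      then show ?thesis using ab(2) by (intro mult_nonneg_nonneg lyap_nonneg) auto
    qed simp
    have E0: "0 \<le> E" unfolding E_def by (rule Bochner_Integration.integral_nonneg[OF nn])
    have SM: "space M \<in> sets (F 0)" using space_F[of 0] sets.top[of "F 0"] by simp
    have la: "0 \<le> lyap r1 r2 a" "0 \<le> lyap r1 r2 b" using ab by (auto intro!: lyap_nonneg)
    have Ele: "exp (- (e1 * (r2 - r1))\<^sup>2 * u) * E \<le> 0 + \<epsilon>" if e: "\<epsilon> > 0" for \<epsilon>
    proof -
      have "Y 0 \<omega> \<in> {a..b}" if "\<omega> \<in> space M" for \<omega> using Y_0[OF that] y0 d by (simp add: a_def b_def)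
      from T.dynkin[OF ab u _ SM this e, of 0]
      obtain ra rb where rr: "0 \<le> ra" "0 \<le> rb" and m: "\<bar>exp (- (e1 * (r2 - r1))\<^sup>2 * u) * (\<integral>\<omega>. indicator (space M) \<omega> * indicator {\<omega>\<in>space M. \<forall>r\<in>{0..0+u}. Y r \<omega> \<in> {a..b}} \<omega> * lyap r1 r2 (Y (0 + u) \<omega>) \<partial>M)
        + lyap r1 r2 a * ra + lyap r1 r2 b * rb - (\<integral>\<omega>. indicator (space M) \<omega> * lyap r1 r2 (Y 0 \<omega>) \<partial>M)\<bar> \<le> \<epsilon>"
        by auto
      have 1: "(\<integral>\<omega>. indicator (space M) \<omega> * lyap r1 r2 (Y 0 \<omega>) \<partial>M) = (\<integral>\<omega>. 0 \<partial>M)"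
        by (rule Bochner_Integration.integral_cong[OF refl]) (use lyap_eq_0[of r1 r2 r2] r y0 in \<open>simp add: Y_0\<close>)
      have 2: "(\<integral>\<omega>. indicator (space M) \<omega> * indicator {\<omega>\<in>space M. \<forall>r\<in>{0..0+u}. Y r \<omega> \<in> {a..b}} \<omega> * lyap r1 r2 (Y (0 + u) \<omega>) \<partial>M) = E"
        unfolding E_def St_def by (rule Bochner_Integration.integral_cong[OF refl]) simp
      have "0 \<le> lyap r1 r2 a * ra" "0 \<le> lyap r1 r2 b * rb" using la rr by simp_all
      then show ?thesis using m unfolding 1 2 by simp
    qed
    have "exp (- (e1 * (r2 - r1))\<^sup>2 * u) * E \<le> 0" by (rule field_le_epsilon[OF Ele])
    then have "E \<le> 0" by (simp add: mult_le_0_iff)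
    then have E: "E = 0" using E0 by simp
    have Ym: "Y u \<in> borel_measurable M" using u by (intro Y_meas_M) simp
    have Ss: "St u \<in> events" unfolding St_def
      by (rule stay_sets[OF Y_meas_M continuous_on_subset[OF Y_cont]]) auto
    have "continuous_on {a..b} (lyap r1 r2)" unfolding lyap_def using ab(2) by (intro continuous_intros) auto
    then obtain C where C: "\<And>x. x \<in> {a..b} \<Longrightarrow> \<bar>lyap r1 r2 x\<bar> \<le> C" using compact_bound_real[OF _ compact_Icc] by blast
    have "integrable M (\<lambda>\<omega>. indicator (St u) \<omega> * lyap r1 r2 (Y u \<omega>))"
    proof (rule integrable_const_bound[of _ "\<bar>C\<bar>"])
      show "AE \<omega> in M. norm (indicator (St u) \<omega> * lyap r1 r2 (Y u \<omega>)) \<le> \<bar>C\<bar>"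
      proof (rule AE_I2)
        fix \<omega>
        have "\<omega> \<in> St u \<Longrightarrow> Y u \<omega> \<in> {a..b}" using u by (auto simp: St_def)
        then show "norm (indicator (St u) \<omega> * lyap r1 r2 (Y u \<omega>)) \<le> \<bar>C\<bar>" using C[of "Y u \<omega>"] by (cases "\<omega> \<in> St u") auto
      qed
      show "(\<lambda>\<omega>. indicator (St u) \<omega> * lyap r1 r2 (Y u \<omega>)) \<in> borel_measurable M" using Ym Ss by measurable
    qed
    from integral_nonneg_eq_0_iff_AE[OF this] have "AE \<omega> in M. indicator (St u) \<omega> * lyap r1 r2 (Y u \<omega>) = 0" using E nn unfolding E_def by simp
    then show ?thesis
    proof eventually_elim
      case (elim \<omega>)
      show ?case
      proof
        assume w: "\<omega> \<in> St u"
        then have "Y u \<omega> \<in> {a..b}" using u by (auto simp: St_def)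
        then have "r1 < Y u \<omega>" using ab(2) by auto
        moreover have "lyap r1 r2 (Y u \<omega>) = 0" using elim w by simp
        ultimately show "Y u \<omega> = r2" using lyap_eq_0 by blast
      qed
    qed
  qed
  have "AE \<omega> in M. \<forall>q\<in>\<rat> \<inter> {0<..}. \<omega> \<in> St q \<longrightarrow> Y q \<omega> = r2"
    by (subst AE_ball_countable) (use step countable_rat in auto)
  then show ?thesis
    using AE_space
  proof eventually_elim
    case (elim \<omega>)
    then have w: "\<omega> \<in> space M" and q: "\<And>q. q \<in> \<rat> \<Longrightarrow> 0 < q \<Longrightarrow> \<omega> \<in> St q \<Longrightarrow> Y q \<omega> = r2" by auto
    note Yc = Y_cont[OF w]
    show ?case
    proof (intro allI impI, rule ccontr)
      fix t :: real assume t: "0 \<le> t" and ne: "Y t \<omega> \<noteq> r2"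
      define e where "e = min d \<bar>Y t \<omega> - r2\<bar>"
      have e: "0 < e" "e \<le> d" "e \<le> \<bar>Y t \<omega> - r2\<bar>" using d ne by (auto simp: e_def)
      define S where "S = {x \<in> {0..t}. \<bar>Y x \<omega> - r2\<bar> \<in> {e..}}"
      have c: "continuous_on {0..t} (\<lambda>x. \<bar>Y x \<omega> - r2\<bar>)"
        by (intro continuous_intros continuous_on_subset[OF Yc]) auto
      have "closed S"
        unfolding S_def using continuous_closed_preimage[OF c closed_atLeastAtMost closed_atLeast, of e] by (simp add: vimage_def Int_def)
      moreover have "S \<noteq> {}" using t e(3) by (auto simp: S_def)
      moreover have bb: "bdd_below S" by (rule bdd_belowI[of _ 0]) (auto simp: S_def)
      ultimately have S: "Inf S \<in> S" using closed_contains_Inf by blast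
      define \<tau> where "\<tau> = Inf S"
      have tau: "\<tau> \<in> {0..t}" "e \<le> \<bar>Y \<tau> \<omega> - r2\<bar>" using S by (auto simp: S_def \<tau>_def)
      have "\<tau> \<noteq> 0" using tau(2) e(1) Y_0[OF w] y0 by auto
      then have tp: "0 < \<tau>" using tau(1) by simp
      have before: "\<bar>Y x \<omega> - r2\<bar> < e" if "0 \<le> x" "x < \<tau>" for x
      proof (rule ccontr)
        assume "\<not> \<bar>Y x \<omega> - r2\<bar> < e"
        then have "x \<in> S" using that tau(1) by (auto simp: S_def)
        then have "\<tau> \<le> x" unfolding \<tau>_def by (rule cInf_lower[OF _ bb])
        then show False using that by simp
      qed
      have "continuous_on {0..t} (\<lambda>x. Y x \<omega>)" by (rule continuous_on_subset[OF Yc]) auto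
      then obtain \<delta> where \<delta>: "\<delta> > 0" "\<And>x. x \<in> {0..t} \<Longrightarrow> dist x \<tau> < \<delta> \<Longrightarrow> dist (Y x \<omega>) (Y \<tau> \<omega>) < e"
        using tau(1) e(1) unfolding continuous_on_iff by blast
      \<comment> \<open>A rational time just before \<open>\<tau>\<close>: the path has not left
        \<open>{a..b}\<close> up to it and so is at \<open>r2\<close>, while continuity puts it
        within \<open>e\<close> of the value at \<open>\<tau>\<close>, which is at least
        \<open>e\<close> away from \<open>r2\<close>.\<close>
      have "max 0 (\<tau> - \<delta>) < \<tau>" using tp \<delta>(1) by simp
      then obtain x where x: "x \<in> \<rat>" "max 0 (\<tau> - \<delta>) < x" "x < \<tau>" using Rats_dense_in_real by blast
      have "\<omega> \<in> St x"
      proof -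
        have "Y r \<omega> \<in> {a..b}" if "r \<in> {0..x}" for r
          using before[of r] that x(3) e(2) by (auto simp: a_def b_def)
        then show ?thesis unfolding St_def using w by blast
      qed
      then have "Y x \<omega> = r2" using q x by simp
      moreover have "dist (Y x \<omega>) (Y \<tau> \<omega>) < e" using x tau(1) by (intro \<delta>(2)) (auto simp: dist_real_def)
      ultimately show False using tau(2) by (simp add: dist_real_def abs_minus_commute)
    qed
  qed
qed

end

lemma restrict_path_cong: "(\<And>t. t \<in> {0..T} \<Longrightarrow> f t = g t) \<Longrightarrow> restrict_path T f = restrict_path T g"
  by (auto simp: restrict_path_def)

lemma qnv_poly_cont: "continuous_on UNIV (qnv_poly e1 r1 r2)"
  unfolding qnv_poly_def by (intro continuous_intros)

theorem theorem3p1: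
  fixes T e1 r1 r2 y0 :: real
    and h :: "(real \<Rightarrow> real) \<Rightarrow> ennreal"
    and M :: "'a measure" and F :: "real \<Rightarrow> 'a measure"
    and Bt Y :: "real \<Rightarrow> 'a \<Rightarrow> real"
    and N :: "'b measure" and G :: "real \<Rightarrow> 'b measure"
    and B :: "real \<Rightarrow> 'b \<Rightarrow> real"
  assumes "T > 0" and "e1 \<noteq> 0" and "r1 < r2" and "y0 \<noteq> r1"
    and "h \<in> borel_measurable (path_space T)"
    and "sde_solution M F Bt (qnv_poly e1 r1 r2) y0 Y"
    and "brownian_motion N G B"
  defines "Z \<equiv> gbm ((y0 - r2) / (y0 - r1)) (e1 * (r2 - r1)) B"
  shows "(\<integral>\<^sup>+ \<omega>. h (restrict_path T (\<lambda>t. Y t \<omega>)) \<partial>M) =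
         (\<integral>\<^sup>+ \<omega>. h (restrict_path T (\<lambda>t. (r2 - r1 * Z t \<omega>) / (1 - Z t \<omega>)))
                   * indicator {\<omega>'\<in>space N. \<forall>t\<in>{0..T}. Z t \<omega>' \<noteq> 1} \<omega>
                   * ennreal ((y0 - r1) / (r2 - r1) * (1 - Z T \<omega>)) \<partial>N)"
proof -
  interpret Y: sde M F Bt "qnv_poly e1 r1 r2" y0 Y
    by unfold_locales (use assms(6) qnv_poly_cont in \<open>auto simp: sde_solution_def\<close>)
  interpret N: brownian N G B by unfold_locales (rule assms(7))
  show ?thesis
  proof (cases "y0 = r2")
    case True
    \<comment> \<open>\<open>Z\<close> vanishes identically, so it never meets 1, the weight is 1
      and the transformed path is constantly \<open>r2\<close>.\<close>
    have Z0: "Z t \<omega> = 0" for t \<omega> unfolding Z_def gbm_def True by simp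
    have "(\<integral>\<^sup>+ \<omega>. h (restrict_path T (\<lambda>t. Y t \<omega>)) \<partial>M) = (\<integral>\<^sup>+ \<omega>. h (restrict_path T (\<lambda>t. r2)) \<partial>M)"
    proof (rule nn_integral_cong_AE)
      show "AE \<omega> in M. h (restrict_path T (\<lambda>t. Y t \<omega>)) = h (restrict_path T (\<lambda>t. r2))"
        using Y.absorbed_at_root[OF refl assms(3) True]
        by eventually_elim (rule arg_cong[where f=h], rule restrict_path_cong, simp)
    qed
    also have "\<dots> = h (restrict_path T (\<lambda>t. r2))" by (simp add: Y.emeasure_space_1)
    also have "\<dots> = (\<integral>\<^sup>+ \<omega>. h (restrict_path T (\<lambda>t. r2)) \<partial>N)" by (simp add: N.emeasure_space_1)
    also have "\<dots> = (\<integral>\<^sup>+ \<omega>. h (restrict_path T (\<lambda>t. (r2 - r1 * Z t \<omega>) / (1 - Z t \<omega>)))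
                   * indicator {\<omega>'\<in>space N. \<forall>t\<in>{0..T}. Z t \<omega>' \<noteq> 1} \<omega>
                   * ennreal ((y0 - r1) / (r2 - r1) * (1 - Z T \<omega>)) \<partial>N)"
      by (rule nn_integral_cong) (use True assms(3) in \<open>simp add: Z0\<close>)
    finally show ?thesis .
  next
    case False
    have "y0 \<in> {r1<..<r2} \<or> y0 \<in> {r2<..} \<or> y0 \<in> {..<r1}" using False assms(4) by auto
    then obtain I where I: "state_interval r1 r2 I" "y0 \<in> I"
      unfolding state_interval_def[OF assms(3)] by blast
    interpret Q: qnv_pair M F Bt e1 r1 r2 y0 Y N G B I
      by unfold_locales (rule assms(3) I)+
    show ?thesis
      using Q.path_law[OF assms(1,5)] unfolding Q.f_def Q.z0_def Q.\<sigma>_def Z_def .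
  qed
qed

end
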